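(* Let $R$ be an $\mathbb{F}_p$-algebra and $\lambda\in R$. Then the subalgebra of coinvariants $S(A^{(\lambda)}_R)_\Theta^{\mathrm{co}A^{(\lambda)}_R}$ is isomorphic, as an $R$-algebra, to the localization of the polynomial algebra $R[Z_{X^{r_1}Y^{r_2}}]_{0\le r_1,r_2\le p-1}$ at the elements $$Z_1,\quad Z_1^p+\lambda^pZ_X,\quad Z_1+\lambda^2Z_{X^2},\quad Z_1^{s-1}+\sum_{k=2}^{s-1}\binom sk\lambda^kZ_1^{s-k}Z_{X^k}+\lambda^sZ_{X^s}\ \ (3\le s\le p-1).$$ Here $Z_1=Z_{X^0Y^0}$ and $Z_{X^k}=Z_{X^kY^0}$. Consequently, the quotient $U(G^{(\lambda)}_R)/G^{(\lambda)}_R$ is the spectrum of this algebra.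
   Context: Throughout, $p$ is a prime, $R$ is a commutative $\mathbb{F}_p$-algebra and $\lambda\in R$. $G^{(\lambda)}_R=\mathrm{Spec}\,A^{(\lambda)}_R$ with $A^{(\lambda)}_R=R[X,Y]/(X^p,Y^p)$ and Hopf structure: - comultiplication $X\mapsto X\otimes1+(1+\lambda X)\otimes X$ and $Y\mapsto Y\otimes1+(1+\lambda X)\otimes Y$; - counit $X,Y\mapsto0$; - antipode $X\mapsto-X/(1+\lambda X)$ and $Y\mapsto-Y/(1+\lambda X)$. It is the kernel of the Frobenius on $\mathcal H^{(\lambda)}_R=\mathrm{Spec}\,R[X,Y,\frac1{1+\lambda X}]$ (same structure formulas, Frobenius $X\mapsto X^p$, $Y\mapsto Y^p$). For an $R$-Hopf algebra $H$ that is free with basis $e_1,\dots,e_n$: - the group algebra scheme $A(\mathrm{Spec}\,H)$ is $B\mapsto\mathrm{Hom}_R(H,B)$ with the convolution product, represented by $R[T_{e_1},\dots,T_{e_n}]$ with comultiplication $T_{e_j}\mapsto\sum_iT_{e_i}\otimes R_{ij}(T)$, where $\Delta_H(e_j)=\sum_ie_i\otimes R_{ij}(e)$; - its unit group scheme is $U(\mathrm{Spec}\,H)=\mathrm{Spec}\,R[T_{e_i},1/\det(R_{ij}(T))]$; - there is a closed immersion $i:\mathrm{Spec}\,H\to U(\mathrm{Spec}\,H)$ with $i^\#(T_{e_i})=e_i$. For $G^{(\lambda)}_R$ with the basis $X^{r_1}Y^{r_2}$, the coordinate ring of $U(G^{(\lambda)}_R)$ is $S(A^{(\lambda)}_R)_\Theta=R[T_{X^{r_1}Y^{r_2}},1/D]$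 with $D=\prod_{r=0}^{p-1}\big(\sum_{k=0}^r\binom rk\lambda^kT_{X^kY^0}\big)^p$. It is a right $A^{(\lambda)}_R$-comodule algebra via $\rho=(\mathrm{id}\otimes i^\#)\circ\Delta$, and $S(A^{(\lambda)}_R)_\Theta^{\mathrm{co}A^{(\lambda)}_R}=\{s:\rho(s)=s\otimes1\}$. *)

theory Defs
  imports
    "HOL-Algebra.Module"
    "HOL-Algebra.QuotRing"
    "HOL-Computational_Algebra.Primes"
    "HOL-Library.Multiset"
begin

section \<open>Commutative algebras over a commutative ring\<close>

text \<open>An \<open>R\<close>-algebra is a record satisfying the library locale \<^locale>\<open>algebra\<close>.
  Homomorphisms only matter on the carrier of their source.\<close>

definition alg_hom ::
  "('r, 'k) ring_scheme \<Rightarrow> ('r, 'a, 'l) module_scheme \<Rightarrow> ('r, 'b, 'm) module_scheme \<Rightarrow> ('a \<Rightarrow> 'b) set"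
  where "alg_hom R A B =
    {h \<in> ring_hom A B. \<forall>r\<in>carrier R. \<forall>a\<in>carrier A. h (r \<odot>\<^bsub>A\<^esub> a) = r \<odot>\<^bsub>B\<^esub> h a}"

definition alg_iso ::
  "('r, 'k) ring_scheme \<Rightarrow> ('r, 'a, 'l) module_scheme \<Rightarrow> ('r, 'b, 'm) module_scheme \<Rightarrow> ('a \<Rightarrow> 'b) set"
  where "alg_iso R A B = {h \<in> alg_hom R A B. bij_betw h (carrier A) (carrier B)}"

definition alg_quot :: "('r, 'a, 'l) module_scheme \<Rightarrow> 'a set \<Rightarrow> ('r, 'a set) module"
  where "alg_quot A I =
    \<lparr>carrier = carrier (A Quot I), monoid.mult = monoid.mult (A Quot I), one = one (A Quot I),
     zero = zero (A Quot I), add = add (A Quot I),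
     smult = (\<lambda>r X. \<Union>x\<in>X. I +>\<^bsub>A\<^esub> (r \<odot>\<^bsub>A\<^esub> x))\<rparr>"

text \<open>The algebra \<open>R[M]\<close> of a commutative monoid \<open>M\<close>: finitely supported functions
  under convolution. It is used for polynomial algebras and for tensor products.\<close>

definition msingle ::
  "('r, 'k) ring_scheme \<Rightarrow> ('m, 'l) monoid_scheme \<Rightarrow> 'm \<Rightarrow> 'm \<Rightarrow> 'r"
  where "msingle R M m = (\<lambda>m'. if m' = m then \<one>\<^bsub>R\<^esub> else \<zero>\<^bsub>R\<^esub>)"

definition monoid_algebra ::
  "('r, 'k) ring_scheme \<Rightarrow> ('m, 'l) monoid_scheme \<Rightarrow> ('r, 'm \<Rightarrow> 'r) module"
  where "monoid_algebra R M =
    \<lparr>carrier = {f. (\<forall>m\<in>carrier M. f m \<in> carrier R) \<and> (\<forall>m. m \<notin> carrier M \<longrightarrow> f m = \<zero>\<^bsub>R\<^esub>) \<and>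
                  finite {m. f m \<noteq> \<zero>\<^bsub>R\<^esub>}},
     monoid.mult = (\<lambda>f g m. \<Oplus>\<^bsub>R\<^esub>q\<in>{q. f (fst q) \<noteq> \<zero>\<^bsub>R\<^esub> \<and> g (snd q) \<noteq> \<zero>\<^bsub>R\<^esub> \<and> fst q \<otimes>\<^bsub>M\<^esub> snd q = m}.
                        f (fst q) \<otimes>\<^bsub>R\<^esub> g (snd q)),
     one = msingle R M \<one>\<^bsub>M\<^esub>,
     zero = (\<lambda>m. \<zero>\<^bsub>R\<^esub>),
     add = (\<lambda>f g m. f m \<oplus>\<^bsub>R\<^esub> g m),
     smult = (\<lambda>r f m. r \<otimes>\<^bsub>R\<^esub> f m)\<rparr>"

text \<open>\<open>R[T\<^sub>i]\<close> for \<open>i \<in> I\<close>; as in HOL-Algebra's indexed polynomials, monomials are multisets of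
  variables.\<close>

definition monomials :: "'i set \<Rightarrow> 'i multiset monoid"
  where "monomials I = \<lparr>carrier = {m. set_mset m \<subseteq> I}, monoid.mult = (+), one = {#}\<rparr>"

definition mpoly :: "('r, 'k) ring_scheme \<Rightarrow> 'i set \<Rightarrow> ('r, 'i multiset \<Rightarrow> 'r) module"
  where "mpoly R I = monoid_algebra R (monomials I)"

definition mvar :: "('r, 'k) ring_scheme \<Rightarrow> 'i set \<Rightarrow> 'i \<Rightarrow> 'i multiset \<Rightarrow> 'r"
  where "mvar R I i = msingle R (monomials I) {#i#}"

text \<open>\<open>B \<otimes>\<^sub>R C\<close> is the algebra of the multiplicative monoid \<open>B \<times> C\<close> modulo the
  bilinearity relations. The module spanned by these relations is stable under multiplication by
  the elements \<open>[b, c]\<close>, so the ideal below is nothing more than that module.\<close>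

definition tensor_rels ::
  "('r, 'k) ring_scheme \<Rightarrow> ('r, 'b, 'l) module_scheme \<Rightarrow> ('r, 'c, 'm) module_scheme \<Rightarrow>
    ('b \<times> 'c \<Rightarrow> 'r) set"
  where "tensor_rels R B C =
    (let F = monoid_algebra R (B \<times>\<times> C); g = (\<lambda>b c. msingle R (B \<times>\<times> C) (b, c)) in
      {g (b \<oplus>\<^bsub>B\<^esub> b') c \<ominus>\<^bsub>F\<^esub> (g b c \<oplus>\<^bsub>F\<^esub> g b' c) | b b' c.
          b \<in> carrier B \<and> b' \<in> carrier B \<and> c \<in> carrier C} \<union>
      {g b (c \<oplus>\<^bsub>C\<^esub> c') \<ominus>\<^bsub>F\<^esub> (g b c \<oplus>\<^bsub>F\<^esub> g b c') | b c c'.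
          b \<in> carrier B \<and> c \<in> carrier C \<and> c' \<in> carrier C} \<union>
      {g (r \<odot>\<^bsub>B\<^esub> b) c \<ominus>\<^bsub>F\<^esub> (r \<odot>\<^bsub>F\<^esub> g b c) | r b c.
          r \<in> carrier R \<and> b \<in> carrier B \<and> c \<in> carrier C} \<union>
      {g b (r \<odot>\<^bsub>C\<^esub> c) \<ominus>\<^bsub>F\<^esub> (r \<odot>\<^bsub>F\<^esub> g b c) | r b c.
          r \<in> carrier R \<and> b \<in> carrier B \<and> c \<in> carrier C})"

definition alg_tensor ::
  "('r, 'k) ring_scheme \<Rightarrow> ('r, 'b, 'l) module_scheme \<Rightarrow> ('r, 'c, 'm) module_scheme \<Rightarrow>
    ('r, ('b \<times> 'c \<Rightarrow> 'r) set) module"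
  where "alg_tensor R B C =
    alg_quot (monoid_algebra R (B \<times>\<times> C)) (Idl\<^bsub>monoid_algebra R (B \<times>\<times> C)\<^esub> (tensor_rels R B C))"

definition tens ::
  "('r, 'k) ring_scheme \<Rightarrow> ('r, 'b, 'l) module_scheme \<Rightarrow> ('r, 'c, 'm) module_scheme \<Rightarrow>
    'b \<Rightarrow> 'c \<Rightarrow> ('b \<times> 'c \<Rightarrow> 'r) set"
  where "tens R B C b c =
    (Idl\<^bsub>monoid_algebra R (B \<times>\<times> C)\<^esub> (tensor_rels R B C)) +>\<^bsub>monoid_algebra R (B \<times>\<times> C)\<^esub>
      msingle R (B \<times>\<times> C) (b, c)"

definition tensor_map ::
  "('r, 'k) ring_scheme \<Rightarrow> ('r, 'b) module \<Rightarrow> ('r, 'c) module \<Rightarrow> ('r, 'b1) module \<Rightarrow>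
    ('r, 'c1) module \<Rightarrow> ('b \<Rightarrow> 'b1) \<Rightarrow> ('c \<Rightarrow> 'c1) \<Rightarrow>
    ('b \<times> 'c \<Rightarrow> 'r) set \<Rightarrow> ('b1 \<times> 'c1 \<Rightarrow> 'r) set"
  where "tensor_map R B C B1 C1 f g =
    (SOME h. h \<in> alg_hom R (alg_tensor R B C) (alg_tensor R B1 C1) \<and>
       (\<forall>b\<in>carrier B. \<forall>c\<in>carrier C. h (tens R B C b c) = tens R B1 C1 (f b) (g c)))"

text \<open>Localization at the multiplicative set generated by \<open>E\<close>.\<close>

inductive_set mult_closure :: "('a, 'l) monoid_scheme \<Rightarrow> 'a set \<Rightarrow> 'a set"
  for A (structure) and E where
    one: "\<one> \<in> mult_closure A E"
  | incl: "e \<in> E \<Longrightarrow> e \<in> mult_closure A E"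
  | mult: "\<lbrakk>s \<in> mult_closure A E; t \<in> mult_closure A E\<rbrakk> \<Longrightarrow> s \<otimes> t \<in> mult_closure A E"

definition loc_rel :: "('a, 'l) ring_scheme \<Rightarrow> 'a set \<Rightarrow> (('a \<times> 'a) \<times> ('a \<times> 'a)) set"
  where "loc_rel A E =
    {((a, s), (b, t)). a \<in> carrier A \<and> b \<in> carrier A \<and>
       s \<in> mult_closure A E \<and> t \<in> mult_closure A E \<and>
       (\<exists>u\<in>mult_closure A E. u \<otimes>\<^bsub>A\<^esub> (a \<otimes>\<^bsub>A\<^esub> t) = u \<otimes>\<^bsub>A\<^esub> (b \<otimes>\<^bsub>A\<^esub> s))}"

definition frac :: "('a, 'l) ring_scheme \<Rightarrow> 'a set \<Rightarrow> 'a \<Rightarrow> 'a \<Rightarrow> ('a \<times> 'a) set"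
  where "frac A E a s = loc_rel A E `` {(a, s)}"

definition localization :: "('r, 'a, 'l) module_scheme \<Rightarrow> 'a set \<Rightarrow> ('r, ('a \<times> 'a) set) module"
  where "localization A E =
    \<lparr>carrier = (carrier A \<times> mult_closure A E) // loc_rel A E,
     monoid.mult = (\<lambda>X Y. \<Union>x\<in>X. \<Union>y\<in>Y. frac A E (fst x \<otimes>\<^bsub>A\<^esub> fst y) (snd x \<otimes>\<^bsub>A\<^esub> snd y)),
     one = frac A E \<one>\<^bsub>A\<^esub> \<one>\<^bsub>A\<^esub>,
     zero = frac A E \<zero>\<^bsub>A\<^esub> \<one>\<^bsub>A\<^esub>,
     add = (\<lambda>X Y. \<Union>x\<in>X. \<Union>y\<in>Y.
              frac A E (fst x \<otimes>\<^bsub>A\<^esub> snd y \<oplus>\<^bsub>A\<^esub> fst y \<otimes>\<^bsub>A\<^esub> snd x) (snd x \<otimes>\<^bsub>A\<^esub> snd y)),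
     smult = (\<lambda>r X. \<Union>x\<in>X. frac A E (r \<odot>\<^bsub>A\<^esub> fst x) (snd x))\<rparr>"


section \<open>The group scheme and the coaction on its unit group scheme\<close>

datatype coord = CX | CY

definition A_rels :: "('r, 'k) ring_scheme \<Rightarrow> nat \<Rightarrow> (coord multiset \<Rightarrow> 'r) set"
  where "A_rels R p =
    {mvar R UNIV CX [^]\<^bsub>mpoly R (UNIV :: coord set)\<^esub> p,
     mvar R UNIV CY [^]\<^bsub>mpoly R (UNIV :: coord set)\<^esub> p}"

text \<open>\<open>A_alg R p\<close> is \<open>R[X,Y]/(X\<^sup>p, Y\<^sup>p)\<close>; only the comultiplication depends on \<open>\<lambda>\<close>.\<close>

definition A_alg :: "('r, 'k) ring_scheme \<Rightarrow> nat \<Rightarrow> ('r, (coord multiset \<Rightarrow> 'r) set) module"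
  where "A_alg R p =
    alg_quot (mpoly R UNIV) (Idl\<^bsub>mpoly R (UNIV :: coord set)\<^esub> (A_rels R p))"

definition A_gen :: "('r, 'k) ring_scheme \<Rightarrow> nat \<Rightarrow> coord \<Rightarrow> (coord multiset \<Rightarrow> 'r) set"
  where "A_gen R p v =
    (Idl\<^bsub>mpoly R (UNIV :: coord set)\<^esub> (A_rels R p)) +>\<^bsub>mpoly R (UNIV :: coord set)\<^esub> mvar R UNIV v"

definition A_comult ::
  "('r, 'k) ring_scheme \<Rightarrow> nat \<Rightarrow> 'r \<Rightarrow> (coord multiset \<Rightarrow> 'r) set \<Rightarrow>
    ((coord multiset \<Rightarrow> 'r) set \<times> (coord multiset \<Rightarrow> 'r) set \<Rightarrow> 'r) set"
  where "A_comult R p lam =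
    (let A = A_alg R p; AA = alg_tensor R A A; x = A_gen R p CX; tt = tens R A A;
         w = \<one>\<^bsub>A\<^esub> \<oplus>\<^bsub>A\<^esub> lam \<odot>\<^bsub>A\<^esub> x in
      (SOME h. h \<in> alg_hom R A AA \<and>
        (\<forall>v. h (A_gen R p v) = tt (A_gen R p v) \<one>\<^bsub>A\<^esub> \<oplus>\<^bsub>AA\<^esub> tt w (A_gen R p v))))"

text \<open>The index \<open>(r\<^sub>1, r\<^sub>2)\<close> stands for the basis element \<open>X\<^sup>r\<^sup>1 Y\<^sup>r\<^sup>2\<close> of \<open>A\<close>.\<close>

definition idx :: "nat \<Rightarrow> (nat \<times> nat) set"
  where "idx p = {..<p} \<times> {..<p}"

definition A_basis :: "('r, 'k) ring_scheme \<Rightarrow> nat \<Rightarrow> nat \<times> nat \<Rightarrow> (coord multiset \<Rightarrow> 'r) set"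
  where "A_basis R p j =
    (A_gen R p CX [^]\<^bsub>A_alg R p\<^esub> fst j) \<otimes>\<^bsub>A_alg R p\<^esub> (A_gen R p CY [^]\<^bsub>A_alg R p\<^esub> snd j)"

text \<open>For a Hopf algebra \<open>H\<close> with comultiplication \<open>\<Delta>\<close> and basis \<open>e\<close>, the structure constants
  \<open>d i k j\<close> are those of \<open>\<Delta>(e\<^sub>j) = \<Sum>\<^sub>i e\<^sub>i \<otimes> R\<^sub>i\<^sub>j(e)\<close> with \<open>R\<^sub>i\<^sub>j(e) = \<Sum>\<^sub>k d i k j e\<^sub>k\<close>. The linear
  form \<open>R\<^sub>i\<^sub>j\<close> can then be evaluated at any family \<open>v\<close> of elements of an \<open>R\<close>-algebra.\<close>

definition lin_form ::
  "('r, 'a, 'l) module_scheme \<Rightarrow> 'i set \<Rightarrow> ('i \<Rightarrow> 'i \<Rightarrow> 'i \<Rightarrow> 'r) \<Rightarrow> ('i \<Rightarrow> 'a) \<Rightarrow> 'i \<Rightarrow> 'i \<Rightarrow> 'a"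
  where "lin_form B I d v i j = (\<Oplus>\<^bsub>B\<^esub>k\<in>I. d i k j \<odot>\<^bsub>B\<^esub> v k)"

definition comult_coeffs ::
  "('r, 'k) ring_scheme \<Rightarrow> ('r, 'h, 'l) module_scheme \<Rightarrow> ('h \<Rightarrow> ('h \<times> 'h \<Rightarrow> 'r) set) \<Rightarrow>
    'i set \<Rightarrow> ('i \<Rightarrow> 'h) \<Rightarrow> 'i \<Rightarrow> 'i \<Rightarrow> 'i \<Rightarrow> 'r"
  where "comult_coeffs R H \<Delta> I e =
    (SOME d. (\<forall>i\<in>I. \<forall>k\<in>I. \<forall>j\<in>I. d i k j \<in> carrier R) \<and>
       (\<forall>j\<in>I. \<Delta> (e j) =
          (\<Oplus>\<^bsub>alg_tensor R H H\<^esub>i\<in>I. tens R H H (e i) (lin_form H I d e i j))))"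

text \<open>\<open>S_alg\<close> is the coordinate ring \<open>R[T\<^sub>j, 1/D]\<close> of the unit group scheme, and
  \<open>coaction\<close> is \<open>(id \<otimes> i\<^sup>#) \<circ> \<Delta>\<close>. The homomorphisms below are characterized by their
  values on generators; on the carrier they are unique.\<close>

definition D_elem :: "('r, 'k) ring_scheme \<Rightarrow> nat \<Rightarrow> 'r \<Rightarrow> (nat \<times> nat) multiset \<Rightarrow> 'r"
  where "D_elem R p lam =
    (let P = mpoly R (idx p) in
      (\<Otimes>\<^bsub>P\<^esub>r\<in>{..<p}.
        (\<Oplus>\<^bsub>P\<^esub>k\<in>{..r}. [(r choose k)] \<cdot>\<^bsub>P\<^esub> ((lam [^]\<^bsub>R\<^esub> k) \<odot>\<^bsub>P\<^esub> mvar R (idx p) (k, 0))) [^]\<^bsub>P\<^esub> p))"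

type_synonym 'r S_elem =
  "(((nat \<times> nat) multiset \<Rightarrow> 'r) \<times> ((nat \<times> nat) multiset \<Rightarrow> 'r)) set"

definition S_alg :: "('r, 'k) ring_scheme \<Rightarrow> nat \<Rightarrow> 'r \<Rightarrow> ('r, 'r S_elem) module"
  where "S_alg R p lam = localization (mpoly R (idx p)) {D_elem R p lam}"

definition S_var :: "('r, 'k) ring_scheme \<Rightarrow> nat \<Rightarrow> 'r \<Rightarrow> nat \<times> nat \<Rightarrow> 'r S_elem"
  where "S_var R p lam j =
    frac (mpoly R (idx p)) {D_elem R p lam} (mvar R (idx p) j) \<one>\<^bsub>mpoly R (idx p)\<^esub>"

definition S_comult ::
  "('r, 'k) ring_scheme \<Rightarrow> nat \<Rightarrow> 'r \<Rightarrow> 'r S_elem \<Rightarrow> ('r S_elem \<times> 'r S_elem \<Rightarrow> 'r) set"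
  where "S_comult R p lam =
    (let S = S_alg R p lam; T = S_var R p lam;
         d = comult_coeffs R (A_alg R p) (A_comult R p lam) (idx p) (A_basis R p) in
      (SOME h. h \<in> alg_hom R S (alg_tensor R S S) \<and>
        (\<forall>j\<in>idx p. h (T j) =
          (\<Oplus>\<^bsub>alg_tensor R S S\<^esub>i\<in>idx p. tens R S S (T i) (lin_form S (idx p) d T i j)))))"

definition S_to_A ::
  "('r, 'k) ring_scheme \<Rightarrow> nat \<Rightarrow> 'r \<Rightarrow> 'r S_elem \<Rightarrow> (coord multiset \<Rightarrow> 'r) set"
  where "S_to_A R p lam =
    (SOME h. h \<in> alg_hom R (S_alg R p lam) (A_alg R p) \<and>
       (\<forall>j\<in>idx p. h (S_var R p lam j) = A_basis R p j))"

definition coaction ::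
  "('r, 'k) ring_scheme \<Rightarrow> nat \<Rightarrow> 'r \<Rightarrow> 'r S_elem \<Rightarrow>
    ('r S_elem \<times> (coord multiset \<Rightarrow> 'r) set \<Rightarrow> 'r) set"
  where "coaction R p lam =
    (let S = S_alg R p lam in
      tensor_map R S S S (A_alg R p) (\<lambda>s. s) (S_to_A R p lam) \<circ> S_comult R p lam)"

definition coinvariants :: "('r, 'k) ring_scheme \<Rightarrow> nat \<Rightarrow> 'r \<Rightarrow> ('r, 'r S_elem) module"
  where "coinvariants R p lam =
    (let S = S_alg R p lam; A = A_alg R p in
      S\<lparr>carrier := {s \<in> carrier S. coaction R p lam s = tens R S A s \<one>\<^bsub>A\<^esub>}\<rparr>)"


section \<open>The localized polynomial algebra\<close>

text \<open>The element \<open>Z\<^sub>1 + \<lambda>\<^sup>2 Z\<^sub>X\<^sub>2\<close> involves the variable with index \<open>(2, 0)\<close>, which exists only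
  for \<open>p \<ge> 3\<close>. For \<open>p = 2\<close> only the first two elements are inverted.\<close>

definition Z_denoms :: "('r, 'k) ring_scheme \<Rightarrow> nat \<Rightarrow> 'r \<Rightarrow> ((nat \<times> nat) multiset \<Rightarrow> 'r) set"
  where "Z_denoms R p lam =
    (let P = mpoly R (idx p); Z = (\<lambda>k. mvar R (idx p) (k, 0)) in
      {Z 0, (Z 0 [^]\<^bsub>P\<^esub> p) \<oplus>\<^bsub>P\<^esub> ((lam [^]\<^bsub>R\<^esub> p) \<odot>\<^bsub>P\<^esub> Z 1)} \<union>
      (if 3 \<le> p then {Z 0 \<oplus>\<^bsub>P\<^esub> ((lam [^]\<^bsub>R\<^esub> (2::nat)) \<odot>\<^bsub>P\<^esub> Z 2)} else {}) \<union>
      {((Z 0 [^]\<^bsub>P\<^esub> (s - 1)) \<oplus>\<^bsub>P\<^esub>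
         (\<Oplus>\<^bsub>P\<^esub>k\<in>{2..s - 1}. [(s choose k)] \<cdot>\<^bsub>P\<^esub>
            ((lam [^]\<^bsub>R\<^esub> k) \<odot>\<^bsub>P\<^esub> ((Z 0 [^]\<^bsub>P\<^esub> (s - k)) \<otimes>\<^bsub>P\<^esub> Z k)))) \<oplus>\<^bsub>P\<^esub>
       ((lam [^]\<^bsub>R\<^esub> s) \<odot>\<^bsub>P\<^esub> Z s) | s. 3 \<le> s \<and> s \<le> p - 1})"

definition Z_alg :: "('r, 'k) ring_scheme \<Rightarrow> nat \<Rightarrow> 'r \<Rightarrow> ('r, 'r S_elem) module"
  where "Z_alg R p lam = localization (mpoly R (idx p)) (Z_denoms R p lam)"


section \<open>Fppf quotients\<close>

text \<open>Flatness in its equational form (equivalent to exactness of \<open>- \<otimes>\<^sub>B M\<close>): every linear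
  relation in \<open>M\<close> is a consequence of relations in \<open>B\<close>.\<close>

definition flat :: "('b, 'k) ring_scheme \<Rightarrow> ('b, 'm, 'l) module_scheme \<Rightarrow> bool"
  where "flat B M \<longleftrightarrow>
    (\<forall>(n::nat) f x.
      f \<in> {..<n} \<rightarrow> carrier B \<and> x \<in> {..<n} \<rightarrow> carrier M \<and>
      (\<Oplus>\<^bsub>M\<^esub>k\<in>{..<n}. f k \<odot>\<^bsub>M\<^esub> x k) = \<zero>\<^bsub>M\<^esub> \<longrightarrow>
      (\<exists>(l::nat) a y.
        (\<forall>k<n. \<forall>j<l. a k j \<in> carrier B) \<and> y \<in> {..<l} \<rightarrow> carrier M \<and>
        (\<forall>k<n. x k = (\<Oplus>\<^bsub>M\<^esub>j\<in>{..<l}. a k j \<odot>\<^bsub>M\<^esub> y j)) \<and>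
        (\<forall>j<l. (\<Oplus>\<^bsub>B\<^esub>k\<in>{..<n}. f k \<otimes>\<^bsub>B\<^esub> a k j) = \<zero>\<^bsub>B\<^esub>)))"

definition struct_map :: "('b, 'c, 'l) module_scheme \<Rightarrow> 'b \<Rightarrow> 'c"
  where "struct_map C b = b \<odot>\<^bsub>C\<^esub> \<one>\<^bsub>C\<^esub>"

definition spec_surjective :: "('b, 'k) ring_scheme \<Rightarrow> ('b, 'c, 'l) module_scheme \<Rightarrow> bool"
  where "spec_surjective B C \<longleftrightarrow>
    (\<forall>P. primeideal P B \<longrightarrow> (\<exists>Q. primeideal Q C \<and> P = {b \<in> carrier B. struct_map C b \<in> Q}))"

text \<open>Up to isomorphism the finitely presented \<open>B\<close>-algebras are the
  \<open>fp_alg B n F = B[x\<^sub>0, \<dots>, x\<^sub>n\<^sub>-\<^sub>1]/(F)\<close> with \<open>F\<close> a finite set of polynomials.\<close>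

definition fp_alg ::
  "('b, 'k) ring_scheme \<Rightarrow> nat \<Rightarrow> (nat multiset \<Rightarrow> 'b) set \<Rightarrow> ('b, (nat multiset \<Rightarrow> 'b) set) module"
  where "fp_alg B n F = alg_quot (mpoly B {..<n}) (Idl\<^bsub>mpoly B {..<n}\<^esub> F)"

definition fppf_cover :: "('b, 'k) ring_scheme \<Rightarrow> nat \<Rightarrow> (nat multiset \<Rightarrow> 'b) set \<Rightarrow> bool"
  where "fppf_cover B n F \<longleftrightarrow>
    finite F \<and> F \<subseteq> carrier (mpoly B {..<n}) \<and>
    flat B (fp_alg B n F) \<and> spec_surjective B (fp_alg B n F)"

text \<open>A \<open>B\<close>-algebra \<open>C\<close> viewed as an algebra over the base ring of the algebra \<open>B\<close>.\<close>

definition restrict_scalars ::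
  "('r, 'b, 'k) module_scheme \<Rightarrow> ('b, 'c, 'l) module_scheme \<Rightarrow> ('r, 'c) module"
  where "restrict_scalars B C =
    \<lparr>carrier = carrier C, monoid.mult = monoid.mult C, one = one C, zero = zero C, add = add C,
     smult = (\<lambda>r x. struct_map B r \<odot>\<^bsub>C\<^esub> x)\<rparr>"

text \<open>For a right \<open>A\<close>-comodule algebra \<open>(S, \<rho>)\<close>, the \<open>B\<close>-valued point \<open>u \<cdot> g\<close> of \<open>Spec S\<close> is
  the composite of \<open>\<rho>\<close> with the homomorphism \<open>s \<otimes> a \<mapsto> u(s) g(a)\<close>.\<close>

definition point_act ::
  "('r, 'k) ring_scheme \<Rightarrow> ('r, 's) module \<Rightarrow> ('r, 'a) module \<Rightarrow> ('s \<Rightarrow> ('s \<times> 'a \<Rightarrow> 'r) set) \<Rightarrow>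
    ('r, 'b) module \<Rightarrow> ('s \<Rightarrow> 'b) \<Rightarrow> ('a \<Rightarrow> 'b) \<Rightarrow> 's \<Rightarrow> 'b"
  where "point_act R S A \<rho> B u g =
    (SOME h. h \<in> alg_hom R (alg_tensor R S A) B \<and>
       (\<forall>s\<in>carrier S. \<forall>a\<in>carrier A. h (tens R S A s a) = u s \<otimes>\<^bsub>B\<^esub> g a)) \<circ> \<rho>"

text \<open>Let \<open>G = Spec A\<close> act on \<open>U = Spec S\<close> through \<open>\<rho>\<close>. The predicate says that the morphism
  \<open>Spec \<theta> : U \<rightarrow> Spec C\<close> makes \<open>Spec C\<close> the fppf sheaf associated with \<open>B \<mapsto> U(B)/G(B)\<close>: it
  is constant on orbits, two points of \<open>U\<close> with the same image lie fppf-locally in the same orbit,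
  and every point of \<open>Spec C\<close> lifts fppf-locally to \<open>U\<close>. (The functor \<open>Spec C\<close> itself is an fppf
  sheaf, being representable.) The test algebras \<open>B\<close> have their carriers in an
  arbitrary type.\<close>

definition fppf_quotient ::
  "'b itself \<Rightarrow> ('r, 'k) ring_scheme \<Rightarrow> ('r, 's) module \<Rightarrow> ('r, 'a) module \<Rightarrow>
    ('s \<Rightarrow> ('s \<times> 'a \<Rightarrow> 'r) set) \<Rightarrow> ('r, 'c) module \<Rightarrow> ('c \<Rightarrow> 's) \<Rightarrow> bool"
  where "fppf_quotient _ R S A \<rho> C \<theta> \<longleftrightarrow>
    \<theta> \<in> alg_hom R C S \<and>
    (\<forall>B :: ('r, 'b) module. algebra R B \<longrightarrow>
      (\<forall>u\<in>alg_hom R S B. \<forall>g\<in>alg_hom R A B. \<forall>c\<in>carrier C.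
         point_act R S A \<rho> B u g (\<theta> c) = u (\<theta> c)) \<and>
      (\<forall>u\<in>alg_hom R S B. \<forall>u'\<in>alg_hom R S B. (\<forall>c\<in>carrier C. u (\<theta> c) = u' (\<theta> c)) \<longrightarrow>
         (\<exists>n F. fppf_cover B n F \<and>
           (let B' = restrict_scalars B (fp_alg B n F); \<iota> = struct_map (fp_alg B n F) in
             \<exists>g\<in>alg_hom R A B'. \<forall>s\<in>carrier S. \<iota> (u' s) = point_act R S A \<rho> B' (\<iota> \<circ> u) g s))) \<and>
      (\<forall>v\<in>alg_hom R C B.
         (\<exists>n F. fppf_cover B n F \<and>
           (let B' = restrict_scalars B (fp_alg B n F); \<iota> = struct_map (fp_alg B n F) in
             \<exists>u\<in>alg_hom R S B'. \<forall>c\<in>carrier C. u (\<theta> c) = \<iota> (v c)))))"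

end

(*
  A point t of U is a linear functional on B[X, Y]/(X^p, Y^p) whose values on the powers of
  1 + lam X are units.  Put xi = t(X)/t(1), k = 1 + lam xi and eta = k t(Y/(1 + lam X))/t(1).
  Then t |-> (xi, eta) is a G-equivariant map from U to H^(lam), and the values of t on the
  monomials in
    X~ = (X - xi)/k   and   Y~ = k Y/(1 + lam X) - eta
  are G-invariant, because a translation moves X, Y and xi, eta compatibly.  Hence U is the product
  of H^(lam) with a trivial G-scheme F.  As G is the Frobenius kernel of H^(lam), the quotient is
  F times H^(lam) with coordinates xi^p, eta^p.  The variables Z_X and Z_Y correspond to t(X)^p and
  eta^p, the other Z_j to the coordinates of F up to powers of t(1).  The p-th roots needed to lift
  a point of the quotient exist over the finite free cover B[x, y]/(x^p - a, y^p - b).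
*)

theory Submission
  imports Defs "HOL-Decision_Procs.Algebra_Aux" "HOL-Algebra.Multiplicative_Group" "HOL-Algebra.Divisibility"
begin

section \<open>Binomial expansions\<close>

text \<open>The division by 1 + lam X in the second coordinate is forced by the group law. The
  element 1 + lam X is group-like: translation by (x, y) multiplies it by g = 1 + lam x and sends Y
  to Y + (1 + lam X) y. Hence Y/(1 + lam X) goes to (Y/(1 + lam X) + y)/g, and the factor k, itself
  multiplied by g, restores a translation law for eta. The powers of t(1) are dictated by the
  prescribed denominators. The value of t on (1 + lam X)^s is k^s times its value on (1 + lam X~)^s,
  whose linear term vanishes because t(X~) = 0. Taking Z_(X^k) = t(X~^k) t(1)^(k-2) makes t(1)^(s-2)
  times this value homogeneous of degree s-1, and it is then the denominator with index s. Likewise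
  Z_X is t(X)^p and not xi^p because Z_1^p + lam^p Z_X is then (t(1) + lam t(X))^p. All computations
  take place for points in an arbitrary test ring. The algebras \<open>S\<close> and
  \<open>Z\<close> enter through the families of units that they represent, and the isomorphism is
  the coordinate map evaluated at the universal point of \<open>S\<close>.\<close>

lemma (in cring) add_pow_m_comm:
  "x \<in> carrier R \<Longrightarrow> y \<in> carrier R \<Longrightarrow> x \<otimes> ([(n::nat)] \<cdot> y) = [n] \<cdot> (x \<otimes> y)"
  by (simp add: add_pow_rdistr)

lemma (in cring) binomial_expansion:
  assumes x: "x \<in> carrier R" and y: "y \<in> carrier R"
  shows "(x \<oplus> y) [^] (n::nat) = (\<Oplus>k\<in>{..n}. [(n choose k)] \<cdot> (x [^] k \<otimes> y [^] (n - k)))"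
proof (induction n)
  case 0
  show ?case using x y by simp
next
  case (Suc n)
  let ?S = "\<Oplus>k\<in>{..n}. [(n choose k)] \<cdot> (x [^] k \<otimes> y [^] (n - k))"
  have xS: "x \<otimes> ?S = (\<Oplus>k\<in>{..n}. [(n choose k)] \<cdot> (x [^] Suc k \<otimes> y [^] (n - k)))"
    using x y by (subst finsum_rdistr) (auto intro!: finsum_cong' simp: add_pow_m_comm m_ac)
  have yS: "y \<otimes> ?S = (\<Oplus>k\<in>{..n}. [(n choose k)] \<cdot> (x [^] k \<otimes> y [^] (Suc n - k)))"
    using x y
    by (subst finsum_rdistr) (auto intro!: finsum_cong' simp: add_pow_m_comm m_ac Suc_diff_le)
  \<comment> \<open>The term added at \<open>Suc n\<close> is 0 because
    \<open>n choose Suc n\<close> is. With it, splitting off \<open>k = 0\<close> leaves a sum over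
    \<open>{..n}\<close> with the same products of powers as in \<open>xS\<close>, so Pascal's rule
    applies termwise.\<close>
  have yS': "y \<otimes> ?S = (\<Oplus>k\<in>{..Suc n}. [(n choose k)] \<cdot> (x [^] k \<otimes> y [^] (Suc n - k)))"
    using x y by (subst finsum_Suc) (simp_all add: yS Pi_def binomial_eq_0)
  also have "\<dots> = (\<Oplus>k\<in>{..n}. [(n choose Suc k)] \<cdot> (x [^] Suc k \<otimes> y [^] (n - k))) \<oplus> y [^] Suc n"
    using x y by (subst finsum_Suc2) (simp_all add: Pi_def)
  finally have yS2: "y \<otimes> ?S = \<dots>" .
  have "(x \<oplus> y) [^] Suc n = (x \<oplus> y) \<otimes> ?S"
    using Suc x y by (simp add: m_comm)
  also have "\<dots> = x \<otimes> ?S \<oplus> y \<otimes> ?S"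
    using x y by (simp add: l_distr Pi_def)
  also have "\<dots> = (\<Oplus>k\<in>{..n}. [(Suc n choose Suc k)] \<cdot> (x [^] Suc k \<otimes> y [^] (n - k))) \<oplus> y [^] Suc n"
  proof -
    let ?c = "\<lambda>k. x [^] Suc k \<otimes> y [^] (n - k)"
    have "(\<Oplus>k\<in>{..n}. [(Suc n choose Suc k)] \<cdot> ?c k) =
        (\<Oplus>k\<in>{..n}. [(n choose k)] \<cdot> ?c k \<oplus> [(n choose Suc k)] \<cdot> ?c k)"
      using x y by (intro finsum_cong') (auto simp: add.nat_pow_mult)
    also have "\<dots> = (\<Oplus>k\<in>{..n}. [(n choose k)] \<cdot> ?c k) \<oplus> (\<Oplus>k\<in>{..n}. [(n choose Suc k)] \<cdot> ?c k)"
      using x y by (intro finsum_addf) auto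
    finally show ?thesis
      unfolding xS yS2 using x y by (simp only: a_assoc finsum_closed Pi_def nat_pow_closed
        m_closed add.nat_pow_closed mem_Collect_eq simp_thms)
  qed
  also have "\<dots> = (\<Oplus>k\<in>{..Suc n}. [(Suc n choose k)] \<cdot> (x [^] k \<otimes> y [^] (Suc n - k)))"
    using x y by (subst finsum_Suc2) (simp_all add: Pi_def)
  finally show ?case .
qed

text \<open>\<open>p\<close> divides \<open>p choose k\<close> for \<open>0 < k < p\<close>, so only
  the two end terms of the binomial expansion survive. The characteristic is expressed by
  \<open>p\<close> times 1 being 0, a condition that every algebra over such a ring inherits, the
  zero ring included.\<close>

lemma (in cring) frobenius_add:
  assumes p: "Factorial_Ring.prime (p::nat)" and char: "[p] \<cdot> \<one> = \<zero>"
    and x: "x \<in> carrier R" and y: "y \<in> carrier R"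
  shows "(x \<oplus> y) [^] p = x [^] p \<oplus> y [^] p"
proof -
  have p0: "0 < p" using p by (rule prime_gt_0_nat)
  have pz: "[p] \<cdot> z = \<zero>" if "z \<in> carrier R" for z
    using add_pow_ldistr[of \<one> z p] that char by simp
  have "(x \<oplus> y) [^] p = (\<Oplus>k\<in>{..p}. [(p choose k)] \<cdot> (x [^] k \<otimes> y [^] (p - k)))"
    by (rule binomial_expansion[OF x y])
  also have "\<dots> = (\<Oplus>k\<in>{0, p}. [(p choose k)] \<cdot> (x [^] k \<otimes> y [^] (p - k)))"
  proof (rule add.finprod_mono_neutral_cong_right)
    show "[(p choose k)] \<cdot> (x [^] k \<otimes> y [^] (p - k)) = \<zero>" if "k \<in> {..p} - {0, p}" for k
    proof -
      have "p dvd p choose k" using that p by (intro dvd_choose_prime) auto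
      then obtain m where m: "p choose k = p * m" by (elim dvdE)
      have "[(p * m)] \<cdot> (x [^] k \<otimes> y [^] (p - k)) = [m] \<cdot> ([p] \<cdot> (x [^] k \<otimes> y [^] (p - k)))"
        using x y by (simp add: add.nat_pow_pow)
      then show ?thesis using x y m pz by simp
    qed
  qed (use x y in auto)
  also have "\<dots> = x [^] p \<oplus> y [^] p"
    using x y p0 by (simp add: a_comm)
  finally show ?thesis .
qed

lemma (in cring) frobenius_minus:
  assumes p: "Factorial_Ring.prime (p::nat)" and char: "[p] \<cdot> \<one> = \<zero>"
    and x: "x \<in> carrier R" and y: "y \<in> carrier R"
  shows "(x \<ominus> y) [^] p = x [^] p \<ominus> y [^] p"
proof -
  have "(x \<ominus> y) [^] p \<oplus> y [^] p = ((x \<ominus> y) \<oplus> y) [^] p"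
    using x y by (simp add: frobenius_add[OF p char])
  also have "(x \<ominus> y) \<oplus> y = x" using x y by (simp add: minus_eq a_assoc l_neg)
  finally show ?thesis using x y by (metis add.inv_solve_right' minus_eq minus_closed nat_pow_closed)
qed

section \<open>Monoid algebras\<close>

text \<open>The scaled generators r [m]. They span the monoid algebra under addition alone.\<close>

definition mterm :: "('r, 'k) ring_scheme \<Rightarrow> 'r \<Rightarrow> 'm \<Rightarrow> 'm \<Rightarrow> 'r"
  where "mterm R r m = (\<lambda>m'. if m' = m then r else \<zero>\<^bsub>R\<^esub>)"

text \<open>The semilinear extension of \<open>\<phi>\<close> from \<open>M\<close> to the monoid
  algebra, with coefficients transported along \<open>\<sigma>\<close>. The ring homomorphism
  \<open>\<sigma>\<close> is left free since coefficients will also be sent through a Frobenius or a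
  composite with a structure map.\<close>

definition mlin ::
  "('r, 'k) ring_scheme \<Rightarrow> ('b, 'l) ring_scheme \<Rightarrow> ('r \<Rightarrow> 'b) \<Rightarrow> ('m \<Rightarrow> 'b) \<Rightarrow> ('m \<Rightarrow> 'r) \<Rightarrow> 'b"
  where "mlin R B \<sigma> \<phi> f = (\<Oplus>\<^bsub>B\<^esub>m\<in>{m. f m \<noteq> \<zero>\<^bsub>R\<^esub>}. \<sigma> (f m) \<otimes>\<^bsub>B\<^esub> \<phi> m)"

lemma msingle_eq_mterm: "msingle R M m = mterm R \<one>\<^bsub>R\<^esub> m"
  by (simp add: msingle_def mterm_def)

lemma mterm_supp: "{k. mterm R r m k \<noteq> \<zero>\<^bsub>R\<^esub>} \<subseteq> {m}"
  by (auto simp: mterm_def)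

lemma mterm_same: "mterm R r m m = r"
  by (simp add: mterm_def)

locale monoid_alg = R?: cring R + M: comm_monoid M
  for R :: "('r, 'k) ring_scheme" (structure) and M :: "('m, 'l) monoid_scheme"
begin

abbreviation F where "F \<equiv> monoid_algebra R M"

lemma F_sel:
  "f \<in> carrier F \<longleftrightarrow> (\<forall>m\<in>carrier M. f m \<in> carrier R) \<and> (\<forall>m. m \<notin> carrier M \<longrightarrow> f m = \<zero>) \<and>
     finite {m. f m \<noteq> \<zero>}"
  "\<zero>\<^bsub>F\<^esub> = (\<lambda>m. \<zero>)" "\<one>\<^bsub>F\<^esub> = mterm R \<one> \<one>\<^bsub>M\<^esub>"
  "f \<oplus>\<^bsub>F\<^esub> g = (\<lambda>m. f m \<oplus> g m)" "r \<odot>\<^bsub>F\<^esub> f = (\<lambda>m. r \<otimes> f m)"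
  by (simp_all add: monoid_algebra_def msingle_eq_mterm)

lemma coeff_closed: "f \<in> carrier F \<Longrightarrow> f m \<in> carrier R"
  by (cases "m \<in> carrier M") (auto simp: F_sel)

lemma supp_subset: "f \<in> carrier F \<Longrightarrow> {m. f m \<noteq> \<zero>} \<subseteq> carrier M"
  by (auto simp: F_sel)

lemma supp_finite: "f \<in> carrier F \<Longrightarrow> finite {m. f m \<noteq> \<zero>}"
  by (auto simp: F_sel)

lemma mterm_closed: "r \<in> carrier R \<Longrightarrow> m \<in> carrier M \<Longrightarrow> mterm R r m \<in> carrier F"
  by (auto simp: F_sel mterm_def)

lemma F_zero_closed: "\<zero>\<^bsub>F\<^esub> \<in> carrier F"
  by (auto simp: F_sel)

lemma F_add_closed: "f \<in> carrier F \<Longrightarrow> g \<in> carrier F \<Longrightarrow> f \<oplus>\<^bsub>F\<^esub> g \<in> carrier F"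
  by (auto simp: F_sel intro!: finite_subset[of _ "{m. f m \<noteq> \<zero>} \<union> {m. g m \<noteq> \<zero>}"])

lemma F_smult_closed: "r \<in> carrier R \<Longrightarrow> f \<in> carrier F \<Longrightarrow> r \<odot>\<^bsub>F\<^esub> f \<in> carrier F"
  by (auto simp: F_sel intro!: finite_subset[of _ "{m. f m \<noteq> \<zero>}"])

text \<open>The defining sum runs over a set that depends on \<open>k\<close>. Spread over a fixed
  rectangle, with zeros off the fibre over \<open>k\<close>, it becomes a sum to which exchange of
  factors and distributivity apply termwise.\<close>

lemma F_mult_coeff:
  assumes f: "f \<in> carrier F" and g: "g \<in> carrier F"
    and A: "finite A" "{m. f m \<noteq> \<zero>} \<subseteq> A" and B: "finite B" "{m. g m \<noteq> \<zero>} \<subseteq> B"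
  shows "(f \<otimes>\<^bsub>F\<^esub> g) k =
    (\<Oplus>q\<in>A \<times> B. if fst q \<otimes>\<^bsub>M\<^esub> snd q = k then f (fst q) \<otimes> g (snd q) else \<zero>)"
proof -
  have "(f \<otimes>\<^bsub>F\<^esub> g) k = (\<Oplus>q\<in>{q. f (fst q) \<noteq> \<zero> \<and> g (snd q) \<noteq> \<zero> \<and> fst q \<otimes>\<^bsub>M\<^esub> snd q = k}.
                        f (fst q) \<otimes> g (snd q))"
    by (simp add: monoid_algebra_def)
  also have "\<dots> = (\<Oplus>q\<in>A \<times> B. if fst q \<otimes>\<^bsub>M\<^esub> snd q = k then f (fst q) \<otimes> g (snd q) else \<zero>)"
  proof (rule add.finprod_mono_neutral_cong_left)
    show "finite (A \<times> B)" using A B by simp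
    show "{q. f (fst q) \<noteq> \<zero> \<and> g (snd q) \<noteq> \<zero> \<and> fst q \<otimes>\<^bsub>M\<^esub> snd q = k} \<subseteq> A \<times> B"
      using A(2) B(2) by (auto simp: subset_iff mem_Times_iff)
    show "(if fst q \<otimes>\<^bsub>M\<^esub> snd q = k then f (fst q) \<otimes> g (snd q) else \<zero>) = \<zero>"
      if "q \<in> A \<times> B - {q. f (fst q) \<noteq> \<zero> \<and> g (snd q) \<noteq> \<zero> \<and> fst q \<otimes>\<^bsub>M\<^esub> snd q = k}" for q
      using that coeff_closed[OF f] coeff_closed[OF g] by auto
  qed (use coeff_closed[OF f] coeff_closed[OF g] in auto)
  finally show ?thesis .
qed

lemma F_mult_closed:
  assumes f: "f \<in> carrier F" and g: "g \<in> carrier F"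
  shows "f \<otimes>\<^bsub>F\<^esub> g \<in> carrier F"
proof -
  let ?A = "{m. f m \<noteq> \<zero>}" and ?B = "{m. g m \<noteq> \<zero>}"
  note c = F_mult_coeff[OF f g supp_finite[OF f] subset_refl supp_finite[OF g] subset_refl]
  have z: "(f \<otimes>\<^bsub>F\<^esub> g) k = \<zero>" if "k \<notin> (\<lambda>q. fst q \<otimes>\<^bsub>M\<^esub> snd q) ` (?A \<times> ?B)" for k
    unfolding c using that by (intro add.finprod_one_eqI) auto
  have fin: "finite ((\<lambda>q. fst q \<otimes>\<^bsub>M\<^esub> snd q) ` (?A \<times> ?B))"
    using supp_finite[OF f] supp_finite[OF g] by auto
  have sub: "(\<lambda>q. fst q \<otimes>\<^bsub>M\<^esub> snd q) ` (?A \<times> ?B) \<subseteq> carrier M"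
    using supp_subset[OF f] supp_subset[OF g] by (auto simp: subset_iff)
  have cl: "(f \<otimes>\<^bsub>F\<^esub> g) k \<in> carrier R" for k
    unfolding c using coeff_closed[OF f] coeff_closed[OF g] by (intro finsum_closed) auto
  show ?thesis
    unfolding F_sel(1)
  proof (intro conjI ballI allI impI)
    show "(f \<otimes>\<^bsub>F\<^esub> g) m = \<zero>" if "m \<notin> carrier M" for m using z sub that by blast
    show "finite {m. (f \<otimes>\<^bsub>F\<^esub> g) m \<noteq> \<zero>}" using z by (intro finite_subset[OF _ fin]) blast
  qed (rule cl)
qed

lemma F_mult_mterm:
  assumes "r \<in> carrier R" "s \<in> carrier R" "m \<in> carrier M" "n \<in> carrier M"
  shows "mterm R r m \<otimes>\<^bsub>F\<^esub> mterm R s n = mterm R (r \<otimes> s) (m \<otimes>\<^bsub>M\<^esub> n)"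
proof
  fix k
  have "(mterm R r m \<otimes>\<^bsub>F\<^esub> mterm R s n) k = (\<Oplus>q\<in>{m} \<times> {n}. if fst q \<otimes>\<^bsub>M\<^esub> snd q = k
      then mterm R r m (fst q) \<otimes> mterm R s n (snd q) else \<zero>)"
    using assms by (intro F_mult_coeff mterm_closed) (auto simp: mterm_def)
  also have "\<dots> = mterm R (r \<otimes> s) (m \<otimes>\<^bsub>M\<^esub> n) k"
    using assms by (simp add: mterm_def)
  finally show "(mterm R r m \<otimes>\<^bsub>F\<^esub> mterm R s n) k = mterm R (r \<otimes> s) (m \<otimes>\<^bsub>M\<^esub> n) k" .
qed

lemma F_comm:
  assumes f: "f \<in> carrier F" and g: "g \<in> carrier F"
  shows "f \<otimes>\<^bsub>F\<^esub> g = g \<otimes>\<^bsub>F\<^esub> f"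
proof
  fix k
  let ?A = "{m. f m \<noteq> \<zero>}" and ?B = "{m. g m \<noteq> \<zero>}"
  note [simp] = coeff_closed[OF f] coeff_closed[OF g]
  have "(f \<otimes>\<^bsub>F\<^esub> g) k = (\<Oplus>q\<in>?A \<times> ?B. if fst q \<otimes>\<^bsub>M\<^esub> snd q = k then f (fst q) \<otimes> g (snd q) else \<zero>)"
    by (intro F_mult_coeff f g supp_finite subset_refl)
  also have "\<dots> = (\<Oplus>q\<in>?A \<times> ?B. if fst (prod.swap q) \<otimes>\<^bsub>M\<^esub> snd (prod.swap q) = k
      then g (fst (prod.swap q)) \<otimes> f (snd (prod.swap q)) else \<zero>)"
    using supp_subset[OF f] supp_subset[OF g]
    by (intro finsum_cong') (auto simp: m_comm M.m_comm subset_iff)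
  also have "\<dots> = (\<Oplus>q\<in>prod.swap ` (?A \<times> ?B). if fst q \<otimes>\<^bsub>M\<^esub> snd q = k
      then g (fst q) \<otimes> f (snd q) else \<zero>)"
    by (intro finsum_reindex[symmetric]) auto
  also have "prod.swap ` (?A \<times> ?B) = ?B \<times> ?A" by auto
  also have "(\<Oplus>q\<in>?B \<times> ?A. if fst q \<otimes>\<^bsub>M\<^esub> snd q = k then g (fst q) \<otimes> f (snd q) else \<zero>)
      = (g \<otimes>\<^bsub>F\<^esub> f) k"
    by (intro F_mult_coeff[symmetric] f g supp_finite subset_refl)
  finally show "(f \<otimes>\<^bsub>F\<^esub> g) k = (g \<otimes>\<^bsub>F\<^esub> f) k" .
qed

lemma F_l_distr:
  assumes f: "f \<in> carrier F" and g: "g \<in> carrier F" and h: "h \<in> carrier F"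
  shows "(f \<oplus>\<^bsub>F\<^esub> g) \<otimes>\<^bsub>F\<^esub> h = f \<otimes>\<^bsub>F\<^esub> h \<oplus>\<^bsub>F\<^esub> g \<otimes>\<^bsub>F\<^esub> h"
proof
  fix k
  let ?A = "{m. f m \<noteq> \<zero>} \<union> {m. g m \<noteq> \<zero>}" and ?B = "{m. h m \<noteq> \<zero>}"
  have fA: "finite ?A" "finite ?B" using supp_finite f g h by auto
  note [simp] = coeff_closed[OF f] coeff_closed[OF g] coeff_closed[OF h]
  have "((f \<oplus>\<^bsub>F\<^esub> g) \<otimes>\<^bsub>F\<^esub> h) k =
     (\<Oplus>q\<in>?A \<times> ?B. if fst q \<otimes>\<^bsub>M\<^esub> snd q = k then (f \<oplus>\<^bsub>F\<^esub> g) (fst q) \<otimes> h (snd q) else \<zero>)"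
    using fA by (intro F_mult_coeff F_add_closed f g h) (auto simp: F_sel)
  also have "\<dots> = (\<Oplus>q\<in>?A \<times> ?B.
      (if fst q \<otimes>\<^bsub>M\<^esub> snd q = k then f (fst q) \<otimes> h (snd q) else \<zero>) \<oplus>
      (if fst q \<otimes>\<^bsub>M\<^esub> snd q = k then g (fst q) \<otimes> h (snd q) else \<zero>))"
    by (intro finsum_cong') (auto simp: F_sel l_distr)
  also have "\<dots> = (f \<otimes>\<^bsub>F\<^esub> h) k \<oplus> (g \<otimes>\<^bsub>F\<^esub> h) k"
    using fA by (simp add: finsum_addf Pi_def F_mult_coeff[OF f h, of ?A ?B] F_mult_coeff[OF g h, of ?A ?B])
  finally show "((f \<oplus>\<^bsub>F\<^esub> g) \<otimes>\<^bsub>F\<^esub> h) k = (f \<otimes>\<^bsub>F\<^esub> h \<oplus>\<^bsub>F\<^esub> g \<otimes>\<^bsub>F\<^esub> h) k"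
    by (simp add: F_sel)
qed

lemma F_r_distr:
  assumes "f \<in> carrier F" "g \<in> carrier F" "h \<in> carrier F"
  shows "h \<otimes>\<^bsub>F\<^esub> (f \<oplus>\<^bsub>F\<^esub> g) = h \<otimes>\<^bsub>F\<^esub> f \<oplus>\<^bsub>F\<^esub> h \<otimes>\<^bsub>F\<^esub> g"
  using F_l_distr[OF assms] assms by (simp add: F_comm F_add_closed)

text \<open>Induction on the size of the support, removing one term at a time. It reduces
  multilinear identities to the terms r [m], where they are laws of \<open>R\<close> and
  \<open>M\<close>.\<close>

lemma F_induct [consumes 1, case_names zero mterm add]:
  assumes f: "f \<in> carrier F"
    and z: "P \<zero>\<^bsub>F\<^esub>"
    and s: "\<And>r m. r \<in> carrier R \<Longrightarrow> m \<in> carrier M \<Longrightarrow> P (mterm R r m)"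
    and a: "\<And>f g. f \<in> carrier F \<Longrightarrow> g \<in> carrier F \<Longrightarrow> P f \<Longrightarrow> P g \<Longrightarrow> P (f \<oplus>\<^bsub>F\<^esub> g)"
  shows "P f"
  using f
proof (induction "card {m. f m \<noteq> \<zero>}" arbitrary: f)
  case 0
  then have "f = \<zero>\<^bsub>F\<^esub>" using supp_finite[of f] by (auto simp: F_sel(2))
  then show ?case using z by simp
next
  case (Suc n)
  then obtain m where m: "f m \<noteq> \<zero>" by (metis (mono_tags) card.empty empty_Collect_eq nat.distinct(1))
  define g where "g = f(m := \<zero>)"
  have supp: "{k. g k \<noteq> \<zero>} = {k. f k \<noteq> \<zero>} - {m}" by (auto simp: g_def)
  have g: "g \<in> carrier F" using Suc.prems by (auto simp: F_sel(1) supp) (auto simp: g_def)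
  have mM: "m \<in> carrier M" using m Suc.prems by (auto simp: F_sel(1))
  have fm: "f m \<in> carrier R" using Suc.prems by (rule coeff_closed)
  have "n = card {k. g k \<noteq> \<zero>}"
    unfolding supp using Suc m supp_finite[OF Suc.prems] by simp
  then have "P g" using Suc.hyps(1) g by blast
  moreover have "f = mterm R (f m) m \<oplus>\<^bsub>F\<^esub> g"
    using coeff_closed[OF Suc.prems] by (auto simp: F_sel mterm_def g_def fun_eq_iff)
  ultimately show ?case using a[OF mterm_closed[OF fm mM] g s[OF fm mM]] by simp
qed

lemma F_l_zero_mult: "f \<in> carrier F \<Longrightarrow> \<zero>\<^bsub>F\<^esub> \<otimes>\<^bsub>F\<^esub> f = \<zero>\<^bsub>F\<^esub>"
  by (simp add: monoid_algebra_def)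

lemma F_r_zero_mult: "f \<in> carrier F \<Longrightarrow> f \<otimes>\<^bsub>F\<^esub> \<zero>\<^bsub>F\<^esub> = \<zero>\<^bsub>F\<^esub>"
  by (simp add: monoid_algebra_def)

lemma F_zero_add: "f \<in> carrier F \<Longrightarrow> \<zero>\<^bsub>F\<^esub> \<oplus>\<^bsub>F\<^esub> f = f"
  using coeff_closed by (auto simp: F_sel)

lemma F_assoc:
  assumes f: "f \<in> carrier F" and g: "g \<in> carrier F" and h: "h \<in> carrier F"
  shows "(f \<otimes>\<^bsub>F\<^esub> g) \<otimes>\<^bsub>F\<^esub> h = f \<otimes>\<^bsub>F\<^esub> (g \<otimes>\<^bsub>F\<^esub> h)"
  using f
proof (induction f rule: F_induct)
  case zero
  show ?case using g h by (simp add: F_l_zero_mult F_mult_closed)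
next
  case (add f f')
  then show ?case using g h by (simp add: F_l_distr F_mult_closed)
next
  case (mterm r m)
  note rm = this
  show ?case using g
  proof (induction g rule: F_induct)
    case zero
    show ?case using h rm by (simp add: F_l_zero_mult F_r_zero_mult mterm_closed)
  next
    case (add g g')
    then show ?case using h rm by (simp add: F_l_distr F_r_distr F_mult_closed mterm_closed)
  next
    case (mterm s n)
    show ?case using h
    proof (induction h rule: F_induct)
      case zero
      show ?case using mterm rm by (simp add: F_r_zero_mult F_mult_closed mterm_closed)
    next
      case (add h h')
      then show ?case using mterm rm by (simp add: F_r_distr F_mult_closed mterm_closed)
    next
      case (mterm t l)
      then show ?case using rm \<open>s \<in> carrier R\<close> \<open>n \<in> carrier M\<close>
        by (simp add: F_mult_mterm m_assoc M.m_assoc)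
    qed
  qed
qed

lemma F_one_closed: "\<one>\<^bsub>F\<^esub> \<in> carrier F"
  by (simp add: F_sel(3) mterm_closed)

lemma F_one: "f \<in> carrier F \<Longrightarrow> \<one>\<^bsub>F\<^esub> \<otimes>\<^bsub>F\<^esub> f = f"
  by (induction f rule: F_induct)
    (simp_all add: F_sel(3) F_r_zero_mult F_r_distr F_mult_mterm mterm_closed)

lemma smult_mterm: "r \<in> carrier R \<Longrightarrow> s \<in> carrier R \<Longrightarrow> r \<odot>\<^bsub>F\<^esub> mterm R s m = mterm R (r \<otimes> s) m"
  by (auto simp: F_sel mterm_def)

lemma F_smult_add:
  "r \<in> carrier R \<Longrightarrow> f \<in> carrier F \<Longrightarrow> g \<in> carrier F \<Longrightarrow>
    r \<odot>\<^bsub>F\<^esub> (f \<oplus>\<^bsub>F\<^esub> g) = r \<odot>\<^bsub>F\<^esub> f \<oplus>\<^bsub>F\<^esub> r \<odot>\<^bsub>F\<^esub> g"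
  using coeff_closed by (simp add: F_sel(4,5) r_distr)

text \<open>Once scalars act as multiplication by terms at the unit of \<open>M\<close>, their
  compatibility with products is an instance of associativity.\<close>

lemma F_smult_eq:
  assumes r: "r \<in> carrier R" and f: "f \<in> carrier F"
  shows "r \<odot>\<^bsub>F\<^esub> f = mterm R r \<one>\<^bsub>M\<^esub> \<otimes>\<^bsub>F\<^esub> f"
  using f
proof (induction f rule: F_induct)
  case zero
  show ?case using r by (simp add: F_r_zero_mult mterm_closed) (simp add: F_sel)
next
  case (add f g)
  then show ?case using r by (simp add: F_r_distr F_smult_add mterm_closed)
qed (use r in \<open>simp add: F_mult_mterm smult_mterm\<close>)

lemma F_algebra: "algebra R F"
proof (rule algebraI)
  have inv: "\<exists>g\<in>carrier F. g \<oplus>\<^bsub>F\<^esub> f = \<zero>\<^bsub>F\<^esub>" if f: "f \<in> carrier F" for f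
    using coeff_closed[OF f]
    by (intro bexI[of _ "(\<ominus> \<one>) \<odot>\<^bsub>F\<^esub> f"] F_smult_closed f)
      (auto simp: F_sel l_minus l_neg)
  show "cring F"
  proof (rule cringI)
    show "abelian_group F"
    proof (rule abelian_groupI)
      fix x y z assume "x \<in> carrier F" "y \<in> carrier F" "z \<in> carrier F"
      then show "x \<oplus>\<^bsub>F\<^esub> y \<oplus>\<^bsub>F\<^esub> z = x \<oplus>\<^bsub>F\<^esub> (y \<oplus>\<^bsub>F\<^esub> z)"
        using coeff_closed by (simp add: F_sel(4) a_assoc)
    next
      fix x y assume "x \<in> carrier F" "y \<in> carrier F"
      then show "x \<oplus>\<^bsub>F\<^esub> y = y \<oplus>\<^bsub>F\<^esub> x"
        using coeff_closed by (simp add: F_sel(4) a_comm)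
    qed (auto intro: F_add_closed F_zero_closed inv F_zero_add)
    show "comm_monoid F"
      by (rule comm_monoidI)
        (simp_all add: F_mult_closed F_assoc F_one F_one_closed, rule F_comm)
  qed (rule F_l_distr)
  show "(a \<odot>\<^bsub>F\<^esub> x) \<otimes>\<^bsub>F\<^esub> y = a \<odot>\<^bsub>F\<^esub> (x \<otimes>\<^bsub>F\<^esub> y)"
    if "a \<in> carrier R" "x \<in> carrier F" "y \<in> carrier F" for a x y
    using that by (simp add: F_smult_eq F_assoc mterm_closed F_mult_closed)
  show "(a \<oplus> b) \<odot>\<^bsub>F\<^esub> x = a \<odot>\<^bsub>F\<^esub> x \<oplus>\<^bsub>F\<^esub> b \<odot>\<^bsub>F\<^esub> x"
    if "a \<in> carrier R" "b \<in> carrier R" "x \<in> carrier F" for a b x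
    using that coeff_closed by (simp add: F_sel(4,5) l_distr)
  show "(a \<otimes> b) \<odot>\<^bsub>F\<^esub> x = a \<odot>\<^bsub>F\<^esub> (b \<odot>\<^bsub>F\<^esub> x)"
    if "a \<in> carrier R" "b \<in> carrier R" "x \<in> carrier F" for a b x
    using that coeff_closed by (simp add: F_sel(5) m_assoc)
  show "\<one> \<odot>\<^bsub>F\<^esub> x = x" if "x \<in> carrier F" for x
    using that coeff_closed by (simp add: F_sel(5))
qed (auto intro: F_smult_add F_smult_closed is_cring)

lemma F_cring: "cring F"
  using F_algebra by (rule algebra.axioms)

end

text \<open>Multiplicativity of \<open>\<phi>\<close> is left to \<open>L_mult\<close>: maps out of
  tensor products and truncated polynomial algebras start from extensions that are only linear and
  are then factored through an ideal.\<close>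

locale monoid_alg_target = monoid_alg R M + B: cring B
  for R :: "('r, 'k) ring_scheme" (structure) and M :: "('m, 'l) monoid_scheme"
    and B :: "('b, 'n) ring_scheme" +
  fixes \<sigma> :: "'r \<Rightarrow> 'b" and \<phi> :: "'m \<Rightarrow> 'b"
  assumes \<sigma>: "\<sigma> \<in> ring_hom R B" and \<phi>: "\<phi> \<in> carrier M \<rightarrow> carrier B"
begin

abbreviation L where "L \<equiv> mlin R B \<sigma> \<phi>"

lemma \<sigma>_simps:
  "r \<in> carrier R \<Longrightarrow> \<sigma> r \<in> carrier B"
  "r \<in> carrier R \<Longrightarrow> s \<in> carrier R \<Longrightarrow> \<sigma> (r \<oplus> s) = \<sigma> r \<oplus>\<^bsub>B\<^esub> \<sigma> s"
  "r \<in> carrier R \<Longrightarrow> s \<in> carrier R \<Longrightarrow> \<sigma> (r \<otimes> s) = \<sigma> r \<otimes>\<^bsub>B\<^esub> \<sigma> s"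
  "\<sigma> \<one> = \<one>\<^bsub>B\<^esub>" "\<sigma> \<zero> = \<zero>\<^bsub>B\<^esub>"
  using ring_hom_closed[OF \<sigma>] ring_hom_add[OF \<sigma>] ring_hom_mult[OF \<sigma>] ring_hom_one[OF \<sigma>]
    ring_hom_zero[OF \<sigma> ring_axioms B.ring_axioms] by blast+

lemma \<phi>_closed: "m \<in> carrier M \<Longrightarrow> \<phi> m \<in> carrier B"
  using \<phi> by auto

lemma L_superset:
  assumes f: "f \<in> carrier F" and S: "finite S" "{m. f m \<noteq> \<zero>} \<subseteq> S" "S \<subseteq> carrier M"
  shows "L f = (\<Oplus>\<^bsub>B\<^esub>m\<in>S. \<sigma> (f m) \<otimes>\<^bsub>B\<^esub> \<phi> m)"
  unfolding mlin_def using S coeff_closed[OF f]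
  by (intro B.add.finprod_mono_neutral_cong_left) (auto simp: \<sigma>_simps \<phi>_closed subset_iff)

lemma L_closed: "f \<in> carrier F \<Longrightarrow> L f \<in> carrier B"
  unfolding mlin_def using supp_subset[of f] coeff_closed[of f]
  by (intro B.finsum_closed) (auto simp: \<sigma>_simps \<phi>_closed subset_iff)

lemma L_mterm: "r \<in> carrier R \<Longrightarrow> m \<in> carrier M \<Longrightarrow> L (mterm R r m) = \<sigma> r \<otimes>\<^bsub>B\<^esub> \<phi> m"
  using L_superset[OF mterm_closed, of r m "{m}"] mterm_supp[of R r m]
  by (simp add: \<sigma>_simps \<phi>_closed mterm_same)

lemma L_add:
  assumes f: "f \<in> carrier F" and g: "g \<in> carrier F"
  shows "L (f \<oplus>\<^bsub>F\<^esub> g) = L f \<oplus>\<^bsub>B\<^esub> L g"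
proof -
  let ?S = "{m. f m \<noteq> \<zero>} \<union> {m. g m \<noteq> \<zero>}"
  have S: "finite ?S" "?S \<subseteq> carrier M"
    using supp_finite f g supp_subset by auto
  then have SM: "m \<in> ?S \<Longrightarrow> m \<in> carrier M" for m by blast
  note [simp] = coeff_closed[OF f] coeff_closed[OF g]
  have "L (f \<oplus>\<^bsub>F\<^esub> g) = (\<Oplus>\<^bsub>B\<^esub>m\<in>?S. \<sigma> ((f \<oplus>\<^bsub>F\<^esub> g) m) \<otimes>\<^bsub>B\<^esub> \<phi> m)"
    using S by (intro L_superset F_add_closed f g) (auto simp: F_sel)
  also have "\<dots> = (\<Oplus>\<^bsub>B\<^esub>m\<in>?S. \<sigma> (f m) \<otimes>\<^bsub>B\<^esub> \<phi> m \<oplus>\<^bsub>B\<^esub> \<sigma> (g m) \<otimes>\<^bsub>B\<^esub> \<phi> m)"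
    using SM by (intro B.finsum_cong') (auto simp: F_sel(4) \<sigma>_simps \<phi>_closed B.l_distr)
  also have "\<dots> = L f \<oplus>\<^bsub>B\<^esub> L g"
    using SM by (subst B.finsum_addf)
      (auto simp: \<sigma>_simps \<phi>_closed L_superset[OF f S(1) _ S(2)] L_superset[OF g S(1) _ S(2)])
  finally show ?thesis .
qed

lemma L_zero: "L \<zero>\<^bsub>F\<^esub> = \<zero>\<^bsub>B\<^esub>"
  by (simp add: mlin_def F_sel)

lemma L_smult:
  assumes f: "f \<in> carrier F" and r: "r \<in> carrier R"
  shows "L (r \<odot>\<^bsub>F\<^esub> f) = \<sigma> r \<otimes>\<^bsub>B\<^esub> L f"
  using f
proof (induction f rule: F_induct)
  case zero
  show ?case using r algebra.axioms(1)[OF F_algebra]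
    by (simp add: L_zero module.smult_r_null \<sigma>_simps)
next
  case (add f g)
  then show ?case using r by (simp add: F_smult_add L_add F_smult_closed L_closed \<sigma>_simps B.r_distr)
qed (use r in \<open>simp add: smult_mterm L_mterm \<sigma>_simps \<phi>_closed B.m_assoc\<close>)

lemma L_mult:
  assumes hom: "\<And>m n. m \<in> carrier M \<Longrightarrow> n \<in> carrier M \<Longrightarrow> \<phi> (m \<otimes>\<^bsub>M\<^esub> n) = \<phi> m \<otimes>\<^bsub>B\<^esub> \<phi> n"
    and f: "f \<in> carrier F" and g: "g \<in> carrier F"
  shows "L (f \<otimes>\<^bsub>F\<^esub> g) = L f \<otimes>\<^bsub>B\<^esub> L g"
  using f
proof (induction f rule: F_induct)
  case zero
  show ?case using g by (simp add: F_l_zero_mult L_zero L_closed)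
next
  case (add f f')
  then show ?case using g by (simp add: F_l_distr L_add F_mult_closed L_closed B.l_distr)
next
  case (mterm r m)
  note rm = this
  show ?case using g
  proof (induction g rule: F_induct)
    case zero
    show ?case using rm by (simp add: F_r_zero_mult L_zero L_closed mterm_closed)
  next
    case (add g g')
    then show ?case using rm
      by (simp add: F_r_distr L_add F_mult_closed L_closed B.r_distr mterm_closed)
  next
    case (mterm s n)
    then show ?case using rm
      by (simp add: F_mult_mterm L_mterm hom \<sigma>_simps \<phi>_closed B.m_ac)
  qed
qed

lemma L_ring_hom:
  assumes "\<And>m n. m \<in> carrier M \<Longrightarrow> n \<in> carrier M \<Longrightarrow> \<phi> (m \<otimes>\<^bsub>M\<^esub> n) = \<phi> m \<otimes>\<^bsub>B\<^esub> \<phi> n"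
    and "\<phi> \<one>\<^bsub>M\<^esub> = \<one>\<^bsub>B\<^esub>"
  shows "L \<in> ring_hom F B"
  by (intro ring_hom_memI L_closed L_mult L_add assms)
    (simp_all add: F_sel(3) L_mterm \<sigma>_simps assms(2))

end

section \<open>Additive maps and algebra homomorphisms\<close>

text \<open>Functionals on a Hopf algebra are not ring homomorphisms, so sums are the common ground.
  Compatibility with scalars is stated apart from it, being sometimes linear over the base and
  sometimes semilinear along a ring homomorphism.\<close>

definition additive_map :: "('a, 'k) ring_scheme \<Rightarrow> ('b, 'l) ring_scheme \<Rightarrow> ('a \<Rightarrow> 'b) set"
  where "additive_map A B =
    {h \<in> carrier A \<rightarrow> carrier B. \<forall>x\<in>carrier A. \<forall>y\<in>carrier A. h (x \<oplus>\<^bsub>A\<^esub> y) = h x \<oplus>\<^bsub>B\<^esub> h y}"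

lemma additive_mapI:
  assumes "\<And>x. x \<in> carrier A \<Longrightarrow> h x \<in> carrier B"
    and "\<And>x y. x \<in> carrier A \<Longrightarrow> y \<in> carrier A \<Longrightarrow> h (x \<oplus>\<^bsub>A\<^esub> y) = h x \<oplus>\<^bsub>B\<^esub> h y"
  shows "h \<in> additive_map A B"
  using assms by (auto simp: additive_map_def)

lemma additive_map_closed: "h \<in> additive_map A B \<Longrightarrow> x \<in> carrier A \<Longrightarrow> h x \<in> carrier B"
  by (auto simp: additive_map_def)

lemma additive_map_add:
  "h \<in> additive_map A B \<Longrightarrow> x \<in> carrier A \<Longrightarrow> y \<in> carrier A \<Longrightarrow> h (x \<oplus>\<^bsub>A\<^esub> y) = h x \<oplus>\<^bsub>B\<^esub> h y"
  by (auto simp: additive_map_def)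

lemma ring_hom_additive: "h \<in> ring_hom A B \<Longrightarrow> h \<in> additive_map A B"
  by (auto simp: additive_map_def ring_hom_def)

lemma additive_map_comp:
  "h \<in> additive_map A B \<Longrightarrow> g \<in> additive_map B C \<Longrightarrow> (\<lambda>x. g (h x)) \<in> additive_map A C"
  by (intro additive_mapI) (simp_all add: additive_map_closed additive_map_add)

lemma additive_map_zero:
  assumes "h \<in> additive_map A B" "ring A" "ring B"
  shows "h \<zero>\<^bsub>A\<^esub> = \<zero>\<^bsub>B\<^esub>"
proof -
  interpret A: ring A by fact
  interpret B: ring B by fact
  have c: "h \<zero>\<^bsub>A\<^esub> \<in> carrier B" by (rule additive_map_closed[OF assms(1) A.zero_closed])
  have "h \<zero>\<^bsub>A\<^esub> \<oplus>\<^bsub>B\<^esub> h \<zero>\<^bsub>A\<^esub> = h \<zero>\<^bsub>A\<^esub>"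
    using additive_map_add[OF assms(1) A.zero_closed A.zero_closed] by simp
  then show ?thesis using c by simp
qed

lemma additive_map_minus:
  assumes "h \<in> additive_map A B" "ring A" "ring B" "x \<in> carrier A" "y \<in> carrier A"
  shows "h (x \<ominus>\<^bsub>A\<^esub> y) = h x \<ominus>\<^bsub>B\<^esub> h y"
proof -
  interpret A: ring A by fact
  interpret B: ring B by fact
  have c: "h x \<in> carrier B" "h y \<in> carrier B" "h (x \<ominus>\<^bsub>A\<^esub> y) \<in> carrier B"
    using assms additive_map_closed[OF assms(1)] by auto
  have "h (x \<ominus>\<^bsub>A\<^esub> y) \<oplus>\<^bsub>B\<^esub> h y = h (x \<ominus>\<^bsub>A\<^esub> y \<oplus>\<^bsub>A\<^esub> y)"
    using assms by (simp add: additive_map_add)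
  also have "x \<ominus>\<^bsub>A\<^esub> y \<oplus>\<^bsub>A\<^esub> y = x" using assms by (simp add: A.minus_eq A.a_assoc A.l_neg)
  finally show ?thesis using c by (metis B.add.inv_solve_right' B.minus_eq)
qed

lemma additive_map_finsum:
  assumes h: "h \<in> additive_map A B" and "ring A" "ring B" and f: "f \<in> I \<rightarrow> carrier A"
  shows "h (\<Oplus>\<^bsub>A\<^esub>i\<in>I. f i) = (\<Oplus>\<^bsub>B\<^esub>i\<in>I. h (f i))"
proof -
  interpret A: ring A by fact
  interpret B: ring B by fact
  show ?thesis using f
  proof (induction I rule: infinite_finite_induct)
    case (insert x F)
    then have "(\<lambda>i. h (f i)) \<in> F \<rightarrow> carrier B" "h (f x) \<in> carrier B" "f \<in> F \<rightarrow> carrier A" "f x \<in> carrier A"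
      using additive_map_closed[OF h] by auto
    with insert show ?case by (simp add: additive_map_add[OF h])
  qed (simp_all add: additive_map_zero[OF assms(1-3)])
qed

lemma (in ring_hom_cring) hom_nat_pow: "x \<in> carrier R \<Longrightarrow> h (x [^]\<^bsub>R\<^esub> (n::nat)) = h x [^]\<^bsub>S\<^esub> n"
  by (induction n) auto

lemma (in ring_hom_cring) hom_add_pow: "x \<in> carrier R \<Longrightarrow> h ([(n::nat)] \<cdot>\<^bsub>R\<^esub> x) = [n] \<cdot>\<^bsub>S\<^esub> h x"
  by (induction n) auto

lemma (in ring_hom_cring) hom_minus:
  "x \<in> carrier R \<Longrightarrow> y \<in> carrier R \<Longrightarrow> h (x \<ominus>\<^bsub>R\<^esub> y) = h x \<ominus>\<^bsub>S\<^esub> h y"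
  by (simp add: R.minus_eq S.minus_eq)

lemma (in ring_hom_cring) hom_Units: "x \<in> Units R \<Longrightarrow> h x \<in> Units S"
  using hom_mult[of x "inv\<^bsub>R\<^esub> x"] hom_mult[of "inv\<^bsub>R\<^esub> x" x]
  unfolding Units_def[of S] by (auto intro!: bexI[of _ "h (inv\<^bsub>R\<^esub> x)"])

lemma (in ring_hom_cring) hom_inv: "x \<in> Units R \<Longrightarrow> h (inv\<^bsub>R\<^esub> x) = inv\<^bsub>S\<^esub> (h x)"
  using hom_mult[of x "inv\<^bsub>R\<^esub> x"] by (intro S.comm_inv_char[symmetric]) auto

lemma alg_homI:
  assumes "h \<in> ring_hom A B"
    and "\<And>r a. r \<in> carrier R \<Longrightarrow> a \<in> carrier A \<Longrightarrow> h (r \<odot>\<^bsub>A\<^esub> a) = r \<odot>\<^bsub>B\<^esub> h a"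
  shows "h \<in> alg_hom R A B"
  using assms by (auto simp: alg_hom_def)

lemma alg_homD: "h \<in> alg_hom R A B \<Longrightarrow> h \<in> ring_hom A B"
  by (auto simp: alg_hom_def)

lemma alg_hom_smult:
  "h \<in> alg_hom R A B \<Longrightarrow> r \<in> carrier R \<Longrightarrow> a \<in> carrier A \<Longrightarrow> h (r \<odot>\<^bsub>A\<^esub> a) = r \<odot>\<^bsub>B\<^esub> h a"
  by (auto simp: alg_hom_def)

lemma alg_hom_closed: "h \<in> alg_hom R A B \<Longrightarrow> a \<in> carrier A \<Longrightarrow> h a \<in> carrier B"
  by (auto simp: alg_hom_def dest: ring_hom_closed)

lemma alg_hom_comp:
  assumes "f \<in> alg_hom R A B" "g \<in> alg_hom R B C"
  shows "(\<lambda>x. g (f x)) \<in> alg_hom R A C"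
  using ring_hom_trans[OF alg_homD[OF assms(1)] alg_homD[OF assms(2)]] assms
  by (intro alg_homI) (auto simp: o_def alg_hom_smult alg_hom_closed)

lemma alg_hom_id: "(\<lambda>x. x) \<in> alg_hom R A A"
  by (auto simp: alg_hom_def ring_hom_def)

context algebra
begin

lemma smult_eq_mult: "r \<in> carrier R \<Longrightarrow> x \<in> carrier M \<Longrightarrow> r \<odot>\<^bsub>M\<^esub> x = struct_map M r \<otimes>\<^bsub>M\<^esub> x"
  by (simp add: struct_map_def smult_assoc2)

lemma struct_closed: "r \<in> carrier R \<Longrightarrow> struct_map M r \<in> carrier M"
  by (simp add: struct_map_def)

lemma struct_hom: "struct_map M \<in> ring_hom R M"
proof (rule ring_hom_memI)
  fix x y assume xy: "x \<in> carrier R" "y \<in> carrier R"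
  show "struct_map M (x \<otimes> y) = struct_map M x \<otimes>\<^bsub>M\<^esub> struct_map M y"
    using xy by (simp add: smult_eq_mult[symmetric] struct_closed) (simp add: struct_map_def smult_assoc1)
qed (simp_all add: struct_map_def smult_l_distr)

lemma smult_mult_smult:
  assumes "r \<in> carrier R" "s \<in> carrier R" "x \<in> carrier M" "y \<in> carrier M"
  shows "(r \<odot>\<^bsub>M\<^esub> x) \<otimes>\<^bsub>M\<^esub> (s \<odot>\<^bsub>M\<^esub> y) = (r \<otimes> s) \<odot>\<^bsub>M\<^esub> (x \<otimes>\<^bsub>M\<^esub> y)"
proof -
  have "(r \<odot>\<^bsub>M\<^esub> x) \<otimes>\<^bsub>M\<^esub> (s \<odot>\<^bsub>M\<^esub> y) = r \<odot>\<^bsub>M\<^esub> (x \<otimes>\<^bsub>M\<^esub> (s \<odot>\<^bsub>M\<^esub> y))"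
    using assms by (simp add: smult_assoc2)
  also have "x \<otimes>\<^bsub>M\<^esub> (s \<odot>\<^bsub>M\<^esub> y) = s \<odot>\<^bsub>M\<^esub> (x \<otimes>\<^bsub>M\<^esub> y)"
    using assms smult_assoc2[of s y x] by (simp add: m_comm)
  finally show ?thesis using assms by (simp add: smult_assoc1)
qed

lemma algebra_char:
  assumes "[(p::nat)] \<cdot>\<^bsub>R\<^esub> \<one> = \<zero>"
  shows "[p] \<cdot>\<^bsub>M\<^esub> \<one>\<^bsub>M\<^esub> = \<zero>\<^bsub>M\<^esub>"
proof -
  interpret h: ring_hom_cring R M "struct_map M"
    by unfold_locales (rule struct_hom)
  show ?thesis using h.hom_add_pow[of \<one> p] assms by simp
qed

end

lemma alg_homI':
  assumes A: "algebra R A" and B: "algebra R B" and h: "h \<in> ring_hom A B"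
    and s: "\<And>r. r \<in> carrier R \<Longrightarrow> h (struct_map A r) = struct_map B r"
  shows "h \<in> alg_hom R A B"
proof (rule alg_homI[OF h])
  fix r a assume ra: "r \<in> carrier R" "a \<in> carrier A"
  then show "h (r \<odot>\<^bsub>A\<^esub> a) = r \<odot>\<^bsub>B\<^esub> h a"
    using algebra.smult_eq_mult[OF A] algebra.smult_eq_mult[OF B] algebra.struct_closed[OF A]
      ring_hom_mult[OF h] ring_hom_closed[OF h] s by simp
qed

lemma alg_hom_struct:
  assumes "h \<in> alg_hom R A B" "algebra R A" "r \<in> carrier R"
  shows "h (struct_map A r) = struct_map B r"
proof -
  interpret algebra R A by fact
  show ?thesis using alg_hom_smult[OF assms(1,3) one_closed] ring_hom_one[OF alg_homD[OF assms(1)]]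
    by (simp add: struct_map_def)
qed

lemma alg_hom_ring_hom_cring: "h \<in> alg_hom R A B \<Longrightarrow> algebra R A \<Longrightarrow> algebra R B \<Longrightarrow> ring_hom_cring A B h"
  by (simp add: alg_homD algebra.axioms(2) ring_hom_cring.intro ring_hom_cring_axioms.intro)

section \<open>Restriction of scalars\<close>

lemma restrict_scalars_simps:
  "carrier (restrict_scalars B C) = carrier C"
  "monoid.mult (restrict_scalars B C) = monoid.mult C"
  "monoid.one (restrict_scalars B C) = monoid.one C"
  "ring.zero (restrict_scalars B C) = ring.zero C"
  "ring.add (restrict_scalars B C) = ring.add C"
  "module.smult (restrict_scalars B C) r x = struct_map B r \<odot>\<^bsub>C\<^esub> x"
  by (simp_all add: restrict_scalars_def)

lemma ring_hom_restrict_scalars [simp]: "ring_hom A (restrict_scalars B C) = ring_hom A C"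
  "ring_hom (restrict_scalars B C) A = ring_hom C A"
  by (simp_all add: ring_hom_def restrict_scalars_simps)

lemma pow_restrict_scalars [simp]: "x [^]\<^bsub>restrict_scalars B C\<^esub> (n::nat) = x [^]\<^bsub>C\<^esub> n"
  by (simp add: nat_pow_def restrict_scalars_simps)

lemma struct_restrict_scalars [simp]: "struct_map (restrict_scalars B C) r = struct_map C (struct_map B r)"
  by (simp add: struct_map_def restrict_scalars_simps)

lemma abelian_group_transfer:
  assumes "abelian_group C" "carrier D = carrier C" "ring.zero D = ring.zero C" "ring.add D = ring.add C"
  shows "abelian_group D"
proof -
  interpret C: abelian_group C by fact
  show ?thesis
  proof (rule abelian_groupI)
    show "\<exists>y\<in>carrier D. y \<oplus>\<^bsub>D\<^esub> x = \<zero>\<^bsub>D\<^esub>" if "x \<in> carrier D" for x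
      using that by (intro bexI[of _ "\<ominus>\<^bsub>C\<^esub> x"]) (simp_all add: assms(2-4) C.l_neg)
    show "x \<oplus>\<^bsub>D\<^esub> y = y \<oplus>\<^bsub>D\<^esub> x" if "x \<in> carrier D" "y \<in> carrier D" for x y
      using that C.a_comm by (simp add: assms(2-4))
  qed (simp_all add: assms(2-4) C.a_assoc)
qed

lemma cring_transfer:
  assumes "cring C" "carrier D = carrier C" "monoid.mult D = monoid.mult C"
    "monoid.one D = monoid.one C" "ring.zero D = ring.zero C" "ring.add D = ring.add C"
  shows "cring D"
proof -
  interpret C: cring C by fact
  show ?thesis
  proof (rule cringI)
    show "abelian_group D" using abelian_group_transfer[OF C.is_abelian_group] assms by blast
    show "comm_monoid D" by (rule comm_monoidI) (simp_all add: assms(2-6) C.m_ac)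
  qed (simp add: assms(2-6) C.l_distr)
qed

lemma restrict_scalars_algebra:
  assumes B: "algebra R B" and C: "algebra B C"
  shows "algebra R (restrict_scalars B C)"
proof -
  interpret B: algebra R B by fact
  interpret C: algebra B C by fact
  note st = ring_hom_add[OF B.struct_hom] ring_hom_mult[OF B.struct_hom] ring_hom_one[OF B.struct_hom]
  show ?thesis
    by (rule algebraI)
      (simp_all add: B.R_cring cring_transfer[OF C.M_cring] restrict_scalars_simps B.struct_closed
        C.smult_l_distr C.smult_r_distr C.smult_assoc1 C.smult_assoc2 st)
qed

section \<open>Quotient algebras\<close>

text \<open>The axioms of an algebra are equations, apart from additive inverses, for which the
  image of the inverse is a witness; so they pass to the image of a surjection that respects the
  operations.\<close>

lemma algebra_image:
  assumes A: "algebra R A" and sur: "carrier B = q ` carrier A"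
    and mult: "\<And>x y. x \<in> carrier A \<Longrightarrow> y \<in> carrier A \<Longrightarrow> q x \<otimes>\<^bsub>B\<^esub> q y = q (x \<otimes>\<^bsub>A\<^esub> y)"
    and add: "\<And>x y. x \<in> carrier A \<Longrightarrow> y \<in> carrier A \<Longrightarrow> q x \<oplus>\<^bsub>B\<^esub> q y = q (x \<oplus>\<^bsub>A\<^esub> y)"
    and one: "\<one>\<^bsub>B\<^esub> = q \<one>\<^bsub>A\<^esub>" and zero: "\<zero>\<^bsub>B\<^esub> = q \<zero>\<^bsub>A\<^esub>"
    and smult: "\<And>r x. r \<in> carrier R \<Longrightarrow> x \<in> carrier A \<Longrightarrow> r \<odot>\<^bsub>B\<^esub> q x = q (r \<odot>\<^bsub>A\<^esub> x)"
  shows "algebra R B"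
proof -
  interpret A: algebra R A by fact
  have inv: "\<exists>y\<in>carrier B. y \<oplus>\<^bsub>B\<^esub> x = \<zero>\<^bsub>B\<^esub>" if "x \<in> carrier B" for x
  proof -
    from that obtain a where "a \<in> carrier A" "x = q a" by (auto simp: sur)
    then show ?thesis
      by (intro bexI[of _ "q (\<ominus>\<^bsub>A\<^esub> a)"]) (auto simp: add zero sur A.M.l_neg)
  qed
  show ?thesis
  proof (rule algebraI)
    show "cring B"
    proof (rule cringI)
      show "abelian_group B"
        by (rule abelian_groupI[OF _ _ _ _ _ inv])
          (auto simp: sur add zero A.M.a_assoc, simp add: A.M.a_comm)
      show "comm_monoid B"
        by (rule comm_monoidI) (auto simp: sur mult one A.m_assoc, simp add: A.m_comm)
    qed (auto simp: sur mult add A.l_distr)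
  qed (auto simp: sur mult add smult A.R_cring A.smult_l_distr A.smult_r_distr A.smult_assoc1 A.smult_assoc2)
qed

locale quot_alg = algebra R A + ideal I A
  for R :: "('r, 'k) ring_scheme" and A :: "('r, 'a, 'l) module_scheme" and I
begin

lemma M_ring: "ring A"
  using M_cring by (rule cring.axioms)

abbreviation Q where "Q \<equiv> alg_quot A I"
abbreviation q where "q \<equiv> \<lambda>x. I +>\<^bsub>A\<^esub> x"

lemma Q_sel:
  "carrier Q = q ` carrier A" "\<zero>\<^bsub>Q\<^esub> = I" "\<one>\<^bsub>Q\<^esub> = q \<one>\<^bsub>A\<^esub>"
  by (auto simp: alg_quot_def FactRing_simps)

lemma q_zero: "q \<zero>\<^bsub>A\<^esub> = I"
  using a_rcos_zero[OF is_ideal additive_subgroup.zero_closed[OF is_additive_subgroup]] by simp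

lemma q_eq_iff: "x \<in> carrier A \<Longrightarrow> y \<in> carrier A \<Longrightarrow> q x = q y \<longleftrightarrow> x \<ominus>\<^bsub>A\<^esub> y \<in> I"
  using quotient_eq_iff_same_a_r_cos[OF is_ideal] by blast

lemma q_mult: "x \<in> carrier A \<Longrightarrow> y \<in> carrier A \<Longrightarrow> q x \<otimes>\<^bsub>Q\<^esub> q y = q (x \<otimes>\<^bsub>A\<^esub> y)"
  by (simp add: alg_quot_def FactRing_simps rcoset_mult_add)

lemma q_add: "x \<in> carrier A \<Longrightarrow> y \<in> carrier A \<Longrightarrow> q x \<oplus>\<^bsub>Q\<^esub> q y = q (x \<oplus>\<^bsub>A\<^esub> y)"
  by (simp add: alg_quot_def FactRing_simps a_rcos_sum)

text \<open>The scalar action on a quotient is a union over all representatives of a coset. It is a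
  single coset because r (y - x) stays in the ideal.\<close>

lemma q_smult:
  assumes r: "r \<in> carrier R" and x: "x \<in> carrier A"
  shows "r \<odot>\<^bsub>Q\<^esub> q x = q (r \<odot>\<^bsub>A\<^esub> x)"
proof -
  have eq: "q (r \<odot>\<^bsub>A\<^esub> y) = q (r \<odot>\<^bsub>A\<^esub> x)" if y: "y \<in> q x" for y
  proof -
    have yA: "y \<in> carrier A" using y x a_r_coset_subset_G[OF a_subset] by blast
    have "q y = q x" using a_repr_independence[OF y x a_subgroup] by simp
    then have "y \<ominus>\<^bsub>A\<^esub> x \<in> I" using q_eq_iff yA x by simp
    then have "struct_map A r \<otimes>\<^bsub>A\<^esub> (y \<ominus>\<^bsub>A\<^esub> x) \<in> I" using r by (simp add: I_l_closed struct_closed)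
    also have "struct_map A r \<otimes>\<^bsub>A\<^esub> (y \<ominus>\<^bsub>A\<^esub> x) = r \<odot>\<^bsub>A\<^esub> y \<ominus>\<^bsub>A\<^esub> r \<odot>\<^bsub>A\<^esub> x"
      using r x yA by (simp add: smult_eq_mult M.minus_eq r_distr r_minus struct_closed)
    finally show ?thesis using q_eq_iff r x yA by simp
  qed
  have "x \<in> q x" using a_rcos_self[OF x] .
  then have "(\<Union>y\<in>q x. q (r \<odot>\<^bsub>A\<^esub> y)) = q (r \<odot>\<^bsub>A\<^esub> x)" using eq by blast
  then show ?thesis by (simp add: alg_quot_def)
qed

lemma Q_algebra: "algebra R Q"
  by (rule algebra_image[OF algebra_axioms Q_sel(1) q_mult q_add Q_sel(3) _ q_smult])
    (simp_all add: Q_sel q_zero)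

lemma q_hom: "q \<in> alg_hom R A Q"
  by (intro alg_homI ring_hom_memI) (simp_all add: q_mult q_add q_smult Q_sel)

lemma q_closed: "x \<in> carrier A \<Longrightarrow> q x \<in> carrier Q"
  by (simp add: Q_sel)

text \<open>Only the values on cosets are asserted; whether \<open>h\<close> is additive or
  multiplicative, \<open>h'\<close> inherits this from the surjectivity of the projection.\<close>

lemma factor:
  assumes h: "h \<in> additive_map A B" and B: "ring B" and kill: "\<And>x. x \<in> I \<Longrightarrow> h x = \<zero>\<^bsub>B\<^esub>"
  shows "\<exists>h'. \<forall>x\<in>carrier A. h' (q x) = h x"
proof -
  interpret B: ring B by fact
  have eq: "h x = h y" if xy: "x \<in> carrier A" "y \<in> carrier A" "q x = q y" for x y
  proof -
    have "h (x \<ominus>\<^bsub>A\<^esub> y) = \<zero>\<^bsub>B\<^esub>" using kill q_eq_iff xy by simp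
    then show ?thesis
      using additive_map_minus[OF h M_ring B xy(1,2)] additive_map_closed[OF h] xy
      by (simp add: B.r_right_minus_eq)
  qed
  show ?thesis
  proof (intro exI ballI)
    fix x assume x: "x \<in> carrier A"
    show "(\<lambda>X. h (SOME y. y \<in> carrier A \<and> q y = X)) (q x) = h x"
      using someI[of "\<lambda>y. y \<in> carrier A \<and> q y = q x" x] x by (intro eq) auto
  qed
qed

lemma factor_additive:
  assumes h: "h \<in> additive_map A B" and B: "ring B" and kill: "\<And>x. x \<in> I \<Longrightarrow> h x = \<zero>\<^bsub>B\<^esub>"
  shows "\<exists>h'\<in>additive_map Q B. \<forall>x\<in>carrier A. h' (q x) = h x"
proof -
  obtain h' where h': "\<forall>x\<in>carrier A. h' (q x) = h x" using factor[OF assms] by blast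
  then have "h' \<in> additive_map Q B"
    using additive_map_closed[OF h] additive_map_add[OF h]
    by (intro additive_mapI) (auto simp: Q_sel q_add)
  with h' show ?thesis by blast
qed

lemma factor_hom:
  assumes h: "h \<in> ring_hom A B" and B: "cring B" and kill: "\<And>x. x \<in> I \<Longrightarrow> h x = \<zero>\<^bsub>B\<^esub>"
  shows "\<exists>h'\<in>ring_hom Q B. \<forall>x\<in>carrier A. h' (q x) = h x"
proof -
  obtain h' where h': "\<forall>x\<in>carrier A. h' (q x) = h x"
    using factor[OF ring_hom_additive[OF h] cring.axioms(1)[OF B] kill] by blast
  then have "h' \<in> ring_hom Q B"
    using ring_hom_closed[OF h] ring_hom_mult[OF h] ring_hom_add[OF h] ring_hom_one[OF h]
    by (intro ring_hom_memI) (auto simp: Q_sel q_mult q_add)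
  with h' show ?thesis by blast
qed

end

text \<open>The kernel of an additive map need not be an ideal. The elements all of whose multiples
  are killed do form one, which is why the hypothesis speaks of multiples of the generators.\<close>

lemma (in cring) genideal_kill:
  assumes G: "G \<subseteq> carrier R" and h: "h \<in> additive_map R B" and B: "ring B"
    and kill: "\<And>g a. g \<in> G \<Longrightarrow> a \<in> carrier R \<Longrightarrow> h (a \<otimes> g) = \<zero>\<^bsub>B\<^esub>"
    and x: "x \<in> Idl G"
  shows "h x = \<zero>\<^bsub>B\<^esub>"
proof -
  interpret B: ring B by fact
  let ?K = "{x \<in> carrier R. \<forall>a\<in>carrier R. h (a \<otimes> x) = \<zero>\<^bsub>B\<^esub>}"
  have z: "h \<zero> = \<zero>\<^bsub>B\<^esub>" by (rule additive_map_zero[OF h ring_axioms B])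
  have mi: "h (\<ominus> y) = \<zero>\<^bsub>B\<^esub>" if "y \<in> carrier R" "h y = \<zero>\<^bsub>B\<^esub>" for y
    using additive_map_minus[OF h ring_axioms B zero_closed that(1)] that z
    by (simp add: minus_eq B.minus_eq)
  have "ideal ?K R"
  proof (rule idealI[OF ring_axioms])
    show "subgroup ?K (add_monoid R)"
      by unfold_locales (auto simp: r_distr additive_map_add[OF h] z r_minus mi
        simp flip: a_inv_def)
  next
    fix a x assume "a \<in> ?K" "x \<in> carrier R"
    then show "x \<otimes> a \<in> ?K" by (auto simp: m_assoc[symmetric])
    then show "a \<otimes> x \<in> ?K" using \<open>a \<in> ?K\<close> \<open>x \<in> carrier R\<close> by (simp add: m_comm)
  qed
  moreover have "G \<subseteq> ?K" using G kill by auto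
  ultimately have "x \<in> ?K" using genideal_minimal x by blast
  then have "h (\<one> \<otimes> x) = \<zero>\<^bsub>B\<^esub>" "x \<in> carrier R" by blast+
  then show ?thesis by simp
qed

lemma (in cring) genideal_kill_hom:
  assumes G: "G \<subseteq> carrier R" and h: "h \<in> ring_hom R B" and B: "cring B"
    and kill: "\<And>g. g \<in> G \<Longrightarrow> h g = \<zero>\<^bsub>B\<^esub>" and x: "x \<in> Idl G"
  shows "h x = \<zero>\<^bsub>B\<^esub>"
proof -
  interpret B: cring B by fact
  show ?thesis
    using G kill ring_hom_closed[OF h] ring_hom_mult[OF h]
    by (intro genideal_kill[OF G ring_hom_additive[OF h] B.ring_axioms _ x]) (auto simp: subset_iff)
qed

section \<open>Polynomial algebras\<close>

lemma monomials_comm_monoid: "comm_monoid (monomials I)"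
  by (rule comm_monoidI) (auto simp: monomials_def)

lemma mpoly_monoid_alg: "cring R \<Longrightarrow> monoid_alg R (monomials I)"
  by (simp add: monoid_alg_def monomials_comm_monoid)

lemma mpoly_algebra: "cring R \<Longrightarrow> algebra R (mpoly R I)"
  unfolding mpoly_def by (rule monoid_alg.F_algebra[OF mpoly_monoid_alg])

lemma mvar_closed: "cring R \<Longrightarrow> i \<in> I \<Longrightarrow> mvar R I i \<in> carrier (mpoly R I)"
  unfolding mpoly_def mvar_def msingle_eq_mterm
  by (rule monoid_alg.mterm_closed[OF mpoly_monoid_alg])
    (simp_all add: monomials_def cring.cring_simprules(6))

lemma mpoly_induct [consumes 2, case_names const var add mult]:
  assumes R: "cring R" and f: "f \<in> carrier (mpoly R I)"
    and const: "\<And>r. r \<in> carrier R \<Longrightarrow> P (struct_map (mpoly R I) r)"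
    and var: "\<And>i. i \<in> I \<Longrightarrow> P (mvar R I i)"
    and add: "\<And>f g. f \<in> carrier (mpoly R I) \<Longrightarrow> g \<in> carrier (mpoly R I) \<Longrightarrow> P f \<Longrightarrow> P g \<Longrightarrow>
      P (f \<oplus>\<^bsub>mpoly R I\<^esub> g)"
    and mult: "\<And>f g. f \<in> carrier (mpoly R I) \<Longrightarrow> g \<in> carrier (mpoly R I) \<Longrightarrow> P f \<Longrightarrow> P g \<Longrightarrow>
      P (f \<otimes>\<^bsub>mpoly R I\<^esub> g)"
  shows "P f"
proof -
  interpret monoid_alg R "monomials I" by (rule mpoly_monoid_alg[OF R])
  have FP: "mpoly R I = F" by (simp add: mpoly_def)
  have st: "struct_map F r = mterm R r {#}" if "r \<in> carrier R" for r
    using that smult_mterm[of r "\<one>\<^bsub>R\<^esub>"] by (simp add: struct_map_def F_sel(3)) (simp add: monomials_def)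
  have mon: "P (mterm R \<one>\<^bsub>R\<^esub> m)" if "set_mset m \<subseteq> I" for m
    using that
  proof (induction m)
    case empty
    then show ?case using const[of "\<one>\<^bsub>R\<^esub>"] by (simp add: FP st)
  next
    case (add i m)
    then have "P (mvar R I i \<otimes>\<^bsub>F\<^esub> mterm R \<one>\<^bsub>R\<^esub> m)"
      using mvar_closed[OF R, of i I] var
      by (intro mult[unfolded FP] mterm_closed) (auto simp: FP, simp_all add: monomials_def)
    also have "mvar R I i \<otimes>\<^bsub>F\<^esub> mterm R \<one>\<^bsub>R\<^esub> m = mterm R \<one>\<^bsub>R\<^esub> (add_mset i m)"
      using add.prems F_mult_mterm[of "\<one>\<^bsub>R\<^esub>" "\<one>\<^bsub>R\<^esub>" "{#i#}" m]
      by (simp add: mvar_def msingle_eq_mterm monomials_def)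
    finally show ?case .
  qed
  show ?thesis using f[unfolded FP]
  proof (induction f rule: F_induct)
    case zero
    show ?case using const[of "\<zero>\<^bsub>R\<^esub>"] by (simp add: FP st) (simp add: F_sel mterm_def)
  next
    case (mterm r m)
    then have "P (struct_map F r \<otimes>\<^bsub>F\<^esub> mterm R \<one>\<^bsub>R\<^esub> m)"
      using const[of r] mon[of m]
      by (intro mult[unfolded FP]) (auto simp: FP st intro!: mterm_closed, simp_all add: monomials_def)
    then show ?case using mterm F_mult_mterm[of r "\<one>\<^bsub>R\<^esub>" "{#}" m]
      by (auto simp: st) (simp add: monomials_def)
  qed (rule add[unfolded FP])
qed

lemma mpoly_hom_eq:
  assumes R: "cring R" and B: "cring B" and h: "h \<in> ring_hom (mpoly R I) B" and h': "h' \<in> ring_hom (mpoly R I) B"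
    and const: "\<And>r. r \<in> carrier R \<Longrightarrow> h (struct_map (mpoly R I) r) = h' (struct_map (mpoly R I) r)"
    and var: "\<And>i. i \<in> I \<Longrightarrow> h (mvar R I i) = h' (mvar R I i)"
    and f: "f \<in> carrier (mpoly R I)"
  shows "h f = h' f"
  using R f
  by (induction f rule: mpoly_induct)
    (simp_all add: const var ring_hom_add[OF h] ring_hom_add[OF h'] ring_hom_mult[OF h] ring_hom_mult[OF h'])

text \<open>As \<open>I\<close> is finite, the value of a monomial can be taken as a product over
  all of \<open>I\<close> with the multiplicities as exponents, and multiplicativity holds factor by
  factor.\<close>

lemma mpoly_eval:
  assumes R: "cring R" and B: "cring B" and I: "finite I"
    and \<sigma>: "\<sigma> \<in> ring_hom R B" and \<beta>: "\<beta> \<in> I \<rightarrow> carrier B"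
  shows "\<exists>h\<in>ring_hom (mpoly R I) B. (\<forall>i\<in>I. h (mvar R I i) = \<beta> i) \<and>
    (\<forall>r\<in>carrier R. h (struct_map (mpoly R I) r) = \<sigma> r)"
proof -
  interpret B: cring B by fact
  interpret R: cring R by fact
  define \<phi> where "\<phi> m = (\<Otimes>\<^bsub>B\<^esub>i\<in>I. \<beta> i [^]\<^bsub>B\<^esub> count m i)" for m
  interpret monoid_alg_target R "monomials I" B \<sigma> \<phi>
    using mpoly_monoid_alg[OF R, of I] \<sigma> \<beta>
    by (auto simp: monoid_alg_target_def monoid_alg_target_axioms_def B \<phi>_def
        intro!: B.finprod_closed B.nat_pow_closed)
  have FP: "mpoly R I = F" by (simp add: mpoly_def)
  have hom: "L \<in> ring_hom F B"
  proof (rule L_ring_hom)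
    show "\<phi> (m \<otimes>\<^bsub>monomials I\<^esub> n) = \<phi> m \<otimes>\<^bsub>B\<^esub> \<phi> n" for m n
    proof -
      have "\<phi> (m + n) = (\<Otimes>\<^bsub>B\<^esub>i\<in>I. \<beta> i [^]\<^bsub>B\<^esub> count m i \<otimes>\<^bsub>B\<^esub> \<beta> i [^]\<^bsub>B\<^esub> count n i)"
        unfolding \<phi>_def using \<beta> by (intro B.finprod_cong') (auto simp: B.nat_pow_mult Pi_iff)
      also have "\<dots> = \<phi> m \<otimes>\<^bsub>B\<^esub> \<phi> n"
        unfolding \<phi>_def using \<beta> by (intro B.finprod_multf) auto
      finally show ?thesis by (simp add: monomials_def)
    qed
    show "\<phi> \<one>\<^bsub>monomials I\<^esub> = \<one>\<^bsub>B\<^esub>" by (simp add: \<phi>_def monomials_def)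
  qed
  have var: "L (mvar R I i) = \<beta> i" if i: "i \<in> I" for i
  proof -
    have "\<phi> {#i#} = (\<Otimes>\<^bsub>B\<^esub>j\<in>I. if i = j then \<beta> j else \<one>\<^bsub>B\<^esub>)"
      unfolding \<phi>_def using \<beta> by (intro B.finprod_cong') (auto simp: Pi_iff)
    also have "\<dots> = \<beta> i" using B.finprod_singleton[OF i I \<beta>] .
    finally have "\<phi> {#i#} = \<beta> i" .
    then show ?thesis using i funcset_mem[OF \<beta> i]
      by (simp add: mvar_def msingle_eq_mterm L_mterm \<sigma>_simps monomials_def)
  qed
  have const: "L (struct_map F r) = \<sigma> r" if "r \<in> carrier R" for r
    using that L_smult[OF F_one_closed, of r] ring_hom_one[OF hom] by (simp add: struct_map_def \<sigma>_simps)
  show ?thesis unfolding FP using hom var const by blast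
qed

section \<open>Tensor products\<close>

lemma DirProd_comm_monoid:
  assumes "comm_monoid G" "comm_monoid H"
  shows "comm_monoid (G \<times>\<times> H)"
proof -
  interpret G: comm_monoid G by fact
  interpret H: comm_monoid H by fact
  show ?thesis by (rule comm_monoidI) (auto simp: G.m_ac H.m_ac)
qed

locale tensor_alg = B: algebra R B + C: algebra R C
  for R :: "('r, 'k) ring_scheme" and B :: "('r, 'b, 'l) module_scheme"
    and C :: "('r, 'c, 'm) module_scheme"
begin

abbreviation F where "F \<equiv> monoid_algebra R (B \<times>\<times> C)"
abbreviation TT where "TT \<equiv> alg_tensor R B C"
abbreviation J where "J \<equiv> Idl\<^bsub>F\<^esub> (tensor_rels R B C)"
abbreviation g where "g b c \<equiv> mterm R \<one>\<^bsub>R\<^esub> (b, c)"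

lemma F_monoid_alg: "monoid_alg R (B \<times>\<times> C)"
  using DirProd_comm_monoid[of B C] cring.axioms(2)[OF B.M_cring] cring.axioms(2)[OF C.M_cring]
  by (simp add: monoid_alg_def B.R_cring)

sublocale FF: monoid_alg R "B \<times>\<times> C"
  by (rule F_monoid_alg)

sublocale FA: algebra R F
  by (rule FF.F_algebra)

lemma g_closed: "b \<in> carrier B \<Longrightarrow> c \<in> carrier C \<Longrightarrow> g b c \<in> carrier F"
  by (rule FF.mterm_closed) auto

lemma rels_closed: "tensor_rels R B C \<subseteq> carrier F"
  unfolding tensor_rels_def Let_def msingle_eq_mterm
  by (auto intro!: FA.minus_closed FA.add.m_closed FA.smult_closed g_closed)

sublocale quot_alg R F J
  by (intro quot_alg.intro FA.algebra_axioms FA.genideal_ideal rels_closed)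

lemma TT_eq: "TT = Q"
  by (simp add: alg_tensor_def)

lemma tens_eq: "tens R B C b c = q (g b c)"
  by (simp add: tens_def msingle_eq_mterm)

lemma TT_algebra: "algebra R TT"
  unfolding TT_eq by (rule Q_algebra)

sublocale TTA: algebra R TT
  by (rule TT_algebra)

lemma tens_closed: "b \<in> carrier B \<Longrightarrow> c \<in> carrier C \<Longrightarrow> tens R B C b c \<in> carrier TT"
  unfolding tens_eq TT_eq by (intro q_closed g_closed)

lemma q_rel: "x \<ominus>\<^bsub>F\<^esub> y \<in> tensor_rels R B C \<Longrightarrow> x \<in> carrier F \<Longrightarrow> y \<in> carrier F \<Longrightarrow> q x = q y"
  using q_eq_iff FA.genideal_self[OF rels_closed] by blast

lemma tens_add1:
  assumes "b \<in> carrier B" "b' \<in> carrier B" "c \<in> carrier C"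
  shows "tens R B C (b \<oplus>\<^bsub>B\<^esub> b') c = tens R B C b c \<oplus>\<^bsub>TT\<^esub> tens R B C b' c"
proof -
  have "g (b \<oplus>\<^bsub>B\<^esub> b') c \<ominus>\<^bsub>F\<^esub> (g b c \<oplus>\<^bsub>F\<^esub> g b' c) \<in> tensor_rels R B C"
    using assms unfolding tensor_rels_def Let_def msingle_eq_mterm by blast
  then show ?thesis
    unfolding tens_eq TT_eq using assms by (subst q_add) (rule q_rel | simp add: g_closed)+
qed

lemma tens_add2:
  assumes "b \<in> carrier B" "c \<in> carrier C" "c' \<in> carrier C"
  shows "tens R B C b (c \<oplus>\<^bsub>C\<^esub> c') = tens R B C b c \<oplus>\<^bsub>TT\<^esub> tens R B C b c'"
proof -
  have "g b (c \<oplus>\<^bsub>C\<^esub> c') \<ominus>\<^bsub>F\<^esub> (g b c \<oplus>\<^bsub>F\<^esub> g b c') \<in> tensor_rels R B C"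
    using assms unfolding tensor_rels_def Let_def msingle_eq_mterm by blast
  then show ?thesis
    unfolding tens_eq TT_eq using assms by (subst q_add) (rule q_rel | simp add: g_closed)+
qed

lemma tens_smult1:
  assumes "r \<in> carrier R" "b \<in> carrier B" "c \<in> carrier C"
  shows "tens R B C (r \<odot>\<^bsub>B\<^esub> b) c = r \<odot>\<^bsub>TT\<^esub> tens R B C b c"
proof -
  have "g (r \<odot>\<^bsub>B\<^esub> b) c \<ominus>\<^bsub>F\<^esub> (r \<odot>\<^bsub>F\<^esub> g b c) \<in> tensor_rels R B C"
    using assms unfolding tensor_rels_def Let_def msingle_eq_mterm by blast
  then show ?thesis
    unfolding tens_eq TT_eq using assms by (subst q_smult) (rule q_rel | simp add: g_closed)+
qed

lemma tens_smult2:
  assumes "r \<in> carrier R" "b \<in> carrier B" "c \<in> carrier C"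
  shows "tens R B C b (r \<odot>\<^bsub>C\<^esub> c) = r \<odot>\<^bsub>TT\<^esub> tens R B C b c"
proof -
  have "g b (r \<odot>\<^bsub>C\<^esub> c) \<ominus>\<^bsub>F\<^esub> (r \<odot>\<^bsub>F\<^esub> g b c) \<in> tensor_rels R B C"
    using assms unfolding tensor_rels_def Let_def msingle_eq_mterm by blast
  then show ?thesis
    unfolding tens_eq TT_eq using assms by (subst q_smult) (rule q_rel | simp add: g_closed)+
qed

lemma tens_mult:
  assumes "b \<in> carrier B" "b' \<in> carrier B" "c \<in> carrier C" "c' \<in> carrier C"
  shows "tens R B C b c \<otimes>\<^bsub>TT\<^esub> tens R B C b' c' = tens R B C (b \<otimes>\<^bsub>B\<^esub> b') (c \<otimes>\<^bsub>C\<^esub> c')"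
  unfolding tens_eq TT_eq using assms
  by (subst q_mult) (simp_all add: g_closed FF.F_mult_mterm)

lemma tens_one: "tens R B C \<one>\<^bsub>B\<^esub> \<one>\<^bsub>C\<^esub> = \<one>\<^bsub>TT\<^esub>"
  unfolding tens_eq TT_eq Q_sel(3) FF.F_sel(3) by simp

lemma tens_induct [consumes 1, case_names tens add]:
  assumes x: "x \<in> carrier TT"
    and tens: "\<And>b c. b \<in> carrier B \<Longrightarrow> c \<in> carrier C \<Longrightarrow> P (tens R B C b c)"
    and add: "\<And>x y. x \<in> carrier TT \<Longrightarrow> y \<in> carrier TT \<Longrightarrow> P x \<Longrightarrow> P y \<Longrightarrow> P (x \<oplus>\<^bsub>TT\<^esub> y)"
  shows "P x"
proof -
  obtain f where f: "f \<in> carrier F" and xf: "x = q f" using x by (auto simp: TT_eq Q_sel)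
  have mt: "q (mterm R r (b, c)) = tens R B C (r \<odot>\<^bsub>B\<^esub> b) c"
    if "r \<in> carrier R" "b \<in> carrier B" "c \<in> carrier C" for r b c
    using that FF.smult_mterm[of r "\<one>\<^bsub>R\<^esub>" "(b, c)"]
    by (simp add: tens_smult1) (simp add: tens_eq TT_eq q_smult g_closed)
  show ?thesis unfolding xf using f
  proof (induction f rule: FF.F_induct)
    case zero
    have "q \<zero>\<^bsub>F\<^esub> = tens R B C \<zero>\<^bsub>B\<^esub> \<zero>\<^bsub>C\<^esub>"
      using tens_smult1[of "\<zero>\<^bsub>R\<^esub>" "\<zero>\<^bsub>B\<^esub>" "\<zero>\<^bsub>C\<^esub>"] tens_closed[of "\<zero>\<^bsub>B\<^esub>" "\<zero>\<^bsub>C\<^esub>"]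
      by (simp add: TT_eq[symmetric]) (simp add: TT_eq Q_sel q_zero)
    then show ?case using tens by simp
  next
    case (mterm r m)
    then show ?case using tens mt by (cases m) auto
  next
    case (add f f')
    then show ?case
      using assms(3)[of "q f" "q f'"] by (simp add: TT_eq q_add q_closed)
  qed
qed

text \<open>The relation ideal is killed because multiplying a relation by a generator \<open>[b, c]\<close> gives
  a multiple of a relation of the same shape.\<close>

lemma bilinear_lift:
  assumes D: "algebra R D"
    and closed: "\<And>b c. b \<in> carrier B \<Longrightarrow> c \<in> carrier C \<Longrightarrow> \<phi> b c \<in> carrier D"
    and add1: "\<And>b b' c. b \<in> carrier B \<Longrightarrow> b' \<in> carrier B \<Longrightarrow> c \<in> carrier C \<Longrightarrow>
      \<phi> (b \<oplus>\<^bsub>B\<^esub> b') c = \<phi> b c \<oplus>\<^bsub>D\<^esub> \<phi> b' c"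
    and add2: "\<And>b c c'. b \<in> carrier B \<Longrightarrow> c \<in> carrier C \<Longrightarrow> c' \<in> carrier C \<Longrightarrow>
      \<phi> b (c \<oplus>\<^bsub>C\<^esub> c') = \<phi> b c \<oplus>\<^bsub>D\<^esub> \<phi> b c'"
    and smult1: "\<And>r b c. r \<in> carrier R \<Longrightarrow> b \<in> carrier B \<Longrightarrow> c \<in> carrier C \<Longrightarrow>
      \<phi> (r \<odot>\<^bsub>B\<^esub> b) c = r \<odot>\<^bsub>D\<^esub> \<phi> b c"
    and smult2: "\<And>r b c. r \<in> carrier R \<Longrightarrow> b \<in> carrier B \<Longrightarrow> c \<in> carrier C \<Longrightarrow>
      \<phi> b (r \<odot>\<^bsub>C\<^esub> c) = r \<odot>\<^bsub>D\<^esub> \<phi> b c"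
  shows "\<exists>h\<in>additive_map TT D. (\<forall>b\<in>carrier B. \<forall>c\<in>carrier C. h (tens R B C b c) = \<phi> b c) \<and>
    (\<forall>r\<in>carrier R. \<forall>x\<in>carrier TT. h (r \<odot>\<^bsub>TT\<^esub> x) = r \<odot>\<^bsub>D\<^esub> h x)"
proof -
  interpret D: algebra R D by fact
  note D_ring = cring.axioms(1)[OF D.M_cring]
  interpret T: monoid_alg_target R "B \<times>\<times> C" D "struct_map D" "\<lambda>(b, c). \<phi> b c"
    by (auto simp: monoid_alg_target_def monoid_alg_target_axioms_def F_monoid_alg D.M_cring D.struct_hom closed)
  have LA: "T.L \<in> additive_map F D"
    by (intro additive_mapI T.L_closed T.L_add)
  have kill_term: "T.L (mterm R r (b0, c0) \<otimes>\<^bsub>F\<^esub> x) = \<zero>\<^bsub>D\<^esub>"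
    if x: "x \<in> tensor_rels R B C" and r: "r \<in> carrier R" and b0: "b0 \<in> carrier B" and c0: "c0 \<in> carrier C" for x r b0 c0
  proof -
    define \<psi> where "\<psi> y = T.L (mterm R r (b0, c0) \<otimes>\<^bsub>F\<^esub> y)" for y
    have mt: "mterm R r (b0, c0) \<in> carrier F" using r b0 c0 by (intro FF.mterm_closed) auto
    have \<psi>: "\<psi> \<in> additive_map F D"
      unfolding \<psi>_def using mt
      by (intro additive_mapI) (simp_all add: T.L_closed FF.F_mult_closed FF.F_r_distr T.L_add)
    have g: "\<psi> (g b c) = r \<odot>\<^bsub>D\<^esub> \<phi> (b0 \<otimes>\<^bsub>B\<^esub> b) (c0 \<otimes>\<^bsub>C\<^esub> c)"
      if "b \<in> carrier B" "c \<in> carrier C" for b c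
      unfolding \<psi>_def using that r b0 c0
      by (subst FF.F_mult_mterm) (simp_all add: T.L_mterm D.smult_eq_mult closed)
    have sm: "\<psi> (s \<odot>\<^bsub>F\<^esub> g b c) = s \<odot>\<^bsub>D\<^esub> (r \<odot>\<^bsub>D\<^esub> \<phi> (b0 \<otimes>\<^bsub>B\<^esub> b) (c0 \<otimes>\<^bsub>C\<^esub> c))"
      if "b \<in> carrier B" "c \<in> carrier C" "s \<in> carrier R" for b c s
    proof -
      have "mterm R r (b0, c0) \<otimes>\<^bsub>F\<^esub> (s \<odot>\<^bsub>F\<^esub> g b c) = s \<odot>\<^bsub>F\<^esub> (mterm R r (b0, c0) \<otimes>\<^bsub>F\<^esub> g b c)"
        using mt that g_closed[of b c] FA.smult_assoc2[of s "g b c" "mterm R r (b0, c0)"]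
        by (simp add: FF.F_comm FF.F_smult_closed)
      then show ?thesis
        using mt that g_closed[of b c] g[of b c, unfolded \<psi>_def] T.L_smult[of "mterm R r (b0, c0) \<otimes>\<^bsub>F\<^esub> g b c" s]
        unfolding \<psi>_def by (simp add: FF.F_mult_closed D.smult_eq_mult[of s] closed r b0 c0)
    qed
    have mi: "\<psi> (y \<ominus>\<^bsub>F\<^esub> z) = \<psi> y \<ominus>\<^bsub>D\<^esub> \<psi> z" if "y \<in> carrier F" "z \<in> carrier F" for y z
      using additive_map_minus[OF \<psi> cring.axioms(1)[OF FF.F_cring] D_ring that] .
    have swap: "s \<odot>\<^bsub>D\<^esub> (r \<odot>\<^bsub>D\<^esub> z) = r \<odot>\<^bsub>D\<^esub> (s \<odot>\<^bsub>D\<^esub> z)" if "s \<in> carrier R" "z \<in> carrier D" for s z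
      using that r by (simp add: D.smult_assoc1[symmetric] comm_monoid.m_comm[OF cring.axioms(2)[OF B.R_cring]])
    have Bs: "b0 \<otimes>\<^bsub>B\<^esub> (s \<odot>\<^bsub>B\<^esub> b) = s \<odot>\<^bsub>B\<^esub> (b0 \<otimes>\<^bsub>B\<^esub> b)" if "s \<in> carrier R" "b \<in> carrier B" for s b
      using that b0 B.smult_assoc2[of s b b0] by (simp add: B.m_comm)
    have Cs: "c0 \<otimes>\<^bsub>C\<^esub> (s \<odot>\<^bsub>C\<^esub> c) = s \<odot>\<^bsub>C\<^esub> (c0 \<otimes>\<^bsub>C\<^esub> c)" if "s \<in> carrier R" "c \<in> carrier C" for s c
      using that c0 C.smult_assoc2[of s c c0] by (simp add: C.m_comm)
    note simps = mi g sm additive_map_add[OF \<psi>] g_closed FA.add.m_closed FA.smult_closed b0 c0 r closed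
      add1 add2 smult1 smult2 B.r_distr C.r_distr D.smult_r_distr swap Bs Cs
    have "\<psi> x = \<zero>\<^bsub>D\<^esub>"
      using x unfolding tensor_rels_def Let_def msingle_eq_mterm
      by (elim UnE CollectE exE conjE) (simp_all add: simps)
    then show ?thesis by (simp add: \<psi>_def)
  qed
  have kill: "T.L (a \<otimes>\<^bsub>F\<^esub> x) = \<zero>\<^bsub>D\<^esub>" if x: "x \<in> tensor_rels R B C" and a: "a \<in> carrier F" for a x
  proof -
    have xF: "x \<in> carrier F" using x rels_closed by blast
    show ?thesis using a
      by (induction a rule: FF.F_induct)
        (use x xF kill_term in \<open>auto simp: FF.F_l_zero_mult T.L_zero FF.F_l_distr T.L_add FF.F_mult_closed\<close>)
  qed
  have "T.L x = \<zero>\<^bsub>D\<^esub>" if "x \<in> J" for x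
    using FA.genideal_kill[OF rels_closed LA D_ring kill that] .
  then obtain h where h: "h \<in> additive_map TT D" and hq: "\<forall>x\<in>carrier F. h (q x) = T.L x"
    using factor_additive[OF LA D_ring] unfolding TT_eq by blast
  have "h (tens R B C b c) = \<phi> b c" if "b \<in> carrier B" "c \<in> carrier C" for b c
    using that hq by (simp add: tens_eq g_closed T.L_mterm closed D.struct_hom T.\<sigma>_simps)
  moreover have "h (r \<odot>\<^bsub>TT\<^esub> x) = r \<odot>\<^bsub>D\<^esub> h x" if r: "r \<in> carrier R" and x: "x \<in> carrier TT" for r x
  proof -
    obtain f where f: "f \<in> carrier F" and xf: "x = q f" using x by (auto simp: TT_eq Q_sel)
    show ?thesis using f hq r
      by (simp add: xf TT_eq q_smult T.L_smult D.smult_eq_mult T.L_closed)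
  qed
  ultimately show ?thesis using h by blast
qed

text \<open>Linearity without multiplicativity is what the convolution product of two functionals
  requires.\<close>

lemma linear_tensor_lift:
  assumes D: "algebra R D"
    and f: "f \<in> additive_map B D" "\<And>r b. r \<in> carrier R \<Longrightarrow> b \<in> carrier B \<Longrightarrow> f (r \<odot>\<^bsub>B\<^esub> b) = r \<odot>\<^bsub>D\<^esub> f b"
    and g: "k \<in> additive_map C D" "\<And>r c. r \<in> carrier R \<Longrightarrow> c \<in> carrier C \<Longrightarrow> k (r \<odot>\<^bsub>C\<^esub> c) = r \<odot>\<^bsub>D\<^esub> k c"
  shows "\<exists>h\<in>additive_map TT D. (\<forall>b\<in>carrier B. \<forall>c\<in>carrier C. h (tens R B C b c) = f b \<otimes>\<^bsub>D\<^esub> k c) \<and>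
    (\<forall>r\<in>carrier R. \<forall>x\<in>carrier TT. h (r \<odot>\<^bsub>TT\<^esub> x) = r \<odot>\<^bsub>D\<^esub> h x)"
proof -
  interpret D: algebra R D by fact
  note [simp] = additive_map_closed[OF f(1)] additive_map_closed[OF g(1)]
  have "f b \<otimes>\<^bsub>D\<^esub> (r \<odot>\<^bsub>D\<^esub> k c) = r \<odot>\<^bsub>D\<^esub> (f b \<otimes>\<^bsub>D\<^esub> k c)"
    if "r \<in> carrier R" "b \<in> carrier B" "c \<in> carrier C" for r b c
    using that D.smult_assoc2[of r "k c" "f b"] by (simp add: D.m_comm)
  then show ?thesis
    by (intro bilinear_lift[OF D])
      (simp_all add: additive_map_add[OF f(1)] additive_map_add[OF g(1)] f(2) g(2) D.l_distr D.r_distr D.smult_assoc2)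
qed

lemma hom_tensor_lift:
  assumes D: "algebra R D" and f: "f \<in> alg_hom R B D" and k: "k \<in> alg_hom R C D"
  shows "\<exists>h\<in>alg_hom R TT D. \<forall>b\<in>carrier B. \<forall>c\<in>carrier C. h (tens R B C b c) = f b \<otimes>\<^bsub>D\<^esub> k c"
proof -
  interpret D: algebra R D by fact
  note [simp] = alg_hom_closed[OF f] alg_hom_closed[OF k] tens_closed
  note add = ring_hom_additive[OF alg_homD[OF f]] ring_hom_additive[OF alg_homD[OF k]]
  obtain h where h: "h \<in> additive_map TT D"
    and ht: "\<And>b c. b \<in> carrier B \<Longrightarrow> c \<in> carrier C \<Longrightarrow> h (tens R B C b c) = f b \<otimes>\<^bsub>D\<^esub> k c"
    and hs: "\<And>r x. r \<in> carrier R \<Longrightarrow> x \<in> carrier TT \<Longrightarrow> h (r \<odot>\<^bsub>TT\<^esub> x) = r \<odot>\<^bsub>D\<^esub> h x"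
    using linear_tensor_lift[OF D add(1) alg_hom_smult[OF f] add(2) alg_hom_smult[OF k]] by blast
  note [simp] = additive_map_closed[OF h]
  have m1: "h (x \<otimes>\<^bsub>TT\<^esub> tens R B C b c) = h x \<otimes>\<^bsub>D\<^esub> h (tens R B C b c)"
    if x: "x \<in> carrier TT" and bc: "b \<in> carrier B" "c \<in> carrier C" for x b c
    using x
  proof (induction x rule: tens_induct)
    case (tens b' c')
    then show ?case using bc
      by (simp add: tens_mult ht ring_hom_mult[OF alg_homD[OF f]] ring_hom_mult[OF alg_homD[OF k]] D.m_ac)
  qed (use bc in \<open>simp add: TTA.l_distr additive_map_add[OF h] D.l_distr\<close>)
  have mult: "h (x \<otimes>\<^bsub>TT\<^esub> y) = h x \<otimes>\<^bsub>D\<^esub> h y" if x: "x \<in> carrier TT" and y: "y \<in> carrier TT" for x y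
    using y by (induction y rule: tens_induct)
      (use x m1 in \<open>simp_all add: TTA.r_distr additive_map_add[OF h] D.r_distr\<close>)
  have "h \<one>\<^bsub>TT\<^esub> = \<one>\<^bsub>D\<^esub>"
    using ht[of "\<one>\<^bsub>B\<^esub>" "\<one>\<^bsub>C\<^esub>"]
    by (simp add: tens_one ring_hom_one[OF alg_homD[OF f]] ring_hom_one[OF alg_homD[OF k]])
  then have "h \<in> alg_hom R TT D"
    by (intro alg_homI ring_hom_memI) (simp_all add: mult additive_map_add[OF h] hs)
  with ht show ?thesis by blast
qed

lemma incl1_hom: "(\<lambda>b. tens R B C b \<one>\<^bsub>C\<^esub>) \<in> alg_hom R B TT"
  by (intro alg_homI ring_hom_memI) (simp_all add: tens_closed tens_mult tens_add1 tens_one tens_smult1)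

lemma incl2_hom: "(\<lambda>c. tens R B C \<one>\<^bsub>B\<^esub> c) \<in> alg_hom R C TT"
  by (intro alg_homI ring_hom_memI) (simp_all add: tens_closed tens_mult tens_add2 tens_one tens_smult2)

end

section \<open>Localization\<close>

lemma UN_const_eq:
  assumes "x \<in> X" "\<And>x. x \<in> X \<Longrightarrow> f x = c"
  shows "(\<Union>x\<in>X. f x) = c"
  using assms by auto

lemma UN_const_eq2:
  assumes "x \<in> X" "y \<in> Y" "\<And>x y. x \<in> X \<Longrightarrow> y \<in> Y \<Longrightarrow> f x y = c"
  shows "(\<Union>x\<in>X. \<Union>y\<in>Y. f x y) = c"
  using assms by auto

locale loc_alg = algebra R A
  for R :: "('r, 'k) ring_scheme" and A :: "('r, 'a, 'l) module_scheme" +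
  fixes E :: "'a set"
  assumes E_closed: "E \<subseteq> carrier A"
begin

abbreviation S where "S \<equiv> mult_closure A E"
abbreviation Lc where "Lc \<equiv> localization A E"
abbreviation fr where "fr \<equiv> Defs.frac A E"

lemma S_closed [simp]: "s \<in> S \<Longrightarrow> s \<in> carrier A"
  by (induction rule: mult_closure.induct) (use E_closed in auto)

lemma S_one [simp]: "\<one>\<^bsub>A\<^esub> \<in> S"
  by (rule mult_closure.one)

lemma S_mult [simp]: "s \<in> S \<Longrightarrow> t \<in> S \<Longrightarrow> s \<otimes>\<^bsub>A\<^esub> t \<in> S"
  by (rule mult_closure.mult)

lemma loc_rel_iff:
  "((a, s), (b, t)) \<in> loc_rel A E \<longleftrightarrow> a \<in> carrier A \<and> b \<in> carrier A \<and> s \<in> S \<and> t \<in> S \<and>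
    (\<exists>u\<in>S. u \<otimes>\<^bsub>A\<^esub> (a \<otimes>\<^bsub>A\<^esub> t) = u \<otimes>\<^bsub>A\<^esub> (b \<otimes>\<^bsub>A\<^esub> s))"
  by (simp add: loc_rel_def)

lemma loc_rel_equiv: "equiv (carrier A \<times> S) (loc_rel A E)"
proof (rule equivI)
  show "loc_rel A E \<subseteq> (carrier A \<times> S) \<times> (carrier A \<times> S)" by (auto simp: loc_rel_def)
  show "refl_on (carrier A \<times> S) (loc_rel A E)"
    by (auto simp: refl_on_def loc_rel_def intro!: bexI[of _ "\<one>\<^bsub>A\<^esub>"])
  show "sym (loc_rel A E)" by (auto simp: sym_def loc_rel_def) metis
  show "trans (loc_rel A E)"
  proof (rule transI, clarify)
    fix a s b t c v
    assume "((a, s), (b, t)) \<in> loc_rel A E" "((b, t), (c, v)) \<in> loc_rel A E"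
    then obtain u w where c: "a \<in> carrier A" "b \<in> carrier A" "c \<in> carrier A" "s \<in> S" "t \<in> S" "v \<in> S"
      and u: "u \<in> S" "u \<otimes>\<^bsub>A\<^esub> (a \<otimes>\<^bsub>A\<^esub> t) = u \<otimes>\<^bsub>A\<^esub> (b \<otimes>\<^bsub>A\<^esub> s)"
      and w: "w \<in> S" "w \<otimes>\<^bsub>A\<^esub> (b \<otimes>\<^bsub>A\<^esub> v) = w \<otimes>\<^bsub>A\<^esub> (c \<otimes>\<^bsub>A\<^esub> t)"
      by (auto simp: loc_rel_iff)
    \<comment> \<open>The middle denominator \<open>t\<close> cannot be cancelled, so it becomes
      part of the multiplier.\<close>
    have "(u \<otimes>\<^bsub>A\<^esub> w \<otimes>\<^bsub>A\<^esub> t) \<otimes>\<^bsub>A\<^esub> (a \<otimes>\<^bsub>A\<^esub> v) = (w \<otimes>\<^bsub>A\<^esub> v) \<otimes>\<^bsub>A\<^esub> (u \<otimes>\<^bsub>A\<^esub> (a \<otimes>\<^bsub>A\<^esub> t))"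
      using c u(1) w(1) by (simp add: m_ac)
    also have "\<dots> = (u \<otimes>\<^bsub>A\<^esub> s) \<otimes>\<^bsub>A\<^esub> (w \<otimes>\<^bsub>A\<^esub> (b \<otimes>\<^bsub>A\<^esub> v))"
      unfolding u(2) using c u(1) w(1) by (simp add: m_ac)
    also have "\<dots> = (u \<otimes>\<^bsub>A\<^esub> w \<otimes>\<^bsub>A\<^esub> t) \<otimes>\<^bsub>A\<^esub> (c \<otimes>\<^bsub>A\<^esub> s)"
      unfolding w(2) using c u(1) w(1) by (simp add: m_ac)
    finally show "((a, s), (c, v)) \<in> loc_rel A E"
      unfolding loc_rel_iff using c u(1) w(1) by (intro conjI bexI[of _ "u \<otimes>\<^bsub>A\<^esub> w \<otimes>\<^bsub>A\<^esub> t"]) auto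
  qed
qed

lemma fr_eq_iff:
  assumes "a \<in> carrier A" "b \<in> carrier A" "s \<in> S" "t \<in> S"
  shows "fr a s = fr b t \<longleftrightarrow> (\<exists>u\<in>S. u \<otimes>\<^bsub>A\<^esub> (a \<otimes>\<^bsub>A\<^esub> t) = u \<otimes>\<^bsub>A\<^esub> (b \<otimes>\<^bsub>A\<^esub> s))"
  unfolding Defs.frac_def using assms eq_equiv_class_iff[OF loc_rel_equiv, of "(a, s)" "(b, t)"]
  by (simp add: loc_rel_iff)

lemma fr_self: "a \<in> carrier A \<Longrightarrow> s \<in> S \<Longrightarrow> (a, s) \<in> fr a s"
  unfolding Defs.frac_def using equiv_class_self[OF loc_rel_equiv, of "(a, s)"] by simp

lemma fr_mem:
  assumes "(b, t) \<in> fr a s"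
  shows "a \<in> carrier A" "s \<in> S" "b \<in> carrier A" "t \<in> S"
    "\<exists>u\<in>S. u \<otimes>\<^bsub>A\<^esub> (a \<otimes>\<^bsub>A\<^esub> t) = u \<otimes>\<^bsub>A\<^esub> (b \<otimes>\<^bsub>A\<^esub> s)"
  using assms by (auto simp: Defs.frac_def loc_rel_iff)

lemma carrier_Lc: "carrier Lc = {fr a s | a s. a \<in> carrier A \<and> s \<in> S}"
  by (auto simp: localization_def quotient_def Defs.frac_def)

lemma Lc_cases:
  assumes "x \<in> carrier Lc"
  obtains a s where "a \<in> carrier A" "s \<in> S" "x = fr a s"
  using assms by (auto simp: carrier_Lc)

lemma fr_closed: "a \<in> carrier A \<Longrightarrow> s \<in> S \<Longrightarrow> fr a s \<in> carrier Lc"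
  by (auto simp: carrier_Lc)

lemma fr_mult:
  assumes "a \<in> carrier A" "s \<in> S" "b \<in> carrier A" "t \<in> S"
  shows "fr a s \<otimes>\<^bsub>Lc\<^esub> fr b t = fr (a \<otimes>\<^bsub>A\<^esub> b) (s \<otimes>\<^bsub>A\<^esub> t)"
proof -
  have "fr (fst x \<otimes>\<^bsub>A\<^esub> fst y) (snd x \<otimes>\<^bsub>A\<^esub> snd y) = fr (a \<otimes>\<^bsub>A\<^esub> b) (s \<otimes>\<^bsub>A\<^esub> t)"
    if xy: "x \<in> fr a s" "y \<in> fr b t" for x y
  proof -
    obtain a' s' b' t' where xy': "x = (a', s')" "y = (b', t')" by (cases x, cases y) auto
    obtain u w where u: "u \<in> S" "u \<otimes>\<^bsub>A\<^esub> (a \<otimes>\<^bsub>A\<^esub> s') = u \<otimes>\<^bsub>A\<^esub> (a' \<otimes>\<^bsub>A\<^esub> s)"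
      and w: "w \<in> S" "w \<otimes>\<^bsub>A\<^esub> (b \<otimes>\<^bsub>A\<^esub> t') = w \<otimes>\<^bsub>A\<^esub> (b' \<otimes>\<^bsub>A\<^esub> t)"
      using fr_mem(5) xy unfolding xy' by meson
    note c = fr_mem(3,4)[OF xy(1)[unfolded xy']] fr_mem(3,4)[OF xy(2)[unfolded xy']] assms u(1) w(1)
    have "(u \<otimes>\<^bsub>A\<^esub> w) \<otimes>\<^bsub>A\<^esub> ((a' \<otimes>\<^bsub>A\<^esub> b') \<otimes>\<^bsub>A\<^esub> (s \<otimes>\<^bsub>A\<^esub> t)) =
        (u \<otimes>\<^bsub>A\<^esub> (a' \<otimes>\<^bsub>A\<^esub> s)) \<otimes>\<^bsub>A\<^esub> (w \<otimes>\<^bsub>A\<^esub> (b' \<otimes>\<^bsub>A\<^esub> t))"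
      using c by (simp add: m_ac)
    also have "\<dots> = (u \<otimes>\<^bsub>A\<^esub> w) \<otimes>\<^bsub>A\<^esub> ((a \<otimes>\<^bsub>A\<^esub> b) \<otimes>\<^bsub>A\<^esub> (s' \<otimes>\<^bsub>A\<^esub> t'))"
      unfolding u(2)[symmetric] w(2)[symmetric] using c by (simp add: m_ac)
    finally show ?thesis
      unfolding xy' fst_conv snd_conv using c
      by (subst fr_eq_iff) (auto intro!: bexI[of _ "u \<otimes>\<^bsub>A\<^esub> w"])
  qed
  then have "(\<Union>x\<in>fr a s. \<Union>y\<in>fr b t. fr (fst x \<otimes>\<^bsub>A\<^esub> fst y) (snd x \<otimes>\<^bsub>A\<^esub> snd y)) = fr (a \<otimes>\<^bsub>A\<^esub> b) (s \<otimes>\<^bsub>A\<^esub> t)"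
    by (rule UN_const_eq2[OF fr_self[OF assms(1,2)] fr_self[OF assms(3,4)]])
  then show ?thesis by (simp add: localization_def)
qed

lemma fr_add:
  assumes "a \<in> carrier A" "s \<in> S" "b \<in> carrier A" "t \<in> S"
  shows "fr a s \<oplus>\<^bsub>Lc\<^esub> fr b t = fr (a \<otimes>\<^bsub>A\<^esub> t \<oplus>\<^bsub>A\<^esub> b \<otimes>\<^bsub>A\<^esub> s) (s \<otimes>\<^bsub>A\<^esub> t)"
proof -
  have "fr (fst x \<otimes>\<^bsub>A\<^esub> snd y \<oplus>\<^bsub>A\<^esub> fst y \<otimes>\<^bsub>A\<^esub> snd x) (snd x \<otimes>\<^bsub>A\<^esub> snd y) =
      fr (a \<otimes>\<^bsub>A\<^esub> t \<oplus>\<^bsub>A\<^esub> b \<otimes>\<^bsub>A\<^esub> s) (s \<otimes>\<^bsub>A\<^esub> t)"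
    if xy: "x \<in> fr a s" "y \<in> fr b t" for x y
  proof -
    obtain a' s' b' t' where xy': "x = (a', s')" "y = (b', t')" by (cases x, cases y) auto
    obtain u w where u: "u \<in> S" "u \<otimes>\<^bsub>A\<^esub> (a \<otimes>\<^bsub>A\<^esub> s') = u \<otimes>\<^bsub>A\<^esub> (a' \<otimes>\<^bsub>A\<^esub> s)"
      and w: "w \<in> S" "w \<otimes>\<^bsub>A\<^esub> (b \<otimes>\<^bsub>A\<^esub> t') = w \<otimes>\<^bsub>A\<^esub> (b' \<otimes>\<^bsub>A\<^esub> t)"
      using fr_mem(5) xy unfolding xy' by meson
    note c = fr_mem(3,4)[OF xy(1)[unfolded xy']] fr_mem(3,4)[OF xy(2)[unfolded xy']] assms u(1) w(1)
    have "(u \<otimes>\<^bsub>A\<^esub> w) \<otimes>\<^bsub>A\<^esub> ((a' \<otimes>\<^bsub>A\<^esub> t' \<oplus>\<^bsub>A\<^esub> b' \<otimes>\<^bsub>A\<^esub> s') \<otimes>\<^bsub>A\<^esub> (s \<otimes>\<^bsub>A\<^esub> t)) =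
        (u \<otimes>\<^bsub>A\<^esub> (a' \<otimes>\<^bsub>A\<^esub> s)) \<otimes>\<^bsub>A\<^esub> (w \<otimes>\<^bsub>A\<^esub> (t \<otimes>\<^bsub>A\<^esub> t')) \<oplus>\<^bsub>A\<^esub>
        (w \<otimes>\<^bsub>A\<^esub> (b' \<otimes>\<^bsub>A\<^esub> t)) \<otimes>\<^bsub>A\<^esub> (u \<otimes>\<^bsub>A\<^esub> (s \<otimes>\<^bsub>A\<^esub> s'))"
      using c by (simp add: l_distr r_distr m_ac)
    also have "\<dots> = (u \<otimes>\<^bsub>A\<^esub> w) \<otimes>\<^bsub>A\<^esub> ((a \<otimes>\<^bsub>A\<^esub> t \<oplus>\<^bsub>A\<^esub> b \<otimes>\<^bsub>A\<^esub> s) \<otimes>\<^bsub>A\<^esub> (s' \<otimes>\<^bsub>A\<^esub> t'))"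
      unfolding u(2)[symmetric] w(2)[symmetric] using c by (simp add: l_distr r_distr m_ac)
    finally show ?thesis
      unfolding xy' fst_conv snd_conv using c
      by (subst fr_eq_iff) (auto intro!: bexI[of _ "u \<otimes>\<^bsub>A\<^esub> w"])
  qed
  then have "(\<Union>x\<in>fr a s. \<Union>y\<in>fr b t. fr (fst x \<otimes>\<^bsub>A\<^esub> snd y \<oplus>\<^bsub>A\<^esub> fst y \<otimes>\<^bsub>A\<^esub> snd x) (snd x \<otimes>\<^bsub>A\<^esub> snd y)) = fr (a \<otimes>\<^bsub>A\<^esub> t \<oplus>\<^bsub>A\<^esub> b \<otimes>\<^bsub>A\<^esub> s) (s \<otimes>\<^bsub>A\<^esub> t)"
    by (rule UN_const_eq2[OF fr_self[OF assms(1,2)] fr_self[OF assms(3,4)]])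
  then show ?thesis by (simp add: localization_def)
qed

lemma fr_smult:
  assumes r: "r \<in> carrier R" and as: "a \<in> carrier A" "s \<in> S"
  shows "r \<odot>\<^bsub>Lc\<^esub> fr a s = fr (r \<odot>\<^bsub>A\<^esub> a) s"
proof -
  have "fr (r \<odot>\<^bsub>A\<^esub> fst x) (snd x) = fr (r \<odot>\<^bsub>A\<^esub> a) s" if x: "x \<in> fr a s" for x
  proof -
    obtain a' s' where x': "x = (a', s')" by (cases x) auto
    obtain u where u: "u \<in> S" "u \<otimes>\<^bsub>A\<^esub> (a \<otimes>\<^bsub>A\<^esub> s') = u \<otimes>\<^bsub>A\<^esub> (a' \<otimes>\<^bsub>A\<^esub> s)"
      using fr_mem(5) x unfolding x' by meson
    note c = fr_mem(3,4)[OF x[unfolded x']] as u(1) struct_closed[OF r]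
    have "u \<otimes>\<^bsub>A\<^esub> ((struct_map A r \<otimes>\<^bsub>A\<^esub> a') \<otimes>\<^bsub>A\<^esub> s) = struct_map A r \<otimes>\<^bsub>A\<^esub> (u \<otimes>\<^bsub>A\<^esub> (a' \<otimes>\<^bsub>A\<^esub> s))"
      using c by (simp add: m_ac)
    also have "\<dots> = u \<otimes>\<^bsub>A\<^esub> ((struct_map A r \<otimes>\<^bsub>A\<^esub> a) \<otimes>\<^bsub>A\<^esub> s')"
      unfolding u(2)[symmetric] using c by (simp add: m_ac)
    finally show ?thesis
      unfolding x' fst_conv snd_conv using c r
      by (subst fr_eq_iff) (auto simp: smult_eq_mult intro!: bexI[of _ u])
  qed
  then have "(\<Union>x\<in>fr a s. fr (r \<odot>\<^bsub>A\<^esub> fst x) (snd x)) = fr (r \<odot>\<^bsub>A\<^esub> a) s"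
    by (rule UN_const_eq[OF fr_self[OF as]])
  then show ?thesis by (simp add: localization_def)
qed

lemma fr_one: "\<one>\<^bsub>Lc\<^esub> = fr \<one>\<^bsub>A\<^esub> \<one>\<^bsub>A\<^esub>"
  by (simp add: localization_def)

lemma fr_zero: "\<zero>\<^bsub>Lc\<^esub> = fr \<zero>\<^bsub>A\<^esub> \<one>\<^bsub>A\<^esub>"
  by (simp add: localization_def)

lemma fr_cong:
  "a \<in> carrier A \<Longrightarrow> b \<in> carrier A \<Longrightarrow> s \<in> S \<Longrightarrow> t \<in> S \<Longrightarrow> a \<otimes>\<^bsub>A\<^esub> t = b \<otimes>\<^bsub>A\<^esub> s \<Longrightarrow> fr a s = fr b t"
  by (subst fr_eq_iff) (auto intro!: bexI[of _ "\<one>\<^bsub>A\<^esub>"])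

lemma Lc_cring: "cring Lc"
proof (rule cringI)
  show "abelian_group Lc"
  proof (rule abelian_groupI)
    fix x y assume "x \<in> carrier Lc" "y \<in> carrier Lc"
    then show "x \<oplus>\<^bsub>Lc\<^esub> y \<in> carrier Lc"
      by (elim Lc_cases) (simp add: fr_add fr_closed)
  next
    show "\<zero>\<^bsub>Lc\<^esub> \<in> carrier Lc" by (simp add: fr_zero fr_closed)
  next
    fix x y z assume "x \<in> carrier Lc" "y \<in> carrier Lc" "z \<in> carrier Lc"
    then show "x \<oplus>\<^bsub>Lc\<^esub> y \<oplus>\<^bsub>Lc\<^esub> z = x \<oplus>\<^bsub>Lc\<^esub> (y \<oplus>\<^bsub>Lc\<^esub> z)"
      by (elim Lc_cases) (simp add: fr_add fr_closed l_distr r_distr m_ac add.m_ac)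
  next
    fix x y assume "x \<in> carrier Lc" "y \<in> carrier Lc"
    then show "x \<oplus>\<^bsub>Lc\<^esub> y = y \<oplus>\<^bsub>Lc\<^esub> x"
      by (elim Lc_cases) (simp add: fr_add fr_closed m_ac add.m_ac)
  next
    fix x assume "x \<in> carrier Lc"
    then show "\<zero>\<^bsub>Lc\<^esub> \<oplus>\<^bsub>Lc\<^esub> x = x"
      by (elim Lc_cases) (simp add: fr_zero fr_add)
  next
    fix x assume "x \<in> carrier Lc"
    then obtain a s where as: "a \<in> carrier A" "s \<in> S" "x = fr a s" by (rule Lc_cases)
    show "\<exists>y\<in>carrier Lc. y \<oplus>\<^bsub>Lc\<^esub> x = \<zero>\<^bsub>Lc\<^esub>"
      using as by (intro bexI[of _ "fr (\<ominus>\<^bsub>A\<^esub> a) s"])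
        (simp add: fr_add fr_zero l_minus M.l_neg, rule fr_cong, simp_all add: fr_closed)
  qed
  show "comm_monoid Lc"
  proof (rule comm_monoidI)
    fix x y assume "x \<in> carrier Lc" "y \<in> carrier Lc"
    then show "x \<otimes>\<^bsub>Lc\<^esub> y \<in> carrier Lc"
      by (elim Lc_cases) (simp add: fr_mult fr_closed)
  next
    show "\<one>\<^bsub>Lc\<^esub> \<in> carrier Lc" by (simp add: fr_one fr_closed)
  next
    fix x y z assume "x \<in> carrier Lc" "y \<in> carrier Lc" "z \<in> carrier Lc"
    then show "x \<otimes>\<^bsub>Lc\<^esub> y \<otimes>\<^bsub>Lc\<^esub> z = x \<otimes>\<^bsub>Lc\<^esub> (y \<otimes>\<^bsub>Lc\<^esub> z)"
      by (elim Lc_cases) (simp add: fr_mult fr_closed m_ac)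
  next
    fix x y assume "x \<in> carrier Lc" "y \<in> carrier Lc"
    then show "x \<otimes>\<^bsub>Lc\<^esub> y = y \<otimes>\<^bsub>Lc\<^esub> x"
      by (elim Lc_cases) (simp add: fr_mult fr_closed m_ac)
  next
    fix x assume "x \<in> carrier Lc"
    then show "\<one>\<^bsub>Lc\<^esub> \<otimes>\<^bsub>Lc\<^esub> x = x"
      by (elim Lc_cases) (simp add: fr_one fr_mult)
  qed
next
  fix x y z assume "x \<in> carrier Lc" "y \<in> carrier Lc" "z \<in> carrier Lc"
  then show "(x \<oplus>\<^bsub>Lc\<^esub> y) \<otimes>\<^bsub>Lc\<^esub> z = x \<otimes>\<^bsub>Lc\<^esub> z \<oplus>\<^bsub>Lc\<^esub> y \<otimes>\<^bsub>Lc\<^esub> z"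
    by (elim Lc_cases)
      (simp add: fr_mult fr_add, rule fr_cong, simp_all add: l_distr r_distr m_ac)
qed

lemma Lc_algebra: "algebra R Lc"
proof (rule algebraI[OF R_cring Lc_cring])
  fix a x y assume "a \<in> carrier R" "x \<in> carrier Lc" "y \<in> carrier Lc"
  then show "a \<odot>\<^bsub>Lc\<^esub> (x \<oplus>\<^bsub>Lc\<^esub> y) = a \<odot>\<^bsub>Lc\<^esub> x \<oplus>\<^bsub>Lc\<^esub> a \<odot>\<^bsub>Lc\<^esub> y"
    by (elim Lc_cases) (simp add: fr_smult fr_add smult_r_distr smult_assoc2)
next
  fix a b x assume "a \<in> carrier R" "b \<in> carrier R" "x \<in> carrier Lc"
  then show "(a \<oplus>\<^bsub>R\<^esub> b) \<odot>\<^bsub>Lc\<^esub> x = a \<odot>\<^bsub>Lc\<^esub> x \<oplus>\<^bsub>Lc\<^esub> b \<odot>\<^bsub>Lc\<^esub> x"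
    by (elim Lc_cases)
      (simp add: fr_smult fr_add smult_l_distr, rule fr_cong, simp_all add: l_distr r_distr m_ac)
next
  fix a x y assume "a \<in> carrier R" "x \<in> carrier Lc" "y \<in> carrier Lc"
  then show "(a \<odot>\<^bsub>Lc\<^esub> x) \<otimes>\<^bsub>Lc\<^esub> y = a \<odot>\<^bsub>Lc\<^esub> (x \<otimes>\<^bsub>Lc\<^esub> y)"
    by (elim Lc_cases) (simp add: fr_smult fr_mult smult_assoc2)
qed (auto elim!: Lc_cases simp: fr_smult fr_closed smult_assoc1)

lemma fr_hom: "(\<lambda>a. fr a \<one>\<^bsub>A\<^esub>) \<in> alg_hom R A Lc"
  by (intro alg_homI ring_hom_memI) (simp_all add: fr_closed fr_mult fr_add fr_one fr_smult)

lemma fr_inverse: "s \<in> S \<Longrightarrow> fr s \<one>\<^bsub>A\<^esub> \<otimes>\<^bsub>Lc\<^esub> fr \<one>\<^bsub>A\<^esub> s = \<one>\<^bsub>Lc\<^esub>"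
  by (simp add: fr_mult fr_one) (rule fr_cong, auto)

lemma fr_unit: "s \<in> S \<Longrightarrow> fr s \<one>\<^bsub>A\<^esub> \<in> Units Lc"
proof -
  assume s: "s \<in> S"
  interpret Lc: cring Lc by (rule Lc_cring)
  have c: "fr \<one>\<^bsub>A\<^esub> s \<in> carrier Lc" "fr s \<one>\<^bsub>A\<^esub> \<in> carrier Lc" using s by (auto intro: fr_closed)
  have "fr \<one>\<^bsub>A\<^esub> s \<otimes>\<^bsub>Lc\<^esub> fr s \<one>\<^bsub>A\<^esub> = \<one>\<^bsub>Lc\<^esub>" using Lc.m_comm[OF c] fr_inverse[OF s] by simp
  with fr_inverse[OF s] c show ?thesis unfolding Units_def by blast
qed

lemma fr_split: "a \<in> carrier A \<Longrightarrow> s \<in> S \<Longrightarrow> fr a s = fr a \<one>\<^bsub>A\<^esub> \<otimes>\<^bsub>Lc\<^esub> fr \<one>\<^bsub>A\<^esub> s"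
  by (simp add: fr_mult)

lemma S_units:
  assumes h: "h \<in> ring_hom A B" and B: "cring B" and E: "\<And>e. e \<in> E \<Longrightarrow> h e \<in> Units B"
    and s: "s \<in> S"
  shows "h s \<in> Units B"
proof -
  interpret B: cring B by fact
  show ?thesis using s
    by (induction rule: mult_closure.induct) (simp_all add: ring_hom_one[OF h] E ring_hom_mult[OF h])
qed

lemma localization_lift:
  assumes h: "h \<in> ring_hom A B" and B: "cring B" and E: "\<And>e. e \<in> E \<Longrightarrow> h e \<in> Units B"
  shows "\<exists>h'\<in>ring_hom Lc B. \<forall>a\<in>carrier A. h' (fr a \<one>\<^bsub>A\<^esub>) = h a"
proof -
  interpret B: cring B by fact
  note [simp] = S_units[OF h B E] ring_hom_closed[OF h] ring_hom_mult[OF h] ring_hom_add[OF h] ring_hom_one[OF h]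
  have inv_mult: "inv\<^bsub>B\<^esub> (h s \<otimes>\<^bsub>B\<^esub> h t) = inv\<^bsub>B\<^esub> h s \<otimes>\<^bsub>B\<^esub> inv\<^bsub>B\<^esub> h t" if "s \<in> S" "t \<in> S" for s t
  proof (rule B.comm_inv_char)
    have "h s \<otimes>\<^bsub>B\<^esub> h t \<otimes>\<^bsub>B\<^esub> (inv\<^bsub>B\<^esub> h s \<otimes>\<^bsub>B\<^esub> inv\<^bsub>B\<^esub> h t) =
        (h s \<otimes>\<^bsub>B\<^esub> inv\<^bsub>B\<^esub> h s) \<otimes>\<^bsub>B\<^esub> (h t \<otimes>\<^bsub>B\<^esub> inv\<^bsub>B\<^esub> h t)"
      using that by (simp add: B.m_ac del: B.Units_r_inv B.Units_l_inv)
    then show "h s \<otimes>\<^bsub>B\<^esub> h t \<otimes>\<^bsub>B\<^esub> (inv\<^bsub>B\<^esub> h s \<otimes>\<^bsub>B\<^esub> inv\<^bsub>B\<^esub> h t) = \<one>\<^bsub>B\<^esub>" using that by simp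
  qed (use that in auto)
  \<comment> \<open>A pair is chosen from the class. The choice does not matter: the multiplier
    relating two pairs goes to a unit of \<open>B\<close> and cancels.\<close>
  define k where "k X = (let x = (SOME x. x \<in> X) in h (fst x) \<otimes>\<^bsub>B\<^esub> inv\<^bsub>B\<^esub> (h (snd x)))" for X
  have k: "k (fr a s) = h a \<otimes>\<^bsub>B\<^esub> inv\<^bsub>B\<^esub> (h s)" if as: "a \<in> carrier A" "s \<in> S" for a s
  proof -
    obtain b t where bt: "(SOME x. x \<in> fr a s) = (b, t)" by (cases "SOME x. x \<in> fr a s") auto
    have mem: "(b, t) \<in> fr a s" using someI[of "\<lambda>x. x \<in> fr a s", OF fr_self[OF as]] bt by simp
    obtain u where u: "u \<in> S" "u \<otimes>\<^bsub>A\<^esub> (a \<otimes>\<^bsub>A\<^esub> t) = u \<otimes>\<^bsub>A\<^esub> (b \<otimes>\<^bsub>A\<^esub> s)" using fr_mem(5)[OF mem] by blast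
    note c = fr_mem(3,4)[OF mem] as u(1)
    have "h u \<otimes>\<^bsub>B\<^esub> (h a \<otimes>\<^bsub>B\<^esub> h t) = h u \<otimes>\<^bsub>B\<^esub> (h b \<otimes>\<^bsub>B\<^esub> h s)"
      using arg_cong[OF u(2), of h] c by simp
    then have e: "h a \<otimes>\<^bsub>B\<^esub> h t = h b \<otimes>\<^bsub>B\<^esub> h s" using c by (simp add: B.Units_l_cancel)
    have "h b \<otimes>\<^bsub>B\<^esub> inv\<^bsub>B\<^esub> h t = (h b \<otimes>\<^bsub>B\<^esub> h s) \<otimes>\<^bsub>B\<^esub> inv\<^bsub>B\<^esub> h s \<otimes>\<^bsub>B\<^esub> inv\<^bsub>B\<^esub> h t"
      using c by (simp add: B.m_assoc)
    also have "\<dots> = h a \<otimes>\<^bsub>B\<^esub> inv\<^bsub>B\<^esub> h s \<otimes>\<^bsub>B\<^esub> (h t \<otimes>\<^bsub>B\<^esub> inv\<^bsub>B\<^esub> h t)"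
      unfolding e[symmetric] using c by (simp add: B.m_ac del: B.Units_r_inv B.Units_l_inv)
    finally show ?thesis using c by (simp add: k_def bt)
  qed
  have "k \<in> ring_hom Lc B"
  proof (rule ring_hom_memI)
    fix x y assume "x \<in> carrier Lc" "y \<in> carrier Lc"
    then obtain a s b t where c: "a \<in> carrier A" "s \<in> S" "b \<in> carrier A" "t \<in> S" and xy: "x = fr a s" "y = fr b t"
      by (elim Lc_cases)
    show "k (x \<otimes>\<^bsub>Lc\<^esub> y) = k x \<otimes>\<^bsub>B\<^esub> k y"
      using c by (simp add: xy fr_mult k inv_mult B.m_ac)
    have "h a \<otimes>\<^bsub>B\<^esub> h t \<otimes>\<^bsub>B\<^esub> (inv\<^bsub>B\<^esub> h s \<otimes>\<^bsub>B\<^esub> inv\<^bsub>B\<^esub> h t) = (h a \<otimes>\<^bsub>B\<^esub> inv\<^bsub>B\<^esub> h s) \<otimes>\<^bsub>B\<^esub> (h t \<otimes>\<^bsub>B\<^esub> inv\<^bsub>B\<^esub> h t)"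
      "h b \<otimes>\<^bsub>B\<^esub> h s \<otimes>\<^bsub>B\<^esub> (inv\<^bsub>B\<^esub> h s \<otimes>\<^bsub>B\<^esub> inv\<^bsub>B\<^esub> h t) = (h b \<otimes>\<^bsub>B\<^esub> inv\<^bsub>B\<^esub> h t) \<otimes>\<^bsub>B\<^esub> (h s \<otimes>\<^bsub>B\<^esub> inv\<^bsub>B\<^esub> h s)"
      using c by (simp_all add: B.m_ac del: B.Units_r_inv B.Units_l_inv)
    then show "k (x \<oplus>\<^bsub>Lc\<^esub> y) = k x \<oplus>\<^bsub>B\<^esub> k y"
      using c by (simp add: xy fr_add k inv_mult B.l_distr)
  qed (auto elim!: Lc_cases simp: k fr_one)
  moreover have "k (fr a \<one>\<^bsub>A\<^esub>) = h a" if "a \<in> carrier A" for a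
    using that k[of a "\<one>\<^bsub>A\<^esub>"] by simp
  ultimately show ?thesis by blast
qed

text \<open>A homomorphism is determined on 1/s by its value on s, inverses being unique.\<close>

lemma localization_ext:
  assumes h: "h \<in> ring_hom Lc B" and h': "h' \<in> ring_hom Lc B" and B: "cring B"
    and eq: "\<And>a. a \<in> carrier A \<Longrightarrow> h (fr a \<one>\<^bsub>A\<^esub>) = h' (fr a \<one>\<^bsub>A\<^esub>)" and x: "x \<in> carrier Lc"
  shows "h x = h' x"
proof -
  interpret B: cring B by fact
  interpret h: ring_hom_cring Lc B h using h B Lc_cring by (simp add: ring_hom_cring_def ring_hom_cring_axioms_def)
  interpret h': ring_hom_cring Lc B h' using h' B Lc_cring by (simp add: ring_hom_cring_def ring_hom_cring_axioms_def)
  obtain a s where as: "a \<in> carrier A" "s \<in> S" and xs: "x = fr a s" using x by (rule Lc_cases)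
  have c: "fr s \<one>\<^bsub>A\<^esub> \<in> carrier Lc" "fr \<one>\<^bsub>A\<^esub> s \<in> carrier Lc" "fr a \<one>\<^bsub>A\<^esub> \<in> carrier Lc"
    using as by (auto intro: fr_closed)
  have "h (fr s \<one>\<^bsub>A\<^esub>) \<otimes>\<^bsub>B\<^esub> h (fr \<one>\<^bsub>A\<^esub> s) = \<one>\<^bsub>B\<^esub>" "h' (fr s \<one>\<^bsub>A\<^esub>) \<otimes>\<^bsub>B\<^esub> h' (fr \<one>\<^bsub>A\<^esub> s) = \<one>\<^bsub>B\<^esub>"
    using fr_inverse[OF as(2)] c by (metis h.hom_mult h.hom_one, metis h'.hom_mult h'.hom_one)
  then have "h (fr \<one>\<^bsub>A\<^esub> s) = h' (fr \<one>\<^bsub>A\<^esub> s)"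
    using eq as c by (metis B.inv_unique B.m_comm S_closed h'.hom_closed h.hom_closed)
  then show ?thesis using eq as c by (simp add: xs fr_split[of a s])
qed

end

section \<open>The algebras \<open>B[x, y]/(x\<^sup>p - a, y\<^sup>p - b)\<close>\<close>

text \<open>Constants and variable names are free because the algebra returns in several roles: over
  \<open>R\<close> with \<open>a = b = 0\<close> it is \<open>A\<close>, over a test ring it carries
  the functionals and their shifted coordinates, and with numbers as variables it is the fppf
  cover.\<close>

definition trunc_rels :: "('b, 'k) ring_scheme \<Rightarrow> nat \<Rightarrow> 'v \<Rightarrow> 'v \<Rightarrow> 'b \<Rightarrow> 'b \<Rightarrow> ('v multiset \<Rightarrow> 'b) set"
  where "trunc_rels B p v w a b =
    (let P = mpoly B {v, w} in
      {mvar B {v, w} v [^]\<^bsub>P\<^esub> p \<ominus>\<^bsub>P\<^esub> struct_map P a, mvar B {v, w} w [^]\<^bsub>P\<^esub> p \<ominus>\<^bsub>P\<^esub> struct_map P b})"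

definition trunc ::
  "('b, 'k) ring_scheme \<Rightarrow> nat \<Rightarrow> 'v \<Rightarrow> 'v \<Rightarrow> 'b \<Rightarrow> 'b \<Rightarrow> ('b, ('v multiset \<Rightarrow> 'b) set) module"
  where "trunc B p v w a b =
    alg_quot (mpoly B {v, w}) (Idl\<^bsub>mpoly B {v, w}\<^esub> (trunc_rels B p v w a b))"

definition tgen ::
  "('b, 'k) ring_scheme \<Rightarrow> nat \<Rightarrow> 'v \<Rightarrow> 'v \<Rightarrow> 'b \<Rightarrow> 'b \<Rightarrow> 'v \<Rightarrow> ('v multiset \<Rightarrow> 'b) set"
  where "tgen B p v w a b u =
    (Idl\<^bsub>mpoly B {v, w}\<^esub> (trunc_rels B p v w a b)) +>\<^bsub>mpoly B {v, w}\<^esub> mvar B {v, w} u"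

definition tmon ::
  "('b, 'k) ring_scheme \<Rightarrow> nat \<Rightarrow> 'v \<Rightarrow> 'v \<Rightarrow> 'b \<Rightarrow> 'b \<Rightarrow> nat \<times> nat \<Rightarrow> ('v multiset \<Rightarrow> 'b) set"
  where "tmon B p v w a b j =
    tgen B p v w a b v [^]\<^bsub>trunc B p v w a b\<^esub> fst j \<otimes>\<^bsub>trunc B p v w a b\<^esub>
    tgen B p v w a b w [^]\<^bsub>trunc B p v w a b\<^esub> snd j"

text \<open>The \<open>\<sigma>\<close>-semilinear map with prescribed values on the monomials with
  exponents below \<open>p\<close>. That such a map exists for arbitrary values is the linear
  independence of these monomials.\<close>

definition tlin ::
  "('b, 'k) ring_scheme \<Rightarrow> nat \<Rightarrow> 'v \<Rightarrow> 'v \<Rightarrow> 'b \<Rightarrow> 'b \<Rightarrow> ('c, 'l) ring_scheme \<Rightarrow> ('b \<Rightarrow> 'c) \<Rightarrow>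
    (nat \<times> nat \<Rightarrow> 'c) \<Rightarrow> ('v multiset \<Rightarrow> 'b) set \<Rightarrow> 'c"
  where "tlin B p v w a b C \<sigma> t =
    (SOME h. h \<in> additive_map (trunc B p v w a b) C \<and>
      (\<forall>\<beta>\<in>carrier B. \<forall>z\<in>carrier (trunc B p v w a b).
         h (\<beta> \<odot>\<^bsub>trunc B p v w a b\<^esub> z) = \<sigma> \<beta> \<otimes>\<^bsub>C\<^esub> h z) \<and>
      (\<forall>j\<in>idx p. h (tmon B p v w a b j) = t j))"

locale trunc_alg = B: cring B for B :: "('b, 'k) ring_scheme" +
  fixes p :: nat and v w :: 'v and a b :: 'b
  assumes vw: "v \<noteq> w" and p0: "0 < p" and ab: "a \<in> carrier B" "b \<in> carrier B"
begin

abbreviation P where "P \<equiv> mpoly B {v, w}"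
abbreviation V where "V \<equiv> trunc B p v w a b"
abbreviation X where "X \<equiv> tgen B p v w a b v"
abbreviation Y where "Y \<equiv> tgen B p v w a b w"
abbreviation mon where "mon \<equiv> tmon B p v w a b"
abbreviation K where "K \<equiv> Idl\<^bsub>P\<^esub> (trunc_rels B p v w a b)"

sublocale FF: monoid_alg B "monomials {v, w}"
  by (rule mpoly_monoid_alg[OF B.is_cring])

lemma P_eq: "monoid_algebra B (monomials {v, w}) = P"
  by (simp add: mpoly_def)

sublocale PA: algebra B P
  by (rule mpoly_algebra[OF B.is_cring])

lemma mv_closed: "mvar B {v, w} v \<in> carrier P" "mvar B {v, w} w \<in> carrier P"
  by (auto intro: mvar_closed[OF B.is_cring])

lemma rels_closed: "trunc_rels B p v w a b \<subseteq> carrier P"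
  using mv_closed ab by (auto simp: trunc_rels_def Let_def PA.struct_closed)

sublocale quot_alg B P K
  by (intro quot_alg.intro PA.algebra_axioms PA.genideal_ideal rels_closed)

lemma V_eq: "V = Q"
  by (simp add: trunc_def)

lemma V_algebra: "algebra B V"
  unfolding V_eq by (rule Q_algebra)

sublocale VA: algebra B V
  by (rule V_algebra)

lemma V_cring: "cring V"
  by (rule VA.M_cring)

lemma gen_closed [simp]: "X \<in> carrier V" "Y \<in> carrier V"
  unfolding tgen_def V_eq by (intro q_closed mv_closed)+

sublocale qh: ring_hom_cring P V q
  using q_hom PA.M_cring V_cring
  by (auto simp: ring_hom_cring_def ring_hom_cring_axioms_def V_eq dest: alg_homD)

lemma q_struct: "\<beta> \<in> carrier B \<Longrightarrow> q (struct_map P \<beta>) = struct_map V \<beta>"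
  using alg_hom_struct[OF q_hom PA.algebra_axioms] by (simp add: V_eq)

lemma gen_pow:
  "X [^]\<^bsub>V\<^esub> p = struct_map V a" "Y [^]\<^bsub>V\<^esub> p = struct_map V b"
proof -
  have "mvar B {v, w} v [^]\<^bsub>P\<^esub> p \<ominus>\<^bsub>P\<^esub> struct_map P a \<in> K" "mvar B {v, w} w [^]\<^bsub>P\<^esub> p \<ominus>\<^bsub>P\<^esub> struct_map P b \<in> K"
    using PA.genideal_self[OF rels_closed] by (auto simp: trunc_rels_def Let_def)
  then have "q (mvar B {v, w} v [^]\<^bsub>P\<^esub> p) = q (struct_map P a)" "q (mvar B {v, w} w [^]\<^bsub>P\<^esub> p) = q (struct_map P b)"
    using mv_closed ab by (intro iffD2[OF q_eq_iff]; simp add: PA.struct_closed)+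
  then show "X [^]\<^bsub>V\<^esub> p = struct_map V a" "Y [^]\<^bsub>V\<^esub> p = struct_map V b"
    using mv_closed ab by (simp_all add: tgen_def qh.hom_nat_pow q_struct)
qed

lemma mon_closed [simp]: "mon j \<in> carrier V"
  by (simp add: tmon_def)

lemma V_lift:
  assumes C: "cring C" and \<sigma>: "\<sigma> \<in> ring_hom B C" and x: "x \<in> carrier C" "y \<in> carrier C"
    and xp: "x [^]\<^bsub>C\<^esub> p = \<sigma> a" "y [^]\<^bsub>C\<^esub> p = \<sigma> b"
  shows "\<exists>h\<in>ring_hom V C. h X = x \<and> h Y = y \<and> (\<forall>\<beta>\<in>carrier B. h (struct_map V \<beta>) = \<sigma> \<beta>)"
proof -
  interpret C: cring C by fact
  define k where "k u = (if u = v then x else y)" for u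
  have kc: "k \<in> {v, w} \<rightarrow> carrier C" and kv: "k v = x" "k w = y" using x vw by (auto simp: k_def)
  obtain e where e: "e \<in> ring_hom P C" and ev: "\<And>u. u \<in> {v, w} \<Longrightarrow> e (mvar B {v, w} u) = k u"
    and es: "\<And>r. r \<in> carrier B \<Longrightarrow> e (struct_map P r) = \<sigma> r"
    using mpoly_eval[OF B.is_cring C _ \<sigma> kc] by blast
  interpret e: ring_hom_cring P C e
    using e C PA.M_cring by (simp add: ring_hom_cring_def ring_hom_cring_axioms_def)
  have kill: "e g = \<zero>\<^bsub>C\<^esub>" if "g \<in> trunc_rels B p v w a b" for g
    using that mv_closed ab vw x xp es ev kv ring_hom_closed[OF \<sigma>]
    by (auto simp: trunc_rels_def Let_def e.hom_minus e.hom_nat_pow PA.struct_closed)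
  obtain h where h: "h \<in> ring_hom V C" and hq: "\<And>f. f \<in> carrier P \<Longrightarrow> h (q f) = e f"
    using factor_hom[OF e C PA.genideal_kill_hom[OF rels_closed e C kill]] unfolding V_eq by blast
  have "h X = x" "h Y = y" using hq mv_closed ev kv by (auto simp: tgen_def)
  moreover have "h (struct_map V \<beta>) = \<sigma> \<beta>" if "\<beta> \<in> carrier B" for \<beta>
    using that hq[of "struct_map P \<beta>"] es by (simp add: q_struct PA.struct_closed)
  ultimately show ?thesis using h by blast
qed

lemma V_hom_eq:
  assumes C: "cring C" and h: "h \<in> ring_hom V C" and h': "h' \<in> ring_hom V C"
    and eq: "h X = h' X" "h Y = h' Y" "\<And>\<beta>. \<beta> \<in> carrier B \<Longrightarrow> h (struct_map V \<beta>) = h' (struct_map V \<beta>)"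
    and z: "z \<in> carrier V"
  shows "h z = h' z"
proof -
  obtain f where f: "f \<in> carrier P" and zf: "z = q f" using z by (auto simp: V_eq Q_sel)
  have "(h \<circ> q) f = (h' \<circ> q) f"
  proof (rule mpoly_hom_eq[OF B.is_cring C _ _ _ _ f])
    show "(h \<circ> q) (mvar B {v, w} u) = (h' \<circ> q) (mvar B {v, w} u)" if "u \<in> {v, w}" for u
      using that eq(1,2) by (elim insertE) (simp_all add: tgen_def)
    show "(h \<circ> q) (struct_map P r) = (h' \<circ> q) (struct_map P r)" if "r \<in> carrier B" for r
      using eq(3)[OF that] q_struct[OF that] by simp
  qed (rule ring_hom_trans[OF qh.homh h] ring_hom_trans[OF qh.homh h'])+
  then show ?thesis by (simp add: zf)
qed

lemma mvar_pow:
  assumes "u \<in> {v, w}"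
  shows "mvar B {v, w} u [^]\<^bsub>P\<^esub> (n::nat) = mterm B \<one>\<^bsub>B\<^esub> (replicate_mset n u)"
proof (induction n)
  case 0
  show ?case using FF.F_sel(3) by (simp add: P_eq) (simp add: monomials_def)
next
  case (Suc n)
  then show ?case
    using FF.F_mult_mterm[of "\<one>\<^bsub>B\<^esub>" "\<one>\<^bsub>B\<^esub>" "replicate_mset n u" "{#u#}"] assms
    by (simp add: mvar_def msingle_eq_mterm P_eq) (auto simp: monomials_def)
qed

lemma mvar_prod:
  "mvar B {v, w} v [^]\<^bsub>P\<^esub> (i::nat) \<otimes>\<^bsub>P\<^esub> mvar B {v, w} w [^]\<^bsub>P\<^esub> (j::nat) =
    mterm B \<one>\<^bsub>B\<^esub> (replicate_mset i v + replicate_mset j w)"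
proof -
  have "set_mset (replicate_mset i v) \<subseteq> {v, w}" "set_mset (replicate_mset j w) \<subseteq> {v, w}"
    by (auto simp: set_mset_replicate_mset_subset)
  then show ?thesis
    using FF.F_mult_mterm[of "\<one>\<^bsub>B\<^esub>" "\<one>\<^bsub>B\<^esub>" "replicate_mset i v" "replicate_mset j w"]
    by (simp add: mvar_pow P_eq) (simp add: monomials_def)
qed

lemma mset_vw: "set_mset m \<subseteq> {v, w} \<Longrightarrow> m = replicate_mset (count m v) v + replicate_mset (count m w) w"
  using vw by (intro multiset_eqI) (auto simp: not_in_iff[symmetric] intro: count_inI)

lemma q_mterm:
  assumes r: "r \<in> carrier B" and m: "set_mset m \<subseteq> {v, w}"
  shows "q (mterm B r m) = r \<odot>\<^bsub>V\<^esub> (X [^]\<^bsub>V\<^esub> count m v \<otimes>\<^bsub>V\<^esub> Y [^]\<^bsub>V\<^esub> count m w)"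
proof -
  let ?x = "mvar B {v, w} v" and ?y = "mvar B {v, w} w"
  have "mterm B r m = r \<odot>\<^bsub>P\<^esub> (?x [^]\<^bsub>P\<^esub> count m v \<otimes>\<^bsub>P\<^esub> ?y [^]\<^bsub>P\<^esub> count m w)"
    unfolding mvar_prod mset_vw[OF m, symmetric]
    using FF.smult_mterm[OF r B.one_closed, of m] r by (simp add: P_eq)
  then show ?thesis
    using mv_closed r alg_hom_smult[OF q_hom r, of "?x [^]\<^bsub>P\<^esub> count m v \<otimes>\<^bsub>P\<^esub> ?y [^]\<^bsub>P\<^esub> count m w"]
    by (simp add: tgen_def qh.hom_nat_pow V_eq[symmetric])
qed

lemma pow_reduce:
  assumes z: "z \<in> carrier V" and zp: "z [^]\<^bsub>V\<^esub> p = struct_map V c" and c: "c \<in> carrier B"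
  shows "z [^]\<^bsub>V\<^esub> (i::nat) = (c [^]\<^bsub>B\<^esub> (i div p)) \<odot>\<^bsub>V\<^esub> z [^]\<^bsub>V\<^esub> (i mod p)"
proof -
  interpret s: ring_hom_cring B V "struct_map V"
    using VA.struct_hom V_cring B.is_cring by (simp add: ring_hom_cring_def ring_hom_cring_axioms_def)
  have "z [^]\<^bsub>V\<^esub> i = z [^]\<^bsub>V\<^esub> (p * (i div p) + i mod p)" by simp
  also have "\<dots> = (z [^]\<^bsub>V\<^esub> p) [^]\<^bsub>V\<^esub> (i div p) \<otimes>\<^bsub>V\<^esub> z [^]\<^bsub>V\<^esub> (i mod p)"
    using z by (simp only: VA.nat_pow_mult[symmetric] VA.nat_pow_pow)
  also have "\<dots> = (c [^]\<^bsub>B\<^esub> (i div p)) \<odot>\<^bsub>V\<^esub> z [^]\<^bsub>V\<^esub> (i mod p)"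
    unfolding zp s.hom_nat_pow[OF c, symmetric] using z c by (intro VA.smult_eq_mult[symmetric]) auto
  finally show ?thesis .
qed

text \<open>A generator to the power i equals a constant times the same generator to the power
  \<open>i mod p\<close>, so the monomials indexed by \<open>idx p\<close> span.\<close>

lemma V_induct [consumes 1, case_names mon add]:
  assumes z: "z \<in> carrier V"
    and m: "\<And>\<beta> j. \<beta> \<in> carrier B \<Longrightarrow> j \<in> idx p \<Longrightarrow> Pr (\<beta> \<odot>\<^bsub>V\<^esub> mon j)"
    and ad: "\<And>x y. x \<in> carrier V \<Longrightarrow> y \<in> carrier V \<Longrightarrow> Pr x \<Longrightarrow> Pr y \<Longrightarrow> Pr (x \<oplus>\<^bsub>V\<^esub> y)"
  shows "Pr z"
proof -
  obtain f where f: "f \<in> carrier P" and zf: "z = q f" using z by (auto simp: V_eq Q_sel)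
  show ?thesis unfolding zf using f[folded P_eq]
  proof (induction f rule: FF.F_induct)
    case zero
    have "\<zero>\<^bsub>B\<^esub> \<odot>\<^bsub>V\<^esub> mon (0, 0) = q \<zero>\<^bsub>P\<^esub>" by simp
    then show ?case using m[of "\<zero>\<^bsub>B\<^esub>" "(0, 0)"] p0 by (simp add: idx_def P_eq)
  next
    case (mterm r m')
    then have m': "set_mset m' \<subseteq> {v, w}" by (simp add: monomials_def)
    define i j where "i = count m' v" and "j = count m' w"
    have "q (mterm B r m') = r \<odot>\<^bsub>V\<^esub> (((a [^]\<^bsub>B\<^esub> (i div p)) \<odot>\<^bsub>V\<^esub> X [^]\<^bsub>V\<^esub> (i mod p)) \<otimes>\<^bsub>V\<^esub>
        ((b [^]\<^bsub>B\<^esub> (j div p)) \<odot>\<^bsub>V\<^esub> Y [^]\<^bsub>V\<^esub> (j mod p)))"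
      using q_mterm[OF mterm(1) m'] pow_reduce[OF gen_closed(1) gen_pow(1) ab(1), of i]
        pow_reduce[OF gen_closed(2) gen_pow(2) ab(2), of j] by (simp add: i_def j_def)
    also have "\<dots> = (r \<otimes>\<^bsub>B\<^esub> (a [^]\<^bsub>B\<^esub> (i div p) \<otimes>\<^bsub>B\<^esub> b [^]\<^bsub>B\<^esub> (j div p))) \<odot>\<^bsub>V\<^esub> mon (i mod p, j mod p)"
      using mterm(1) ab by (simp add: VA.smult_mult_smult VA.smult_assoc1 tmon_def)
    finally show ?case using m[of _ "(i mod p, j mod p)"] mterm(1) ab p0 by (simp add: idx_def)
  next
    case (add f g)
    then show ?case using ad[of "q f" "q g"] by (simp add: P_eq)
  qed
qed

lemma additive_ext:
  assumes h: "h \<in> additive_map V C" and h': "h' \<in> additive_map V C"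
    and eq: "\<And>\<beta> j. \<beta> \<in> carrier B \<Longrightarrow> j \<in> idx p \<Longrightarrow> h (\<beta> \<odot>\<^bsub>V\<^esub> mon j) = h' (\<beta> \<odot>\<^bsub>V\<^esub> mon j)"
    and z: "z \<in> carrier V"
  shows "h z = h' z"
  using z by (induction z rule: V_induct) (simp_all add: eq additive_map_add[OF h] additive_map_add[OF h'])

text \<open>Linear independence of the monomials. The map is first defined on all monomials of the
  polynomial ring by reducing exponents modulo \<open>p\<close> and recording the quotients as
  powers of \<open>a\<close> and \<open>b\<close>. Raising an exponent by \<open>p\<close> then
  multiplies the value by the matching constant, so every multiple of a relation is killed.\<close>

lemma tlin_exists:
  assumes C: "cring C" and \<sigma>: "\<sigma> \<in> ring_hom B C" and t: "t \<in> idx p \<rightarrow> carrier C"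
  shows "\<exists>h. h \<in> additive_map V C \<and>
      (\<forall>\<beta>\<in>carrier B. \<forall>z\<in>carrier V. h (\<beta> \<odot>\<^bsub>V\<^esub> z) = \<sigma> \<beta> \<otimes>\<^bsub>C\<^esub> h z) \<and> (\<forall>j\<in>idx p. h (mon j) = t j)"
proof -
  interpret C: cring C by fact
  define \<phi> where "\<phi> m = (\<sigma> a [^]\<^bsub>C\<^esub> (count m v div p) \<otimes>\<^bsub>C\<^esub> \<sigma> b [^]\<^bsub>C\<^esub> (count m w div p)) \<otimes>\<^bsub>C\<^esub>
    t (count m v mod p, count m w mod p)" for m
  have tc: "t (i mod p, j mod p) \<in> carrier C" for i j
    using t p0 by (auto simp: idx_def Pi_iff)
  have \<sigma>ab: "\<sigma> a \<in> carrier C" "\<sigma> b \<in> carrier C" using ring_hom_closed[OF \<sigma>] ab by auto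
  interpret T: monoid_alg_target B "monomials {v, w}" C \<sigma> \<phi>
    by (auto simp: monoid_alg_target_def monoid_alg_target_axioms_def FF.monoid_alg_axioms C \<sigma> \<phi>_def tc \<sigma>ab)
  have \<phi>c: "\<phi> m \<in> carrier C" for m by (simp add: \<phi>_def tc \<sigma>ab)
  have \<phi>v: "\<phi> (m + replicate_mset p v) = \<sigma> a \<otimes>\<^bsub>C\<^esub> \<phi> m" "\<phi> (m + replicate_mset p w) = \<sigma> b \<otimes>\<^bsub>C\<^esub> \<phi> m" for m
    using vw p0 by (simp_all add: \<phi>_def \<sigma>ab tc C.m_ac)
  have LA: "T.L \<in> additive_map P C"
    unfolding P_eq[symmetric] by (intro additive_mapI T.L_closed T.L_add)
  have st: "struct_map P r = mterm B r {#}" if "r \<in> carrier B" for r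
    using that FF.smult_mterm[of r "\<one>\<^bsub>B\<^esub>" "{#}"] FF.F_sel(3)
    by (simp add: struct_map_def P_eq) (simp add: monomials_def)
  have kill1: "T.L (mterm B r m \<otimes>\<^bsub>P\<^esub> (mvar B {v, w} u [^]\<^bsub>P\<^esub> p \<ominus>\<^bsub>P\<^esub> struct_map P c)) = \<zero>\<^bsub>C\<^esub>"
    if r: "r \<in> carrier B" and m: "set_mset m \<subseteq> {v, w}" and u: "u \<in> {v, w}" and c: "c \<in> carrier B"
      and \<phi>u: "\<phi> (m + replicate_mset p u) = \<sigma> c \<otimes>\<^bsub>C\<^esub> \<phi> m" for r m u c
  proof -
    let ?u = "mvar B {v, w} u [^]\<^bsub>P\<^esub> p"
    have ru: "set_mset (replicate_mset p u) \<subseteq> {v, w}" using u by (auto simp: set_mset_replicate_mset_subset)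
    have cl: "mterm B r m \<in> carrier P" "?u \<in> carrier P" "struct_map P c \<in> carrier P"
      using FF.mterm_closed[OF r, of m] m by (simp add: P_eq) (simp add: monomials_def,
        use u c mv_closed in \<open>auto simp: PA.struct_closed\<close>)
    have "T.L (mterm B r m \<otimes>\<^bsub>P\<^esub> (?u \<ominus>\<^bsub>P\<^esub> struct_map P c)) =
        T.L (mterm B r m \<otimes>\<^bsub>P\<^esub> ?u) \<ominus>\<^bsub>C\<^esub> T.L (mterm B r m \<otimes>\<^bsub>P\<^esub> struct_map P c)"
    proof -
      have "mterm B r m \<otimes>\<^bsub>P\<^esub> (?u \<ominus>\<^bsub>P\<^esub> struct_map P c) =
          mterm B r m \<otimes>\<^bsub>P\<^esub> ?u \<ominus>\<^bsub>P\<^esub> mterm B r m \<otimes>\<^bsub>P\<^esub> struct_map P c"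
        using cl by (simp add: PA.minus_eq PA.r_distr PA.r_minus)
      then show ?thesis using cl by (simp add: additive_map_minus[OF LA M_ring C.ring_axioms])
    qed
    also have "mterm B r m \<otimes>\<^bsub>P\<^esub> ?u = mterm B r (m + replicate_mset p u)"
      unfolding mvar_pow[OF u]
      using FF.F_mult_mterm[of r "\<one>\<^bsub>B\<^esub>" m "replicate_mset p u"] r m ru
      by (simp add: P_eq) (simp add: monomials_def)
    also have "mterm B r m \<otimes>\<^bsub>P\<^esub> struct_map P c = mterm B (r \<otimes>\<^bsub>B\<^esub> c) m"
      unfolding st[OF c] using FF.F_mult_mterm[of r c m "{#}"] r m c
      by (simp add: P_eq) (simp add: monomials_def)
    also have "T.L (mterm B r (m + replicate_mset p u)) = \<sigma> r \<otimes>\<^bsub>C\<^esub> (\<sigma> c \<otimes>\<^bsub>C\<^esub> \<phi> m)"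
      using T.L_mterm[OF r, of "m + replicate_mset p u"] m ru \<phi>u by (simp add: monomials_def)
    also have "T.L (mterm B (r \<otimes>\<^bsub>B\<^esub> c) m) = \<sigma> r \<otimes>\<^bsub>C\<^esub> (\<sigma> c \<otimes>\<^bsub>C\<^esub> \<phi> m)"
      using T.L_mterm[of "r \<otimes>\<^bsub>B\<^esub> c" m] m r c by (simp add: monomials_def T.\<sigma>_simps C.m_assoc \<phi>c)
    finally show ?thesis using r c by (simp add: T.\<sigma>_simps \<phi>c)
  qed
  have kill: "T.L (f \<otimes>\<^bsub>P\<^esub> g) = \<zero>\<^bsub>C\<^esub>" if g: "g \<in> trunc_rels B p v w a b" and f: "f \<in> carrier P" for f g
  proof -
    have gP: "g \<in> carrier P" using g rels_closed by blast
    show ?thesis using f[folded P_eq]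
    proof (induction f rule: FF.F_induct)
      case zero
      show ?case using gP T.L_zero by (simp add: P_eq)
    next
      case (mterm r m)
      then show ?case using g kill1[of r m v a] kill1[of r m w b] \<phi>v ab
        by (auto simp: trunc_rels_def Let_def monomials_def)
    next
      case (add f f')
      then show ?case using gP additive_map_add[OF LA] by (simp add: P_eq PA.l_distr)
    qed
  qed
  have "T.L x = \<zero>\<^bsub>C\<^esub>" if "x \<in> K" for x
    using PA.genideal_kill[OF rels_closed LA C.ring_axioms kill that] .
  then obtain h where h: "h \<in> additive_map V C" and hq: "\<And>x. x \<in> carrier P \<Longrightarrow> h (q x) = T.L x"
    using factor_additive[OF LA C.ring_axioms] unfolding V_eq by blast
  have "h (\<beta> \<odot>\<^bsub>V\<^esub> z) = \<sigma> \<beta> \<otimes>\<^bsub>C\<^esub> h z" if \<beta>: "\<beta> \<in> carrier B" and z: "z \<in> carrier V" for \<beta> z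
  proof -
    obtain f where f: "f \<in> carrier P" and zf: "z = q f" using z by (auto simp: V_eq Q_sel)
    show ?thesis using f \<beta> hq T.L_smult[of f \<beta>] by (simp add: zf V_eq q_smult P_eq)
  qed
  moreover have "h (mon j) = t j" if j: "j \<in> idx p" for j
  proof -
    obtain k l where kl: "j = (k, l)" "k < p" "l < p" using j by (auto simp: idx_def)
    have ru: "set_mset (replicate_mset k v + replicate_mset l w) \<subseteq> {v, w}"
      by (auto simp: set_mset_replicate_mset_subset)
    have "mon j = q (mvar B {v, w} v [^]\<^bsub>P\<^esub> k \<otimes>\<^bsub>P\<^esub> mvar B {v, w} w [^]\<^bsub>P\<^esub> l)"
      using mv_closed by (simp add: kl tmon_def tgen_def qh.hom_nat_pow)
    then have "h (mon j) = T.L (mterm B \<one>\<^bsub>B\<^esub> (replicate_mset k v + replicate_mset l w))"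
      using hq[of "mvar B {v, w} v [^]\<^bsub>P\<^esub> k \<otimes>\<^bsub>P\<^esub> mvar B {v, w} w [^]\<^bsub>P\<^esub> l"] mv_closed
      by (simp add: mvar_prod[symmetric])
    also have "\<dots> = \<phi> (replicate_mset k v + replicate_mset l w)"
      using T.L_mterm[OF B.one_closed, of "replicate_mset k v + replicate_mset l w"] ru
      by (simp add: monomials_def T.\<sigma>_simps \<phi>c)
    also have "\<dots> = t j" using kl vw tc[of k l] by (simp add: \<phi>_def)
    finally show ?thesis .
  qed
  ultimately show ?thesis using h by blast
qed

context
  fixes C :: "('c, 'n) ring_scheme" and \<sigma> t
  assumes C: "cring C" and \<sigma>: "\<sigma> \<in> ring_hom B C" and t: "t \<in> idx p \<rightarrow> carrier C"
begin

lemma tlin_props: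
  "tlin B p v w a b C \<sigma> t \<in> additive_map V C"
  "\<beta> \<in> carrier B \<Longrightarrow> z \<in> carrier V \<Longrightarrow>
    tlin B p v w a b C \<sigma> t (\<beta> \<odot>\<^bsub>V\<^esub> z) = \<sigma> \<beta> \<otimes>\<^bsub>C\<^esub> tlin B p v w a b C \<sigma> t z"
  "j \<in> idx p \<Longrightarrow> tlin B p v w a b C \<sigma> t (mon j) = t j"
  using someI_ex[OF tlin_exists[OF C \<sigma> t]] unfolding tlin_def by blast+

lemma tlin_closed: "z \<in> carrier V \<Longrightarrow> tlin B p v w a b C \<sigma> t z \<in> carrier C"
  using additive_map_closed[OF tlin_props(1)] .

end

section \<open>Coordinates in the monomial basis, flatness and surjectivity on spectra\<close>

definition coef :: "nat \<times> nat \<Rightarrow> ('v multiset \<Rightarrow> 'b) set \<Rightarrow> 'b"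
  where "coef j = tlin B p v w a b B (\<lambda>x. x) (\<lambda>i. if i = j then \<one>\<^bsub>B\<^esub> else \<zero>\<^bsub>B\<^esub>)"

lemma coef_props:
  "coef j \<in> additive_map V B"
  "\<beta> \<in> carrier B \<Longrightarrow> z \<in> carrier V \<Longrightarrow> coef j (\<beta> \<odot>\<^bsub>V\<^esub> z) = \<beta> \<otimes>\<^bsub>B\<^esub> coef j z"
  "i \<in> idx p \<Longrightarrow> coef j (mon i) = (if i = j then \<one>\<^bsub>B\<^esub> else \<zero>\<^bsub>B\<^esub>)"
proof -
  have id: "(\<lambda>x. x) \<in> ring_hom B B" by (auto simp: ring_hom_def)
  have t: "(\<lambda>i. if i = j then \<one>\<^bsub>B\<^esub> else \<zero>\<^bsub>B\<^esub>) \<in> idx p \<rightarrow> carrier B" by auto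
  note * = tlin_props[OF B.is_cring id t, folded coef_def]
  show "coef j \<in> additive_map V B"
    "\<beta> \<in> carrier B \<Longrightarrow> z \<in> carrier V \<Longrightarrow> coef j (\<beta> \<odot>\<^bsub>V\<^esub> z) = \<beta> \<otimes>\<^bsub>B\<^esub> coef j z"
    "i \<in> idx p \<Longrightarrow> coef j (mon i) = (if i = j then \<one>\<^bsub>B\<^esub> else \<zero>\<^bsub>B\<^esub>)"
    by (rule *; assumption)+
qed

lemma coef_closed: "z \<in> carrier V \<Longrightarrow> coef j z \<in> carrier B"
  using additive_map_closed[OF coef_props(1)] .

lemma mon00: "mon (0, 0) = \<one>\<^bsub>V\<^esub>"
  by (simp add: tmon_def)

lemma coef00_struct: "\<beta> \<in> carrier B \<Longrightarrow> coef (0, 0) (struct_map V \<beta>) = \<beta>"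
  using coef_props(2)[of \<beta> "mon (0, 0)" "(0, 0)"] coef_props(3)[of "(0, 0)" "(0, 0)"] p0
  by (simp add: struct_map_def mon00 idx_def)

lemma expand:
  assumes z: "z \<in> carrier V"
  shows "z = (\<Oplus>\<^bsub>V\<^esub>j\<in>idx p. coef j z \<odot>\<^bsub>V\<^esub> mon j)"
proof -
  have c: "coef j x \<odot>\<^bsub>V\<^esub> mon j \<in> carrier V" if "x \<in> carrier V" for x j
    using that by (simp add: coef_closed)
  show ?thesis
  proof (rule additive_ext[OF _ _ _ z, of "\<lambda>z. z" V])
    show "(\<lambda>z. z) \<in> additive_map V V" by (auto intro: additive_mapI)
    show "(\<lambda>z. \<Oplus>\<^bsub>V\<^esub>j\<in>idx p. coef j z \<odot>\<^bsub>V\<^esub> mon j) \<in> additive_map V V"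
    proof (rule additive_mapI)
      fix x y assume xy: "x \<in> carrier V" "y \<in> carrier V"
      have "(\<Oplus>\<^bsub>V\<^esub>j\<in>idx p. coef j (x \<oplus>\<^bsub>V\<^esub> y) \<odot>\<^bsub>V\<^esub> mon j) =
          (\<Oplus>\<^bsub>V\<^esub>j\<in>idx p. coef j x \<odot>\<^bsub>V\<^esub> mon j \<oplus>\<^bsub>V\<^esub> coef j y \<odot>\<^bsub>V\<^esub> mon j)"
        using xy c by (intro VA.finsum_cong')
          (auto simp: additive_map_add[OF coef_props(1)] VA.smult_l_distr coef_closed)
      then show "(\<Oplus>\<^bsub>V\<^esub>j\<in>idx p. coef j (x \<oplus>\<^bsub>V\<^esub> y) \<odot>\<^bsub>V\<^esub> mon j) =
          (\<Oplus>\<^bsub>V\<^esub>j\<in>idx p. coef j x \<odot>\<^bsub>V\<^esub> mon j) \<oplus>\<^bsub>V\<^esub> (\<Oplus>\<^bsub>V\<^esub>j\<in>idx p. coef j y \<odot>\<^bsub>V\<^esub> mon j)"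
        using xy c by (simp add: VA.finsum_addf)
    qed (use c in auto)
    fix \<beta> j assume \<beta>: "\<beta> \<in> carrier B" and j: "j \<in> idx p"
    have "(\<Oplus>\<^bsub>V\<^esub>i\<in>idx p. coef i (\<beta> \<odot>\<^bsub>V\<^esub> mon j) \<odot>\<^bsub>V\<^esub> mon i) =
        (\<Oplus>\<^bsub>V\<^esub>i\<in>idx p. if j = i then \<beta> \<odot>\<^bsub>V\<^esub> mon i else \<zero>\<^bsub>V\<^esub>)"
      using \<beta> j by (intro VA.finsum_cong') (auto simp: coef_props)
    also have "\<dots> = \<beta> \<odot>\<^bsub>V\<^esub> mon j"
      using j \<beta> by (intro VA.add.finprod_singleton) (auto simp: idx_def)
    finally show "\<beta> \<odot>\<^bsub>V\<^esub> mon j = (\<Oplus>\<^bsub>V\<^esub>i\<in>idx p. coef i (\<beta> \<odot>\<^bsub>V\<^esub> mon j) \<odot>\<^bsub>V\<^esub> mon i)" ..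
  qed
qed

text \<open>A free module: a linear relation holds coordinatewise, so the basis and the coordinates
  of the given elements are the data demanded by the equational criterion.\<close>

lemma V_flat: "flat B V"
  unfolding flat_def
proof (intro allI impI, elim conjE)
  fix n f x assume f: "f \<in> {..<n} \<rightarrow> carrier B" and x: "x \<in> {..<n} \<rightarrow> carrier V"
    and z: "(\<Oplus>\<^bsub>V\<^esub>k\<in>{..<n}. f k \<odot>\<^bsub>V\<^esub> x k) = \<zero>\<^bsub>V\<^esub>"
  \<comment> \<open>The criterion numbers its generators by an initial segment of the naturals;
    quotient and remainder by \<open>p\<close> match it with \<open>idx p\<close>.\<close>
  define \<pi> where "\<pi> j = (j div p, j mod p)" for j
  have \<pi>inj: "inj_on \<pi> {..<p * p}"
    by (rule inj_onI) (metis \<pi>_def div_mult_mod_eq prod.inject)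
  have \<pi>im: "\<pi> ` {..<p * p} = idx p"
  proof
    show "\<pi> ` {..<p * p} \<subseteq> idx p" using p0 by (auto simp: \<pi>_def idx_def less_mult_imp_div_less)
    show "idx p \<subseteq> \<pi> ` {..<p * p}"
    proof
      fix j assume "j \<in> idx p"
      then obtain k l where kl: "j = (k, l)" "k < p" "l < p" by (auto simp: idx_def)
      have "k * p + l < (k + 1) * p" using kl by simp
      also have "\<dots> \<le> p * p" using kl by (intro mult_le_mono1) simp
      finally have "k * p + l < p * p" .
      moreover have "\<pi> (k * p + l) = j" using kl by (simp add: \<pi>_def)
      ultimately show "j \<in> \<pi> ` {..<p * p}" by force
    qed
  qed
  have e: "x k = (\<Oplus>\<^bsub>V\<^esub>j\<in>{..<p * p}. coef (\<pi> j) (x k) \<odot>\<^bsub>V\<^esub> mon (\<pi> j))" if k: "k < n" for k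
  proof -
    have xk: "x k \<in> carrier V" using x k by auto
    have "(\<Oplus>\<^bsub>V\<^esub>j\<in>{..<p * p}. coef (\<pi> j) (x k) \<odot>\<^bsub>V\<^esub> mon (\<pi> j)) =
        (\<Oplus>\<^bsub>V\<^esub>j\<in>\<pi> ` {..<p * p}. coef j (x k) \<odot>\<^bsub>V\<^esub> mon j)"
      using xk by (intro VA.finsum_reindex[symmetric] \<pi>inj) (auto simp: coef_closed)
    then show ?thesis using expand[OF xk] by (simp add: \<pi>im)
  qed
  have r: "(\<Oplus>\<^bsub>B\<^esub>k\<in>{..<n}. f k \<otimes>\<^bsub>B\<^esub> coef j (x k)) = \<zero>\<^bsub>B\<^esub>" for j
  proof -
    have "(\<Oplus>\<^bsub>B\<^esub>k\<in>{..<n}. f k \<otimes>\<^bsub>B\<^esub> coef j (x k)) = (\<Oplus>\<^bsub>B\<^esub>k\<in>{..<n}. coef j (f k \<odot>\<^bsub>V\<^esub> x k))"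
      using f x by (intro B.finsum_cong') (auto simp: coef_props(2) Pi_iff coef_closed)
    also have "\<dots> = coef j (\<Oplus>\<^bsub>V\<^esub>k\<in>{..<n}. f k \<odot>\<^bsub>V\<^esub> x k)"
      using f x by (intro additive_map_finsum[symmetric] coef_props cring.axioms(1)[OF V_cring] B.ring_axioms) (auto simp: Pi_iff)
    also have "\<dots> = \<zero>\<^bsub>B\<^esub>"
      unfolding z by (rule additive_map_zero[OF coef_props(1) cring.axioms(1)[OF V_cring] B.ring_axioms])
    finally show ?thesis .
  qed
  show "\<exists>(l::nat) c y. (\<forall>k<n. \<forall>j<l. c k j \<in> carrier B) \<and> y \<in> {..<l} \<rightarrow> carrier V \<and>
        (\<forall>k<n. x k = (\<Oplus>\<^bsub>V\<^esub>j\<in>{..<l}. c k j \<odot>\<^bsub>V\<^esub> y j)) \<and>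
        (\<forall>j<l. (\<Oplus>\<^bsub>B\<^esub>k\<in>{..<n}. f k \<otimes>\<^bsub>B\<^esub> c k j) = \<zero>\<^bsub>B\<^esub>)"
    using e r x
    by (intro exI[of _ "p * p"] exI[of _ "\<lambda>k j. coef (\<pi> j) (x k)"] exI[of _ "\<lambda>j. mon (\<pi> j)"])
      (auto simp: Pi_iff coef_closed)
qed

text \<open>In characteristic \<open>p\<close> the Frobenius of \<open>V\<close> factors through \<open>B\<close>; the prime of \<open>V\<close> over \<open>Q\<close> is
  the preimage of \<open>Q\<close> under this map \<open>V \<rightarrow> B\<close>.\<close>

lemma V_spec_surjective:
  assumes p: "Factorial_Ring.prime p" and char: "[p] \<cdot>\<^bsub>B\<^esub> \<one>\<^bsub>B\<^esub> = \<zero>\<^bsub>B\<^esub>"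
  shows "spec_surjective B V"
  unfolding spec_surjective_def
proof (intro allI impI)
  fix I assume I: "primeideal I B"
  interpret I: primeideal I B by fact
  have fr: "(\<lambda>x. x [^]\<^bsub>B\<^esub> p) \<in> ring_hom B B"
    by (rule ring_hom_memI) (simp_all add: B.nat_pow_distrib B.frobenius_add[OF p char])
  \<comment> \<open>Relative to the Frobenius on coefficients the relations ask for p-th roots of
    the p-th powers of \<open>a\<close> and \<open>b\<close>, so the generators may go to
    \<open>a\<close> and \<open>b\<close> themselves.\<close>
  obtain h where h: "h \<in> ring_hom V B" and hs: "\<And>\<beta>. \<beta> \<in> carrier B \<Longrightarrow> h (struct_map V \<beta>) = \<beta> [^]\<^bsub>B\<^esub> p"
    using V_lift[OF B.is_cring fr ab refl refl] by blast
  interpret h: ring_hom_cring V B h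
    using h V_cring B.is_cring by (simp add: ring_hom_cring_def ring_hom_cring_axioms_def)
  \<comment> \<open>Prime ideals are radical; this turns membership of the Frobenius image back into
    membership of the element.\<close>
  have pw: "\<beta> [^]\<^bsub>B\<^esub> (n::nat) \<in> I \<Longrightarrow> 0 < n \<Longrightarrow> \<beta> \<in> I" if "\<beta> \<in> carrier B" for \<beta> n
  proof (induction n)
    case (Suc n)
    then show ?case using that I.I_prime[of "\<beta> [^]\<^bsub>B\<^esub> n" \<beta>] I.one_imp_carrier I.I_notcarr
      by (cases n) auto
  qed simp
  have "ring_hom_ring V B h"
    by (rule ring_hom_ringI2[OF cring.axioms(1)[OF V_cring] B.ring_axioms h])
  then have id: "ideal {z \<in> carrier V. h z \<in> I} V"
    using ring_hom_ring.ideal_vimage[OF _ I.is_ideal] by blast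
  have "primeideal {z \<in> carrier V. h z \<in> I} V"
  proof (rule primeidealI[OF id V_cring])
    show "carrier V \<noteq> {z \<in> carrier V. h z \<in> I}"
      using h.hom_one I.one_imp_carrier I.I_notcarr VA.one_closed by (metis (mono_tags, lifting) mem_Collect_eq)
    fix x y assume "x \<in> carrier V" "y \<in> carrier V" "x \<otimes>\<^bsub>V\<^esub> y \<in> {z \<in> carrier V. h z \<in> I}"
    then show "x \<in> {z \<in> carrier V. h z \<in> I} \<or> y \<in> {z \<in> carrier V. h z \<in> I}"
      using I.I_prime[of "h x" "h y"] by auto
  qed
  moreover have "I = {\<beta> \<in> carrier B. struct_map V \<beta> \<in> {z \<in> carrier V. h z \<in> I}}"
  proof -
    have "\<beta> [^]\<^bsub>B\<^esub> p \<in> I" if "\<beta> \<in> I" for \<beta>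
      using that p0 I.I_l_closed[of \<beta> "\<beta> [^]\<^bsub>B\<^esub> (p - 1)"] I.Icarr[OF that]
      by (cases p) auto
    then have "\<beta> \<in> I \<longleftrightarrow> h (struct_map V \<beta>) \<in> I" if "\<beta> \<in> carrier B" for \<beta>
      using pw[OF that _ p0] hs[OF that] by auto
    then show ?thesis using I.Icarr VA.struct_closed by blast
  qed
  ultimately show "\<exists>Q. primeideal Q V \<and> I = {\<beta> \<in> carrier B. struct_map V \<beta> \<in> Q}" by blast
qed

end

section \<open>Points of the unit group scheme\<close>

lemma additive_map_add_pow:
  assumes h: "h \<in> additive_map A B" and A: "ring A" and B: "ring B" and x: "x \<in> carrier A"
  shows "h ([(n::nat)] \<cdot>\<^bsub>A\<^esub> x) = [n] \<cdot>\<^bsub>B\<^esub> h x"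
proof -
  interpret A: ring A by fact
  interpret B: ring B by fact
  show ?thesis
    by (induction n) (simp_all add: x additive_map_zero[OF h A B] additive_map_add[OF h])
qed

text \<open>An inverse given as a power is a polynomial expression, so every ring homomorphism
  visibly commutes with it.\<close>

lemma (in cring) mult_one_pow_pred:
  assumes "z \<in> carrier R" "z [^] (p::nat) = \<one>" "0 < p"
  shows "z [^] (p - 1) \<otimes> z = \<one>" "z [^] (p - 1) \<in> carrier R"
proof -
  have "z [^] Suc (p - 1) = \<one>" using assms by simp
  then show "z [^] (p - 1) \<otimes> z = \<one>" by simp
qed (use assms in simp)

lemma (in cring) Units_of_mult: "x \<in> carrier R \<Longrightarrow> y \<in> carrier R \<Longrightarrow> x \<otimes> y \<in> Units R \<Longrightarrow> x \<in> Units R"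
  using unit_factor[of x y] by blast

lemma (in cring) Units_of_pow: "x \<in> carrier R \<Longrightarrow> x [^] (n::nat) \<in> Units R \<Longrightarrow> 0 < n \<Longrightarrow> x \<in> Units R"
  by (cases n) (auto simp: m_comm intro: Units_of_mult[of x "x [^] (n - 1)"])

text \<open>A test ring with the image \<open>l\<close> of the parameter. The base ring is absent:
  over a fixed test ring all computations concern one truncated algebra, and the passage between
  test rings is a matter of naturality.\<close>

locale point_ring = B: cring B for B :: "('b, 'k) ring_scheme" (structure) +
  fixes p :: nat and l :: 'b
  assumes p: "Factorial_Ring.prime p" and char: "[p] \<cdot> \<one> = \<zero>" and l [simp]: "l \<in> carrier B"
begin

lemma p_gt: "0 < p" "1 < p"
  using prime_gt_0_nat[OF p] prime_gt_1_nat[OF p] by auto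

lemma idx_small: "(0, 0) \<in> idx p" "(1, 0) \<in> idx p" "(0, 1) \<in> idx p"
  using p_gt by (auto simp: idx_def)

lemma truncI: "a \<in> carrier B \<Longrightarrow> b \<in> carrier B \<Longrightarrow> trunc_alg B p CX CY a b"
  using p_gt by unfold_locales auto

lemma id_hom: "(\<lambda>x. x) \<in> ring_hom B B"
  by (auto simp: ring_hom_def)

sublocale V: trunc_alg B p CX CY \<zero> \<zero>
  by (rule truncI) auto

abbreviation cst where "cst \<equiv> struct_map V.V"
abbreviation X where "X \<equiv> V.X"
abbreviation Y where "Y \<equiv> V.Y"

sublocale cs: ring_hom_cring B V.V cst
  using V.VA.struct_hom V.V_cring B.is_cring by (simp add: ring_hom_cring_def ring_hom_cring_axioms_def)

lemma V_char: "[p] \<cdot>\<^bsub>V.V\<^esub> \<one>\<^bsub>V.V\<^esub> = \<zero>\<^bsub>V.V\<^esub>"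
  by (rule V.VA.algebra_char[OF char])

lemma V_frobenius:
  "x \<in> carrier V.V \<Longrightarrow> y \<in> carrier V.V \<Longrightarrow> (x \<oplus>\<^bsub>V.V\<^esub> y) [^]\<^bsub>V.V\<^esub> p = x [^]\<^bsub>V.V\<^esub> p \<oplus>\<^bsub>V.V\<^esub> y [^]\<^bsub>V.V\<^esub> p"
  "x \<in> carrier V.V \<Longrightarrow> y \<in> carrier V.V \<Longrightarrow> (x \<ominus>\<^bsub>V.V\<^esub> y) [^]\<^bsub>V.V\<^esub> p = x [^]\<^bsub>V.V\<^esub> p \<ominus>\<^bsub>V.V\<^esub> y [^]\<^bsub>V.V\<^esub> p"
  by (rule cring.frobenius_add[OF V.V_cring p V_char] cring.frobenius_minus[OF V.V_cring p V_char]; assumption)+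

lemma XY_pow: "X [^]\<^bsub>V.V\<^esub> p = \<zero>\<^bsub>V.V\<^esub>" "Y [^]\<^bsub>V.V\<^esub> p = \<zero>\<^bsub>V.V\<^esub>"
  by (simp_all add: V.gen_pow)

text \<open>Depends on the values of \<open>t\<close> on \<open>idx p\<close> alone; elsewhere
  \<open>t\<close> is arbitrary.\<close>

definition Lt :: "(nat \<times> nat \<Rightarrow> 'b) \<Rightarrow> (coord multiset \<Rightarrow> 'b) set \<Rightarrow> 'b"
  where "Lt t = tlin B p CX CY \<zero> \<zero> B (\<lambda>x. x) t"

lemma Lt_props:
  assumes "t \<in> idx p \<rightarrow> carrier B"
  shows "Lt t \<in> additive_map V.V B"
    and "\<beta> \<in> carrier B \<Longrightarrow> z \<in> carrier V.V \<Longrightarrow> Lt t (cst \<beta> \<otimes>\<^bsub>V.V\<^esub> z) = \<beta> \<otimes> Lt t z"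
    and "j \<in> idx p \<Longrightarrow> Lt t (V.mon j) = t j"
    and "z \<in> carrier V.V \<Longrightarrow> Lt t z \<in> carrier B"
  using V.tlin_props[OF B.is_cring id_hom assms] V.tlin_closed[OF B.is_cring id_hom assms]
  by (auto simp: Lt_def V.VA.smult_eq_mult)

lemma Lt_one: "t \<in> idx p \<rightarrow> carrier B \<Longrightarrow> Lt t \<one>\<^bsub>V.V\<^esub> = t (0, 0)"
  using Lt_props(3)[OF _ idx_small(1)] by (simp add: V.mon00)

lemma Lt_X: "t \<in> idx p \<rightarrow> carrier B \<Longrightarrow> Lt t X = t (1, 0)"
  using Lt_props(3)[OF _ idx_small(2)] by (simp add: tmon_def)

lemma Lt_cst: "t \<in> idx p \<rightarrow> carrier B \<Longrightarrow> \<beta> \<in> carrier B \<Longrightarrow> Lt t (cst \<beta>) = \<beta> \<otimes> t (0, 0)"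
  using Lt_props(2)[of t \<beta> "\<one>\<^bsub>V.V\<^esub>"] by (simp add: Lt_one)

lemma Lt_add: "t \<in> idx p \<rightarrow> carrier B \<Longrightarrow> x \<in> carrier V.V \<Longrightarrow> y \<in> carrier V.V \<Longrightarrow>
    Lt t (x \<oplus>\<^bsub>V.V\<^esub> y) = Lt t x \<oplus> Lt t y"
  by (rule additive_map_add[OF Lt_props(1)])

lemma Lt_minus: "t \<in> idx p \<rightarrow> carrier B \<Longrightarrow> x \<in> carrier V.V \<Longrightarrow> y \<in> carrier V.V \<Longrightarrow>
    Lt t (x \<ominus>\<^bsub>V.V\<^esub> y) = Lt t x \<ominus> Lt t y"
  by (rule additive_map_minus[OF Lt_props(1) V.VA.ring_axioms B.ring_axioms])

lemma Lt_unique: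
  assumes t: "t \<in> idx p \<rightarrow> carrier B" and h: "h \<in> additive_map V.V B"
    and hs: "\<And>\<beta> z. \<beta> \<in> carrier B \<Longrightarrow> z \<in> carrier V.V \<Longrightarrow> h (cst \<beta> \<otimes>\<^bsub>V.V\<^esub> z) = \<beta> \<otimes> h z"
    and hm: "\<And>j. j \<in> idx p \<Longrightarrow> h (V.mon j) = t j" and z: "z \<in> carrier V.V"
  shows "Lt t z = h z"
  by (rule V.additive_ext[OF Lt_props(1)[OF t] h _ z])
    (simp add: V.VA.smult_eq_mult Lt_props(2,3)[OF t] hs hm)

text \<open>The value at (1 + l U)^r of a functional taking U^k to t k. For U = \<open>X\<close>
  these are the factors of \<open>D_elem\<close> before raising to the power
  \<open>p\<close>.\<close>

definition wsum :: "nat \<Rightarrow> (nat \<Rightarrow> 'b) \<Rightarrow> 'b"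
  where "wsum r t = (\<Oplus>k\<in>{..r}. [(r choose k)] \<cdot> (l [^] k \<otimes> t k))"

lemma Lt_wsum:
  assumes t: "t \<in> idx p \<rightarrow> carrier B" and U: "U \<in> carrier V.V"
  shows "Lt t ((\<one>\<^bsub>V.V\<^esub> \<oplus>\<^bsub>V.V\<^esub> cst l \<otimes>\<^bsub>V.V\<^esub> U) [^]\<^bsub>V.V\<^esub> r) = wsum r (\<lambda>k. Lt t (U [^]\<^bsub>V.V\<^esub> k))"
proof -
  let ?V = "V.V"
  have e: "(\<one>\<^bsub>?V\<^esub> \<oplus>\<^bsub>?V\<^esub> cst l \<otimes>\<^bsub>?V\<^esub> U) [^]\<^bsub>?V\<^esub> r =
      (\<Oplus>\<^bsub>?V\<^esub>k\<in>{..r}. [(r choose k)] \<cdot>\<^bsub>?V\<^esub> (cst (l [^] k) \<otimes>\<^bsub>?V\<^esub> U [^]\<^bsub>?V\<^esub> k))"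
    using cring.binomial_expansion[OF V.V_cring, of "cst l \<otimes>\<^bsub>?V\<^esub> U" "\<one>\<^bsub>?V\<^esub>" r] U
    by (simp add: V.VA.a_comm V.VA.nat_pow_distrib cs.hom_nat_pow)
  have lp: "Lt t (cst l [^]\<^bsub>?V\<^esub> i \<otimes>\<^bsub>?V\<^esub> U [^]\<^bsub>?V\<^esub> i) = l [^] i \<otimes> Lt t (U [^]\<^bsub>?V\<^esub> i)" for i :: nat
    using Lt_props(2)[OF t, of "l [^] i" "U [^]\<^bsub>?V\<^esub> i"] U by (simp add: cs.hom_nat_pow)
  show ?thesis
    unfolding e wsum_def using U Lt_props(4)[OF t] lp
    by (subst additive_map_finsum[OF Lt_props(1)[OF t] V.VA.ring_axioms B.ring_axioms])
      (auto intro!: B.finsum_cong'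
        simp: additive_map_add_pow[OF Lt_props(1)[OF t] V.VA.ring_axioms B.ring_axioms])
qed

text \<open>Membership in the unit group scheme: a product of p-th powers is a unit exactly when
  each of its bases is.\<close>

definition pt :: "(nat \<times> nat \<Rightarrow> 'b) \<Rightarrow> bool"
  where "pt t \<longleftrightarrow> t \<in> idx p \<rightarrow> carrier B \<and> (\<forall>r<p. wsum r (\<lambda>k. t (k, 0)) \<in> Units B)"

lemma pt_closed: "pt t \<Longrightarrow> t \<in> idx p \<rightarrow> carrier B"
  by (simp add: pt_def)

lemma wsum_cong: "(\<And>k. k \<le> r \<Longrightarrow> t k = t' k) \<Longrightarrow> (\<And>k. k \<le> r \<Longrightarrow> t' k \<in> carrier B) \<Longrightarrow> wsum r t = wsum r t'"
  unfolding wsum_def by (intro B.finsum_cong') auto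

lemma wsum_pt:
  assumes t: "t \<in> idx p \<rightarrow> carrier B" and r: "r < p"
  shows "wsum r (\<lambda>k. t (k, 0)) = Lt t ((\<one>\<^bsub>V.V\<^esub> \<oplus>\<^bsub>V.V\<^esub> cst l \<otimes>\<^bsub>V.V\<^esub> X) [^]\<^bsub>V.V\<^esub> r)"
proof -
  have "Lt t (X [^]\<^bsub>V.V\<^esub> k) = t (k, 0)" "t (k, 0) \<in> carrier B" if "k \<le> r" for k
  proof -
    have k: "(k, 0) \<in> idx p" using that r by (auto simp: idx_def)
    show "Lt t (X [^]\<^bsub>V.V\<^esub> k) = t (k, 0)" using Lt_props(3)[OF t k] by (simp add: tmon_def)
    show "t (k, 0) \<in> carrier B" using t k by auto
  qed
  then show ?thesis unfolding Lt_wsum[OF t V.gen_closed(1)] by (intro wsum_cong) auto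
qed

definition xi where "xi t = t (1, 0) \<otimes> inv (t (0, 0))"
definition kap where "kap x = \<one> \<oplus> l \<otimes> x"

text \<open>The inverse of 1 + l X, given by a power because (1 + l X)^p = 1 in characteristic
  \<open>p\<close>.\<close>

definition Uinv where "Uinv = (\<one>\<^bsub>V.V\<^esub> \<oplus>\<^bsub>V.V\<^esub> cst l \<otimes>\<^bsub>V.V\<^esub> X) [^]\<^bsub>V.V\<^esub> (p - 1)"
definition Yp where "Yp = Y \<otimes>\<^bsub>V.V\<^esub> Uinv"
definition eta where "eta t = kap (xi t) \<otimes> (Lt t Yp \<otimes> inv (t (0, 0)))"
definition Xt where "Xt x = cst (inv (kap x)) \<otimes>\<^bsub>V.V\<^esub> (X \<ominus>\<^bsub>V.V\<^esub> cst x)"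
definition Yt where "Yt x y = cst (kap x) \<otimes>\<^bsub>V.V\<^esub> Yp \<ominus>\<^bsub>V.V\<^esub> cst y"
text \<open>\<open>x\<close> and \<open>y\<close> are independent of \<open>t\<close>: a lift is
  built from prescribed values in the coordinates belonging to given \<open>x\<close> and
  \<open>y\<close>, before there is a \<open>t\<close> whose \<open>xi\<close> and
  \<open>eta\<close> they could be.\<close>

definition Fpt :: "(nat \<times> nat \<Rightarrow> 'b) \<Rightarrow> 'b \<Rightarrow> 'b \<Rightarrow> nat \<times> nat \<Rightarrow> 'b"
  where "Fpt t x y j = Lt t (Xt x [^]\<^bsub>V.V\<^esub> fst j \<otimes>\<^bsub>V.V\<^esub> Yt x y [^]\<^bsub>V.V\<^esub> snd j)"

lemma kap_closed [simp]: "x \<in> carrier B \<Longrightarrow> kap x \<in> carrier B"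
  by (simp add: kap_def)

lemma one_lX_pow:
  assumes "U \<in> carrier V.V" "U [^]\<^bsub>V.V\<^esub> p = \<zero>\<^bsub>V.V\<^esub>"
  shows "(\<one>\<^bsub>V.V\<^esub> \<oplus>\<^bsub>V.V\<^esub> cst l \<otimes>\<^bsub>V.V\<^esub> U) [^]\<^bsub>V.V\<^esub> p = \<one>\<^bsub>V.V\<^esub>"
  using assms by (simp add: V_frobenius V.VA.nat_pow_distrib)

lemma Uinv: "Uinv \<in> carrier V.V" "Uinv \<otimes>\<^bsub>V.V\<^esub> (\<one>\<^bsub>V.V\<^esub> \<oplus>\<^bsub>V.V\<^esub> cst l \<otimes>\<^bsub>V.V\<^esub> X) = \<one>\<^bsub>V.V\<^esub>"
  using cring.mult_one_pow_pred[OF V.V_cring _ one_lX_pow[OF V.gen_closed(1) XY_pow(1)] p_gt(1)]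
  by (simp_all add: Uinv_def)

lemma Yp_closed [simp]: "Yp \<in> carrier V.V"
  by (simp add: Yp_def Uinv)

lemma Yp_pow: "Yp [^]\<^bsub>V.V\<^esub> p = \<zero>\<^bsub>V.V\<^esub>"
  using Uinv by (simp add: Yp_def V.VA.nat_pow_distrib XY_pow)

lemma Xt_closed [simp]: "x \<in> carrier B \<Longrightarrow> kap x \<in> Units B \<Longrightarrow> Xt x \<in> carrier V.V"
  by (simp add: Xt_def)

lemma Yt_closed [simp]: "x \<in> carrier B \<Longrightarrow> y \<in> carrier B \<Longrightarrow> Yt x y \<in> carrier V.V"
  by (simp add: Yt_def)

subsection \<open>The change of coordinates\<close>

text \<open>\<open>cc x\<close> and \<open>dd y\<close> are the p-th powers of \<open>Xt x\<close>
  and \<open>Yt x y\<close>, computed from the vanishing p-th powers of \<open>X\<close> and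
  \<open>Yp\<close>. They are the constants of a second presentation of the same algebra, with
  \<open>Xt x\<close> and \<open>Yt x y\<close> as generators.\<close>

definition cc where "cc x = \<ominus> (inv (kap x) [^] p \<otimes> x [^] p)"
definition dd where "dd y = \<ominus> (y [^] p)"

end

text \<open>The substitutions defining \<open>Xt\<close> and solving it for \<open>X\<close> are
  inverse to each other. The symbols are abstract since one direction is applied in the algebra with
  the old generators and the other in the one with the new.\<close>

lemma (in cring) coord_X:
  assumes "U \<in> carrier R" "x \<in> carrier R" "k \<in> carrier R" "k' \<in> carrier R" "k \<otimes> k' = \<one>"
  shows "k' \<otimes> ((x \<oplus> k \<otimes> U) \<ominus> x) = U" "x \<oplus> k \<otimes> (k' \<otimes> (U \<ominus> x)) = U"
proof -
  have "k' \<otimes> ((x \<oplus> k \<otimes> U) \<ominus> x) = (k' \<otimes> k) \<otimes> U" using assms(1-4) by algebra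
  then show "k' \<otimes> ((x \<oplus> k \<otimes> U) \<ominus> x) = U" using assms by (simp add: m_comm)
  have "x \<oplus> k \<otimes> (k' \<otimes> (U \<ominus> x)) = x \<oplus> (k \<otimes> k') \<otimes> (U \<ominus> x)" using assms(1-4) by algebra
  also have "\<dots> = x \<oplus> (U \<ominus> x)" using assms by simp
  also have "\<dots> = U" using assms(1-4) by (simp add: minus_eq a_lcomm r_neg)
  finally show "x \<oplus> k \<otimes> (k' \<otimes> (U \<ominus> x)) = U" .
qed

text \<open>The same for \<open>Yt\<close>: \<open>u\<close> stands for 1 + l X and
  \<open>u'\<close> for its inverse.\<close>

lemma (in cring) coord_Y:
  assumes "W \<in> carrier R" "e \<in> carrier R" "u \<in> carrier R" "u' \<in> carrier R" "k \<in> carrier R" "k' \<in> carrier R"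
    and "k \<otimes> k' = \<one>" "u' \<otimes> u = \<one>"
  shows "k \<otimes> (k' \<otimes> (W \<oplus> e) \<otimes> u \<otimes> u') \<ominus> e = W" "k' \<otimes> (k \<otimes> (W \<otimes> u') \<ominus> e \<oplus> e) \<otimes> u = W"
proof -
  have "k \<otimes> (k' \<otimes> (W \<oplus> e) \<otimes> u \<otimes> u') = k \<otimes> k' \<otimes> (W \<oplus> e) \<otimes> (u' \<otimes> u)"
    using assms(1-6) by algebra
  then show "k \<otimes> (k' \<otimes> (W \<oplus> e) \<otimes> u \<otimes> u') \<ominus> e = W"
    using assms by (simp add: minus_eq a_assoc r_neg)
  have "k' \<otimes> (k \<otimes> (W \<otimes> u') \<ominus> e \<oplus> e) \<otimes> u = (k \<otimes> k') \<otimes> W \<otimes> (u' \<otimes> u)"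
    using assms(1-6) by algebra
  then show "k' \<otimes> (k \<otimes> (W \<otimes> u') \<ominus> e \<oplus> e) \<otimes> u = W" using assms by simp
qed

context point_ring
begin

context
  fixes x y
  assumes x [simp]: "x \<in> carrier B" and y [simp]: "y \<in> carrier B" and k: "kap x \<in> Units B"
begin

lemma kinv [simp]: "inv (kap x) \<in> carrier B" "kap x \<otimes> inv (kap x) = \<one>"
  using k by auto

lemma cc_dd_closed: "cc x \<in> carrier B" "dd y \<in> carrier B"
  by (simp_all add: cc_def dd_def)

abbreviation V1 where "V1 \<equiv> trunc B p CX CY (cc x) (dd y)"

interpretation V1: trunc_alg B p CX CY "cc x" "dd y"
  by (rule truncI[OF cc_dd_closed])

interpretation c1: ring_hom_cring B V1 "struct_map V1"
  using V1.VA.struct_hom V1.V_cring B.is_cring by (simp add: ring_hom_cring_def ring_hom_cring_axioms_def)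

lemma kc: "cst (kap x) \<otimes>\<^bsub>V.V\<^esub> cst (inv (kap x)) = \<one>\<^bsub>V.V\<^esub>"
  using cs.hom_mult[of "kap x" "inv (kap x)"] by simp

lemma kc1: "struct_map V1 (kap x) \<otimes>\<^bsub>V1\<^esub> struct_map V1 (inv (kap x)) = \<one>\<^bsub>V1\<^esub>"
  using c1.hom_mult[of "kap x" "inv (kap x)"] by simp

lemma Xt_pow: "Xt x [^]\<^bsub>V.V\<^esub> p = cst (cc x)"
  by (simp add: Xt_def V.VA.nat_pow_distrib V_frobenius XY_pow cc_def cs.hom_nat_pow)
    (simp add: V.VA.minus_eq V.VA.r_minus)

lemma Yt_pow: "Yt x y [^]\<^bsub>V.V\<^esub> p = cst (dd y)"
  by (simp add: Yt_def V.VA.nat_pow_distrib V_frobenius Yp_pow dd_def cs.hom_nat_pow)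

text \<open>The two presentations are compared by their universal properties. \<open>\<beta>\<close>
  interprets the new generators as \<open>Xt x\<close> and \<open>Yt x y\<close>, while
  \<open>\<alpha>\<close> expresses the old ones in the new. Functionals are transported along
  \<open>\<alpha>\<close> to be constructed and along \<open>\<beta>\<close> to be compared.\<close>

lemma change_of_coordinates:
  obtains \<alpha> \<beta> where "\<alpha> \<in> ring_hom V.V V1" "\<beta> \<in> ring_hom V1 V.V"
    "\<And>r. r \<in> carrier B \<Longrightarrow> \<alpha> (cst r) = struct_map V1 r"
    "\<And>r. r \<in> carrier B \<Longrightarrow> \<beta> (struct_map V1 r) = cst r"
    "\<alpha> (Xt x) = V1.X" "\<alpha> (Yt x y) = V1.Y" "\<beta> V1.X = Xt x" "\<beta> V1.Y = Yt x y"
    "\<And>z. z \<in> carrier V.V \<Longrightarrow> \<beta> (\<alpha> z) = z"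
proof -
  note fr1 = cring.frobenius_add[OF V1.V_cring p V1.VA.algebra_char[OF char]]
  let ?c = "struct_map V1"
  \<comment> \<open>The solution for \<open>X\<close> of the equation that the new first generator
    is (X - x)/(1 + l x).\<close>
  define X1 where "X1 = ?c x \<oplus>\<^bsub>V1\<^esub> ?c (kap x) \<otimes>\<^bsub>V1\<^esub> V1.X"
  define u1 where "u1 = \<one>\<^bsub>V1\<^esub> \<oplus>\<^bsub>V1\<^esub> ?c l \<otimes>\<^bsub>V1\<^esub> X1"
  \<comment> \<open>Solves for \<open>Y\<close> in the same way: the shift and the factor
    \<open>kap x\<close> are undone, and the division by 1 + l X is undone with
    \<open>u1\<close>.\<close>
  define Y1 where "Y1 = ?c (inv (kap x)) \<otimes>\<^bsub>V1\<^esub> (V1.Y \<oplus>\<^bsub>V1\<^esub> ?c y) \<otimes>\<^bsub>V1\<^esub> u1"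
  have c [simp]: "X1 \<in> carrier V1" "u1 \<in> carrier V1" "Y1 \<in> carrier V1" by (simp_all add: X1_def u1_def Y1_def)
  have kk: "kap x [^] p \<otimes> inv (kap x) [^] p = \<one>"
    using B.nat_pow_distrib[of "kap x" "inv (kap x)" p] by simp
  have X1p: "X1 [^]\<^bsub>V1\<^esub> p = \<zero>\<^bsub>V1\<^esub>"
  proof -
    have "X1 [^]\<^bsub>V1\<^esub> p = ?c (x [^] p \<oplus> kap x [^] p \<otimes> cc x)"
      by (simp add: X1_def fr1 V1.VA.nat_pow_distrib V1.gen_pow cc_dd_closed c1.hom_nat_pow)
    also have "x [^] p \<oplus> kap x [^] p \<otimes> cc x = x [^] p \<ominus> (kap x [^] p \<otimes> inv (kap x) [^] p) \<otimes> x [^] p"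
      by (simp add: cc_def B.r_minus B.minus_eq B.m_assoc)
    also have "\<dots> = \<zero>" by (simp add: kk)
    finally show ?thesis by simp
  qed
  have u1p: "u1 [^]\<^bsub>V1\<^esub> p = \<one>\<^bsub>V1\<^esub>"
    using p_gt by (simp add: u1_def fr1 V1.VA.nat_pow_distrib X1p)
  have "V1.Y [^]\<^bsub>V1\<^esub> p \<oplus>\<^bsub>V1\<^esub> ?c y [^]\<^bsub>V1\<^esub> p = ?c (dd y \<oplus> y [^] p)"
    by (simp add: V1.gen_pow c1.hom_nat_pow cc_dd_closed)
  also have "dd y \<oplus> y [^] p = \<zero>" by (simp add: dd_def B.l_neg)
  also have "?c \<zero> = \<zero>\<^bsub>V1\<^esub>" by simp
  finally have Y1p: "Y1 [^]\<^bsub>V1\<^esub> p = \<zero>\<^bsub>V1\<^esub>"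
    by (simp add: Y1_def V1.VA.nat_pow_distrib fr1)
  obtain \<alpha> where a: "\<alpha> \<in> ring_hom V.V V1" "\<alpha> X = X1" "\<alpha> Y = Y1" "\<And>r. r \<in> carrier B \<Longrightarrow> \<alpha> (cst r) = ?c r"
    using V.V_lift[OF V1.V_cring V1.VA.struct_hom c(1,3)] X1p Y1p by auto
  obtain \<beta> where b: "\<beta> \<in> ring_hom V1 V.V" "\<beta> V1.X = Xt x" "\<beta> V1.Y = Yt x y"
    "\<And>r. r \<in> carrier B \<Longrightarrow> \<beta> (?c r) = cst r"
    using V1.V_lift[OF V.V_cring V.VA.struct_hom _ _ Xt_pow Yt_pow] k by auto
  interpret a: ring_hom_cring V.V V1 \<alpha>
    using a V.V_cring V1.V_cring by (simp add: ring_hom_cring_def ring_hom_cring_axioms_def)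
  interpret b: ring_hom_cring V1 V.V \<beta>
    using b V.V_cring V1.V_cring by (simp add: ring_hom_cring_def ring_hom_cring_axioms_def)
  have aX: "\<alpha> (Xt x) = V1.X"
    using cring.coord_X(1)[OF V1.V_cring _ _ _ _ kc1, of V1.X "?c x"]
    by (simp add: Xt_def a a.hom_minus X1_def)
  have aY: "\<alpha> (Yt x y) = V1.Y"
    using cring.coord_Y(1)[OF V1.V_cring _ _ _ _ _ _ kc1 cring.mult_one_pow_pred(1)[OF V1.V_cring c(2) u1p p_gt(1)],
        of V1.Y "?c y"]
    by (simp add: Yt_def Yp_def Uinv_def a a.hom_minus a.hom_nat_pow Y1_def u1_def[symmetric])
  have bX: "\<beta> X1 = X"
    using cring.coord_X(2)[OF V.V_cring _ _ _ _ kc, of X "cst x"]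
    by (simp add: X1_def b Xt_def)
  have bY: "\<beta> Y1 = Y"
    using cring.coord_Y(2)[OF V.V_cring _ _ _ _ _ _ kc Uinv(2), of Y "cst y"] Uinv(1)
    by (simp add: Y1_def u1_def b bX Yt_def Yp_def)
  have ba: "\<beta> (\<alpha> z) = z" if z: "z \<in> carrier V.V" for z
  proof -
    have "(\<beta> \<circ> \<alpha>) z = id z"
      by (rule V.V_hom_eq[OF V.V_cring ring_hom_trans[OF a(1) b(1)] id_ring_hom _ _ _ z])
        (simp_all add: a b bX bY)
    then show ?thesis by simp
  qed
  show thesis
    by (rule that[OF a(1) b(1) a(4) b(4) aX aY b(2,3) ba])
qed

text \<open>The values \<open>Fpt t x y\<close> are those of the functional on the second monomial
  basis, pulled back along \<open>\<beta>\<close>; a functional is determined by its values on a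
  basis.\<close>

lemma Lt_change:
  assumes t: "t \<in> idx p \<rightarrow> carrier B" and t': "t' \<in> idx p \<rightarrow> carrier B"
    and eq: "\<And>j. j \<in> idx p \<Longrightarrow> Fpt t x y j = Fpt t' x y j" and j: "j \<in> idx p"
  shows "t j = t' j"
proof -
  obtain \<alpha> \<beta> where ab: "\<alpha> \<in> ring_hom V.V V1" "\<beta> \<in> ring_hom V1 V.V"
    "\<And>r. r \<in> carrier B \<Longrightarrow> \<beta> (struct_map V1 r) = cst r"
    "\<beta> V1.X = Xt x" "\<beta> V1.Y = Yt x y"
    "\<And>z. z \<in> carrier V.V \<Longrightarrow> \<beta> (\<alpha> z) = z"
    using change_of_coordinates by metis
  interpret b: ring_hom_cring V1 V.V \<beta>
    using ab V.V_cring V1.V_cring by (simp add: ring_hom_cring_def ring_hom_cring_axioms_def)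
  have val: "Lt s (\<beta> (r \<odot>\<^bsub>V1\<^esub> V1.mon i)) = r \<otimes> Fpt s x y i"
    if "s \<in> idx p \<rightarrow> carrier B" "r \<in> carrier B" for s r i
    using that k by (simp add: V1.VA.smult_eq_mult V1.VA.struct_closed ab tmon_def b.hom_nat_pow Fpt_def Lt_props(2))
  have "Lt t (\<beta> z) = Lt t' (\<beta> z)" if "z \<in> carrier V1" for z
    by (rule V1.additive_ext[OF additive_map_comp[OF ring_hom_additive[OF ab(2)] Lt_props(1)[OF t]]
      additive_map_comp[OF ring_hom_additive[OF ab(2)] Lt_props(1)[OF t']] _ that])
      (simp add: val t t' eq)
  from this[of "\<alpha> (V.mon j)"] show ?thesis
    using ab(6) ring_hom_closed[OF ab(1)] j by (simp add: Lt_props(3) t t')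
qed

text \<open>Conversely the values on the second basis may be prescribed: take the functional with
  these values on the new presentation and compose it with \<open>\<alpha>\<close>.\<close>

lemma Lt_construct:
  assumes F: "F \<in> idx p \<rightarrow> carrier B"
  obtains t where "t \<in> idx p \<rightarrow> carrier B" "\<And>j. j \<in> idx p \<Longrightarrow> Fpt t x y j = F j"
proof -
  obtain \<alpha> where ab: "\<alpha> \<in> ring_hom V.V V1"
    "\<And>r. r \<in> carrier B \<Longrightarrow> \<alpha> (cst r) = struct_map V1 r"
    "\<alpha> (Xt x) = V1.X" "\<alpha> (Yt x y) = V1.Y"
    using change_of_coordinates by metis
  interpret a: ring_hom_cring V.V V1 \<alpha>
    using ab V.V_cring V1.V_cring by (simp add: ring_hom_cring_def ring_hom_cring_axioms_def)
  let ?L = "tlin B p CX CY (cc x) (dd y) B (\<lambda>x. x) F"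
  note L = V1.tlin_props[OF B.is_cring id_hom F] V1.tlin_closed[OF B.is_cring id_hom F]
  define t where "t j = ?L (\<alpha> (V.mon j))" for j
  have t: "t \<in> idx p \<rightarrow> carrier B" using L(4) by (auto simp: t_def)
  have Lt: "Lt t z = ?L (\<alpha> z)" if "z \<in> carrier V.V" for z
    by (rule Lt_unique[OF t additive_map_comp[OF ring_hom_additive[OF ab(1)] L(1)] _ _ that])
      (simp_all add: ab V1.VA.smult_eq_mult[symmetric] L(2), simp add: t_def)
  have "Fpt t x y j = F j" if "j \<in> idx p" for j
    using L(3)[OF that] k by (simp add: Fpt_def Lt a.hom_nat_pow ab tmon_def)
  with t show thesis by (rule that)
qed

end

end

text \<open>The first identity is the group-like law for 1 + L X. The second says that translating
  \<open>X\<close> and a point \<open>z\<close> together only rescales their difference, by the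
  factor that 1 + L z acquires as well; this is why the quotient \<open>Xt\<close> is
  invariant.\<close>

lemma (in cring) translation_ring:
  assumes "L \<in> carrier R" "X \<in> carrier R" "x \<in> carrier R" "z \<in> carrier R"
  shows "\<one> \<oplus> L \<otimes> (X \<oplus> (\<one> \<oplus> L \<otimes> X) \<otimes> x) = (\<one> \<oplus> L \<otimes> X) \<otimes> (\<one> \<oplus> L \<otimes> x)"
    and "(X \<oplus> (\<one> \<oplus> L \<otimes> X) \<otimes> x) \<ominus> (z \<oplus> (\<one> \<oplus> L \<otimes> z) \<otimes> x) = (\<one> \<oplus> L \<otimes> x) \<otimes> (X \<ominus> z)"
proof -
  show "\<one> \<oplus> L \<otimes> (X \<oplus> (\<one> \<oplus> L \<otimes> X) \<otimes> x) = (\<one> \<oplus> L \<otimes> X) \<otimes> (\<one> \<oplus> L \<otimes> x)"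
    using assms by algebra
  show "(X \<oplus> (\<one> \<oplus> L \<otimes> X) \<otimes> x) \<ominus> (z \<oplus> (\<one> \<oplus> L \<otimes> z) \<otimes> x) = (\<one> \<oplus> L \<otimes> x) \<otimes> (X \<ominus> z)"
    using assms by algebra
qed

text \<open>The law for \<open>eta\<close> in isolated form: \<open>g\<close> is
  \<open>kap x\<close>, \<open>h\<close> its inverse, \<open>t\<close> the value at 1 with inverse
  \<open>i\<close>, and \<open>e\<close> the value at \<open>Yp\<close>.\<close>

lemma (in cring) translation_eta:
  assumes "k \<in> carrier R" "g \<in> carrier R" "h \<in> carrier R" "e \<in> carrier R" "y \<in> carrier R" "t \<in> carrier R" "i \<in> carrier R"
    and gh: "h \<otimes> g = \<one>" and ti: "t \<otimes> i = \<one>"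
  shows "k \<otimes> g \<otimes> (h \<otimes> (e \<oplus> y \<otimes> t) \<otimes> i) = k \<otimes> (e \<otimes> i) \<oplus> k \<otimes> y"
proof -
  have "k \<otimes> g \<otimes> (h \<otimes> (e \<oplus> y \<otimes> t) \<otimes> i) = (h \<otimes> g) \<otimes> (k \<otimes> (e \<otimes> i) \<oplus> k \<otimes> y \<otimes> (t \<otimes> i))"
    using assms(1-7) by algebra
  then show ?thesis using assms by simp
qed

lemma (in cring) minus_self [simp]: "x \<in> carrier R \<Longrightarrow> x \<ominus> x = \<zero>"
  by simp

lemma (in cring) add_cancel_right:
  assumes "u \<in> carrier R" "v \<in> carrier R" "w \<in> carrier R"
  shows "(u \<oplus> v) \<ominus> (w \<oplus> v) = u \<ominus> w"
  using assms by algebra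

declare One_nat_def [simp del]

section \<open>Invariant coordinates of a point\<close>

context point_ring
begin

lemmas Units_closed' [simp] = B.Units_closed

abbreviation uX where "uX \<equiv> \<one>\<^bsub>V.V\<^esub> \<oplus>\<^bsub>V.V\<^esub> cst l \<otimes>\<^bsub>V.V\<^esub> X"

lemma atMost_1: "{..1::nat} = {0, 1}"
  by auto

lemma wsum_closed: "(\<And>k. k \<le> r \<Longrightarrow> t k \<in> carrier B) \<Longrightarrow> wsum r t \<in> carrier B"
  unfolding wsum_def by (intro B.finsum_closed) auto

lemma pt_00: "pt t \<Longrightarrow> t (0, 0) \<in> Units B" and pt_1: "pt t \<Longrightarrow> t (0, 0) \<oplus> l \<otimes> t (1, 0) \<in> Units B"
proof -
  assume t: "pt t"
  have c: "t (0, 0) \<in> carrier B" "t (1, 0) \<in> carrier B" using t idx_small by (auto simp: pt_def)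
  have "wsum 0 (\<lambda>k. t (k, 0)) \<in> Units B" "wsum 1 (\<lambda>k. t (k, 0)) \<in> Units B"
    using t p_gt by (auto simp: pt_def)
  moreover have "wsum 0 (\<lambda>k. t (k, 0)) = t (0, 0)" using c by (simp add: wsum_def)
  moreover have "wsum 1 (\<lambda>k. t (k, 0)) = t (0, 0) \<oplus> l \<otimes> t (1, 0)"
    using c by (simp add: wsum_def atMost_1)
  ultimately show "t (0, 0) \<in> Units B" "t (0, 0) \<oplus> l \<otimes> t (1, 0) \<in> Units B" by simp_all
qed

lemma pt_mem: "pt t \<Longrightarrow> j \<in> idx p \<Longrightarrow> t j \<in> carrier B"
  by (auto simp: pt_def)

lemma xi_closed: "pt t \<Longrightarrow> xi t \<in> carrier B"
  using pt_00 pt_mem idx_small by (simp add: xi_def)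

lemma xi_mult: "pt t \<Longrightarrow> xi t \<otimes> t (0, 0) = t (1, 0)"
  using pt_00 pt_mem[OF _ idx_small(2)] by (simp add: xi_def B.m_assoc)

lemma kap_mult: "pt t \<Longrightarrow> kap (xi t) \<otimes> t (0, 0) = t (0, 0) \<oplus> l \<otimes> t (1, 0)"
  using pt_00 pt_mem[OF _ idx_small(2)] xi_closed by (simp add: kap_def B.l_distr B.m_assoc xi_mult)

text \<open>Multiplied by t(1) it becomes t(1 + l X), one of the values required to be
  units.\<close>

lemma kap_unit: "pt t \<Longrightarrow> kap (xi t) \<in> Units B"
  using pt_1[of t] pt_00[of t] xi_closed[of t] B.Units_of_mult[of "kap (xi t)" "t (0, 0)"] by (simp add: kap_mult)

lemma eta_closed: "pt t \<Longrightarrow> eta t \<in> carrier B"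
  using pt_00 Lt_props(4)[OF pt_closed] xi_closed by (simp add: eta_def)

lemma eta_mult: "pt t \<Longrightarrow> eta t \<otimes> t (0, 0) = kap (xi t) \<otimes> Lt t Yp"
  using pt_00 Lt_props(4)[OF pt_closed] xi_closed by (simp add: eta_def B.m_assoc)

lemma Fpt_closed:
  "t \<in> idx p \<rightarrow> carrier B \<Longrightarrow> x \<in> carrier B \<Longrightarrow> kap x \<in> Units B \<Longrightarrow> y \<in> carrier B \<Longrightarrow> Fpt t x y j \<in> carrier B"
  by (simp add: Fpt_def Lt_props(4))

lemma Fpt_small:
  assumes t: "t \<in> idx p \<rightarrow> carrier B" and x: "x \<in> carrier B" and k: "kap x \<in> Units B" and y: "y \<in> carrier B"
  shows "Fpt t x y (0, 0) = t (0, 0)"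
    and "Fpt t x y (1, 0) = inv (kap x) \<otimes> (t (1, 0) \<ominus> x \<otimes> t (0, 0))"
    and "Fpt t x y (0, 1) = kap x \<otimes> Lt t Yp \<ominus> y \<otimes> t (0, 0)"
  using assms
  by (simp_all add: Fpt_def Lt_one Xt_def Yt_def Lt_props(2,4) Lt_minus Lt_X Lt_cst)

abbreviation FF where "FF t \<equiv> Fpt t (xi t) (eta t)"

text \<open>\<open>xi\<close> and \<open>eta\<close> are chosen so that the functional vanishes on
  the shifted generators. The two coordinates lost in this way are replaced by \<open>xi\<close> and
  \<open>eta\<close> themselves.\<close>

lemma FF_small:
  assumes t: "pt t"
  shows "FF t (0, 0) = t (0, 0)" "FF t (1, 0) = \<zero>" "FF t (0, 1) = \<zero>"
proof -
  note * = Fpt_small[OF pt_closed[OF t] xi_closed[OF t] kap_unit[OF t] eta_closed[OF t]]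
  have c: "t (1, 0) \<in> carrier B" "Lt t Yp \<in> carrier B"
    using pt_mem[OF t] idx_small Lt_props(4)[OF pt_closed[OF t]] by auto
  show "FF t (0, 0) = t (0, 0)" by (rule *(1))
  show "FF t (1, 0) = \<zero>" "FF t (0, 1) = \<zero>"
    unfolding *(2,3) using c kap_unit[OF t] xi_closed[OF t]
    by (simp_all add: t xi_mult eta_mult B.r_right_minus_eq[THEN iffD2])
qed

text \<open>The value taken by each variable of the localized polynomial ring at the point
  \<open>t\<close>. At \<open>(1, 0)\<close> and \<open>(0, 1)\<close> p-th powers replace the
  coordinates that are not invariant. On the remaining \<open>(k, 0)\<close> one has k at least 2,
  so the exponent of t(1) is an honest difference; the factor adapts the value to the form of
  \<open>den\<close>.\<close>

definition zval :: "(nat \<times> nat \<Rightarrow> 'b) \<Rightarrow> nat \<times> nat \<Rightarrow> 'b"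
  where "zval t j =
    (if j = (0, 0) then t (0, 0) else if j = (1, 0) then t (1, 0) [^] p
     else if j = (0, 1) then eta t [^] p
     else if snd j = 0 then FF t j \<otimes> t (0, 0) [^] (fst j - 2) else FF t j)"

text \<open>The way back from \<open>zval\<close> to the values \<open>FF\<close>. Its zeros are the
  vanishing of the functional on the shifted generators; the corresponding entries of
  \<open>z\<close> contain information about \<open>xi\<close> and \<open>eta\<close>
  instead.\<close>

definition fval :: "(nat \<times> nat \<Rightarrow> 'b) \<Rightarrow> nat \<times> nat \<Rightarrow> 'b"
  where "fval z j =
    (if j = (0, 0) then z (0, 0) else if j = (1, 0) \<or> j = (0, 1) then \<zero>
     else if snd j = 0 then z j \<otimes> inv (z (0, 0)) [^] (fst j - 2) else z j)"

text \<open>For s = 2 the sum is empty and the expression is the second-order denominator z(0,0) +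
  l^2 z(2,0), so one formula covers all s from 2 on.\<close>

definition den :: "nat \<Rightarrow> (nat \<times> nat \<Rightarrow> 'b) \<Rightarrow> 'b"
  where "den s z = z (0, 0) [^] (s - 1) \<oplus>
    (\<Oplus>k\<in>{2..s - 1}. [(s choose k)] \<cdot> (l [^] k \<otimes> (z (0, 0) [^] (s - k) \<otimes> z (k, 0)))) \<oplus>
    l [^] s \<otimes> z (s, 0)"

definition zpt :: "(nat \<times> nat \<Rightarrow> 'b) \<Rightarrow> bool"
  where "zpt z \<longleftrightarrow> z \<in> idx p \<rightarrow> carrier B \<and> z (0, 0) \<in> Units B \<and>
    z (0, 0) [^] p \<oplus> l [^] p \<otimes> z (1, 0) \<in> Units B \<and> (\<forall>s. 2 \<le> s \<and> s < p \<longrightarrow> den s z \<in> Units B)"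

lemma inv_pow_cancel:
  assumes u: "u \<in> Units B" and x: "x \<in> carrier B"
  shows "x \<otimes> u [^] (n::nat) \<otimes> inv u [^] n = x" "x \<otimes> inv u [^] n \<otimes> u [^] n = x"
proof -
  have "u [^] n \<otimes> inv u [^] n = (u \<otimes> inv u) [^] n" "inv u [^] n \<otimes> u [^] n = (inv u \<otimes> u) [^] n"
    using u by (simp_all only: B.nat_pow_distrib B.Units_closed B.Units_inv_closed)
  then have "u [^] n \<otimes> inv u [^] n = \<one>" "inv u [^] n \<otimes> u [^] n = \<one>" using u by simp_all
  then show "x \<otimes> u [^] n \<otimes> inv u [^] n = x" "x \<otimes> inv u [^] n \<otimes> u [^] n = x"
    using u x by (simp_all add: B.m_assoc)
qed

text \<open>In \<open>wsum s f\<close> the linear term vanishes with \<open>f 1\<close>, which is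
  why \<open>den\<close> starts its sum at 2. In the other terms c^(s-2) is split as c^(s-k) c^(k-2)
  and the second factor goes into z(k,0); the term at 0 contributes c^(s-2) c.\<close>

lemma den_eq:
  assumes s: "2 \<le> s" and c: "c \<in> carrier B" and f: "\<And>k. k \<le> s \<Longrightarrow> f k \<in> carrier B"
    and f01: "f 0 = c" "f 1 = \<zero>" and z0: "z (0, 0) = c"
    and z: "\<And>k. 2 \<le> k \<Longrightarrow> k \<le> s \<Longrightarrow> z (k, 0) = f k \<otimes> c [^] (k - 2)"
  shows "den s z = c [^] (s - 2) \<otimes> wsum s f"
proof -
  let ?g = "\<lambda>k. [(s choose k)] \<cdot> (l [^] k \<otimes> (c [^] (s - 2) \<otimes> f k))"
  have gc: "?g k \<in> carrier B" if "k \<le> s" for k using that f c by simp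
  have "c [^] (s - 2) \<otimes> wsum s f = (\<Oplus>k\<in>{..s}. c [^] (s - 2) \<otimes> ([(s choose k)] \<cdot> (l [^] k \<otimes> f k)))"
    unfolding wsum_def using f c by (intro B.finsum_rdistr) auto
  also have "\<dots> = (\<Oplus>k\<in>{..s}. ?g k)"
    using f c by (intro B.finsum_cong') (auto simp: B.add_pow_rdistr B.m_lcomm)
  also have "{..s} = insert 0 (insert 1 (insert s {2..s - 1}))" using s by auto
  also have "(\<Oplus>k\<in>insert 0 (insert 1 (insert s {2..s - 1})). ?g k) =
      ?g 0 \<oplus> (?g 1 \<oplus> (?g s \<oplus> (\<Oplus>k\<in>{2..s - 1}. ?g k)))"
  proof -
    have gen: "(\<Oplus>k\<in>insert 0 (insert 1 (insert s {2..s - 1})). G k) =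
        G 0 \<oplus> (G 1 \<oplus> (G s \<oplus> (\<Oplus>k\<in>{2..s - 1}. G k)))"
      if "G \<in> {2..s - 1} \<rightarrow> carrier B" "G 0 \<in> carrier B" "G 1 \<in> carrier B" "G s \<in> carrier B" for G
      using that s by simp
    show ?thesis using gc[of 0] gc[of 1] gc[of s] gc s by (intro gen) auto
  qed
  also have "?g 1 = \<zero>" using c by (simp add: f01)
  also have "?g 0 = c [^] (s - 1)"
  proof -
    have "Suc (s - 2) = s - 1" using s by linarith
    then have "c [^] (s - 2) \<otimes> c = c [^] (s - 1)" by (metis B.nat_pow_Suc)
    then show ?thesis using c by (simp add: f01)
  qed
  also have "?g s = l [^] s \<otimes> z (s, 0)" using s z[of s] f[of s] c by (simp add: B.m_comm)
  also have "(\<Oplus>k\<in>{2..s - 1}. ?g k) = (\<Oplus>k\<in>{2..s - 1}. [(s choose k)] \<cdot> (l [^] k \<otimes> (c [^] (s - k) \<otimes> z (k, 0))))"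
  proof (intro B.finsum_cong')
    fix k assume k: "k \<in> {2..s - 1}"
    then have kf: "f k \<in> carrier B" "k \<le> s" using f by auto
    have "c [^] (s - k) \<otimes> (f k \<otimes> c [^] (k - 2)) = (c [^] (s - k) \<otimes> c [^] (k - 2)) \<otimes> f k"
      using c kf by (simp add: B.m_ac)
    also have "c [^] (s - k) \<otimes> c [^] (k - 2) = c [^] (s - 2)"
    proof -
      have "s - k + (k - 2) = s - 2" using k kf(2) by auto
      then show ?thesis by (simp only: B.nat_pow_mult[OF c])
    qed
    finally show "?g k = [(s choose k)] \<cdot> (l [^] k \<otimes> (c [^] (s - k) \<otimes> z (k, 0)))"
      using k z kf by simp
  qed (use c f z in auto)
  finally have "c [^] (s - 2) \<otimes> wsum s f = c [^] (s - 1) \<oplus> (\<zero> \<oplus> (l [^] s \<otimes> z (s, 0) \<oplus>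
      (\<Oplus>k\<in>{2..s - 1}. [(s choose k)] \<cdot> (l [^] k \<otimes> (c [^] (s - k) \<otimes> z (k, 0))))))" .
  moreover have "(\<Oplus>k\<in>{2..s - 1}. [(s choose k)] \<cdot> (l [^] k \<otimes> (c [^] (s - k) \<otimes> z (k, 0)))) \<in> carrier B"
    using c f z by (intro B.finsum_closed) auto
  moreover have "z (s, 0) \<in> carrier B" using s z[of s] f c by simp
  ultimately show ?thesis unfolding den_def z0 using c by (simp add: B.a_ac)
qed

text \<open>Comes from X = x + k Xt with k = 1 + l x.\<close>

lemma uX_Xt:
  assumes x: "x \<in> carrier B" and k: "kap x \<in> Units B"
  shows "uX = cst (kap x) \<otimes>\<^bsub>V.V\<^esub> (\<one>\<^bsub>V.V\<^esub> \<oplus>\<^bsub>V.V\<^esub> cst l \<otimes>\<^bsub>V.V\<^esub> Xt x)"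
proof -
  have "cst (kap x) \<otimes>\<^bsub>V.V\<^esub> (\<one>\<^bsub>V.V\<^esub> \<oplus>\<^bsub>V.V\<^esub> cst l \<otimes>\<^bsub>V.V\<^esub> Xt x) =
      cst (kap x) \<oplus>\<^bsub>V.V\<^esub> cst l \<otimes>\<^bsub>V.V\<^esub> (cst (kap x) \<otimes>\<^bsub>V.V\<^esub> Xt x)"
    using x k by (simp add: V.VA.r_distr V.VA.m_lcomm)
  also have "cst (kap x) \<otimes>\<^bsub>V.V\<^esub> Xt x = (cst (kap x) \<otimes>\<^bsub>V.V\<^esub> cst (inv (kap x))) \<otimes>\<^bsub>V.V\<^esub> (X \<ominus>\<^bsub>V.V\<^esub> cst x)"
    using x k by (simp add: Xt_def V.VA.m_assoc)
  also have "\<dots> = X \<ominus>\<^bsub>V.V\<^esub> cst x" using kc[OF x x k] x by simp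
  also have "cst (kap x) \<oplus>\<^bsub>V.V\<^esub> cst l \<otimes>\<^bsub>V.V\<^esub> (X \<ominus>\<^bsub>V.V\<^esub> cst x) = uX"
    using x by (simp add: kap_def V.VA.minus_eq V.VA.r_distr V.VA.r_minus V.VA.a_ac V.VA.r_neg V.VA.r_neg1)
  finally show ?thesis ..
qed

text \<open>In old and shifted coordinates the values at powers of 1 + l X differ by a power of the
  unit \<open>kap x\<close>. Hence whether they are units can be read off from the invariant values
  alone.\<close>

lemma wsum_FF:
  assumes t: "t \<in> idx p \<rightarrow> carrier B" and x: "x \<in> carrier B" and k: "kap x \<in> Units B" and s: "s < p"
  shows "wsum s (\<lambda>k. t (k, 0)) = kap x [^] s \<otimes> wsum s (\<lambda>i. Fpt t x y (i, 0))"
proof -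
  have "uX [^]\<^bsub>V.V\<^esub> s = cst (kap x [^] s) \<otimes>\<^bsub>V.V\<^esub> (\<one>\<^bsub>V.V\<^esub> \<oplus>\<^bsub>V.V\<^esub> cst l \<otimes>\<^bsub>V.V\<^esub> Xt x) [^]\<^bsub>V.V\<^esub> s"
    unfolding uX_Xt[OF x k] using x k by (simp add: V.VA.nat_pow_distrib cs.hom_nat_pow)
  then have "wsum s (\<lambda>k. t (k, 0)) = kap x [^] s \<otimes> wsum s (\<lambda>i. Lt t (Xt x [^]\<^bsub>V.V\<^esub> i))"
    unfolding wsum_pt[OF t s] using x k Lt_wsum[OF t Xt_closed[OF x k]] by (simp only: Lt_props(2)[OF t]
      B.nat_pow_closed kap_closed V.VA.nat_pow_closed V.VA.m_closed V.VA.a_closed V.VA.one_closed cs.hom_closed l Xt_closed)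
  then show ?thesis using x k by (simp add: Fpt_def)
qed

lemma zval_closed: "pt t \<Longrightarrow> zval t \<in> idx p \<rightarrow> carrier B"
  using pt_mem pt_00 eta_closed xi_closed kap_unit Fpt_closed[OF pt_closed] idx_small
  by (auto simp: zval_def)

lemma zval_k0: "2 \<le> k \<Longrightarrow> zval t (k, 0) = FF t (k, 0) \<otimes> t (0, 0) [^] (k - 2)"
  by (simp add: zval_def)

lemma den_zval:
  assumes t: "pt t" and s: "2 \<le> s"
  shows "den s (zval t) = t (0, 0) [^] (s - 2) \<otimes> wsum s (\<lambda>k. FF t (k, 0))"
proof (rule den_eq[OF s])
  show "FF t (k, 0) \<in> carrier B" for k
    using t by (intro Fpt_closed pt_closed xi_closed kap_unit eta_closed)
  show "zval t (0, 0) = t (0, 0)" by (simp add: zval_def)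
qed (use t pt_00[OF t] in \<open>simp_all add: FF_small zval_k0\<close>)

lemma zpt_zval:
  assumes t: "pt t"
  shows "zpt (zval t)"
  unfolding zpt_def
proof (intro conjI allI impI)
  have c: "t (0, 0) \<in> carrier B" "t (1, 0) \<in> carrier B" using pt_mem[OF t] idx_small by auto
  have "zval t (0, 0) [^] p \<oplus> l [^] p \<otimes> zval t (1, 0) = (t (0, 0) \<oplus> l \<otimes> t (1, 0)) [^] p"
    using c by (simp add: zval_def B.frobenius_add[OF p char] B.nat_pow_distrib)
  then show "zval t (0, 0) [^] p \<oplus> l [^] p \<otimes> zval t (1, 0) \<in> Units B"
    using pt_1[OF t] by (simp add: B.Units_pow_closed)
  show "zval t (0, 0) \<in> Units B" using pt_00[OF t] by (simp add: zval_def)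
  fix s assume s: "2 \<le> s \<and> s < p"
  have Fc: "wsum s (\<lambda>k. FF t (k, 0)) \<in> carrier B"
    using t by (intro wsum_closed Fpt_closed pt_closed xi_closed kap_unit eta_closed)
  have "kap (xi t) [^] s \<otimes> wsum s (\<lambda>k. FF t (k, 0)) \<in> Units B"
    using wsum_FF[OF pt_closed[OF t] xi_closed[OF t] kap_unit[OF t], of s "eta t"] t s
    unfolding pt_def by metis
  then have "wsum s (\<lambda>k. FF t (k, 0)) \<otimes> kap (xi t) [^] s \<in> Units B"
    using Fc kap_unit[OF t] by (simp add: B.m_comm)
  then have "wsum s (\<lambda>k. FF t (k, 0)) \<in> Units B"
    by (rule B.Units_of_mult[OF Fc B.nat_pow_closed[OF B.Units_closed[OF kap_unit[OF t]]]])
  then show "den s (zval t) \<in> Units B"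
    using den_zval[OF t] s pt_00[OF t] by (simp add: B.Units_pow_closed)
qed (rule zval_closed[OF t])

text \<open>\<open>zval\<close> keeps all invariant values, the powers of t(1) being invertible. So
  two points with the same \<open>zval\<close> can differ only in \<open>xi\<close> and
  \<open>eta\<close>.\<close>

lemma FF_of_zval:
  assumes t: "pt t"
  shows "FF t j = fval (zval t) j"
proof -
  have c: "FF t j \<in> carrier B" using t by (intro Fpt_closed pt_closed xi_closed kap_unit eta_closed)
  consider "j = (0, 0)" | "j = (1, 0)" | "j = (0, 1)" | "j \<noteq> (0, 0)" "j \<noteq> (1, 0)" "j \<noteq> (0, 1)" by blast
  then show ?thesis
  proof cases
    case 4
    then show ?thesis using inv_pow_cancel(1)[OF pt_00[OF t] c] by (simp add: fval_def zval_def)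
  qed (simp_all add: fval_def zval_def FF_small[OF t, simplified])
qed

lemma fval_closed:
  assumes z: "zpt z"
  shows "fval z \<in> idx p \<rightarrow> carrier B"
proof
  fix j assume "j \<in> idx p"
  then have "z j \<in> carrier B" "z (0, 0) \<in> Units B" using z by (auto simp: zpt_def)
  then show "fval z j \<in> carrier B" by (simp add: fval_def)
qed

text \<open>Given p-th roots \<open>x\<close> and \<open>y\<close>, the functional is prescribed by
  \<open>fval z\<close> in the coordinates that belong to them. It remains to see that its own
  \<open>xi\<close> and \<open>eta\<close> are \<open>x\<close> and \<open>y\<close>, and that the
  inverted elements make it a point of the unit group scheme.\<close>

lemma zpt_lift:
  assumes z: "zpt z" and x: "x \<in> carrier B" and y: "y \<in> carrier B"
    and xp: "x [^] p \<otimes> z (0, 0) [^] p = z (1, 0)" and yp: "y [^] p = z (0, 1)"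
  obtains t where "pt t" "xi t = x" "eta t = y" "\<And>j. j \<in> idx p \<Longrightarrow> zval t j = z j"
proof -
  have z0: "z (0, 0) \<in> Units B" "z (0, 0) \<in> carrier B" using z by (auto simp: zpt_def)
  \<comment> \<open>The p-th power of \<open>kap x\<close> times z(0,0) is one of the inverted
    elements; a factor of an element with an invertible power is itself invertible.\<close>
  have "(kap x \<otimes> z (0, 0)) [^] p = z (0, 0) [^] p \<oplus> l [^] p \<otimes> z (1, 0)"
    unfolding xp[symmetric] using x z0
    by (simp add: kap_def B.l_distr B.frobenius_add[OF p char] B.nat_pow_distrib B.m_assoc)
  then have "(kap x \<otimes> z (0, 0)) [^] p \<in> Units B" using z by (simp only: zpt_def)
  then have "kap x \<otimes> z (0, 0) \<in> Units B"
    by (rule B.Units_of_pow[OF B.m_closed[OF kap_closed[OF x] z0(2)] _ p_gt(1)])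
  then have k: "kap x \<in> Units B" by (rule B.Units_of_mult[OF kap_closed[OF x] z0(2)])
  obtain t where t: "t \<in> idx p \<rightarrow> carrier B" and tF: "\<And>j. j \<in> idx p \<Longrightarrow> Fpt t x y j = fval z j"
    using Lt_construct[OF x y k fval_closed[OF z]] by blast
  note Fs = Fpt_small[OF t x k y]
  have t0: "t (0, 0) = z (0, 0)" using tF[OF idx_small(1)] Fs(1) by (simp add: fval_def)
  have t1c: "t (1, 0) \<in> carrier B" "Lt t Yp \<in> carrier B" using t idx_small Lt_props(4)[OF t] by auto
  \<comment> \<open>The zero of \<open>fval\<close> at \<open>(1, 0)\<close> is the equation t(X) =
    x t(1), that is \<open>xi t = x\<close>. The zero at \<open>(0, 1)\<close>, used further on,
    gives \<open>eta t = y\<close> in the same way.\<close>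
  have "inv (kap x) \<otimes> (t (1, 0) \<ominus> x \<otimes> t (0, 0)) = \<zero>" using tF[OF idx_small(2)] Fs(2) by (simp add: fval_def)
  then have "kap x \<otimes> (inv (kap x) \<otimes> (t (1, 0) \<ominus> x \<otimes> t (0, 0))) = kap x \<otimes> \<zero>" by simp
  then have "t (1, 0) \<ominus> x \<otimes> t (0, 0) = \<zero>"
    using k x t1c z0 by (simp add: B.m_assoc[symmetric] t0 del: B.r_right_minus_eq)
  then have t1: "t (1, 0) = x \<otimes> z (0, 0)" using x t1c z0 by (simp add: t0)
  have "kap x \<otimes> Lt t Yp \<ominus> y \<otimes> t (0, 0) = \<zero>" using tF[OF idx_small(3)] Fs(3) by (simp add: fval_def)
  then have tY: "kap x \<otimes> Lt t Yp = y \<otimes> z (0, 0)" using x y t1c z0 by (simp add: t0)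
  have xit: "xi t = x" using x z0 by (simp add: xi_def t0 t1 B.m_assoc)
  have etat: "eta t = y"
    using x y z0 t1c tY by (simp add: eta_def xit t0 B.m_assoc[symmetric]) (simp add: B.m_assoc)
  \<comment> \<open>The cases 0 and 1 are t(1) and \<open>kap x\<close> times t(1); from 2 on,
    \<open>den r z\<close> is \<open>wsum\<close> in shifted coordinates up to a power of
    t(1).\<close>
  have w: "wsum r (\<lambda>k. t (k, 0)) \<in> Units B" if r: "r < p" for r
  proof (cases "r < 2")
    case True
    have "wsum 0 (\<lambda>k. t (k, 0)) = z (0, 0)" using z0 by (simp add: wsum_def t0)
    moreover have "wsum 1 (\<lambda>k. t (k, 0)) = kap x \<otimes> z (0, 0)"
      using z0 x t1c by (simp add: wsum_def atMost_1 t0 t1 kap_def B.l_distr B.m_assoc)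
    moreover have "r = 0 \<or> r = 1" using True by auto
    ultimately show ?thesis using z0 k by auto
  next
    case False
    have Fc: "Fpt t x y (i, 0) \<in> carrier B" for i using t x k y by (intro Fpt_closed)
    have "den r z = z (0, 0) [^] (r - 2) \<otimes> wsum r (\<lambda>i. Fpt t x y (i, 0))"
    proof (rule den_eq)
      fix i assume i: "2 \<le> i" "i \<le> r"
      then have ii: "(i, 0) \<in> idx p" using r by (auto simp: idx_def)
      then have "z (i, 0) \<in> carrier B" using z by (auto simp: zpt_def)
      then show "z (i, 0) = Fpt t x y (i, 0) \<otimes> z (0, 0) [^] (i - 2)"
        using i tF[OF ii] inv_pow_cancel(2)[OF z0(1), of "z (i, 0)" "i - 2"] by (simp add: fval_def)
    next
      show "Fpt t x y (1, 0) = \<zero>" using tF[OF idx_small(2)] by (simp add: fval_def)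
    qed (use False Fc z0 Fs(1) t0 in auto)
    moreover have "den r z \<in> Units B" using z False r by (auto simp: zpt_def)
    moreover have wc: "wsum r (\<lambda>i. Fpt t x y (i, 0)) \<in> carrier B" by (intro wsum_closed Fc)
    ultimately have "wsum r (\<lambda>i. Fpt t x y (i, 0)) \<otimes> z (0, 0) [^] (r - 2) \<in> Units B"
      using z0(2) by (metis B.m_comm B.nat_pow_closed)
    then have "wsum r (\<lambda>i. Fpt t x y (i, 0)) \<in> Units B"
      by (rule B.Units_of_mult[OF wc B.nat_pow_closed[OF z0(2)]])
    then show ?thesis using wsum_FF[OF t x k r, of y] k by (simp add: B.Units_pow_closed)
  qed
  have pt: "pt t" using t w by (simp add: pt_def)
  have "zval t j = z j" if j: "j \<in> idx p" for j
  proof -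
    have zj: "z j \<in> carrier B" using z j by (auto simp: zpt_def)
    consider "j = (0, 0)" | "j = (1, 0)" | "j = (0, 1)" | "j \<noteq> (0, 0)" "j \<noteq> (1, 0)" "j \<noteq> (0, 1)" by blast
    then show ?thesis
    proof cases
      case 2
      then show ?thesis using xp x z0 t1 by (simp add: zval_def B.nat_pow_distrib)
    next
      case 4
      then show ?thesis using tF[OF j] inv_pow_cancel(2)[OF z0(1) zj, of "fst j - 2"]
        by (simp add: zval_def xit etat fval_def t0)
    qed (simp_all add: zval_def t0 etat yp)
  qed
  with pt xit etat show thesis by (rule that)
qed

lemma xi_pow: "pt t \<Longrightarrow> xi t [^] p \<otimes> zval t (0, 0) [^] p = zval t (1, 0)"
  using xi_closed[of t] pt_00[of t] by (simp add: zval_def B.nat_pow_distrib[symmetric] xi_mult[simplified])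

lemma eta_pow: "eta t [^] p = zval t (0, 1)"
  by (simp add: zval_def)

subsection \<open>The translation action\<close>

text \<open>\<open>TX\<close> and \<open>TY\<close> are what the comultiplication makes of
  \<open>X\<close> and \<open>Y\<close> when its right factor is evaluated at a point of the group
  with coordinates \<open>x\<close> and \<open>y\<close>.\<close>

definition TX where "TX x = X \<oplus>\<^bsub>V.V\<^esub> uX \<otimes>\<^bsub>V.V\<^esub> cst x"
definition TY where "TY y = Y \<oplus>\<^bsub>V.V\<^esub> uX \<otimes>\<^bsub>V.V\<^esub> cst y"
definition act :: "(nat \<times> nat \<Rightarrow> 'b) \<Rightarrow> 'b \<Rightarrow> 'b \<Rightarrow> nat \<times> nat \<Rightarrow> 'b"
  where "act t x y j = Lt t (TX x [^]\<^bsub>V.V\<^esub> fst j \<otimes>\<^bsub>V.V\<^esub> TY y [^]\<^bsub>V.V\<^esub> snd j)"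

lemma TX_TY_closed [simp]: "x \<in> carrier B \<Longrightarrow> TX x \<in> carrier V.V" "x \<in> carrier B \<Longrightarrow> TY x \<in> carrier V.V"
  by (simp_all add: TX_def TY_def)

context
  fixes x y
  assumes x [simp]: "x \<in> carrier B" and y [simp]: "y \<in> carrier B" and xp: "x [^] p = \<zero>" and yp: "y [^] p = \<zero>"
begin

lemma translation_exists:
  obtains \<tau> where "\<tau> \<in> ring_hom V.V V.V" "\<tau> X = TX x" "\<tau> Y = TY y" "\<And>r. r \<in> carrier B \<Longrightarrow> \<tau> (cst r) = cst r"
proof -
  have c0: "cst x [^]\<^bsub>V.V\<^esub> p = \<zero>\<^bsub>V.V\<^esub>" "cst y [^]\<^bsub>V.V\<^esub> p = \<zero>\<^bsub>V.V\<^esub>"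
    using cs.hom_nat_pow[of x p] cs.hom_nat_pow[of y p] xp yp by simp_all
  have "TX x [^]\<^bsub>V.V\<^esub> p = \<zero>\<^bsub>V.V\<^esub>" "TY y [^]\<^bsub>V.V\<^esub> p = \<zero>\<^bsub>V.V\<^esub>"
    by (simp_all add: TX_def TY_def V_frobenius V.VA.nat_pow_distrib XY_pow c0)
  then show thesis
    using V.V_lift[OF V.V_cring V.VA.struct_hom TX_TY_closed(1)[OF x] TX_TY_closed(2)[OF y]] that by auto
qed

text \<open>On the level of functionals, acting is composing with the translation
  \<open>\<tau>\<close>: both sides are linear and agree on monomials.\<close>

lemma act_Lt:
  assumes t: "t \<in> idx p \<rightarrow> carrier B"
    and \<tau>: "\<tau> \<in> ring_hom V.V V.V" "\<tau> X = TX x" "\<tau> Y = TY y" "\<And>r. r \<in> carrier B \<Longrightarrow> \<tau> (cst r) = cst r"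
    and z: "z \<in> carrier V.V"
  shows "act t x y \<in> idx p \<rightarrow> carrier B" "Lt (act t x y) z = Lt t (\<tau> z)"
proof -
  interpret \<tau>: ring_hom_cring V.V V.V \<tau>
    using \<tau> V.V_cring by (simp add: ring_hom_cring_def ring_hom_cring_axioms_def)
  show ac: "act t x y \<in> idx p \<rightarrow> carrier B" by (auto simp: act_def Lt_props(4)[OF t])
  show "Lt (act t x y) z = Lt t (\<tau> z)"
    by (rule Lt_unique[OF ac additive_map_comp[OF ring_hom_additive[OF \<tau>(1)] Lt_props(1)[OF t]] _ _ z])
      (simp_all add: \<tau> Lt_props(2)[OF t], simp add: tmon_def act_def \<tau>.hom_nat_pow \<tau>)
qed

text \<open>Every claim is transported through the translation \<open>\<tau>\<close>. The invariance
  of \<open>FF\<close> combines two changes: the translate is evaluated in coordinates shifted by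
  its own \<open>xi\<close> and \<open>eta\<close>, and \<open>\<tau>\<close> carries these to the
  coordinates of the original point.\<close>

lemma act_props:
  assumes t: "pt t"
  shows "pt (act t x y)" "xi (act t x y) = xi t \<oplus> kap (xi t) \<otimes> x"
    "eta (act t x y) = eta t \<oplus> kap (xi t) \<otimes> y" "FF (act t x y) j = FF t j"
    "zval (act t x y) j = zval t j"
proof -
  obtain \<tau> where \<tau>: "\<tau> \<in> ring_hom V.V V.V" "\<tau> X = TX x" "\<tau> Y = TY y" "\<And>r. r \<in> carrier B \<Longrightarrow> \<tau> (cst r) = cst r"
    using translation_exists by metis
  interpret \<tau>: ring_hom_cring V.V V.V \<tau>
    using \<tau> V.V_cring by (simp add: ring_hom_cring_def ring_hom_cring_axioms_def)
  note tc = pt_closed[OF t]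
  let ?a = "act t x y"
  have aL: "Lt ?a z = Lt t (\<tau> z)" if "z \<in> carrier V.V" for z
    by (rule act_Lt(2)[OF tc \<tau>(1-3) _ that]) (rule \<tau>(4))
  have ac: "?a \<in> idx p \<rightarrow> carrier B"
    by (rule act_Lt(1)[OF tc \<tau>(1-3) _ V.gen_closed(1)]) (rule \<tau>(4))
  let ?g = "kap x"
  note [simp] = xi_closed[OF t] eta_closed[OF t] kap_unit[OF t] pt_00[OF t]
  have tm [simp]: "t (0, 0) \<in> carrier B" "t (1, 0) \<in> carrier B" "Lt t Yp \<in> carrier B"
    using pt_mem[OF t] idx_small Lt_props(4)[OF tc] by auto
  \<comment> \<open>Here x^p = 0 enters; it makes g^(p-1) the inverse of g.\<close>
  have gp: "?g [^] p = \<one>"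
    by (simp add: kap_def B.frobenius_add[OF p char] B.nat_pow_distrib xp)
  have g1: "?g [^] (p - 1) \<otimes> ?g = \<one>"
    by (rule B.mult_one_pow_pred(1)[OF _ gp p_gt(1)]) simp
  have g2: "?g \<otimes> ?g [^] (p - 1) = \<one>" using g1 by (subst B.m_comm) simp_all
  have gu: "?g \<in> Units B" by (rule B.Units_of_mult[of _ "?g [^] (p - 1)"]) (simp_all add: g2)
  have a0: "?a (0, 0) = t (0, 0)" by (simp add: act_def Lt_one[OF tc])
  have LuX: "Lt t (uX \<otimes>\<^bsub>V.V\<^esub> cst x) = x \<otimes> (t (0, 0) \<oplus> l \<otimes> t (1, 0))"
    using Lt_props(2)[OF tc x, of uX] Lt_props(2)[OF tc l, of X]
    by (simp add: V.VA.m_comm[of uX] Lt_add[OF tc] Lt_one[OF tc] Lt_X[OF tc])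
  have a1: "?a (1, 0) = t (1, 0) \<oplus> x \<otimes> (t (0, 0) \<oplus> l \<otimes> t (1, 0))"
    by (simp add: act_def TX_def Lt_add[OF tc] LuX Lt_X[OF tc])
  have xi': "xi ?a = xi t \<oplus> kap (xi t) \<otimes> x"
  proof -
    have "xi ?a = t (1, 0) \<otimes> inv (t (0, 0)) \<oplus> x \<otimes> (kap (xi t) \<otimes> t (0, 0)) \<otimes> inv (t (0, 0))"
      unfolding xi_def[of ?a] a0 a1 kap_mult[OF t] by (simp add: B.l_distr)
    also have "x \<otimes> (kap (xi t) \<otimes> t (0, 0)) \<otimes> inv (t (0, 0)) = (kap (xi t) \<otimes> x) \<otimes> (t (0, 0) \<otimes> inv (t (0, 0)))"
      by (simp add: B.m_ac del: B.Units_r_inv B.Units_l_inv)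
    also have "\<dots> = kap (xi t) \<otimes> x" by simp
    finally show ?thesis by (simp add: xi_def)
  qed
  have kap': "kap (xi ?a) = kap (xi t) \<otimes> ?g"
    unfolding xi' kap_def by (rule B.translation_ring(1)) auto
  have ka: "kap (xi ?a) \<in> Units B" unfolding kap' using gu by simp
  \<comment> \<open>The group-like law; the two formulas after it describe the inverse of 1 + l X
    and then Y/(1 + l X), which picks up the factor 1/g.\<close>
  have \<tau>u: "\<tau> uX = uX \<otimes>\<^bsub>V.V\<^esub> cst ?g"
    using cring.translation_ring(1)[OF V.V_cring, of "cst l" X "cst x" "cst x"]
    by (simp add: \<tau> TX_def kap_def)
  have \<tau>U: "\<tau> Uinv = Uinv \<otimes>\<^bsub>V.V\<^esub> cst (?g [^] (p - 1))"
    unfolding Uinv_def using \<tau>.hom_nat_pow[of uX "p - 1"] unfolding \<tau>u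
    by (simp add: V.VA.nat_pow_distrib cs.hom_nat_pow)
  have \<tau>Y: "\<tau> Yp = cst (?g [^] (p - 1)) \<otimes>\<^bsub>V.V\<^esub> (Yp \<oplus>\<^bsub>V.V\<^esub> cst y)"
  proof -
    have "\<tau> Yp = (Y \<oplus>\<^bsub>V.V\<^esub> uX \<otimes>\<^bsub>V.V\<^esub> cst y) \<otimes>\<^bsub>V.V\<^esub> (Uinv \<otimes>\<^bsub>V.V\<^esub> cst (?g [^] (p - 1)))"
      using Uinv(1) by (simp only: Yp_def \<tau>.hom_mult V.gen_closed \<tau>U \<tau>(3) TY_def)
    also have "\<dots> = cst (?g [^] (p - 1)) \<otimes>\<^bsub>V.V\<^esub> (Y \<otimes>\<^bsub>V.V\<^esub> Uinv \<oplus>\<^bsub>V.V\<^esub> (Uinv \<otimes>\<^bsub>V.V\<^esub> uX) \<otimes>\<^bsub>V.V\<^esub> cst y)"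
      using Uinv(1) V.VA.a_closed[OF V.VA.one_closed V.VA.m_closed[OF cs.hom_closed[OF l] V.gen_closed(1)]]
      by (simp only: V.VA.l_distr V.VA.r_distr V.VA.m_ac V.VA.m_closed V.gen_closed cs.hom_closed y B.nat_pow_closed kap_closed x)
    also have "\<dots> = cst (?g [^] (p - 1)) \<otimes>\<^bsub>V.V\<^esub> (Yp \<oplus>\<^bsub>V.V\<^esub> cst y)"
      unfolding Uinv(2) by (simp add: Yp_def)
    finally show ?thesis .
  qed
  have LY: "Lt ?a Yp = ?g [^] (p - 1) \<otimes> (Lt t Yp \<oplus> y \<otimes> t (0, 0))"
    unfolding aL[OF Yp_closed] \<tau>Y using Lt_props(2)[OF tc, of "?g [^] (p - 1)" "Yp \<oplus>\<^bsub>V.V\<^esub> cst y"]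
    by (simp only: B.nat_pow_closed kap_closed x y V.VA.a_closed Yp_closed cs.hom_closed Lt_add[OF tc] Lt_cst[OF tc])
  have eta': "eta ?a = eta t \<oplus> kap (xi t) \<otimes> y"
    unfolding eta_def[of ?a] kap' LY a0 using B.translation_eta[OF _ _ _ _ y _ _ g1, of "kap (xi t)" "Lt t Yp" "t (0, 0)" "inv (t (0, 0))"]
    by (simp add: eta_def B.m_assoc)
  define s where "s = xi ?a"
  define e where "e = eta ?a"
  have s [simp]: "s \<in> carrier B" "kap s \<in> Units B" and e [simp]: "e \<in> carrier B"
    using ka eta' by (simp_all add: s_def e_def xi')
  \<comment> \<open>X minus the first coordinate and \<open>kap\<close> of that coordinate both
    acquire the factor g, so it cancels in their quotient.\<close>
  have \<tau>X: "\<tau> (Xt s) = Xt (xi t)"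
  proof -
    have "inv (kap s) \<otimes> ?g = inv (kap s) \<otimes> ?g \<otimes> (kap (xi t) \<otimes> inv (kap (xi t)))" by simp
    also have "\<dots> = inv (kap s) \<otimes> (kap (xi t) \<otimes> ?g) \<otimes> inv (kap (xi t))"
      using B.Units_inv_closed[OF s(2)] by (simp add: B.m_ac del: B.Units_r_inv B.Units_l_inv kinv(2))
    also have "\<dots> = inv (kap (xi t))" unfolding kap'[symmetric] s_def[symmetric] by simp
    finally have i: "inv (kap s) \<otimes> ?g = inv (kap (xi t))" .
    have "\<tau> (Xt s) = cst (inv (kap s)) \<otimes>\<^bsub>V.V\<^esub> (TX x \<ominus>\<^bsub>V.V\<^esub> cst s)"
      by (simp add: Xt_def \<tau> \<tau>.hom_minus)
    also have "TX x \<ominus>\<^bsub>V.V\<^esub> cst s = cst ?g \<otimes>\<^bsub>V.V\<^esub> (X \<ominus>\<^bsub>V.V\<^esub> cst (xi t))"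
      using cring.translation_ring(2)[OF V.V_cring, of "cst l" X "cst x" "cst (xi t)"]
      by (simp add: s_def xi' TX_def kap_def)
    also have "cst (inv (kap s)) \<otimes>\<^bsub>V.V\<^esub> (cst ?g \<otimes>\<^bsub>V.V\<^esub> (X \<ominus>\<^bsub>V.V\<^esub> cst (xi t))) =
        cst (inv (kap s) \<otimes> ?g) \<otimes>\<^bsub>V.V\<^esub> (X \<ominus>\<^bsub>V.V\<^esub> cst (xi t))"
      by (simp add: V.VA.m_assoc)
    finally show ?thesis by (simp only: i Xt_def)
  qed
  have \<tau>Yt: "\<tau> (Yt s e) = Yt (xi t) (eta t)"
  proof -
    have i: "kap s \<otimes> ?g [^] (p - 1) = kap (xi t)"
      unfolding s_def kap' using g2 by (simp add: B.m_assoc)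
    have "\<tau> (Yt s e) = cst (kap s) \<otimes>\<^bsub>V.V\<^esub> \<tau> Yp \<ominus>\<^bsub>V.V\<^esub> cst e"
      by (simp add: Yt_def \<tau> \<tau>.hom_minus)
    also have "cst (kap s) \<otimes>\<^bsub>V.V\<^esub> \<tau> Yp = cst (kap s \<otimes> ?g [^] (p - 1)) \<otimes>\<^bsub>V.V\<^esub> (Yp \<oplus>\<^bsub>V.V\<^esub> cst y)"
      unfolding \<tau>Y by (simp add: V.VA.m_assoc)
    also have "\<dots> = cst (kap (xi t)) \<otimes>\<^bsub>V.V\<^esub> Yp \<oplus>\<^bsub>V.V\<^esub> cst (kap (xi t) \<otimes> y)"
      unfolding i by (simp add: V.VA.r_distr)
    also have "\<dots> \<ominus>\<^bsub>V.V\<^esub> cst e = cst (kap (xi t)) \<otimes>\<^bsub>V.V\<^esub> Yp \<ominus>\<^bsub>V.V\<^esub> cst (eta t)"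
    proof -
      have "(u \<oplus>\<^bsub>V.V\<^esub> v) \<ominus>\<^bsub>V.V\<^esub> (w \<oplus>\<^bsub>V.V\<^esub> v) = u \<ominus>\<^bsub>V.V\<^esub> w"
        if "u \<in> carrier V.V" "v \<in> carrier V.V" "w \<in> carrier V.V" for u v w
        using that cring.add_cancel_right[OF V.V_cring] by blast
      from this[of "cst (kap (xi t)) \<otimes>\<^bsub>V.V\<^esub> Yp" "cst (kap (xi t) \<otimes> y)" "cst (eta t)"] show ?thesis
        by (simp add: e_def eta')
    qed
    finally show ?thesis by (simp only: Yt_def)
  qed
  show FF': "FF ?a j = FF t j" for j
    unfolding Fpt_def s_def[symmetric] e_def[symmetric]
    by (subst aL) (simp_all add: \<tau>.hom_nat_pow \<tau>X \<tau>Yt)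
  \<comment> \<open>Translation multiplies (1 + l X)^r by the unit g^r, so the values at these
    powers remain units.\<close>
  have w: "wsum r (\<lambda>k. ?a (k, 0)) \<in> Units B" if r: "r < p" for r
  proof -
    have "wsum r (\<lambda>k. ?a (k, 0)) = Lt t (\<tau> (uX [^]\<^bsub>V.V\<^esub> r))"
      unfolding wsum_pt[OF ac r] by (rule aL) simp
    also have "\<tau> (uX [^]\<^bsub>V.V\<^esub> r) = cst (?g [^] r) \<otimes>\<^bsub>V.V\<^esub> uX [^]\<^bsub>V.V\<^esub> r"
      using \<tau>.hom_nat_pow[of uX r] unfolding \<tau>u by (simp add: V.VA.nat_pow_distrib cs.hom_nat_pow V.VA.m_comm)
    also have "Lt t \<dots> = ?g [^] r \<otimes> wsum r (\<lambda>k. t (k, 0))"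
      unfolding wsum_pt[OF tc r] by (rule Lt_props(2)[OF tc]) simp_all
    finally show ?thesis using t r gu by (simp add: pt_def B.Units_pow_closed)
  qed
  show "pt ?a" using ac w by (simp add: pt_def)
  show "xi ?a = xi t \<oplus> kap (xi t) \<otimes> x" by (rule xi')
  show "eta ?a = eta t \<oplus> kap (xi t) \<otimes> y" by (rule eta')
  \<comment> \<open>Apart from the value at 1 and invariant values, \<open>zval\<close> contains
    p-th powers, and x^p = y^p = 0 removes the change in them.\<close>
  have "?a (1, 0) [^] p = t (1, 0) [^] p"
    unfolding a1 by (simp add: B.frobenius_add[OF p char] B.nat_pow_distrib xp)
  moreover have "eta ?a [^] p = eta t [^] p"
    unfolding eta' by (simp add: B.frobenius_add[OF p char] B.nat_pow_distrib yp)
  ultimately show "zval ?a j = zval t j"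
    unfolding zval_def FF' a0 by simp
qed

end

text \<open>The laws for \<open>xi\<close> and \<open>eta\<close> of a translate leave one choice of
  \<open>x\<close> and \<open>y\<close>. Their p-th powers vanish because the p-th powers of
  \<open>xi\<close> and \<open>eta\<close> are recorded in \<open>zval\<close>.\<close>

lemma torsor:
  assumes t: "pt t" and t': "pt t'" and z: "\<And>j. j \<in> idx p \<Longrightarrow> zval t j = zval t' j"
  obtains x y where "x \<in> carrier B" "y \<in> carrier B" "x [^] p = \<zero>" "y [^] p = \<zero>"
    "\<And>j. j \<in> idx p \<Longrightarrow> t' j = act t x y j"
proof -
  let ?k = "kap (xi t)"
  note [simp] = xi_closed[OF t] eta_closed[OF t] kap_unit[OF t] pt_00[OF t]
    xi_closed[OF t'] eta_closed[OF t'] kap_unit[OF t'] pt_00[OF t']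
  define x where "x = inv ?k \<otimes> (xi t' \<ominus> xi t)"
  define y where "y = inv ?k \<otimes> (eta t' \<ominus> eta t)"
  have c [simp]: "x \<in> carrier B" "y \<in> carrier B" by (simp_all add: x_def y_def)
  have t0: "t (0, 0) = t' (0, 0)" using z[OF idx_small(1)] by (simp add: zval_def)
  \<comment> \<open>\<open>zval\<close> records t(X)^p, so xi^p is obtained after cancelling the
    p-th power of the unit t(1).\<close>
  have "xi t [^] p \<otimes> t (0, 0) [^] p = xi t' [^] p \<otimes> t (0, 0) [^] p"
    using xi_pow[OF t] xi_pow[OF t'] z[OF idx_small(2)] t0 by (simp add: zval_def)
  then have "xi t [^] p = xi t' [^] p"
    using inv_pow_cancel(1)[OF pt_00[OF t], of "xi t [^] p" p] inv_pow_cancel(1)[OF pt_00[OF t], of "xi t' [^] p" p]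
      B.nat_pow_closed[OF xi_closed[OF t]] B.nat_pow_closed[OF xi_closed[OF t']] by metis
  then have xp: "x [^] p = \<zero>" by (simp add: x_def B.nat_pow_distrib B.frobenius_minus[OF p char])
  have "eta t [^] p = eta t' [^] p" using eta_pow z[OF idx_small(3)] by simp
  then have yp: "y [^] p = \<zero>" by (simp add: y_def B.nat_pow_distrib B.frobenius_minus[OF p char])
  note a = act_props[OF c xp yp t]
  have kx: "?k \<otimes> (inv ?k \<otimes> w) = w" if "w \<in> carrier B" for w using that by (simp add: B.m_assoc[symmetric])
  have canc: "v \<oplus> (w \<ominus> v) = w" if "v \<in> carrier B" "w \<in> carrier B" for v w
    using that by (metis B.a_lcomm B.minus_eq B.r_neg B.r_zero B.a_inv_closed)
  have xi': "xi (act t x y) = xi t'" unfolding a(2) by (simp add: x_def kx canc)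
  have eta': "eta (act t x y) = eta t'" unfolding a(3) by (simp add: y_def kx canc)
  \<comment> \<open>The translate now has the \<open>xi\<close> and \<open>eta\<close> of
    \<open>t'\<close>, so its invariant values and those of \<open>t'\<close> refer to the same
    shifted coordinates, where a functional is determined by its values.\<close>
  have "Fpt (act t x y) (xi t') (eta t') j = FF t' j" if "j \<in> idx p" for j
  proof -
    have "FF (act t x y) j = fval (zval t) j" unfolding a(4) by (rule FF_of_zval[OF t])
    also have "\<dots> = fval (zval t') j" using z[OF that] z[OF idx_small(1)] by (simp add: fval_def)
    finally show ?thesis using FF_of_zval[OF t'] by (simp add: xi' eta')
  qed
  then have "act t x y j = t' j" if "j \<in> idx p" for j
    using that by (intro Lt_change[OF xi_closed[OF t'] eta_closed[OF t'] kap_unit[OF t'] pt_closed[OF a(1)] pt_closed[OF t']])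
  then show thesis using that[OF c xp yp] by simp
qed

end

section \<open>Naturality of the coordinates\<close>

text \<open>The defining choice mentions \<open>t\<close> on \<open>idx p\<close> alone, so the two
  families describe the same choice.\<close>

lemma (in point_ring) Lt_cong: "(\<And>j. j \<in> idx p \<Longrightarrow> t j = t' j) \<Longrightarrow> Lt t = Lt t'"
  unfolding Lt_def tlin_def by simp

lemma (in point_ring) zval_cong:
  assumes "\<And>j. j \<in> idx p \<Longrightarrow> t j = t' j"
  shows "zval t j = zval t' j"
  using Lt_cong[OF assms] assms[OF idx_small(1)] assms[OF idx_small(2)]
  by (simp add: zval_def Fpt_def xi_def eta_def)

text \<open>The functionals are obtained by choice, separately over each test ring; their
  compatibility with a change of ring rests on their uniqueness.\<close>

locale point_hom = B: point_ring B p l + C: point_ring C p m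
  for B :: "('b, 'k) ring_scheme" and C :: "('c, 'n) ring_scheme" and p l m +
  fixes h :: "'b \<Rightarrow> 'c"
  assumes h: "h \<in> ring_hom B C" and hl: "h l = m"
begin

sublocale hh: ring_hom_cring B C h
  using h by unfold_locales

lemma lift_hom:
  obtains H where "H \<in> ring_hom B.V.V C.V.V" "H B.X = C.X" "H B.Y = C.Y"
    "\<And>r. r \<in> carrier B \<Longrightarrow> H (B.cst r) = C.cst (h r)"
proof -
  have "\<exists>H\<in>ring_hom B.V.V C.V.V. H B.X = C.X \<and> H B.Y = C.Y \<and>
      (\<forall>r\<in>carrier B. H (B.cst r) = (C.cst \<circ> h) r)"
    by (rule B.V.V_lift[OF C.V.V_cring ring_hom_trans[OF h C.V.VA.struct_hom]])
      (simp_all add: C.XY_pow)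
  then show thesis using that by auto
qed

context
  fixes H
  assumes H: "H \<in> ring_hom B.V.V C.V.V" "H B.X = C.X" "H B.Y = C.Y"
    and Hc: "\<And>r. r \<in> carrier B \<Longrightarrow> H (B.cst r) = C.cst (h r)"
begin

interpretation H: ring_hom_cring B.V.V C.V.V H
  using H B.V.V_cring C.V.V_cring by (simp add: ring_hom_cring_def ring_hom_cring_axioms_def)

text \<open>Both sides are additive in \<open>z\<close> and agree on scalar multiples of monomials,
  where the two choices are pinned down by \<open>t\<close>.\<close>

lemma Lt_nat:
  assumes t: "t \<in> idx p \<rightarrow> carrier B" and z: "z \<in> carrier B.V.V"
  shows "C.Lt (\<lambda>j. h (t j)) (H z) = h (B.Lt t z)"
proof -
  have ht: "(\<lambda>j. h (t j)) \<in> idx p \<rightarrow> carrier C" using t by (auto simp: Pi_iff)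
  show ?thesis
  proof (rule B.V.additive_ext[OF additive_map_comp[OF ring_hom_additive[OF H(1)] C.Lt_props(1)[OF ht]]
        additive_map_comp[OF B.Lt_props(1)[OF t] ring_hom_additive[OF h]] _ z])
    fix r j assume r: "r \<in> carrier B" and j: "j \<in> idx p"
    have "H (B.V.mon j) = C.V.mon j" by (simp add: tmon_def H.hom_nat_pow H)
    then have "H (r \<odot>\<^bsub>B.V.V\<^esub> B.V.mon j) = C.cst (h r) \<otimes>\<^bsub>C.V.V\<^esub> C.V.mon j"
      using r by (simp add: B.V.VA.smult_eq_mult Hc)
    moreover have "t j \<in> carrier B" using t j by auto
    ultimately show "C.Lt (\<lambda>j. h (t j)) (H (r \<odot>\<^bsub>B.V.V\<^esub> B.V.mon j)) = h (B.Lt t (r \<odot>\<^bsub>B.V.V\<^esub> B.V.mon j))"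
      using r j by (simp add: C.Lt_props(2,3)[OF ht] B.V.VA.smult_eq_mult B.Lt_props(2,3)[OF t])
  qed
qed

lemma kap_nat: "x \<in> carrier B \<Longrightarrow> h (B.kap x) = C.kap (h x)"
  by (simp add: B.kap_def C.kap_def hl)

lemma Uinv_nat: "H B.Uinv = C.Uinv"
  by (simp add: B.Uinv_def C.Uinv_def H.hom_nat_pow H Hc hl)

lemma Yp_nat: "H B.Yp = C.Yp"
  using B.Uinv(1) by (simp add: B.Yp_def C.Yp_def H Uinv_nat)

lemma Xt_nat: "x \<in> carrier B \<Longrightarrow> B.kap x \<in> Units B \<Longrightarrow> H (B.Xt x) = C.Xt (h x)"
  by (simp add: B.Xt_def C.Xt_def H.hom_minus H Hc hh.hom_inv kap_nat)

lemma Yt_nat: "x \<in> carrier B \<Longrightarrow> y \<in> carrier B \<Longrightarrow> H (B.Yt x y) = C.Yt (h x) (h y)"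
  by (simp add: B.Yt_def C.Yt_def H.hom_minus H Hc Yp_nat kap_nat)

end

lemma coord_nat:
  assumes t: "B.pt t"
  shows "h (B.xi t) = C.xi (\<lambda>j. h (t j))" "h (B.eta t) = C.eta (\<lambda>j. h (t j))"
    "h (B.zval t j) = C.zval (\<lambda>j. h (t j)) j"
proof -
  obtain H where H: "H \<in> ring_hom B.V.V C.V.V" "H B.X = C.X" "H B.Y = C.Y"
    "\<And>r. r \<in> carrier B \<Longrightarrow> H (B.cst r) = C.cst (h r)"
    using lift_hom by metis
  interpret H: ring_hom_cring B.V.V C.V.V H
    using H B.V.V_cring C.V.V_cring by (simp add: ring_hom_cring_def ring_hom_cring_axioms_def)
  have L: "h (B.Lt t z) = C.Lt (\<lambda>j. h (t j)) (H z)" if "z \<in> carrier B.V.V" for z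
    by (rule Lt_nat[OF H(1-3) _ B.pt_closed[OF t] that, symmetric]) (rule H(4))
  note cl [simp] = B.xi_closed[OF t] B.eta_closed[OF t] B.kap_unit[OF t] B.pt_00[OF t]
    B.pt_mem[OF t B.idx_small(2)] B.Lt_props(4)[OF B.pt_closed[OF t]]
  show xi: "h (B.xi t) = C.xi (\<lambda>j. h (t j))"
    by (simp add: B.xi_def C.xi_def hh.hom_inv)
  have Yp: "H B.Yp = C.Yp" by (rule Yp_nat[OF H(1-3)]) (rule H(4))
  show eta: "h (B.eta t) = C.eta (\<lambda>j. h (t j))"
    by (simp add: B.eta_def C.eta_def hh.hom_inv xi kap_nat[OF H(1-3)] H(4) L Yp)
  have Xt: "H (B.Xt (B.xi t)) = C.Xt (C.xi (\<lambda>j. h (t j)))"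
    by (subst xi[symmetric]) (rule Xt_nat[OF H(1-3)], simp_all add: H(4))
  have Yt: "H (B.Yt (B.xi t) (B.eta t)) = C.Yt (C.xi (\<lambda>j. h (t j))) (C.eta (\<lambda>j. h (t j)))"
    by (subst xi[symmetric], subst eta[symmetric]) (rule Yt_nat[OF H(1-3)], simp_all add: H(4))
  have FF: "h (B.FF t j) = C.FF (\<lambda>j. h (t j)) j" for j
    by (simp add: B.Fpt_def C.Fpt_def L H.hom_nat_pow Xt Yt)
  have FFc: "B.FF t j \<in> carrier B" by (intro B.Fpt_closed B.pt_closed t) simp_all
  show "h (B.zval t j) = C.zval (\<lambda>j. h (t j)) j"
    using FFc by (simp add: B.zval_def C.zval_def hh.hom_nat_pow eta FF)
qed

end

section \<open>The coordinate rings\<close>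

lemma (in cring) finprod_Units_iff:
  assumes "finite I" "f \<in> I \<rightarrow> carrier R"
  shows "finprod R f I \<in> Units R \<longleftrightarrow> (\<forall>i\<in>I. f i \<in> Units R)"
  using assms
proof (induction I)
  case (insert i I)
  then have c: "f i \<in> carrier R" "finprod R f I \<in> carrier R" by auto
  have "f i \<otimes> finprod R f I \<in> Units R \<longleftrightarrow> f i \<in> Units R \<and> finprod R f I \<in> Units R"
    using Units_of_mult[OF c] Units_of_mult[OF c(2,1)] m_comm[OF c] Units_m_closed by metis
  moreover have "f \<in> I \<rightarrow> carrier R" using insert by auto
  ultimately show ?case using insert c by simp
qed simp

locale hopf =
  fixes R :: "('r, 'k) ring_scheme" and p :: nat and lam :: 'r
  assumes p: "Factorial_Ring.prime p" and R: "cring R" and char: "[p] \<cdot>\<^bsub>R\<^esub> \<one>\<^bsub>R\<^esub> = \<zero>\<^bsub>R\<^esub>"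
    and lam: "lam \<in> carrier R"
begin

abbreviation A where "A \<equiv> A_alg R p"
abbreviation S where "S \<equiv> S_alg R p lam"
abbreviation Z where "Z \<equiv> Z_alg R p lam"
abbreviation P where "P \<equiv> mpoly R (idx p)"
abbreviation T where "T \<equiv> S_var R p lam"
abbreviation e where "e \<equiv> A_basis R p"

sublocale Rp: point_ring R p lam
  using p R char lam by (simp add: point_ring_def point_ring_axioms_def)

lemma alg_point: "algebra R B \<Longrightarrow> point_ring B p (struct_map B lam)"
  using p lam by (simp add: point_ring_def point_ring_axioms_def algebra.axioms(2) algebra.algebra_char[OF _ char]
    algebra.struct_closed)

lemma alg_point_hom:
  assumes "algebra R B" "algebra R C" "h \<in> alg_hom R B C"
  shows "point_hom B C p (struct_map B lam) (struct_map C lam) h"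
  using assms lam by (simp add: point_hom_def point_hom_axioms_def alg_point alg_homD alg_hom_struct)

lemma finite_idx: "finite (idx p)"
  by (simp add: idx_def)

lemma UNIV_coord: "(UNIV :: coord set) = {CX, CY}"
  by (auto intro: coord.exhaust)

lemma A_rels_eq: "A_rels R p = trunc_rels R p CX CY \<zero>\<^bsub>R\<^esub> \<zero>\<^bsub>R\<^esub>"
proof -
  have "struct_map Rp.V.P \<zero>\<^bsub>R\<^esub> = \<zero>\<^bsub>Rp.V.P\<^esub>"
    by (simp add: struct_map_def)
  then show ?thesis
    using Rp.V.mv_closed unfolding A_rels_def trunc_rels_def Let_def UNIV_coord
    by (simp add: Rp.V.PA.minus_eq)
qed

text \<open>The Hopf algebra is the truncated algebra over \<open>R\<close> with both constants 0,
  which supplies its universal property and its monomial basis.\<close>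

lemma A_eq: "A = Rp.V.V"
  by (simp add: A_alg_def trunc_def A_rels_eq UNIV_coord)

lemma A_gen_eq: "A_gen R p CX = Rp.X" "A_gen R p CY = Rp.Y"
  by (simp_all add: A_gen_def tgen_def A_rels_eq UNIV_coord)

lemma A_basis_eq: "e = Rp.V.mon"
  by (simp add: fun_eq_iff A_basis_def tmon_def A_gen_eq A_eq)

lemma A_algebra: "algebra R A"
  unfolding A_eq by (rule Rp.V.V_algebra)

lemma e_closed: "e j \<in> carrier A"
  by (simp add: A_eq A_basis_eq)

lemma A_lift:
  assumes B: "algebra R B" and x: "x \<in> carrier B" "y \<in> carrier B"
    and xp: "x [^]\<^bsub>B\<^esub> p = \<zero>\<^bsub>B\<^esub>" "y [^]\<^bsub>B\<^esub> p = \<zero>\<^bsub>B\<^esub>"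
  obtains g where "g \<in> alg_hom R A B" "g Rp.X = x" "g Rp.Y = y"
proof -
  interpret B: algebra R B by fact
  have s0: "struct_map B \<zero>\<^bsub>R\<^esub> = \<zero>\<^bsub>B\<^esub>" by (simp add: struct_map_def)
  obtain g where g: "g \<in> ring_hom A B" "g Rp.X = x" "g Rp.Y = y"
    "\<And>r. r \<in> carrier R \<Longrightarrow> g (struct_map A r) = struct_map B r"
    using Rp.V.V_lift[OF B.M_cring B.struct_hom x] xp s0 unfolding A_eq by auto
  then show thesis using that alg_homI'[OF A_algebra B g(1)] by blast
qed

lemma mv_closed: "j \<in> idx p \<Longrightarrow> mvar R (idx p) j \<in> carrier P"
  by (rule mvar_closed[OF R])

lemma k0_idx: "k < p \<Longrightarrow> (k, 0) \<in> idx p"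
  by (simp add: idx_def)

section \<open>The coordinate ring of the unit group scheme and its points\<close>

sublocale PA: algebra R P
  by (rule mpoly_algebra[OF R])

lemma D_closed: "D_elem R p lam \<in> carrier P"
  unfolding D_elem_def Let_def using lam
  by (intro PA.finprod_closed funcsetI PA.nat_pow_closed PA.M.finsum_closed PA.M.add.nat_pow_closed
    PA.smult_closed mv_closed k0_idx Rp.B.nat_pow_closed) auto

sublocale SL: loc_alg R P "{D_elem R p lam}"
  by unfold_locales (use D_closed in auto)

lemma S_eq: "S = SL.Lc"
  by (simp add: S_alg_def)

lemma T_eq: "T j = SL.fr (mvar R (idx p) j) \<one>\<^bsub>P\<^esub>"
  by (simp add: S_var_def)

lemma S_algebra: "algebra R S"
  unfolding S_eq by (rule SL.Lc_algebra)

lemma T_closed: "j \<in> idx p \<Longrightarrow> T j \<in> carrier S"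
  unfolding S_eq T_eq by (intro SL.fr_closed mv_closed) simp_all

lemma eval_smult:
  assumes h: "h \<in> ring_hom P B" and hc: "\<And>r. r \<in> carrier R \<Longrightarrow> h (struct_map P r) = struct_map B r"
    and B: "algebra R B" and f: "f \<in> carrier P"
  shows "h ((lam [^]\<^bsub>R\<^esub> (k::nat)) \<odot>\<^bsub>P\<^esub> f) = struct_map B lam [^]\<^bsub>B\<^esub> k \<otimes>\<^bsub>B\<^esub> h f"
proof -
  interpret B: algebra R B by fact
  interpret s: ring_hom_cring R B "struct_map B"
    using B.struct_hom B.M_cring R by (simp add: ring_hom_cring_def ring_hom_cring_axioms_def)
  show ?thesis using f lam ring_hom_mult[OF h]
    by (simp add: PA.smult_eq_mult PA.struct_closed hc s.hom_nat_pow)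
qed

text \<open>Evaluated in \<open>B\<close>, the factors of \<open>D_elem\<close> are p-th powers of
  \<open>wsum\<close>; a product is a unit exactly when every factor is.\<close>

lemma D_eval:
  assumes h: "h \<in> ring_hom P B" and hc: "\<And>r. r \<in> carrier R \<Longrightarrow> h (struct_map P r) = struct_map B r"
    and B: "algebra R B"
  shows "h (D_elem R p lam) \<in> Units B \<longleftrightarrow>
    point_ring.pt B p (struct_map B lam) (\<lambda>j. h (mvar R (idx p) j))"
proof -
  interpret B: point_ring B p "struct_map B lam" by (rule alg_point[OF B])
  interpret h: ring_hom_cring P B h
    using h B.B.is_cring PA.M_cring by (simp add: ring_hom_cring_def ring_hom_cring_axioms_def)
  let ?t = "\<lambda>j. h (mvar R (idx p) j)"
  let ?w = "\<lambda>r. \<Oplus>\<^bsub>P\<^esub>k\<in>{..r}. [(r choose k)] \<cdot>\<^bsub>P\<^esub> ((lam [^]\<^bsub>R\<^esub> k) \<odot>\<^bsub>P\<^esub> mvar R (idx p) (k, 0))"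
  have c: "(\<lambda>k. [(r choose k)] \<cdot>\<^bsub>P\<^esub> ((lam [^]\<^bsub>R\<^esub> k) \<odot>\<^bsub>P\<^esub> mvar R (idx p) (k, 0))) \<in> {..r} \<rightarrow> carrier P"
    if "r < p" for r
    using that lam by (intro funcsetI PA.M.add.nat_pow_closed PA.smult_closed mv_closed k0_idx Rp.B.nat_pow_closed) auto
  have w: "h (?w r) = B.wsum r (\<lambda>k. ?t (k, 0))" if r: "r < p" for r
  proof -
    have "h (?w r) = (\<Oplus>\<^bsub>B\<^esub>k\<in>{..r}. h ([(r choose k)] \<cdot>\<^bsub>P\<^esub> ((lam [^]\<^bsub>R\<^esub> k) \<odot>\<^bsub>P\<^esub> mvar R (idx p) (k, 0))))"
      using h.hom_finsum[OF c[OF r]] by (simp add: o_def)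
    also have "\<dots> = B.wsum r (\<lambda>k. ?t (k, 0))"
      unfolding B.wsum_def using r lam mv_closed[OF k0_idx]
      by (intro B.B.finsum_cong') (auto simp: h.hom_add_pow eval_smult[OF h hc B])
    finally show ?thesis .
  qed
  have wc: "?w r \<in> carrier P" if "r < p" for r using c[OF that] by (rule PA.M.finsum_closed)
  have "h (D_elem R p lam) = (\<Otimes>\<^bsub>B\<^esub>r\<in>{..<p}. h (?w r [^]\<^bsub>P\<^esub> p))"
    unfolding D_elem_def Let_def using wc h.hom_finprod[of "\<lambda>r. ?w r [^]\<^bsub>P\<^esub> p" "{..<p}"] by (simp add: o_def Pi_iff)
  also have "\<dots> = (\<Otimes>\<^bsub>B\<^esub>r\<in>{..<p}. B.wsum r (\<lambda>k. ?t (k, 0)) [^]\<^bsub>B\<^esub> p)"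
    using wc w[symmetric] by (intro B.B.finprod_cong') (auto simp: h.hom_nat_pow)
  finally have hD: "h (D_elem R p lam) = \<dots>" .
  have wB: "B.wsum r (\<lambda>k. ?t (k, 0)) \<in> carrier B" if "r < p" for r
    unfolding w[OF that, symmetric] by (rule h.hom_closed[OF wc[OF that]])
  have "h (D_elem R p lam) \<in> Units B \<longleftrightarrow> (\<forall>r\<in>{..<p}. B.wsum r (\<lambda>k. ?t (k, 0)) [^]\<^bsub>B\<^esub> p \<in> Units B)"
    unfolding hD by (rule B.B.finprod_Units_iff) (auto simp: wB)
  also have "\<dots> \<longleftrightarrow> (\<forall>r<p. B.wsum r (\<lambda>k. ?t (k, 0)) \<in> Units B)"
    using B.B.Units_of_pow[OF wB _ B.p_gt(1)] B.B.Units_pow_closed by (metis lessThan_iff)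
  finally show ?thesis using mv_closed by (auto simp: B.pt_def Pi_iff)
qed

lemma P_eval:
  assumes B: "algebra R B" and t: "t \<in> idx p \<rightarrow> carrier B"
  obtains h where "h \<in> ring_hom P B" "\<And>j. j \<in> idx p \<Longrightarrow> h (mvar R (idx p) j) = t j"
    "\<And>r. r \<in> carrier R \<Longrightarrow> h (struct_map P r) = struct_map B r"
  using mpoly_eval[OF R algebra.axioms(2)[OF B] finite_idx algebra.struct_hom[OF B] t] by blast

lemma pt_cong:
  assumes "algebra R B" "\<And>j. j \<in> idx p \<Longrightarrow> t j = t' j"
  shows "point_ring.pt B p (struct_map B lam) t \<longleftrightarrow> point_ring.pt B p (struct_map B lam) t'"
proof -
  interpret B: point_ring B p "struct_map B lam" by (rule alg_point[OF assms(1)])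
  have "B.wsum r (\<lambda>k. t (k, 0)) = B.wsum r (\<lambda>k. t' (k, 0))" if "r < p" "t' \<in> idx p \<rightarrow> carrier B" for r
    using that assms(2) k0_idx by (intro B.wsum_cong) auto
  moreover have "t \<in> idx p \<rightarrow> carrier B \<longleftrightarrow> t' \<in> idx p \<rightarrow> carrier B" using assms(2) by (auto simp: Pi_iff)
  ultimately show ?thesis by (auto simp: B.pt_def)
qed

lemma loc_struct:
  assumes "loc_alg R P E" "r \<in> carrier R"
  shows "Defs.frac P E (struct_map P r) \<one>\<^bsub>P\<^esub> = struct_map (localization P E) r"
proof -
  interpret L: loc_alg R P E by fact
  show ?thesis using alg_hom_struct[OF L.fr_hom PA.algebra_axioms assms(2)] .
qed

text \<open>Together with \<open>S_hom_eq\<close> and \<open>S_pt\<close>: homomorphisms from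
  \<open>S\<close> to \<open>B\<close> correspond to the families satisfying \<open>pt\<close>, so
  \<open>S\<close> represents the unit group functor.\<close>

lemma S_lift:
  assumes B: "algebra R B" and t: "point_ring.pt B p (struct_map B lam) t"
  obtains u where "u \<in> alg_hom R S B" "\<And>j. j \<in> idx p \<Longrightarrow> u (T j) = t j"
proof -
  interpret B: point_ring B p "struct_map B lam" by (rule alg_point[OF B])
  obtain h where h: "h \<in> ring_hom P B" "\<And>j. j \<in> idx p \<Longrightarrow> h (mvar R (idx p) j) = t j"
    "\<And>r. r \<in> carrier R \<Longrightarrow> h (struct_map P r) = struct_map B r"
    using P_eval[OF B B.pt_closed[OF t]] by metis
  have "h (D_elem R p lam) \<in> Units B"
    using D_eval[OF h(1,3) B] pt_cong[OF B h(2)] t by simp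
  then obtain u where u: "u \<in> ring_hom S B" "\<And>f. f \<in> carrier P \<Longrightarrow> u (SL.fr f \<one>\<^bsub>P\<^esub>) = h f"
    using SL.localization_lift[OF h(1) B.B.is_cring] unfolding S_eq by blast
  have "u (struct_map S r) = struct_map B r" if r: "r \<in> carrier R" for r
    using u(2)[OF PA.struct_closed[OF r]] loc_struct[OF SL.loc_alg_axioms r] h(3)[OF r] by (simp add: S_eq)
  then have "u \<in> alg_hom R S B" by (rule alg_homI'[OF S_algebra B u(1)])
  moreover have "u (T j) = t j" if "j \<in> idx p" for j using that u(2) h(2) mv_closed by (simp add: T_eq)
  ultimately show thesis by (rule that)
qed

lemma S_hom_eq:
  assumes B: "algebra R B" and u: "u \<in> alg_hom R S B" and u': "u' \<in> alg_hom R S B"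
    and eq: "\<And>j. j \<in> idx p \<Longrightarrow> u (T j) = u' (T j)" and s: "s \<in> carrier S"
  shows "u s = u' s"
proof (rule SL.localization_ext[OF _ _ algebra.axioms(2)[OF B]])
  show "u \<in> ring_hom SL.Lc B" "u' \<in> ring_hom SL.Lc B" using alg_homD[OF u] alg_homD[OF u'] by (simp_all add: S_eq)
  fix f assume f: "f \<in> carrier P"
  have hom: "(\<lambda>f. v (SL.fr f \<one>\<^bsub>P\<^esub>)) \<in> ring_hom P B" if "v \<in> alg_hom R S B" for v
    using ring_hom_trans[OF alg_homD[OF SL.fr_hom] alg_homD[OF that[unfolded S_eq]]] by (simp add: o_def)
  show "u (SL.fr f \<one>\<^bsub>P\<^esub>) = u' (SL.fr f \<one>\<^bsub>P\<^esub>)"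
    using alg_hom_struct[OF u S_algebra] alg_hom_struct[OF u' S_algebra] loc_struct[OF SL.loc_alg_axioms]
    by (intro mpoly_hom_eq[OF R algebra.axioms(2)[OF B] hom[OF u] hom[OF u'] _ _ f])
      (simp_all add: S_eq eq[unfolded T_eq])
qed (use s S_eq in simp)

lemma S_pt:
  assumes B: "algebra R B" and u: "u \<in> alg_hom R S B"
  shows "point_ring.pt B p (struct_map B lam) (\<lambda>j. u (T j))"
proof -
  interpret u: ring_hom_cring S B u by (rule alg_hom_ring_hom_cring[OF u S_algebra B])
  let ?h = "\<lambda>f. u (SL.fr f \<one>\<^bsub>P\<^esub>)"
  have h: "?h \<in> ring_hom P B"
    using ring_hom_trans[OF alg_homD[OF SL.fr_hom] alg_homD[OF u[unfolded S_eq]]] by (simp add: o_def)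
  have "SL.fr (D_elem R p lam) \<one>\<^bsub>P\<^esub> \<in> Units S"
    unfolding S_eq by (rule SL.fr_unit) (simp add: mult_closure.incl)
  then have D: "?h (D_elem R p lam) \<in> Units B" by (rule u.hom_Units)
  have "?h (struct_map P r) = struct_map B r" if "r \<in> carrier R" for r
    using that alg_hom_struct[OF u S_algebra] loc_struct[OF SL.loc_alg_axioms] by (simp add: S_eq)
  from D_eval[OF h this B] D show ?thesis by (simp add: T_eq)
qed

section \<open>The localized polynomial algebra and its points\<close>

abbreviation denP where "denP s \<equiv>
  ((mvar R (idx p) (0, 0) [^]\<^bsub>P\<^esub> (s - 1)) \<oplus>\<^bsub>P\<^esub>
    (\<Oplus>\<^bsub>P\<^esub>k\<in>{2..s - 1}. [(s choose k)] \<cdot>\<^bsub>P\<^esub>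
      ((lam [^]\<^bsub>R\<^esub> k) \<odot>\<^bsub>P\<^esub> ((mvar R (idx p) (0, 0) [^]\<^bsub>P\<^esub> (s - k)) \<otimes>\<^bsub>P\<^esub> mvar R (idx p) (k, 0))))) \<oplus>\<^bsub>P\<^esub>
  ((lam [^]\<^bsub>R\<^esub> s) \<odot>\<^bsub>P\<^esub> mvar R (idx p) (s, 0))"

text \<open>The separately listed quadratic denominator is the case s = 2 of the general formula,
  with an empty sum. This puts all of them into one family, which is empty for p = 2.\<close>

lemma Z_denoms_eq:
  "Z_denoms R p lam = {mvar R (idx p) (0, 0),
     (mvar R (idx p) (0, 0) [^]\<^bsub>P\<^esub> p) \<oplus>\<^bsub>P\<^esub> ((lam [^]\<^bsub>R\<^esub> p) \<odot>\<^bsub>P\<^esub> mvar R (idx p) (1, 0))} \<union>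
   {denP s | s. 2 \<le> s \<and> s < p}"
proof -
  have den2: "denP 2 = mvar R (idx p) (0, 0) \<oplus>\<^bsub>P\<^esub> ((lam [^]\<^bsub>R\<^esub> (2::nat)) \<odot>\<^bsub>P\<^esub> mvar R (idx p) (2, 0))"
    using mv_closed[OF Rp.idx_small(1)] by (simp add: One_nat_def)
  have split: "{f s | s. 2 \<le> s \<and> s < p} = (if 3 \<le> p then {f 2} else {}) \<union> {f s | s. 3 \<le> s \<and> s \<le> p - 1}"
    for f :: "nat \<Rightarrow> (nat \<times> nat) multiset \<Rightarrow> 'r"
  proof -
    have "2 \<le> s \<and> s < p \<longleftrightarrow> (3 \<le> p \<and> s = 2) \<or> (3 \<le> s \<and> s \<le> p - 1)" for s by auto
    then show ?thesis by auto
  qed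
  have "{denP s | s. 2 \<le> s \<and> s < p} = (if 3 \<le> p then {denP 2} else {}) \<union> {denP s | s. 3 \<le> s \<and> s \<le> p - 1}"
    by (rule split)
  then show ?thesis unfolding Z_denoms_def Let_def den2[symmetric] by auto
qed

lemma denP_closed: "s < p \<Longrightarrow> denP s \<in> carrier P"
  using lam by (intro PA.M.a_closed PA.nat_pow_closed PA.M.finsum_closed funcsetI PA.M.add.nat_pow_closed
    PA.smult_closed PA.m_closed mv_closed k0_idx Rp.B.nat_pow_closed) auto

lemma Z_denoms_closed: "Z_denoms R p lam \<subseteq> carrier P"
  unfolding Z_denoms_eq using mv_closed[OF Rp.idx_small(1)] mv_closed[OF Rp.idx_small(2)] lam denP_closed by auto

sublocale ZL: loc_alg R P "Z_denoms R p lam"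
  by unfold_locales (rule Z_denoms_closed)

abbreviation zv where "zv j \<equiv> ZL.fr (mvar R (idx p) j) \<one>\<^bsub>P\<^esub>"

lemma Z_eq: "Z = ZL.Lc"
  by (simp add: Z_alg_def)

lemma Z_algebra: "algebra R Z"
  unfolding Z_eq by (rule ZL.Lc_algebra)

lemma zv_closed: "j \<in> idx p \<Longrightarrow> zv j \<in> carrier Z"
  unfolding Z_eq by (intro ZL.fr_closed mv_closed) simp_all

lemma Z_eval:
  assumes h: "h \<in> ring_hom P B" and hc: "\<And>r. r \<in> carrier R \<Longrightarrow> h (struct_map P r) = struct_map B r"
    and B: "algebra R B"
  shows "(\<forall>d\<in>Z_denoms R p lam. h d \<in> Units B) \<longleftrightarrow>
    point_ring.zpt B p (struct_map B lam) (\<lambda>j. h (mvar R (idx p) j))"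
proof -
  interpret B: point_ring B p "struct_map B lam" by (rule alg_point[OF B])
  interpret h: ring_hom_cring P B h
    using h B.B.is_cring PA.M_cring by (simp add: ring_hom_cring_def ring_hom_cring_axioms_def)
  let ?z = "\<lambda>j. h (mvar R (idx p) j)"
  note m0 [simp] = mv_closed[OF Rp.idx_small(1)] mv_closed[OF Rp.idx_small(2)]
  have lc [simp]: "lam [^]\<^bsub>R\<^esub> (k::nat) \<in> carrier R" for k using lam by simp
  have d1: "h ((mvar R (idx p) (0, 0) [^]\<^bsub>P\<^esub> p) \<oplus>\<^bsub>P\<^esub> ((lam [^]\<^bsub>R\<^esub> p) \<odot>\<^bsub>P\<^esub> mvar R (idx p) (1, 0))) =
      ?z (0, 0) [^]\<^bsub>B\<^esub> p \<oplus>\<^bsub>B\<^esub> struct_map B lam [^]\<^bsub>B\<^esub> p \<otimes>\<^bsub>B\<^esub> ?z (1, 0)"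
    by (simp add: h.hom_nat_pow eval_smult[OF h hc B])
  have ds: "h (denP s) = B.den s ?z" if s: "s < p" for s
  proof -
    let ?f = "\<lambda>k. [(s choose k)] \<cdot>\<^bsub>P\<^esub> ((lam [^]\<^bsub>R\<^esub> k) \<odot>\<^bsub>P\<^esub> ((mvar R (idx p) (0, 0) [^]\<^bsub>P\<^esub> (s - k)) \<otimes>\<^bsub>P\<^esub> mvar R (idx p) (k, 0)))"
    have mk: "mvar R (idx p) (k, 0) \<in> carrier P" if "k \<le> s" for k using that s by (intro mv_closed k0_idx) simp
    have fc: "?f \<in> {2..s - 1} \<rightarrow> carrier P" using mk by auto
    have "h (finsum P ?f {2..s - 1}) = (\<Oplus>\<^bsub>B\<^esub>k\<in>{2..s - 1}. h (?f k))"
      using h.hom_finsum[OF fc] by (simp add: o_def)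
    also have "\<dots> = (\<Oplus>\<^bsub>B\<^esub>k\<in>{2..s - 1}. [(s choose k)] \<cdot>\<^bsub>B\<^esub> (struct_map B lam [^]\<^bsub>B\<^esub> k \<otimes>\<^bsub>B\<^esub> (?z (0, 0) [^]\<^bsub>B\<^esub> (s - k) \<otimes>\<^bsub>B\<^esub> ?z (k, 0))))"
      using mk by (intro B.B.finsum_cong') (auto simp: h.hom_add_pow eval_smult[OF h hc B] h.hom_nat_pow)
    finally show ?thesis
      using mk[of s] PA.M.finsum_closed[OF fc] by (simp add: B.den_def h.hom_nat_pow eval_smult[OF h hc B])
  qed
  have "(\<forall>d\<in>Z_denoms R p lam. h d \<in> Units B) \<longleftrightarrow> ?z (0, 0) \<in> Units B \<and>
      ?z (0, 0) [^]\<^bsub>B\<^esub> p \<oplus>\<^bsub>B\<^esub> struct_map B lam [^]\<^bsub>B\<^esub> p \<otimes>\<^bsub>B\<^esub> ?z (1, 0) \<in> Units B \<and>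
      (\<forall>s. 2 \<le> s \<and> s < p \<longrightarrow> h (denP s) \<in> Units B)"
    unfolding Z_denoms_eq d1[symmetric] by blast
  then show ?thesis using mv_closed ds by (auto simp: B.zpt_def Pi_iff)
qed

lemma zpt_cong:
  assumes "algebra R B" "\<And>j. j \<in> idx p \<Longrightarrow> z j = z' j"
  shows "point_ring.zpt B p (struct_map B lam) z \<longleftrightarrow> point_ring.zpt B p (struct_map B lam) z'"
proof -
  interpret B: point_ring B p "struct_map B lam" by (rule alg_point[OF assms(1)])
  have m: "z \<in> idx p \<rightarrow> carrier B \<longleftrightarrow> z' \<in> idx p \<rightarrow> carrier B" using assms(2) by (auto simp: Pi_iff)
  have e0: "z (0, 0) = z' (0, 0)" "z (1, 0) = z' (1, 0)" using assms(2) Rp.idx_small by auto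
  have "B.den s z = B.den s z'" if s: "s < p" and z': "z' \<in> idx p \<rightarrow> carrier B" for s
  proof -
    have ek: "z (k, 0) = z' (k, 0)" "z' (k, 0) \<in> carrier B" if "k \<le> s" for k
      using that s assms(2) k0_idx z' by auto
    have "z' (0, 0) \<in> carrier B" using z' Rp.idx_small by auto
    then have "(\<Oplus>\<^bsub>B\<^esub>k\<in>{2..s - 1}. [(s choose k)] \<cdot>\<^bsub>B\<^esub> (struct_map B lam [^]\<^bsub>B\<^esub> k \<otimes>\<^bsub>B\<^esub> (z (0, 0) [^]\<^bsub>B\<^esub> (s - k) \<otimes>\<^bsub>B\<^esub> z (k, 0)))) =
      (\<Oplus>\<^bsub>B\<^esub>k\<in>{2..s - 1}. [(s choose k)] \<cdot>\<^bsub>B\<^esub> (struct_map B lam [^]\<^bsub>B\<^esub> k \<otimes>\<^bsub>B\<^esub> (z' (0, 0) [^]\<^bsub>B\<^esub> (s - k) \<otimes>\<^bsub>B\<^esub> z' (k, 0))))"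
      using ek e0 by (intro B.B.finsum_cong') auto
    then show ?thesis using ek[of s] e0 by (simp add: B.den_def)
  qed
  then show ?thesis using m e0 by (auto simp: B.zpt_def)
qed

text \<open>Together with \<open>Z_hom_eq\<close> and \<open>Z_zpt\<close>: the algebra
  \<open>Z\<close> represents the families satisfying \<open>zpt\<close>.\<close>

lemma Z_lift:
  assumes B: "algebra R B" and z: "point_ring.zpt B p (struct_map B lam) z"
  obtains v where "v \<in> alg_hom R Z B" "\<And>j. j \<in> idx p \<Longrightarrow> v (zv j) = z j"
proof -
  interpret B: point_ring B p "struct_map B lam" by (rule alg_point[OF B])
  have "z \<in> idx p \<rightarrow> carrier B" using z by (simp add: B.zpt_def)
  then obtain h where h: "h \<in> ring_hom P B" "\<And>j. j \<in> idx p \<Longrightarrow> h (mvar R (idx p) j) = z j"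
    "\<And>r. r \<in> carrier R \<Longrightarrow> h (struct_map P r) = struct_map B r"
    using P_eval[OF B] by metis
  have "\<forall>d\<in>Z_denoms R p lam. h d \<in> Units B"
    using Z_eval[OF h(1,3) B] zpt_cong[OF B h(2)] z by simp
  then obtain v where v: "v \<in> ring_hom Z B" "\<And>f. f \<in> carrier P \<Longrightarrow> v (ZL.fr f \<one>\<^bsub>P\<^esub>) = h f"
    using ZL.localization_lift[OF h(1) B.B.is_cring] unfolding Z_eq by blast
  have "v (struct_map Z r) = struct_map B r" if r: "r \<in> carrier R" for r
    using v(2)[OF PA.struct_closed[OF r]] loc_struct[OF ZL.loc_alg_axioms r] h(3)[OF r] by (simp add: Z_eq)
  then have "v \<in> alg_hom R Z B" by (rule alg_homI'[OF Z_algebra B v(1)])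
  moreover have "v (zv j) = z j" if "j \<in> idx p" for j using that v(2) h(2) mv_closed by simp
  ultimately show thesis by (rule that)
qed

lemma Z_hom_eq:
  assumes B: "algebra R B" and u: "u \<in> alg_hom R Z B" and u': "u' \<in> alg_hom R Z B"
    and eq: "\<And>j. j \<in> idx p \<Longrightarrow> u (zv j) = u' (zv j)" and s: "s \<in> carrier Z"
  shows "u s = u' s"
proof (rule ZL.localization_ext[OF _ _ algebra.axioms(2)[OF B]])
  show "u \<in> ring_hom ZL.Lc B" "u' \<in> ring_hom ZL.Lc B" using alg_homD[OF u] alg_homD[OF u'] by (simp_all add: Z_eq)
  fix f assume f: "f \<in> carrier P"
  have hom: "(\<lambda>f. v (ZL.fr f \<one>\<^bsub>P\<^esub>)) \<in> ring_hom P B" if "v \<in> alg_hom R Z B" for v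
    using ring_hom_trans[OF alg_homD[OF ZL.fr_hom] alg_homD[OF that[unfolded Z_eq]]] by (simp add: o_def)
  show "u (ZL.fr f \<one>\<^bsub>P\<^esub>) = u' (ZL.fr f \<one>\<^bsub>P\<^esub>)"
    using alg_hom_struct[OF u Z_algebra] alg_hom_struct[OF u' Z_algebra] loc_struct[OF ZL.loc_alg_axioms]
    by (intro mpoly_hom_eq[OF R algebra.axioms(2)[OF B] hom[OF u] hom[OF u'] _ _ f])
      (simp_all add: Z_eq eq)
qed (use s Z_eq in simp)

lemma Z_zpt:
  assumes B: "algebra R B" and v: "v \<in> alg_hom R Z B"
  shows "point_ring.zpt B p (struct_map B lam) (\<lambda>j. v (zv j))"
proof -
  interpret v: ring_hom_cring Z B v by (rule alg_hom_ring_hom_cring[OF v Z_algebra B])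
  let ?h = "\<lambda>f. v (ZL.fr f \<one>\<^bsub>P\<^esub>)"
  have h: "?h \<in> ring_hom P B"
    using ring_hom_trans[OF alg_homD[OF ZL.fr_hom] alg_homD[OF v[unfolded Z_eq]]] by (simp add: o_def)
  have "ZL.fr d \<one>\<^bsub>P\<^esub> \<in> Units Z" if "d \<in> Z_denoms R p lam" for d
    unfolding Z_eq using that by (intro ZL.fr_unit mult_closure.incl)
  then have D: "\<forall>d\<in>Z_denoms R p lam. ?h d \<in> Units B" using v.hom_Units by blast
  have "?h (struct_map P r) = struct_map B r" if "r \<in> carrier R" for r
    using that alg_hom_struct[OF v Z_algebra] loc_struct[OF ZL.loc_alg_axioms] by (simp add: Z_eq)
  from Z_eval[OF h this B] D show ?thesis by simp
qed

end

section \<open>The coaction\<close>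

context tensor_alg
begin

lemma tens_additive1: "c \<in> carrier C \<Longrightarrow> (\<lambda>b. tens R B C b c) \<in> additive_map B TT"
  by (intro additive_mapI tens_closed tens_add1)

lemma tens_additive2: "b \<in> carrier B \<Longrightarrow> (\<lambda>c. tens R B C b c) \<in> additive_map C TT"
  by (intro additive_mapI tens_closed tens_add2)

lemma tens_zero1: "c \<in> carrier C \<Longrightarrow> tens R B C \<zero>\<^bsub>B\<^esub> c = \<zero>\<^bsub>TT\<^esub>"
  using additive_map_zero[OF tens_additive1] cring.axioms(1)[OF B.M_cring] cring.axioms(1)[OF TTA.M_cring] by blast

lemma tens_zero2: "b \<in> carrier B \<Longrightarrow> tens R B C b \<zero>\<^bsub>C\<^esub> = \<zero>\<^bsub>TT\<^esub>"
  using additive_map_zero[OF tens_additive2] cring.axioms(1)[OF C.M_cring] cring.axioms(1)[OF TTA.M_cring] by blast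

lemma tens_pow: "b \<in> carrier B \<Longrightarrow> c \<in> carrier C \<Longrightarrow>
    tens R B C b c [^]\<^bsub>TT\<^esub> (n::nat) = tens R B C (b [^]\<^bsub>B\<^esub> n) (c [^]\<^bsub>C\<^esub> n)"
  by (induction n) (simp_all add: tens_one tens_mult)

end

context hopf
begin

abbreviation SA where "SA \<equiv> alg_tensor R S A"
abbreviation SS where "SS \<equiv> alg_tensor R S S"
abbreviation AA where "AA \<equiv> alg_tensor R A A"
abbreviation X where "X \<equiv> Rp.X"
abbreviation Y where "Y \<equiv> Rp.Y"
abbreviation w where "w \<equiv> \<one>\<^bsub>A\<^esub> \<oplus>\<^bsub>A\<^esub> lam \<odot>\<^bsub>A\<^esub> X"
abbreviation cd where "cd \<equiv> comult_coeffs R A (A_comult R p lam) (idx p) e"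

lemma XY_closed: "X \<in> carrier A" "Y \<in> carrier A"
  by (simp_all add: A_eq)

lemma XY_pow: "X [^]\<^bsub>A\<^esub> p = \<zero>\<^bsub>A\<^esub>" "Y [^]\<^bsub>A\<^esub> p = \<zero>\<^bsub>A\<^esub>"
  by (simp_all add: A_eq Rp.XY_pow)

lemma e_pow: "e j = X [^]\<^bsub>A\<^esub> fst j \<otimes>\<^bsub>A\<^esub> Y [^]\<^bsub>A\<^esub> snd j"
  by (simp add: A_basis_eq A_eq tmon_def)

interpretation AT: tensor_alg R A A
  by (intro tensor_alg.intro A_algebra)

interpretation SST: tensor_alg R S S
  by (intro tensor_alg.intro S_algebra)

interpretation SAT: tensor_alg R S A
  by (intro tensor_alg.intro A_algebra S_algebra)

interpretation AB: algebra R A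
  by (rule A_algebra)

lemma ring_A: "ring A" and ring_AA: "ring AA"
  using A_algebra AT.TT_algebra algebra.axioms(2) cring.axioms(1) by blast+

lemma w_closed: "w \<in> carrier A"
  using lam XY_closed by simp

text \<open>The comultiplication is a choice of homomorphism, so existence has to be shown: by the
  Frobenius in the tensor square the proposed images of \<open>X\<close> and \<open>Y\<close> have
  p-th power 0.\<close>

lemma comult_props:
  "A_comult R p lam \<in> alg_hom R A AA"
  "A_comult R p lam X = tens R A A X \<one>\<^bsub>A\<^esub> \<oplus>\<^bsub>AA\<^esub> tens R A A w X"
  "A_comult R p lam Y = tens R A A Y \<one>\<^bsub>A\<^esub> \<oplus>\<^bsub>AA\<^esub> tens R A A w Y"
proof -
  note fr = cring.frobenius_add[OF algebra.axioms(2)[OF AT.TT_algebra] p algebra.algebra_char[OF AT.TT_algebra char]]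
  let ?x = "\<lambda>x. tens R A A x \<one>\<^bsub>A\<^esub> \<oplus>\<^bsub>AA\<^esub> tens R A A w x"
  have c: "?x x \<in> carrier AA" if "x \<in> carrier A" for x
    using that w_closed by (simp add: AT.tens_closed)
  have z: "?x x [^]\<^bsub>AA\<^esub> p = \<zero>\<^bsub>AA\<^esub>" if "x \<in> carrier A" "x [^]\<^bsub>A\<^esub> p = \<zero>\<^bsub>A\<^esub>" for x
    using that w_closed by (simp add: fr AT.tens_closed AT.tens_pow AT.tens_zero1 AT.tens_zero2)
  obtain h where h: "h \<in> alg_hom R A AA" "h X = ?x X" "h Y = ?x Y"
    using A_lift[OF AT.TT_algebra c[OF XY_closed(1)] c[OF XY_closed(2)] z[OF XY_closed(1) XY_pow(1)] z[OF XY_closed(2) XY_pow(2)]]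
    by metis
  have "\<forall>v. h (A_gen R p v) = ?x (A_gen R p v)"
  proof
    fix v show "h (A_gen R p v) = ?x (A_gen R p v)"
      using h by (cases v) (simp_all add: A_gen_eq)
  qed
  with h(1) have "\<exists>h. h \<in> alg_hom R A AA \<and> (\<forall>v. h (A_gen R p v) =
      tens R A A (A_gen R p v) \<one>\<^bsub>A\<^esub> \<oplus>\<^bsub>AA\<^esub> tens R A A (\<one>\<^bsub>A\<^esub> \<oplus>\<^bsub>A\<^esub> lam \<odot>\<^bsub>A\<^esub> A_gen R p CX) (A_gen R p v))"
    unfolding A_gen_eq(1) by blast
  from someI_ex[OF this, folded A_comult_def[unfolded Let_def, symmetric]]
  have s: "A_comult R p lam \<in> alg_hom R A AA"
    "\<And>v. A_comult R p lam (A_gen R p v) = ?x (A_gen R p v)"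
    unfolding A_comult_def Let_def A_gen_eq(1) by blast+
  then show "A_comult R p lam \<in> alg_hom R A AA" "A_comult R p lam X = ?x X" "A_comult R p lam Y = ?x Y"
    using s(2)[of CX] s(2)[of CY] by (simp_all add: A_gen_eq)
qed

lemma A_expand:
  assumes "a \<in> carrier A"
  obtains c where "c \<in> idx p \<rightarrow> carrier R" "a = (\<Oplus>\<^bsub>A\<^esub>j\<in>idx p. c j \<odot>\<^bsub>A\<^esub> e j)"
  using Rp.V.expand[of a] Rp.V.coef_closed[of a] assms that[of "\<lambda>j. Rp.V.coef j a"]
  unfolding A_eq A_basis_eq by auto

text \<open>The left factor is expanded in the basis and its coefficients move across the tensor
  sign. This provides the shape in which structure constants are read off.\<close>

lemma AA_expand:
  assumes "z \<in> carrier AA"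
  shows "\<exists>f. f \<in> idx p \<rightarrow> carrier A \<and> z = (\<Oplus>\<^bsub>AA\<^esub>i\<in>idx p. tens R A A (e i) (f i))"
  using assms
proof (induction z rule: AT.tens_induct)
  case (tens b c)
  obtain \<beta> where \<beta>: "\<beta> \<in> idx p \<rightarrow> carrier R" "b = (\<Oplus>\<^bsub>A\<^esub>j\<in>idx p. \<beta> j \<odot>\<^bsub>A\<^esub> e j)"
    using A_expand[OF tens(1)] by metis
  have "tens R A A b c = (\<Oplus>\<^bsub>AA\<^esub>j\<in>idx p. tens R A A (\<beta> j \<odot>\<^bsub>A\<^esub> e j) c)"
    unfolding \<beta>(2) using \<beta>(1) tens(2)
    by (intro additive_map_finsum[OF AT.tens_additive1 ring_A ring_AA]) (auto simp: e_closed)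
  also have "\<dots> = (\<Oplus>\<^bsub>AA\<^esub>j\<in>idx p. tens R A A (e j) (\<beta> j \<odot>\<^bsub>A\<^esub> c))"
    using \<beta>(1) tens(2) by (intro AT.TTA.finsum_cong')
      (auto simp: AT.tens_smult1 AT.tens_smult2 e_closed Pi_iff AT.tens_closed)
  finally show ?case using \<beta>(1) tens(2) by (intro exI[of _ "\<lambda>j. \<beta> j \<odot>\<^bsub>A\<^esub> c"]) (auto simp: Pi_iff)
next
  case (add x y)
  then obtain f f' where f: "f \<in> idx p \<rightarrow> carrier A" "x = (\<Oplus>\<^bsub>AA\<^esub>i\<in>idx p. tens R A A (e i) (f i))"
    and f': "f' \<in> idx p \<rightarrow> carrier A" "y = (\<Oplus>\<^bsub>AA\<^esub>i\<in>idx p. tens R A A (e i) (f' i))" by blast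
  have "x \<oplus>\<^bsub>AA\<^esub> y = (\<Oplus>\<^bsub>AA\<^esub>i\<in>idx p. tens R A A (e i) (f i) \<oplus>\<^bsub>AA\<^esub> tens R A A (e i) (f' i))"
    unfolding f(2) f'(2) using f(1) f'(1)
    by (intro AT.TTA.finsum_addf[symmetric]) (auto simp: AT.tens_closed e_closed Pi_iff)
  also have "\<dots> = (\<Oplus>\<^bsub>AA\<^esub>i\<in>idx p. tens R A A (e i) (f i \<oplus>\<^bsub>A\<^esub> f' i))"
    using f(1) f'(1) by (intro AT.TTA.finsum_cong') (auto simp: AT.tens_closed e_closed AT.tens_add2 Pi_iff)
  finally show ?case using f(1) f'(1) by (intro exI[of _ "\<lambda>i. f i \<oplus>\<^bsub>A\<^esub> f' i"]) (auto simp: Pi_iff)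
qed

text \<open>The chosen structure constants are meaningful once some exist: the right factors of the
  expansion of the comultiplication are expanded in the basis once more.\<close>

lemma cd_props:
  "i \<in> idx p \<Longrightarrow> k \<in> idx p \<Longrightarrow> j \<in> idx p \<Longrightarrow> cd i k j \<in> carrier R"
  "j \<in> idx p \<Longrightarrow> A_comult R p lam (e j) =
     (\<Oplus>\<^bsub>AA\<^esub>i\<in>idx p. tens R A A (e i) (lin_form A (idx p) cd e i j))"
proof -
  have "\<exists>c. \<forall>i\<in>idx p. (\<forall>k\<in>idx p. c i k \<in> carrier R) \<and> f i = (\<Oplus>\<^bsub>A\<^esub>k\<in>idx p. c i k \<odot>\<^bsub>A\<^esub> e k)"
    if "f \<in> idx p \<rightarrow> carrier A" for f
  proof (rule exI[of _ "\<lambda>i k. Rp.V.coef k (f i)"], intro ballI conjI)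
    fix i assume "i \<in> idx p"
    then have fi: "f i \<in> carrier Rp.V.V" using that by (auto simp: A_eq)
    show "f i = (\<Oplus>\<^bsub>A\<^esub>k\<in>idx p. Rp.V.coef k (f i) \<odot>\<^bsub>A\<^esub> e k)"
      using Rp.V.expand[OF fi] unfolding A_eq A_basis_eq .
    show "Rp.V.coef k (f i) \<in> carrier R" for k by (rule Rp.V.coef_closed[OF fi])
  qed
  then have ex1: "\<exists>c. (\<forall>i\<in>idx p. \<forall>k\<in>idx p. c i k \<in> carrier R) \<and>
      A_comult R p lam (e j) = (\<Oplus>\<^bsub>AA\<^esub>i\<in>idx p. tens R A A (e i) (\<Oplus>\<^bsub>A\<^esub>k\<in>idx p. c i k \<odot>\<^bsub>A\<^esub> e k))" for j
  proof -
    obtain f where f: "f \<in> idx p \<rightarrow> carrier A"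
      "A_comult R p lam (e j) = (\<Oplus>\<^bsub>AA\<^esub>i\<in>idx p. tens R A A (e i) (f i))"
      using AA_expand[OF alg_hom_closed[OF comult_props(1) e_closed]] by blast
    obtain c where c: "\<forall>i\<in>idx p. (\<forall>k\<in>idx p. c i k \<in> carrier R) \<and> f i = (\<Oplus>\<^bsub>A\<^esub>k\<in>idx p. c i k \<odot>\<^bsub>A\<^esub> e k)"
      using f(1) \<open>\<And>f. f \<in> idx p \<rightarrow> carrier A \<Longrightarrow> _\<close> by blast
    have eq: "(\<Oplus>\<^bsub>AA\<^esub>i\<in>idx p. tens R A A (e i) (f i)) =
        (\<Oplus>\<^bsub>AA\<^esub>i\<in>idx p. tens R A A (e i) (\<Oplus>\<^bsub>A\<^esub>k\<in>idx p. c i k \<odot>\<^bsub>A\<^esub> e k))"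
      using f(1) c by (intro AT.TTA.finsum_cong')
        (auto simp: e_closed intro!: AT.tens_closed
          abelian_monoid.finsum_closed[OF abelian_group.axioms(1)[OF ring.is_abelian_group[OF ring_A]]])
    from trans[OF f(2) eq] c show ?thesis by blast
  qed
  have "\<exists>c. \<forall>j. (\<forall>i\<in>idx p. \<forall>k\<in>idx p. c j i k \<in> carrier R) \<and>
      A_comult R p lam (e j) = (\<Oplus>\<^bsub>AA\<^esub>i\<in>idx p. tens R A A (e i) (\<Oplus>\<^bsub>A\<^esub>k\<in>idx p. c j i k \<odot>\<^bsub>A\<^esub> e k))"
    by (rule choice, rule allI, rule ex1)
  then obtain c where c: "\<And>j. (\<forall>i\<in>idx p. \<forall>k\<in>idx p. c j i k \<in> carrier R) \<and>
      A_comult R p lam (e j) = (\<Oplus>\<^bsub>AA\<^esub>i\<in>idx p. tens R A A (e i) (\<Oplus>\<^bsub>A\<^esub>k\<in>idx p. c j i k \<odot>\<^bsub>A\<^esub> e k))"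
    by blast
  have "\<exists>d. (\<forall>i\<in>idx p. \<forall>k\<in>idx p. \<forall>j\<in>idx p. d i k j \<in> carrier R) \<and>
       (\<forall>j\<in>idx p. A_comult R p lam (e j) = (\<Oplus>\<^bsub>AA\<^esub>i\<in>idx p. tens R A A (e i) (lin_form A (idx p) d e i j)))"
    using c by (intro exI[of _ "\<lambda>i k j. c j i k"]) (simp add: lin_form_def)
  from someI_ex[OF this] show "i \<in> idx p \<Longrightarrow> k \<in> idx p \<Longrightarrow> j \<in> idx p \<Longrightarrow> cd i k j \<in> carrier R"
    "j \<in> idx p \<Longrightarrow> A_comult R p lam (e j) =
     (\<Oplus>\<^bsub>AA\<^esub>i\<in>idx p. tens R A A (e i) (lin_form A (idx p) cd e i j))"
    unfolding comult_coeffs_def by blast+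
qed

section \<open>Structure constants, translations and functionals on the Hopf algebra\<close>

lemma lin_form_closed:
  assumes B: "algebra R B" and t: "t \<in> idx p \<rightarrow> carrier B" and ij: "i \<in> idx p" "j \<in> idx p"
  shows "lin_form B (idx p) cd t i j \<in> carrier B"
proof -
  interpret B: algebra R B by fact
  show ?thesis unfolding lin_form_def using t ij by (intro B.finsum_closed) (auto simp: cd_props(1) Pi_iff)
qed

lemma lin_form_map:
  assumes B: "algebra R B" and C: "algebra R C" and h: "h \<in> additive_map B C"
    and hs: "\<And>r b. r \<in> carrier R \<Longrightarrow> b \<in> carrier B \<Longrightarrow> h (r \<odot>\<^bsub>B\<^esub> b) = r \<odot>\<^bsub>C\<^esub> h b"
    and t: "t \<in> idx p \<rightarrow> carrier B" and ij: "i \<in> idx p" "j \<in> idx p" and t': "\<And>k. k \<in> idx p \<Longrightarrow> h (t k) = t' k"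
  shows "h (lin_form B (idx p) cd t i j) = lin_form C (idx p) cd t' i j"
proof -
  interpret B: algebra R B by fact
  interpret C: algebra R C by fact
  have "h (lin_form B (idx p) cd t i j) = (\<Oplus>\<^bsub>C\<^esub>k\<in>idx p. h (cd i k j \<odot>\<^bsub>B\<^esub> t k))"
    unfolding lin_form_def using t ij
    by (intro additive_map_finsum[OF h cring.axioms(1)[OF B.M_cring] cring.axioms(1)[OF C.M_cring]])
      (auto simp: cd_props(1) Pi_iff)
  also have "\<dots> = lin_form C (idx p) cd t' i j"
    unfolding lin_form_def
  proof (intro C.finsum_cong' refl funcsetI)
    fix k assume k: "k \<in> idx p"
    have c: "t k \<in> carrier B" "cd i k j \<in> carrier R" using t k ij cd_props(1) by auto
    show "cd i k j \<odot>\<^bsub>C\<^esub> t' k \<in> carrier C"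
      using additive_map_closed[OF h c(1)] c(2) t'[OF k] by simp
    show "h (cd i k j \<odot>\<^bsub>B\<^esub> t k) = cd i k j \<odot>\<^bsub>C\<^esub> t' k"
      using hs[OF c(2,1)] t'[OF k] by simp
  qed
  finally show ?thesis .
qed

lemma e_Pi: "e \<in> idx p \<rightarrow> carrier A"
  by (simp add: e_closed)

text \<open>The base change map from \<open>A\<close> to the truncated algebra over
  \<open>B\<close>; it connects statements about the Hopf algebra with the computations over test
  rings.\<close>

lemma can_exists:
  assumes B: "algebra R B"
  obtains can where "can \<in> alg_hom R A (restrict_scalars B (trunc B p CX CY \<zero>\<^bsub>B\<^esub> \<zero>\<^bsub>B\<^esub>))"
    "can X = tgen B p CX CY \<zero>\<^bsub>B\<^esub> \<zero>\<^bsub>B\<^esub> CX" "can Y = tgen B p CX CY \<zero>\<^bsub>B\<^esub> \<zero>\<^bsub>B\<^esub> CY"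
    "\<And>j. can (e j) = tmon B p CX CY \<zero>\<^bsub>B\<^esub> \<zero>\<^bsub>B\<^esub> j"
    "can w = \<one>\<^bsub>trunc B p CX CY \<zero>\<^bsub>B\<^esub> \<zero>\<^bsub>B\<^esub>\<^esub> \<oplus>\<^bsub>trunc B p CX CY \<zero>\<^bsub>B\<^esub> \<zero>\<^bsub>B\<^esub>\<^esub>
      struct_map (trunc B p CX CY \<zero>\<^bsub>B\<^esub> \<zero>\<^bsub>B\<^esub>) (struct_map B lam) \<otimes>\<^bsub>trunc B p CX CY \<zero>\<^bsub>B\<^esub> \<zero>\<^bsub>B\<^esub>\<^esub>
      tgen B p CX CY \<zero>\<^bsub>B\<^esub> \<zero>\<^bsub>B\<^esub> CX"
proof -
  interpret B: point_ring B p "struct_map B lam" by (rule alg_point[OF B])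
  have V: "algebra R (restrict_scalars B B.V.V)" by (rule restrict_scalars_algebra[OF B B.V.V_algebra])
  obtain can where can: "can \<in> alg_hom R A (restrict_scalars B B.V.V)" "can X = B.X" "can Y = B.Y"
    by (rule A_lift[OF V, of B.X B.Y]) (simp_all add: restrict_scalars_simps B.XY_pow)
  interpret can: ring_hom_cring A B.V.V can
    using alg_homD[OF can(1)] B.V.V_cring algebra.axioms(2)[OF A_algebra] by (simp add: ring_hom_cring_def ring_hom_cring_axioms_def)
  have "can (e j) = B.V.mon j" for j
    using XY_closed by (simp add: e_pow tmon_def can.hom_nat_pow can)
  moreover have "can w = B.uX"
    using XY_closed lam alg_hom_smult[OF can(1) lam XY_closed(1)]
    by (simp add: can restrict_scalars_simps B.V.VA.smult_eq_mult)
  ultimately show thesis using that[OF can] by blast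
qed

text \<open>The bridge from the structure constants to the explicit translation. The map
  \<open>N\<close> takes the left tensor factor into the truncated algebra and evaluates the right
  one at \<open>g\<close>. After the comultiplication it is the translation of \<open>X\<close> and
  \<open>Y\<close>; applied to the expansion of the comultiplication and followed by the functional,
  it gives the sum.\<close>

lemma act_link:
  assumes B: "algebra R B" and t: "t \<in> idx p \<rightarrow> carrier B" and g: "g \<in> alg_hom R A B" and j: "j \<in> idx p"
  shows "point_ring.act B p (struct_map B lam) t (g X) (g Y) j =
    (\<Oplus>\<^bsub>B\<^esub>i\<in>idx p. t i \<otimes>\<^bsub>B\<^esub> g (lin_form A (idx p) cd e i j))"
proof -
  interpret B: point_ring B p "struct_map B lam" by (rule alg_point[OF B])
  let ?V = "restrict_scalars B B.V.V"
  have V: "algebra R ?V" by (rule restrict_scalars_algebra[OF B B.V.V_algebra])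
  obtain can where can: "can \<in> alg_hom R A ?V" "can X = B.X" "can Y = B.Y" "\<And>j. can (e j) = B.V.mon j" "can w = B.uX"
    using can_exists[OF B] by metis
  have cst: "B.cst \<in> alg_hom R B ?V"
    by (rule alg_homI'[OF B V]) (simp_all add: B.V.VA.struct_hom)
  have cg: "(\<lambda>a. B.cst (g a)) \<in> alg_hom R A ?V" by (rule alg_hom_comp[OF g cst])
  obtain N where N: "N \<in> alg_hom R AA ?V"
    and Nt: "\<And>a a'. a \<in> carrier A \<Longrightarrow> a' \<in> carrier A \<Longrightarrow> N (tens R A A a a') = can a \<otimes>\<^bsub>B.V.V\<^esub> B.cst (g a')"
    using AT.hom_tensor_lift[OF V can(1) cg] by (auto simp: restrict_scalars_simps)
  interpret N: ring_hom_cring AA B.V.V N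
    using alg_homD[OF N] B.V.V_cring AT.TTA.M_cring by (simp add: ring_hom_cring_def ring_hom_cring_axioms_def)
  interpret \<Delta>: ring_hom_cring A AA "A_comult R p lam"
    by (rule alg_hom_ring_hom_cring[OF comult_props(1) A_algebra AT.TT_algebra])
  have gc: "g a \<in> carrier B" if "a \<in> carrier A" for a using alg_hom_closed[OF g that] .
  have g1: "g \<one>\<^bsub>A\<^esub> = \<one>\<^bsub>B\<^esub>" by (rule ring_hom_one[OF alg_homD[OF g]])
  have can1: "can \<one>\<^bsub>A\<^esub> = \<one>\<^bsub>B.V.V\<^esub>" using ring_hom_one[OF alg_homD[OF can(1)]] by (simp add: restrict_scalars_simps)
  have NX: "N (A_comult R p lam X) = B.TX (g X)" "N (A_comult R p lam Y) = B.TY (g Y)"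
    using XY_closed w_closed gc
    by (simp_all add: comult_props AT.tens_closed Nt can g1 B.TX_def B.TY_def)
  have "B.act t (g X) (g Y) j = B.Lt t (N (A_comult R p lam (e j)))"
    using XY_closed by (simp add: B.act_def e_pow \<Delta>.hom_nat_pow N.hom_nat_pow NX)
  also have "N (A_comult R p lam (e j)) =
      (\<Oplus>\<^bsub>B.V.V\<^esub>i\<in>idx p. N (tens R A A (e i) (lin_form A (idx p) cd e i j)))"
    unfolding cd_props(2)[OF j] using N.hom_finsum[of "\<lambda>i. tens R A A (e i) (lin_form A (idx p) cd e i j)" "idx p"] j
    by (simp add: o_def AT.tens_closed e_closed lin_form_closed[OF A_algebra e_Pi])
  also have "\<dots> = (\<Oplus>\<^bsub>B.V.V\<^esub>i\<in>idx p. B.cst (g (lin_form A (idx p) cd e i j)) \<otimes>\<^bsub>B.V.V\<^esub> B.V.mon i)"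
    using j lin_form_closed[OF A_algebra e_Pi] by (intro B.V.VA.finsum_cong')
      (auto simp: Nt e_closed can gc B.V.VA.m_comm)
  also have "B.Lt t \<dots> = (\<Oplus>\<^bsub>B\<^esub>i\<in>idx p. B.Lt t (B.cst (g (lin_form A (idx p) cd e i j)) \<otimes>\<^bsub>B.V.V\<^esub> B.V.mon i))"
    using j lin_form_closed[OF A_algebra e_Pi]
    by (intro additive_map_finsum[OF B.Lt_props(1)[OF t] B.V.VA.ring_axioms B.B.ring_axioms]) (auto simp: gc)
  also have "\<dots> = (\<Oplus>\<^bsub>B\<^esub>i\<in>idx p. t i \<otimes>\<^bsub>B\<^esub> g (lin_form A (idx p) cd e i j))"
  proof (intro B.B.finsum_cong')
    fix i assume i: "i \<in> idx p"
    have "g (lin_form A (idx p) cd e i j) \<in> carrier B" "t i \<in> carrier B"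
      using i j t lin_form_closed[OF A_algebra e_Pi] gc by auto
    then show "B.Lt t (B.cst (g (lin_form A (idx p) cd e i j)) \<otimes>\<^bsub>B.V.V\<^esub> B.V.mon i) = t i \<otimes>\<^bsub>B\<^esub> g (lin_form A (idx p) cd e i j)"
      using i by (simp add: B.Lt_props(2,3)[OF t] B.B.m_comm)
  qed (use t j gc lin_form_closed[OF A_algebra e_Pi] in \<open>auto simp: Pi_iff\<close>)
  finally show ?thesis .
qed

text \<open>The same functional seen on \<open>A\<close> over \<open>R\<close>, where it can be
  paired with the comultiplication; its values at powers of \<open>w\<close> decide whether
  \<open>t\<close> is a point of the unit group scheme.\<close>

lemma A_functional:
  assumes B: "algebra R B" and t: "t \<in> idx p \<rightarrow> carrier B"
  obtains f where "f \<in> additive_map A B" "\<And>r a. r \<in> carrier R \<Longrightarrow> a \<in> carrier A \<Longrightarrow> f (r \<odot>\<^bsub>A\<^esub> a) = r \<odot>\<^bsub>B\<^esub> f a"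
    "\<And>j. j \<in> idx p \<Longrightarrow> f (e j) = t j"
    "\<And>r. r < p \<Longrightarrow> f (w [^]\<^bsub>A\<^esub> r) = point_ring.wsum B (struct_map B lam) r (\<lambda>k. t (k, 0))"
proof -
  interpret B: point_ring B p "struct_map B lam" by (rule alg_point[OF B])
  interpret BA: algebra R B by fact
  let ?V = "restrict_scalars B B.V.V"
  obtain can where can: "can \<in> alg_hom R A ?V" "can X = B.X" "can Y = B.Y" "\<And>j. can (e j) = B.V.mon j" "can w = B.uX"
    using can_exists[OF B] by metis
  interpret can: ring_hom_cring A B.V.V can
    using alg_homD[OF can(1)] B.V.V_cring algebra.axioms(2)[OF A_algebra] by (simp add: ring_hom_cring_def ring_hom_cring_axioms_def)
  let ?f = "\<lambda>a. B.Lt t (can a)"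
  have "?f \<in> additive_map A B"
    by (rule additive_map_comp[OF ring_hom_additive[OF can.homh] B.Lt_props(1)[OF t]])
  moreover have "?f (r \<odot>\<^bsub>A\<^esub> a) = r \<odot>\<^bsub>B\<^esub> ?f a" if "r \<in> carrier R" "a \<in> carrier A" for r a
    using that alg_hom_smult[OF can(1) that] BA.struct_closed[OF that(1)] B.Lt_props(4)[OF t, of "can a"]
    by (simp add: restrict_scalars_simps B.V.VA.smult_eq_mult B.Lt_props(2)[OF t] BA.smult_eq_mult)
  moreover have "?f (e j) = t j" if "j \<in> idx p" for j using that by (simp add: can B.Lt_props(3)[OF t])
  moreover have "?f (w [^]\<^bsub>A\<^esub> r) = B.wsum r (\<lambda>k. t (k, 0))" if "r < p" for r
    using that can.hom_nat_pow[OF w_closed, of r] B.wsum_pt[OF t that] by (simp only: can(5))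
  ultimately show thesis by (rule that)
qed

lemma A_functional_unique:
  assumes "f \<in> additive_map A B" "f' \<in> additive_map A B"
    and "\<And>r a. r \<in> carrier R \<Longrightarrow> a \<in> carrier A \<Longrightarrow> f (r \<odot>\<^bsub>A\<^esub> a) = r \<odot>\<^bsub>B\<^esub> f a"
    and "\<And>r a. r \<in> carrier R \<Longrightarrow> a \<in> carrier A \<Longrightarrow> f' (r \<odot>\<^bsub>A\<^esub> a) = r \<odot>\<^bsub>B\<^esub> f' a"
    and "\<And>j. j \<in> idx p \<Longrightarrow> f (e j) = f' (e j)" and "a \<in> carrier A"
  shows "f a = f' a"
  using Rp.V.additive_ext[of f B f' a] assms unfolding A_eq A_basis_eq by simp

text \<open>w is group-like: 1 + lam (X tensor 1 + w tensor X) regroups as w tensor 1 plus w tensor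
  lam X, which is w tensor w. Powers of a group-like element are group-like.\<close>

lemma comult_w_pow: "A_comult R p lam (w [^]\<^bsub>A\<^esub> (r::nat)) = tens R A A (w [^]\<^bsub>A\<^esub> r) (w [^]\<^bsub>A\<^esub> r)"
proof -
  interpret \<Delta>: ring_hom_cring A AA "A_comult R p lam"
    by (rule alg_hom_ring_hom_cring[OF comult_props(1) A_algebra AT.TT_algebra])
  note c = XY_closed lam w_closed AT.tens_closed
  have lX: "lam \<odot>\<^bsub>A\<^esub> X \<in> carrier A" using lam XY_closed by simp
  have "A_comult R p lam w = tens R A A \<one>\<^bsub>A\<^esub> \<one>\<^bsub>A\<^esub> \<oplus>\<^bsub>AA\<^esub>
      lam \<odot>\<^bsub>AA\<^esub> (tens R A A X \<one>\<^bsub>A\<^esub> \<oplus>\<^bsub>AA\<^esub> tens R A A w X)"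
    using lX XY_closed by (simp add: alg_hom_smult[OF comult_props(1) lam] comult_props(2) AT.tens_one)
  also have "lam \<odot>\<^bsub>AA\<^esub> (tens R A A X \<one>\<^bsub>A\<^esub> \<oplus>\<^bsub>AA\<^esub> tens R A A w X) =
      tens R A A (lam \<odot>\<^bsub>A\<^esub> X) \<one>\<^bsub>A\<^esub> \<oplus>\<^bsub>AA\<^esub> tens R A A w (lam \<odot>\<^bsub>A\<^esub> X)"
    using c by (simp add: AT.TTA.smult_r_distr AT.tens_smult1 AT.tens_smult2)
  also have "tens R A A \<one>\<^bsub>A\<^esub> \<one>\<^bsub>A\<^esub> \<oplus>\<^bsub>AA\<^esub> \<dots> =
      (tens R A A \<one>\<^bsub>A\<^esub> \<one>\<^bsub>A\<^esub> \<oplus>\<^bsub>AA\<^esub> tens R A A (lam \<odot>\<^bsub>A\<^esub> X) \<one>\<^bsub>A\<^esub>) \<oplus>\<^bsub>AA\<^esub> tens R A A w (lam \<odot>\<^bsub>A\<^esub> X)"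
    using lX w_closed by (intro AT.TTA.a_assoc[symmetric] AT.tens_closed) simp_all
  also have "tens R A A \<one>\<^bsub>A\<^esub> \<one>\<^bsub>A\<^esub> \<oplus>\<^bsub>AA\<^esub> tens R A A (lam \<odot>\<^bsub>A\<^esub> X) \<one>\<^bsub>A\<^esub> = tens R A A w \<one>\<^bsub>A\<^esub>"
    using lX by (intro AT.tens_add1[symmetric]) simp_all
  also have "tens R A A w \<one>\<^bsub>A\<^esub> \<oplus>\<^bsub>AA\<^esub> tens R A A w (lam \<odot>\<^bsub>A\<^esub> X) = tens R A A w w"
    using lX w_closed by (intro AT.tens_add2[symmetric]) simp_all
  finally show ?thesis using \<Delta>.hom_nat_pow[OF w_closed, of r] AT.tens_pow[OF w_closed w_closed, of r] by (simp only:)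
qed

section \<open>Comultiplication and coaction on the coordinate ring\<close>

lemma T_Pi: "T \<in> idx p \<rightarrow> carrier S"
  by (simp add: T_closed)

text \<open>For the homomorphism to exist, the proposed images of the variables must form a point of
  the unit group scheme. They are the convolution product of the two universal points
  \<open>f\<close> and \<open>k\<close> over the tensor square, and at a group-like element a
  convolution product takes the product of the two values.\<close>

lemma S_comult_props:
  "S_comult R p lam \<in> alg_hom R S SS"
  "j \<in> idx p \<Longrightarrow> S_comult R p lam (T j) = (\<Oplus>\<^bsub>SS\<^esub>i\<in>idx p. tens R S S (T i) (lin_form S (idx p) cd T i j))"
proof -
  let ?m = "\<lambda>j. \<Oplus>\<^bsub>SS\<^esub>i\<in>idx p. tens R S S (T i) (lin_form S (idx p) cd T i j)"
  interpret B: point_ring SS p "struct_map SS lam" by (rule alg_point[OF SST.TT_algebra])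
  have pt1: "B.pt (\<lambda>j. tens R S S (T j) \<one>\<^bsub>S\<^esub>)" by (rule S_pt[OF SST.TT_algebra SST.incl1_hom])
  have pt2: "B.pt (\<lambda>j. tens R S S \<one>\<^bsub>S\<^esub> (T j))" by (rule S_pt[OF SST.TT_algebra SST.incl2_hom])
  obtain f where f: "f \<in> additive_map A SS" "\<And>r a. r \<in> carrier R \<Longrightarrow> a \<in> carrier A \<Longrightarrow> f (r \<odot>\<^bsub>A\<^esub> a) = r \<odot>\<^bsub>SS\<^esub> f a"
    "\<And>j. j \<in> idx p \<Longrightarrow> f (e j) = tens R S S (T j) \<one>\<^bsub>S\<^esub>"
    "\<And>r. r < p \<Longrightarrow> f (w [^]\<^bsub>A\<^esub> r) = B.wsum r (\<lambda>k. tens R S S (T (k, 0)) \<one>\<^bsub>S\<^esub>)"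
    by (rule A_functional[OF SST.TT_algebra B.pt_closed[OF pt1]]) blast
  obtain k where k: "k \<in> additive_map A SS" "\<And>r a. r \<in> carrier R \<Longrightarrow> a \<in> carrier A \<Longrightarrow> k (r \<odot>\<^bsub>A\<^esub> a) = r \<odot>\<^bsub>SS\<^esub> k a"
    "\<And>j. j \<in> idx p \<Longrightarrow> k (e j) = tens R S S \<one>\<^bsub>S\<^esub> (T j)"
    "\<And>r. r < p \<Longrightarrow> k (w [^]\<^bsub>A\<^esub> r) = B.wsum r (\<lambda>k. tens R S S \<one>\<^bsub>S\<^esub> (T (k, 0)))"
    by (rule A_functional[OF SST.TT_algebra B.pt_closed[OF pt2]]) blast
  obtain M where M: "M \<in> additive_map AA SS"
    and Mt: "\<And>a a'. a \<in> carrier A \<Longrightarrow> a' \<in> carrier A \<Longrightarrow> M (tens R A A a a') = f a \<otimes>\<^bsub>SS\<^esub> k a'"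
    and Ms: "\<And>r x. r \<in> carrier R \<Longrightarrow> x \<in> carrier AA \<Longrightarrow> M (r \<odot>\<^bsub>AA\<^esub> x) = r \<odot>\<^bsub>SS\<^esub> M x"
    using AT.linear_tensor_lift[OF SST.TT_algebra f(1,2) k(1,2)] by blast
  have m: "?m \<in> idx p \<rightarrow> carrier SS"
    using lin_form_closed[OF S_algebra T_Pi] T_closed
    by (intro funcsetI SST.TTA.finsum_closed SST.tens_closed) auto
  have \<mu>: "(\<lambda>a. M (A_comult R p lam a)) \<in> additive_map A SS"
    by (rule additive_map_comp[OF ring_hom_additive[OF alg_homD[OF comult_props(1)]] M])
  have \<mu>s: "M (A_comult R p lam (r \<odot>\<^bsub>A\<^esub> a)) = r \<odot>\<^bsub>SS\<^esub> M (A_comult R p lam a)"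
    if "r \<in> carrier R" "a \<in> carrier A" for r a
    using that by (simp add: alg_hom_smult[OF comult_props(1)] Ms alg_hom_closed[OF comult_props(1)])
  \<comment> \<open>Identifies the proposed images with the convolution product: on a basis element
    it is the sum of f(e_i) times k of the linear form R_ij, and k turns that form into the same
    form in the variables of the right factor.\<close>
  have \<mu>e: "M (A_comult R p lam (e j)) = ?m j" if j: "j \<in> idx p" for j
  proof -
    have "M (A_comult R p lam (e j)) = (\<Oplus>\<^bsub>SS\<^esub>i\<in>idx p. M (tens R A A (e i) (lin_form A (idx p) cd e i j)))"
      unfolding cd_props(2)[OF j]
      using j lin_form_closed[OF A_algebra e_Pi] cring.axioms(1)[OF SST.TTA.M_cring]
      by (intro additive_map_finsum[OF M ring_AA] funcsetI AT.tens_closed e_closed) simp_all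
    also have "\<dots> = ?m j"
    proof (intro SST.TTA.finsum_cong')
      fix i assume i: "i \<in> idx p"
      have "k (lin_form A (idx p) cd e i j) = lin_form SS (idx p) cd (\<lambda>k. tens R S S \<one>\<^bsub>S\<^esub> (T k)) i j"
        by (rule lin_form_map[OF A_algebra SST.TT_algebra k(1,2) e_Pi i j k(3)])
      also have "\<dots> = tens R S S \<one>\<^bsub>S\<^esub> (lin_form S (idx p) cd T i j)"
        by (rule lin_form_map[OF S_algebra SST.TT_algebra ring_hom_additive[OF alg_homD[OF SST.incl2_hom]]
          alg_hom_smult[OF SST.incl2_hom] T_Pi i j refl, symmetric])
      finally show "M (tens R A A (e i) (lin_form A (idx p) cd e i j)) = tens R S S (T i) (lin_form S (idx p) cd T i j)"
        using i j T_closed lin_form_closed[OF A_algebra e_Pi] lin_form_closed[OF S_algebra T_Pi]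
        by (simp add: Mt e_closed f(3) SST.tens_mult)
    qed (use SST.tens_closed[OF T_closed lin_form_closed[OF S_algebra T_Pi _ j]] in auto)
    finally show ?thesis .
  qed
  obtain fm where fm: "fm \<in> additive_map A SS" "\<And>r a. r \<in> carrier R \<Longrightarrow> a \<in> carrier A \<Longrightarrow> fm (r \<odot>\<^bsub>A\<^esub> a) = r \<odot>\<^bsub>SS\<^esub> fm a"
    "\<And>j. j \<in> idx p \<Longrightarrow> fm (e j) = ?m j" "\<And>r. r < p \<Longrightarrow> fm (w [^]\<^bsub>A\<^esub> r) = B.wsum r (\<lambda>k. ?m (k, 0))"
    by (rule A_functional[OF SST.TT_algebra m]) blast
  have "B.wsum r (\<lambda>k. ?m (k, 0)) \<in> Units SS" if r: "r < p" for r
  proof -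
    have wr: "w [^]\<^bsub>A\<^esub> r \<in> carrier A" using w_closed by (rule monoid.nat_pow_closed[OF ring.is_monoid[OF ring_A]])
    have "fm (w [^]\<^bsub>A\<^esub> r) = M (A_comult R p lam (w [^]\<^bsub>A\<^esub> r))"
      by (rule A_functional_unique[OF fm(1) \<mu> fm(2) \<mu>s _ wr]) (simp_all add: fm(3) \<mu>e)
    then have "B.wsum r (\<lambda>k. ?m (k, 0)) = f (w [^]\<^bsub>A\<^esub> r) \<otimes>\<^bsub>SS\<^esub> k (w [^]\<^bsub>A\<^esub> r)"
      unfolding comult_w_pow Mt[OF wr wr] fm(4)[OF r] .
    then show ?thesis
      using pt1 pt2 r unfolding f(4)[OF r] k(4)[OF r] B.pt_def by (auto intro: monoid.Units_m_closed[OF ring.is_monoid[OF cring.axioms(1)[OF SST.TTA.M_cring]]])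
  qed
  then have ptm: "B.pt ?m" using m by (simp add: B.pt_def)
  obtain u where "u \<in> alg_hom R S SS" "\<And>j. j \<in> idx p \<Longrightarrow> u (T j) = ?m j"
    by (rule S_lift[OF SST.TT_algebra ptm]) blast
  then have "\<exists>h. h \<in> alg_hom R S SS \<and> (\<forall>j\<in>idx p. h (T j) = ?m j)" by blast
  from someI_ex[OF this] show "S_comult R p lam \<in> alg_hom R S SS" "j \<in> idx p \<Longrightarrow> S_comult R p lam (T j) = ?m j"
    unfolding S_comult_def Let_def by blast+
qed

text \<open>As a family of values the basis belongs to the identity functional, which takes w^r to
  itself; w is a unit of \<open>A\<close> because w^p = 1.\<close>

lemma S_to_A_props: "S_to_A R p lam \<in> alg_hom R S A" "j \<in> idx p \<Longrightarrow> S_to_A R p lam (T j) = e j"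
proof -
  interpret B: point_ring A p "struct_map A lam" by (rule alg_point[OF A_algebra])
  obtain f where f: "f \<in> additive_map A A" "\<And>r a. r \<in> carrier R \<Longrightarrow> a \<in> carrier A \<Longrightarrow> f (r \<odot>\<^bsub>A\<^esub> a) = r \<odot>\<^bsub>A\<^esub> f a"
    "\<And>j. j \<in> idx p \<Longrightarrow> f (e j) = e j" "\<And>r. r < p \<Longrightarrow> f (w [^]\<^bsub>A\<^esub> r) = B.wsum r (\<lambda>k. e (k, 0))"
    by (rule A_functional[OF A_algebra e_Pi]) blast
  have id: "(\<lambda>a. a) \<in> additive_map A A" by (rule additive_mapI) auto
  have "w [^]\<^bsub>A\<^esub> p = \<one>\<^bsub>A\<^esub>"
    using Rp.one_lX_pow[OF Rp.V.gen_closed(1) Rp.XY_pow(1)] lam by (simp add: A_eq Rp.V.VA.smult_eq_mult)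
  then have wu: "w \<in> Units A"
    using cring.Units_of_pow[OF algebra.axioms(2)[OF A_algebra] w_closed _ B.p_gt(1)] by simp
  have "B.wsum r (\<lambda>k. e (k, 0)) \<in> Units A" if r: "r < p" for r
  proof -
    have "f (w [^]\<^bsub>A\<^esub> r) = w [^]\<^bsub>A\<^esub> r"
      by (rule A_functional_unique[OF f(1) id f(2) refl f(3)]) (simp_all add: w_closed)
    then show ?thesis using f(4)[OF r] monoid.Units_pow_closed[OF ring.is_monoid[OF ring_A] wu, of r] by simp
  qed
  then have pte: "B.pt e" using e_Pi by (simp add: B.pt_def)
  obtain u where "u \<in> alg_hom R S A" "\<And>j. j \<in> idx p \<Longrightarrow> u (T j) = e j"
    by (rule S_lift[OF A_algebra pte]) blast
  then have "\<exists>h. h \<in> alg_hom R S A \<and> (\<forall>j\<in>idx p. h (T j) = e j)" by blast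
  from someI_ex[OF this] show "S_to_A R p lam \<in> alg_hom R S A" "j \<in> idx p \<Longrightarrow> S_to_A R p lam (T j) = e j"
    unfolding S_to_A_def by blast+
qed

abbreviation \<rho> where "\<rho> \<equiv> coaction R p lam"

lemma coaction_props:
  "\<rho> \<in> alg_hom R S SA"
  "j \<in> idx p \<Longrightarrow> \<rho> (T j) = (\<Oplus>\<^bsub>SA\<^esub>i\<in>idx p. tens R S A (T i) (lin_form A (idx p) cd e i j))"
proof -
  let ?tm = "tensor_map R S S S A (\<lambda>s. s) (S_to_A R p lam)"
  have k: "(\<lambda>s. tens R S A \<one>\<^bsub>S\<^esub> (S_to_A R p lam s)) \<in> alg_hom R S SA"
    by (rule alg_hom_comp[OF S_to_A_props(1) SAT.incl2_hom])
  obtain h where "h \<in> alg_hom R SS SA" "\<And>b c. b \<in> carrier S \<Longrightarrow> c \<in> carrier S \<Longrightarrow>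
      h (tens R S S b c) = tens R S A b \<one>\<^bsub>A\<^esub> \<otimes>\<^bsub>SA\<^esub> tens R S A \<one>\<^bsub>S\<^esub> (S_to_A R p lam c)"
    using SST.hom_tensor_lift[OF SAT.TT_algebra SAT.incl1_hom k] by blast
  then have "\<exists>h. h \<in> alg_hom R SS SA \<and>
      (\<forall>b\<in>carrier S. \<forall>c\<in>carrier S. h (tens R S S b c) = tens R S A b (S_to_A R p lam c))"
    using alg_hom_closed[OF S_to_A_props(1)] by (intro exI[of _ h]) (simp add: SAT.tens_mult)
  from someI_ex[OF this] have tm: "?tm \<in> alg_hom R SS SA"
    "\<And>b c. b \<in> carrier S \<Longrightarrow> c \<in> carrier S \<Longrightarrow> ?tm (tens R S S b c) = tens R S A b (S_to_A R p lam c)"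
    unfolding tensor_map_def by blast+
  have \<rho>: "\<rho> = (\<lambda>s. ?tm (S_comult R p lam s))" by (simp add: coaction_def o_def Let_def)
  show "\<rho> \<in> alg_hom R S SA" unfolding \<rho> by (rule alg_hom_comp[OF S_comult_props(1) tm(1)])
  assume j: "j \<in> idx p"
  have "\<rho> (T j) = (\<Oplus>\<^bsub>SA\<^esub>i\<in>idx p. ?tm (tens R S S (T i) (lin_form S (idx p) cd T i j)))"
    unfolding \<rho> S_comult_props(2)[OF j]
    using T_closed j lin_form_closed[OF S_algebra T_Pi]
    by (intro additive_map_finsum[OF ring_hom_additive[OF alg_homD[OF tm(1)]]
      cring.axioms(1)[OF SST.TTA.M_cring] cring.axioms(1)[OF SAT.TTA.M_cring]] funcsetI SST.tens_closed) simp_all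
  also have "\<dots> = (\<Oplus>\<^bsub>SA\<^esub>i\<in>idx p. tens R S A (T i) (lin_form A (idx p) cd e i j))"
  proof (intro SAT.TTA.finsum_cong')
    fix i assume i: "i \<in> idx p"
    have "S_to_A R p lam (lin_form S (idx p) cd T i j) = lin_form A (idx p) cd e i j"
      by (rule lin_form_map[OF S_algebra A_algebra ring_hom_additive[OF alg_homD[OF S_to_A_props(1)]]
        alg_hom_smult[OF S_to_A_props(1)] T_Pi i j S_to_A_props(2)])
    then show "?tm (tens R S S (T i) (lin_form S (idx p) cd T i j)) = tens R S A (T i) (lin_form A (idx p) cd e i j)"
      using i j T_closed lin_form_closed[OF S_algebra T_Pi] by (simp add: tm(2))
  qed (use SAT.tens_closed[OF T_closed lin_form_closed[OF A_algebra e_Pi _ j]] in auto)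
  finally show "\<rho> (T j) = \<dots>" .
qed

text \<open>Evaluating the coaction at a pair of points is the explicit translation of functionals,
  so everything known about \<open>act\<close> applies to it.\<close>

lemma coaction_point:
  assumes B: "algebra R B" and u: "u \<in> alg_hom R S B" and g: "g \<in> alg_hom R A B"
    and h: "h \<in> alg_hom R SA B" and ht: "\<And>s a. s \<in> carrier S \<Longrightarrow> a \<in> carrier A \<Longrightarrow> h (tens R S A s a) = u s \<otimes>\<^bsub>B\<^esub> g a"
    and j: "j \<in> idx p"
  shows "h (\<rho> (T j)) = point_ring.act B p (struct_map B lam) (\<lambda>j. u (T j)) (g X) (g Y) j"
proof -
  interpret B: algebra R B by fact
  have t: "(\<lambda>j. u (T j)) \<in> idx p \<rightarrow> carrier B" using alg_hom_closed[OF u] T_closed by auto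
  have "h (\<rho> (T j)) = (\<Oplus>\<^bsub>B\<^esub>i\<in>idx p. h (tens R S A (T i) (lin_form A (idx p) cd e i j)))"
    unfolding coaction_props(2)[OF j] using j T_closed lin_form_closed[OF A_algebra e_Pi]
    by (intro additive_map_finsum[OF ring_hom_additive[OF alg_homD[OF h]]
      cring.axioms(1)[OF SAT.TTA.M_cring] cring.axioms(1)[OF B.M_cring]] funcsetI SAT.tens_closed) simp_all
  also have "\<dots> = (\<Oplus>\<^bsub>B\<^esub>i\<in>idx p. u (T i) \<otimes>\<^bsub>B\<^esub> g (lin_form A (idx p) cd e i j))"
    using j T_closed lin_form_closed[OF A_algebra e_Pi] alg_hom_closed[OF u] alg_hom_closed[OF g]
    by (intro B.finsum_cong') (auto simp: ht)
  also have "\<dots> = point_ring.act B p (struct_map B lam) (\<lambda>j. u (T j)) (g X) (g Y) j"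
    by (rule act_link[OF B t g j, symmetric])
  finally show ?thesis .
qed

end

section \<open>Coinvariants and the quotient\<close>

context hopf
begin

interpretation SAT: tensor_alg R S A
  by (intro tensor_alg.intro A_algebra S_algebra)

lemma T_pt: "point_ring.pt S p (struct_map S lam) T"
  using S_pt[OF S_algebra alg_hom_id] .

text \<open>The coordinates \<open>zval\<close> of the universal point \<open>T\<close>, read as a
  homomorphism out of \<open>Z\<close>.\<close>

definition psi where
  "psi = (SOME h. h \<in> alg_hom R Z S \<and> (\<forall>j\<in>idx p. h (zv j) = point_ring.zval S p (struct_map S lam) T j))"

lemma psi_props: "psi \<in> alg_hom R Z S"
  "j \<in> idx p \<Longrightarrow> psi (zv j) = point_ring.zval S p (struct_map S lam) T j"
proof -
  interpret S: point_ring S p "struct_map S lam" by (rule alg_point[OF S_algebra])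
  obtain h where "h \<in> alg_hom R Z S" "\<And>j. j \<in> idx p \<Longrightarrow> h (zv j) = S.zval T j"
    by (rule Z_lift[OF S_algebra S.zpt_zval[OF T_pt]]) blast
  then have "\<exists>h. h \<in> alg_hom R Z S \<and> (\<forall>j\<in>idx p. h (zv j) = S.zval T j)" by blast
  from someI_ex[OF this] show "psi \<in> alg_hom R Z S" "j \<in> idx p \<Longrightarrow> psi (zv j) = S.zval T j"
    unfolding psi_def by blast+
qed

text \<open>Every point is an image of the universal one, so naturality of the coordinates makes
  \<open>psi\<close> act as \<open>zval\<close> on points.\<close>

lemma psi_nat:
  assumes B: "algebra R B" and u: "u \<in> alg_hom R S B" and j: "j \<in> idx p"
  shows "u (psi (zv j)) = point_ring.zval B p (struct_map B lam) (\<lambda>j. u (T j)) j"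
proof -
  interpret point_hom S B p "struct_map S lam" "struct_map B lam" u
    by (rule alg_point_hom[OF S_algebra B u])
  show ?thesis unfolding psi_props(2)[OF j] by (rule coord_nat(3)[OF T_pt])
qed

lemma psi_lift:
  assumes B: "algebra R B" and v: "v \<in> alg_hom R Z B" and x: "x \<in> carrier B" and y: "y \<in> carrier B"
    and xp: "x [^]\<^bsub>B\<^esub> p \<otimes>\<^bsub>B\<^esub> v (zv (0, 0)) [^]\<^bsub>B\<^esub> p = v (zv (1, 0))" and yp: "y [^]\<^bsub>B\<^esub> p = v (zv (0, 1))"
  obtains u where "u \<in> alg_hom R S B" "\<And>z. z \<in> carrier Z \<Longrightarrow> u (psi z) = v z"
proof -
  interpret B: point_ring B p "struct_map B lam" by (rule alg_point[OF B])
  obtain t where t: "B.pt t" "\<And>j. j \<in> idx p \<Longrightarrow> B.zval t j = v (zv j)"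
    by (rule B.zpt_lift[OF Z_zpt[OF B v] x y xp yp]) blast
  obtain u where u: "u \<in> alg_hom R S B" "\<And>j. j \<in> idx p \<Longrightarrow> u (T j) = t j"
    by (rule S_lift[OF B t(1)]) blast
  have "u (psi z) = v z" if z: "z \<in> carrier Z" for z
  proof (rule Z_hom_eq[OF B alg_hom_comp[OF psi_props(1) u(1)] v _ z])
    fix j assume j: "j \<in> idx p"
    show "u (psi (zv j)) = v (zv j)"
      using psi_nat[OF B u(1) j] B.zval_cong[of "\<lambda>j. u (T j)" t j, OF u(2)] t(2)[OF j] by simp
  qed
  with u(1) show thesis by (rule that)
qed

text \<open>\<open>g\<close> sends \<open>X\<close> and \<open>Y\<close> to the translation
  parameters found by \<open>torsor\<close>. The conclusion quantifies over all \<open>h\<close>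
  with the right values on pure tensors, so that it covers the homomorphism chosen in
  \<open>point_act\<close> as well as one constructed directly.\<close>

lemma psi_torsor:
  assumes B: "algebra R B" and u: "u \<in> alg_hom R S B" and u': "u' \<in> alg_hom R S B"
    and eq: "\<And>z. z \<in> carrier Z \<Longrightarrow> u (psi z) = u' (psi z)"
  obtains g where "g \<in> alg_hom R A B"
    "\<And>h s. h \<in> alg_hom R SA B \<Longrightarrow>
      (\<And>s a. s \<in> carrier S \<Longrightarrow> a \<in> carrier A \<Longrightarrow> h (tens R S A s a) = u s \<otimes>\<^bsub>B\<^esub> g a) \<Longrightarrow>
      s \<in> carrier S \<Longrightarrow> h (\<rho> s) = u' s"
proof -
  interpret B: point_ring B p "struct_map B lam" by (rule alg_point[OF B])
  have "B.zval (\<lambda>j. u (T j)) j = B.zval (\<lambda>j. u' (T j)) j" if "j \<in> idx p" for j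
    using psi_nat[OF B u that] psi_nat[OF B u' that] eq[OF zv_closed[OF that]] by simp
  then obtain x y where xy: "x \<in> carrier B" "y \<in> carrier B" "x [^]\<^bsub>B\<^esub> p = \<zero>\<^bsub>B\<^esub>" "y [^]\<^bsub>B\<^esub> p = \<zero>\<^bsub>B\<^esub>"
    and act: "\<And>j. j \<in> idx p \<Longrightarrow> u' (T j) = B.act (\<lambda>j. u (T j)) x y j"
    by (rule B.torsor[OF S_pt[OF B u] S_pt[OF B u']]) blast+
  obtain g where g: "g \<in> alg_hom R A B" "g X = x" "g Y = y"
    by (rule A_lift[OF B xy]) blast
  have "h (\<rho> s) = u' s" if h: "h \<in> alg_hom R SA B"
    and ht: "\<And>s a. s \<in> carrier S \<Longrightarrow> a \<in> carrier A \<Longrightarrow> h (tens R S A s a) = u s \<otimes>\<^bsub>B\<^esub> g a"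
    and s: "s \<in> carrier S" for h s
  proof (rule S_hom_eq[OF B alg_hom_comp[OF coaction_props(1) h] u' _ s])
    fix j assume j: "j \<in> idx p"
    show "h (\<rho> (T j)) = u' (T j)"
      using coaction_point[OF B u g(1) h _ j] ht unfolding g(2,3) act[OF j] by blast
  qed
  with g(1) show thesis by (rule that)
qed

text \<open>Universal case of the invariance of \<open>zval\<close> under translation: the test
  algebra is S tensor A, with the two inclusions as point and group element, and the coaction of the
  variables is the resulting translate.\<close>

lemma psi_coinvariant:
  assumes z: "z \<in> carrier Z"
  shows "\<rho> (psi z) = tens R S A (psi z) \<one>\<^bsub>A\<^esub>"
proof (rule Z_hom_eq[OF SAT.TT_algebra alg_hom_comp[OF psi_props(1) coaction_props(1)]
      alg_hom_comp[OF psi_props(1) SAT.incl1_hom] _ z])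
  fix j assume j: "j \<in> idx p"
  interpret B: point_ring SA p "struct_map SA lam" by (rule alg_point[OF SAT.TT_algebra])
  interpret A: algebra R A by (rule A_algebra)
  interpret SS: algebra R S by (rule S_algebra)
  have ht: "tens R S A s a = tens R S A s \<one>\<^bsub>A\<^esub> \<otimes>\<^bsub>SA\<^esub> tens R S A \<one>\<^bsub>S\<^esub> a" if "s \<in> carrier S" "a \<in> carrier A" for s a
    using that by (simp add: SAT.tens_mult)
  have act: "\<rho> (T i) = B.act (\<lambda>j. tens R S A (T j) \<one>\<^bsub>A\<^esub>) (tens R S A \<one>\<^bsub>S\<^esub> X) (tens R S A \<one>\<^bsub>S\<^esub> Y) i"
    if "i \<in> idx p" for i
    by (rule coaction_point[OF SAT.TT_algebra SAT.incl1_hom SAT.incl2_hom alg_hom_id ht that])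
  have c: "tens R S A \<one>\<^bsub>S\<^esub> X \<in> carrier SA" "tens R S A \<one>\<^bsub>S\<^esub> Y \<in> carrier SA"
    by (intro SAT.tens_closed XY_closed; simp)+
  have n: "tens R S A \<one>\<^bsub>S\<^esub> X [^]\<^bsub>SA\<^esub> p = \<zero>\<^bsub>SA\<^esub>" "tens R S A \<one>\<^bsub>S\<^esub> Y [^]\<^bsub>SA\<^esub> p = \<zero>\<^bsub>SA\<^esub>"
    using XY_closed by (simp_all add: SAT.tens_pow XY_pow SAT.tens_zero2)
  have "\<rho> (psi (zv j)) = B.zval (B.act (\<lambda>j. tens R S A (T j) \<one>\<^bsub>A\<^esub>) (tens R S A \<one>\<^bsub>S\<^esub> X) (tens R S A \<one>\<^bsub>S\<^esub> Y)) j"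
    unfolding psi_nat[OF SAT.TT_algebra coaction_props(1) j] by (rule B.zval_cong) (rule act)
  also have "\<dots> = B.zval (\<lambda>j. tens R S A (T j) \<one>\<^bsub>A\<^esub>) j"
    by (rule B.act_props(5)[OF c n S_pt[OF SAT.TT_algebra SAT.incl1_hom]])
  also have "\<dots> = tens R S A (psi (zv j)) \<one>\<^bsub>A\<^esub>"
    by (rule psi_nat[OF SAT.TT_algebra SAT.incl1_hom j, symmetric])
  finally show "\<rho> (psi (zv j)) = tens R S A (psi (zv j)) \<one>\<^bsub>A\<^esub>" .
qed

lemma struct_alg_hom: "algebra R B \<Longrightarrow> algebra B C \<Longrightarrow> struct_map C \<in> alg_hom R B (restrict_scalars B C)"
  by (rule alg_homI') (simp_all add: restrict_scalars_algebra algebra.struct_hom)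

text \<open>A lift of a point of Spec Z requires p-th roots of xi^p = Z_X / Z_1^p and of eta^p =
  Z_Y. The generators of the truncated algebra with these constants are such roots.\<close>

lemma cover_lift:
  assumes B: "algebra R B" and v: "v \<in> alg_hom R Z B" and xy: "x \<noteq> y"
    and a: "a = v (zv (1, 0)) \<otimes>\<^bsub>B\<^esub> inv\<^bsub>B\<^esub> (v (zv (0, 0))) [^]\<^bsub>B\<^esub> p" and b: "b = v (zv (0, 1))"
  shows "a \<in> carrier B" "b \<in> carrier B"
    and "\<exists>u\<in>alg_hom R S (restrict_scalars B (trunc B p x y a b)).
      \<forall>z\<in>carrier Z. u (psi z) = struct_map (trunc B p x y a b) (v z)"
proof -
  interpret B: point_ring B p "struct_map B lam" by (rule alg_point[OF B])
  have z: "B.zpt (\<lambda>j. v (zv j))" by (rule Z_zpt[OF B v])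
  then have v0: "v (zv (0, 0)) \<in> Units B" by (simp add: B.zpt_def)
  have vc: "v (zv (1, 0)) \<in> carrier B" "v (zv (0, 1)) \<in> carrier B"
    using alg_hom_closed[OF v] zv_closed B.idx_small by auto
  show ac: "a \<in> carrier B" and bc: "b \<in> carrier B" using v0 vc by (simp_all add: a b)
  interpret C: trunc_alg B p x y a b
    using xy B.p_gt ac bc by unfold_locales
  interpret s: ring_hom_cring B C.V "struct_map C.V"
    using C.VA.struct_hom C.V_cring B.B.is_cring by (simp add: ring_hom_cring_def ring_hom_cring_axioms_def)
  let ?C = "restrict_scalars B C.V"
  have CA: "algebra R ?C" by (rule restrict_scalars_algebra[OF B C.V_algebra])
  have v': "(\<lambda>z. struct_map C.V (v z)) \<in> alg_hom R Z ?C"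
    by (rule alg_hom_comp[OF v struct_alg_hom[OF B C.V_algebra]])
  have "a \<otimes>\<^bsub>B\<^esub> v (zv (0, 0)) [^]\<^bsub>B\<^esub> p = v (zv (1, 0))"
    unfolding a by (rule B.inv_pow_cancel(2)[OF v0 vc(1)])
  then have "struct_map C.V a \<otimes>\<^bsub>C.V\<^esub> struct_map C.V (v (zv (0, 0))) [^]\<^bsub>C.V\<^esub> p = struct_map C.V (v (zv (1, 0)))"
    using ac v0 s.hom_mult[of a "v (zv (0, 0)) [^]\<^bsub>B\<^esub> p"] s.hom_nat_pow[of "v (zv (0, 0))" p] by simp
  then have xp: "C.X [^]\<^bsub>?C\<^esub> p \<otimes>\<^bsub>?C\<^esub> struct_map C.V (v (zv (0, 0))) [^]\<^bsub>?C\<^esub> p = struct_map C.V (v (zv (1, 0)))"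
    by (simp add: restrict_scalars_simps C.gen_pow)
  have yp: "C.Y [^]\<^bsub>?C\<^esub> p = struct_map C.V (v (zv (0, 1)))" 
    using C.gen_pow(2) by (simp only: pow_restrict_scalars b[symmetric])
  have gc: "C.X \<in> carrier ?C" "C.Y \<in> carrier ?C" by (simp_all add: restrict_scalars_simps)
  obtain u where "u \<in> alg_hom R S ?C" "\<And>z. z \<in> carrier Z \<Longrightarrow> u (psi z) = struct_map C.V (v z)"
    by (rule psi_lift[OF CA v' gc xp yp]) blast
  then show "\<exists>u\<in>alg_hom R S ?C. \<forall>z\<in>carrier Z. u (psi z) = struct_map C.V (v z)" by blast
qed

text \<open>Over \<open>Z\<close> the algebra \<open>S\<close> has the basis \<open>\<xi>\<^sup>i \<eta>\<^sup>j\<close> with \<open>i, j < p\<close>. For a coinvariant \<open>s\<close> the two points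
  \<open>s \<mapsto> s\<close> and \<open>\<xi>, \<eta> \<mapsto> x, y\<close> with values in \<open>S[x, y]/(x\<^sup>p - \<xi>\<^sup>p, y\<^sup>p - \<eta>\<^sup>p)\<close> lie in one orbit, so they agree on
  \<open>s\<close>; comparing constant coefficients shows that \<open>s\<close> comes from \<open>Z\<close>.\<close>

lemma psi_bij: "bij_betw psi (carrier Z) {s \<in> carrier S. \<rho> s = tens R S A s \<one>\<^bsub>A\<^esub>}"
proof -
  define a where "a = zv (1, 0) \<otimes>\<^bsub>Z\<^esub> inv\<^bsub>Z\<^esub> (zv (0, 0)) [^]\<^bsub>Z\<^esub> p"
  define b where "b = zv (0, 1)"
  interpret ZA: algebra R Z by (rule Z_algebra)
  interpret SAl: algebra R S by (rule S_algebra)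
  interpret psi: ring_hom_cring Z S psi by (rule alg_hom_ring_hom_cring[OF psi_props(1) Z_algebra S_algebra])
  have CXY: "CX \<noteq> CY" by simp
  \<comment> \<open>The universal case: the identity of \<open>Z\<close> lifts over the algebra with
    p-th roots of \<open>a\<close> and \<open>b\<close> adjoined.\<close>
  note cl = cover_lift[OF Z_algebra alg_hom_id CXY a_def b_def]
  interpret Q: trunc_alg Z p CX CY a b
    using Rp.p_gt cl(1,2) algebra.axioms(2)[OF Z_algebra] by (simp add: trunc_alg_def trunc_alg_axioms_def)
  interpret W: trunc_alg S p CX CY "psi a" "psi b"
    using Rp.p_gt cl(1,2) algebra.axioms(2)[OF S_algebra] by (simp add: trunc_alg_def trunc_alg_axioms_def)
  let ?Q = "restrict_scalars Z Q.V" and ?W = "restrict_scalars S W.V"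
  have WA: "algebra R ?W" by (rule restrict_scalars_algebra[OF S_algebra W.V_algebra])
  obtain \<phi> where \<phi>: "\<phi> \<in> alg_hom R S ?Q" "\<And>z. z \<in> carrier Z \<Longrightarrow> \<phi> (psi z) = struct_map Q.V z"
    using cl(3) by blast
  have \<phi>c: "\<phi> s \<in> carrier Q.V" if "s \<in> carrier S" for s
    using alg_hom_closed[OF \<phi>(1) that] by (simp add: restrict_scalars_simps)
  \<comment> \<open>The second truncated algebra is the base change of the first along
    \<open>psi\<close>; \<open>H\<close> matches the generators.\<close>
  have "\<exists>h\<in>ring_hom Q.V W.V. h Q.X = W.X \<and> h Q.Y = W.Y \<and>
      (\<forall>\<beta>\<in>carrier Z. h (struct_map Q.V \<beta>) = (struct_map W.V \<circ> psi) \<beta>)"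
    by (rule Q.V_lift[OF W.V_cring ring_hom_trans[OF psi.homh W.VA.struct_hom]]) (simp_all add: W.gen_pow)
  then obtain H where H: "H \<in> ring_hom Q.V W.V" "H Q.X = W.X" "H Q.Y = W.Y"
    "\<And>z. z \<in> carrier Z \<Longrightarrow> H (struct_map Q.V z) = struct_map W.V (psi z)" by auto
  interpret H: ring_hom_cring Q.V W.V H
    using H(1) Q.V_cring W.V_cring by (simp add: ring_hom_cring_def ring_hom_cring_axioms_def)
  \<comment> \<open>Base change maps monomials to monomials, so it commutes with taking the constant
    coefficient.\<close>
  have coef: "W.coef (0, 0) (H q) = psi (Q.coef (0, 0) q)" if q: "q \<in> carrier Q.V" for q
  proof (rule Q.additive_ext[OF additive_map_comp[OF ring_hom_additive[OF H(1)] W.coef_props(1)]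
        additive_map_comp[OF Q.coef_props(1) ring_hom_additive[OF psi.homh]] _ q])
    fix r j assume r: "r \<in> carrier Z" and j: "j \<in> idx p"
    have "H (Q.mon j) = W.mon j" by (simp add: tmon_def H.hom_nat_pow H)
    then have "H (r \<odot>\<^bsub>Q.V\<^esub> Q.mon j) = psi r \<odot>\<^bsub>W.V\<^esub> W.mon j"
      using r by (simp add: Q.VA.smult_eq_mult W.VA.smult_eq_mult Q.VA.struct_closed H)
    then show "W.coef (0, 0) (H (r \<odot>\<^bsub>Q.V\<^esub> Q.mon j)) = psi (Q.coef (0, 0) (r \<odot>\<^bsub>Q.V\<^esub> Q.mon j))"
      using r j by (simp add: W.coef_props(2,3) Q.coef_props(2,3))
  qed
  \<comment> \<open>\<open>\<phi>\<close> after \<open>psi\<close> is the inclusion of constants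
    into a free algebra, which the constant coefficient inverts.\<close>
  have inj: "inj_on psi (carrier Z)"
  proof (rule inj_onI)
    fix z z' assume z: "z \<in> carrier Z" "z' \<in> carrier Z" "psi z = psi z'"
    then have "struct_map Q.V z = struct_map Q.V z'" using \<phi>(2) by metis
    then have "Q.coef (0, 0) (struct_map Q.V z) = Q.coef (0, 0) (struct_map Q.V z')" by (rule arg_cong)
    then show "z = z'" unfolding Q.coef00_struct[OF z(1)] Q.coef00_struct[OF z(2)] .
  qed
  have u': "(\<lambda>s. H (\<phi> s)) \<in> alg_hom R S ?W"
  proof (rule alg_homI'[OF S_algebra WA])
    show "(\<lambda>s. H (\<phi> s)) \<in> ring_hom S ?W"
      using ring_hom_trans[of \<phi> S Q.V H W.V] alg_homD[OF \<phi>(1)] H(1) by (simp add: o_def)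
    fix r assume r: "r \<in> carrier R"
    have "\<phi> (struct_map S r) = struct_map Q.V (struct_map Z r)"
      using alg_hom_struct[OF \<phi>(1) S_algebra r] by simp
    then show "H (\<phi> (struct_map S r)) = struct_map ?W r"
      using H(4)[OF algebra.struct_closed[OF Z_algebra r]] alg_hom_struct[OF psi_props(1) Z_algebra r] by simp
  qed
  have u: "struct_map W.V \<in> alg_hom R S ?W" by (rule struct_alg_hom[OF S_algebra W.V_algebra])
  \<comment> \<open>The two points have the same image in Spec Z, hence lie in one orbit over
    \<open>W\<close>.\<close>
  have eq: "struct_map W.V (psi z) = H (\<phi> (psi z))" if "z \<in> carrier Z" for z
    using \<phi>(2)[OF that] H(4)[OF that] by simp
  obtain g where g: "g \<in> alg_hom R A ?W"
    and gh: "\<And>h s. h \<in> alg_hom R SA ?W \<Longrightarrow>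
      (\<And>s a. s \<in> carrier S \<Longrightarrow> a \<in> carrier A \<Longrightarrow> h (tens R S A s a) = struct_map W.V s \<otimes>\<^bsub>?W\<^esub> g a) \<Longrightarrow>
      s \<in> carrier S \<Longrightarrow> h (\<rho> s) = H (\<phi> s)"
    by (rule psi_torsor[OF WA u u' eq]) blast+
  obtain h where h: "h \<in> alg_hom R SA ?W"
    "\<And>s a. s \<in> carrier S \<Longrightarrow> a \<in> carrier A \<Longrightarrow> h (tens R S A s a) = struct_map W.V s \<otimes>\<^bsub>?W\<^esub> g a"
    using SAT.hom_tensor_lift[OF WA u g] by blast
  have sur: "\<exists>z\<in>carrier Z. psi z = s" if s: "s \<in> carrier S" and co: "\<rho> s = tens R S A s \<one>\<^bsub>A\<^esub>" for s
  proof -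
    have one: "\<one>\<^bsub>A\<^esub> \<in> carrier A" by (rule monoid.one_closed[OF ring.is_monoid[OF ring_A]])
    have "H (\<phi> s) = h (tens R S A s \<one>\<^bsub>A\<^esub>)" using gh[OF h s] co by simp
    also have "\<dots> = struct_map W.V s"
      using h(2)[OF s one] ring_hom_one[OF alg_homD[OF g]] W.VA.struct_closed[OF s] by (simp add: restrict_scalars_simps)
    finally have "psi (Q.coef (0, 0) (\<phi> s)) = s"
      using coef[OF \<phi>c[OF s]] W.coef00_struct[OF s] by simp
    then show ?thesis using Q.coef_closed[OF \<phi>c[OF s]] by blast
  qed
  show ?thesis
    unfolding bij_betw_def using inj sur psi_coinvariant psi.hom_closed by auto
qed

lemma psi_iso: "psi \<in> alg_iso R Z (coinvariants R p lam)"
proof -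
  have c: "psi z \<in> carrier S" "\<rho> (psi z) = tens R S A (psi z) \<one>\<^bsub>A\<^esub>" if "z \<in> carrier Z" for z
    using that psi_coinvariant alg_hom_closed[OF psi_props(1)] by auto
  have "psi \<in> alg_hom R Z (coinvariants R p lam)"
    using c alg_homD[OF psi_props(1)] alg_hom_smult[OF psi_props(1)]
    unfolding alg_hom_def coinvariants_def Let_def ring_hom_def by auto
  then show ?thesis using psi_bij by (simp add: alg_iso_def coinvariants_def Let_def)
qed

section \<open>The fppf quotient\<close>

lemma point_act_eq:
  assumes B: "algebra R B" and u: "u \<in> alg_hom R S B" and g: "g \<in> alg_hom R A B"
  obtains h where "h \<in> alg_hom R SA B"
    "\<And>s a. s \<in> carrier S \<Longrightarrow> a \<in> carrier A \<Longrightarrow> h (tens R S A s a) = u s \<otimes>\<^bsub>B\<^esub> g a"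
    "\<And>s. point_act R S A \<rho> B u g s = h (\<rho> s)"
proof -
  have "\<exists>h. h \<in> alg_hom R SA B \<and> (\<forall>s\<in>carrier S. \<forall>a\<in>carrier A. h (tens R S A s a) = u s \<otimes>\<^bsub>B\<^esub> g a)"
    using SAT.hom_tensor_lift[OF B u g] by blast
  from someI_ex[OF this] show thesis by (intro that) (auto simp: point_act_def)
qed

lemma trunc_fp_alg: "fp_alg B 2 (trunc_rels B p 0 1 a b) = trunc B p 0 1 a b"
proof -
  have "{..<2::nat} = {0, 1}" by auto
  then show ?thesis by (simp add: fp_alg_def trunc_def)
qed

lemma trunc_cover:
  assumes B: "algebra R B" and ab: "a \<in> carrier B" "b \<in> carrier B"
  shows "fppf_cover B 2 (trunc_rels B p 0 1 a b)"
proof -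
  have two: "{..<2::nat} = {0, 1}" by auto
  interpret V: trunc_alg B p "0::nat" 1 a b
    using ab Rp.p_gt algebra.axioms(2)[OF B] by (simp add: trunc_alg_def trunc_alg_axioms_def)
  have "finite (trunc_rels B p (0::nat) 1 a b)" by (simp add: trunc_rels_def Let_def)
  then show ?thesis
    using V.rels_closed V.V_flat V.V_spec_surjective[OF p algebra.algebra_char[OF B char]]
    unfolding fppf_cover_def trunc_fp_alg two by blast
qed

text \<open>For an arbitrary isomorphism onto the coinvariants the claims are transported from
  \<open>psi\<close>, whose image is the same; orbits are collapsed because the values of
  \<open>\<Psi>\<close> are coinvariant.\<close>

lemma quotient:
  assumes \<Psi>: "\<Psi> \<in> alg_iso R Z (coinvariants R p lam)"
  shows "fppf_quotient TYPE('b) R S A \<rho> Z \<Psi>"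
proof -
  let ?C = "{s \<in> carrier S. \<rho> s = tens R S A s \<one>\<^bsub>A\<^esub>}"
  have \<Psi>h: "\<Psi> \<in> alg_hom R Z S"
    using \<Psi> unfolding alg_iso_def alg_hom_def coinvariants_def Let_def ring_hom_def by auto
  have \<Psi>b: "bij_betw \<Psi> (carrier Z) ?C"
    using \<Psi> by (simp add: alg_iso_def coinvariants_def Let_def)
  have \<Psi>c: "\<Psi> c \<in> carrier S" "\<rho> (\<Psi> c) = tens R S A (\<Psi> c) \<one>\<^bsub>A\<^esub>" if "c \<in> carrier Z" for c
    using bij_betwE[OF \<Psi>b] that by auto
  have \<Psi>inj: "c = c'" if "c \<in> carrier Z" "c' \<in> carrier Z" "\<Psi> c = \<Psi> c'" for c c'
    using inj_onD[OF bij_betw_imp_inj_on[OF \<Psi>b]] that by blast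
  \<comment> \<open>\<open>\<Psi>\<close> inverted on the coinvariants after \<open>psi\<close>. As
    \<open>\<Psi>\<close> is injective and both maps are homomorphisms, this is an endomorphism of
    \<open>Z\<close>, and \<open>\<Psi>\<close> after it is \<open>psi\<close>.\<close>
  define \<gamma> where "\<gamma> z = inv_into (carrier Z) \<Psi> (psi z)" for z
  have \<gamma>: "\<gamma> z \<in> carrier Z" "\<Psi> (\<gamma> z) = psi z" if "z \<in> carrier Z" for z
  proof -
    have "psi z \<in> \<Psi> ` carrier Z"
      using bij_betwE[OF psi_bij] that bij_betw_imp_surj_on[OF \<Psi>b] by blast
    then show "\<gamma> z \<in> carrier Z" "\<Psi> (\<gamma> z) = psi z"
      unfolding \<gamma>_def by (rule inv_into_into, rule f_inv_into_f)
  qed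
  interpret ZA: algebra R Z by (rule Z_algebra)
  note hP = alg_homD[OF \<Psi>h] and hp = alg_homD[OF psi_props(1)]
  have \<gamma>h: "\<gamma> \<in> alg_hom R Z Z"
  proof (intro alg_homI ring_hom_memI)
    fix x y assume xy: "x \<in> carrier Z" "y \<in> carrier Z"
    show "\<gamma> x \<in> carrier Z" by (rule \<gamma>(1)[OF xy(1)])
    show "\<gamma> (x \<otimes>\<^bsub>Z\<^esub> y) = \<gamma> x \<otimes>\<^bsub>Z\<^esub> \<gamma> y"
      by (rule \<Psi>inj) (use xy in \<open>simp_all add: \<gamma> ring_hom_mult[OF hP] ring_hom_mult[OF hp]\<close>)
    show "\<gamma> (x \<oplus>\<^bsub>Z\<^esub> y) = \<gamma> x \<oplus>\<^bsub>Z\<^esub> \<gamma> y"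
      by (rule \<Psi>inj) (use xy in \<open>simp_all add: \<gamma> ring_hom_add[OF hP] ring_hom_add[OF hp]\<close>)
  next
    show "\<gamma> \<one>\<^bsub>Z\<^esub> = \<one>\<^bsub>Z\<^esub>"
      by (rule \<Psi>inj) (simp_all add: \<gamma> ring_hom_one[OF hP] ring_hom_one[OF hp])
  next
    fix r x assume rx: "r \<in> carrier R" "x \<in> carrier Z"
    show "\<gamma> (r \<odot>\<^bsub>Z\<^esub> x) = r \<odot>\<^bsub>Z\<^esub> \<gamma> x"
      by (rule \<Psi>inj) (use rx in \<open>simp_all add: \<gamma> alg_hom_smult[OF \<Psi>h] alg_hom_smult[OF psi_props(1)]\<close>)
  qed
  have lift: "\<exists>z\<in>carrier Z. psi z = \<Psi> c \<and> \<gamma> z = c" if c: "c \<in> carrier Z" for c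
  proof -
    have "\<Psi> c \<in> psi ` carrier Z" using bij_betw_imp_surj_on[OF psi_bij] \<Psi>c[OF c] by blast
    then obtain z where z: "z \<in> carrier Z" "psi z = \<Psi> c" by auto
    then have "\<gamma> z = c" using \<Psi>inj[OF \<gamma>(1) c] \<gamma>(2) by simp
    with z show ?thesis by blast
  qed
  have one: "\<one>\<^bsub>A\<^esub> \<in> carrier A" by (rule monoid.one_closed[OF ring.is_monoid[OF ring_A]])
  have orbit: "point_act R S A \<rho> B u g (\<Psi> c) = u (\<Psi> c)"
    if B: "algebra R B" and u: "u \<in> alg_hom R S B" and g: "g \<in> alg_hom R A B" and c: "c \<in> carrier Z"
    for B :: "('r, 'b) module" and u g c
  proof -
    interpret BA: algebra R B by fact
    obtain h where h: "h \<in> alg_hom R SA B"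
      "\<And>s a. s \<in> carrier S \<Longrightarrow> a \<in> carrier A \<Longrightarrow> h (tens R S A s a) = u s \<otimes>\<^bsub>B\<^esub> g a"
      "\<And>s. point_act R S A \<rho> B u g s = h (\<rho> s)"
      by (rule point_act_eq[OF B u g]) blast
    show ?thesis
      unfolding h(3) \<Psi>c(2)[OF c] h(2)[OF \<Psi>c(1)[OF c] one]
      using ring_hom_one[OF alg_homD[OF g]] alg_hom_closed[OF u \<Psi>c(1)[OF c]] by simp
  qed
  have torsor: "\<exists>n F. fppf_cover B n F \<and>
      (let B' = restrict_scalars B (fp_alg B n F); \<iota> = struct_map (fp_alg B n F) in
         \<exists>g\<in>alg_hom R A B'. \<forall>s\<in>carrier S. \<iota> (u' s) = point_act R S A \<rho> B' (\<iota> \<circ> u) g s)"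
    if B: "algebra R B" and u: "u \<in> alg_hom R S B" and u': "u' \<in> alg_hom R S B"
      and eq: "\<forall>c\<in>carrier Z. u (\<Psi> c) = u' (\<Psi> c)" for B :: "('r, 'b) module" and u u'
  proof -
    interpret BA: algebra R B by fact
    \<comment> \<open>Two points with the same image lie in one orbit over every test algebra, so a
      fixed cover serves, here the one with constants 0.\<close>
    let ?F = "trunc_rels B p (0::nat) 1 \<zero>\<^bsub>B\<^esub> \<zero>\<^bsub>B\<^esub>" and ?V = "trunc B p (0::nat) 1 \<zero>\<^bsub>B\<^esub> \<zero>\<^bsub>B\<^esub>"
    let ?B = "restrict_scalars B ?V"
    have z: "\<zero>\<^bsub>B\<^esub> \<in> carrier B" by simp
    interpret V: trunc_alg B p "0::nat" 1 "\<zero>\<^bsub>B\<^esub>" "\<zero>\<^bsub>B\<^esub>"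
      using Rp.p_gt algebra.axioms(2)[OF B] by (simp add: trunc_alg_def trunc_alg_axioms_def)
    have VA: "algebra R ?B" by (rule restrict_scalars_algebra[OF B V.V_algebra])
    note st = struct_alg_hom[OF B V.V_algebra]
    have v: "(\<lambda>s. struct_map ?V (u s)) \<in> alg_hom R S ?B" "(\<lambda>s. struct_map ?V (u' s)) \<in> alg_hom R S ?B"
      by (rule alg_hom_comp[OF u st], rule alg_hom_comp[OF u' st])
    have e: "struct_map ?V (u (psi z)) = struct_map ?V (u' (psi z))" if "z \<in> carrier Z" for z
      using eq \<gamma>[OF that] by metis
    obtain g where g: "g \<in> alg_hom R A ?B"
      and gh: "\<And>h s. h \<in> alg_hom R SA ?B \<Longrightarrow>
        (\<And>s a. s \<in> carrier S \<Longrightarrow> a \<in> carrier A \<Longrightarrow> h (tens R S A s a) = struct_map ?V (u s) \<otimes>\<^bsub>?B\<^esub> g a) \<Longrightarrow>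
        s \<in> carrier S \<Longrightarrow> h (\<rho> s) = struct_map ?V (u' s)"
      by (rule psi_torsor[OF VA v e]) blast+
    obtain h where h: "h \<in> alg_hom R SA ?B"
      "\<And>s a. s \<in> carrier S \<Longrightarrow> a \<in> carrier A \<Longrightarrow> h (tens R S A s a) = struct_map ?V (u s) \<otimes>\<^bsub>?B\<^esub> g a"
      "\<And>s. point_act R S A \<rho> ?B (\<lambda>s. struct_map ?V (u s)) g s = h (\<rho> s)"
      by (rule point_act_eq[OF VA v(1) g]) blast
    have "\<forall>s\<in>carrier S. struct_map ?V (u' s) = point_act R S A \<rho> ?B (struct_map ?V \<circ> u) g s"
      using gh[OF h(1,2)] h(3) by (simp add: o_def)
    then show ?thesis
      using g trunc_cover[OF B z z]
      by (intro exI[of _ 2] exI[of _ ?F]) (auto simp: trunc_fp_alg Let_def)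
  qed
  have cover: "\<exists>n F. fppf_cover B n F \<and>
      (let B' = restrict_scalars B (fp_alg B n F); \<iota> = struct_map (fp_alg B n F) in
         \<exists>u\<in>alg_hom R S B'. \<forall>c\<in>carrier Z. u (\<Psi> c) = \<iota> (v c))"
    if B: "algebra R B" and v: "v \<in> alg_hom R Z B" for B :: "('r, 'b) module" and v
  proof -
    \<comment> \<open>Composing with \<open>\<gamma>\<close> turns the lifting problem for
      \<open>\<Psi>\<close> into the one for \<open>psi\<close>; every element of \<open>Z\<close>
      is a value of \<open>\<gamma>\<close>, so the lift has the required values on
      \<open>\<Psi>\<close>.\<close>
    have v': "(\<lambda>z. v (\<gamma> z)) \<in> alg_hom R Z B" by (rule alg_hom_comp[OF \<gamma>h v])
    have 01: "(0::nat) \<noteq> 1" by simp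
    define a where "a = v (\<gamma> (zv (1, 0))) \<otimes>\<^bsub>B\<^esub> inv\<^bsub>B\<^esub> (v (\<gamma> (zv (0, 0)))) [^]\<^bsub>B\<^esub> p"
    define b where "b = v (\<gamma> (zv (0, 1)))"
    note cl = cover_lift[OF B v' 01 a_def b_def]
    obtain u where u: "u \<in> alg_hom R S (restrict_scalars B (trunc B p (0::nat) 1 a b))"
      "\<And>z. z \<in> carrier Z \<Longrightarrow> u (psi z) = struct_map (trunc B p (0::nat) 1 a b) (v (\<gamma> z))"
      using cl(3) by blast
    have "u (\<Psi> c) = struct_map (trunc B p (0::nat) 1 a b) (v c)" if "c \<in> carrier Z" for c
      using lift[OF that] u(2) by metis
    then show ?thesis
      using u(1) trunc_cover[OF B cl(1,2)]
      by (intro exI[of _ 2] exI[of _ "trunc_rels B p (0::nat) 1 a b"]) (auto simp: trunc_fp_alg Let_def)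
  qed
  show ?thesis
    unfolding fppf_quotient_def using \<Psi>h orbit torsor cover by blast
qed

end

theorem theorem4p4:
  fixes R :: "'r ring" and lam :: 'r and p :: nat
  assumes "Factorial_Ring.prime p"
    and "cring R"
    and "[p] \<cdot>\<^bsub>R\<^esub> \<one>\<^bsub>R\<^esub> = \<zero>\<^bsub>R\<^esub>"
    and "lam \<in> carrier R"
  shows "(\<exists>\<Psi>. \<Psi> \<in> alg_iso R (Z_alg R p lam) (coinvariants R p lam)) \<and>
    (\<forall>\<Psi> \<in> alg_iso R (Z_alg R p lam) (coinvariants R p lam).
       fppf_quotient TYPE('b) R (S_alg R p lam) (A_alg R p) (coaction R p lam)
         (Z_alg R p lam) \<Psi>)"
proof -
  interpret hopf R p lam using assms by (simp add: hopf_def)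
  show ?thesis using psi_iso quotient by blast
qed

end
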